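(* Let $1\le T\le n$. Let $f_t,g_t,m_t\colon(\mathbb{R}^n)^{t-1}\to\mathbb{R}^n$ ($t\in[T]$) be Lipschitz with constants $L_f,L_g,L_m$ respectively, for all $t\in[T]$. Let $\Sigma$ be positive definite with Cholesky decomposition $\Sigma=\Omega^\top\Omega$. Let $(X,Y)$ be the coupling in which $Y$ is produced by the coupling construction described in the context and $X=[x_1,\dots,x_T]$ is given by $x_t=Af_t(x_{<t})+g_t(x_{<t})$ with the same $A$. Let $$B=\tfrac1n\Sigma^{-1}\mathbb{E}\big[(Y-M(Y))^\top F(Y)\big],\qquad S=\tfrac1n\Omega^{-\top}\mathbb{E}\big[F(Y)^\top F(Y)\big]\Omega^{-1},$$ $$L=\log_2(2T)+\sqrt T\,(L_f+L_g+L_m)(1+L_m)^{T-1}\kappa(\Sigma)^{1/2},$$ $$\psi_1=\mathbb{E}\big[\|M(Y)-G(Y)-F(Y)B\|_{2,1}\big]\,\|\Omega\|_{2,1}^{-1},\qquad \psi_2=\sqrt n\,\|S-\mathrm{I}\|_{\mathrm{op}}.$$ Then there is a universal constant $c>0$ such that for all $0\le r\le n$, with probability at least $1-5e^{-r}$, $$\|X-Y\|\le c\,(1+4L_f+L_g)^{T-1}\big(\psi_1+L\,\psi_2+L^3(\sqrt T+\sqrt r)\big)\,\|\Omega\|_{2,1}.$$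
   Context: $\mathsf{GOE}(n)$ denotes the law of a symmetric $n\times n$ random matrix with independent $\mathsf{N}(0,2/n)$ diagonal entries and independent $\mathsf{N}(0,1/n)$ entries below the diagonal. $f_1,g_1,m_1$ are constant vectors; Lipschitz means with respect to the Euclidean norm of the stacked input. $\kappa(\Sigma)$ is the condition number (ratio of largest to smallest eigenvalue). Notation: $F(Y)=[f_1,f_2(y_1),\dots,f_T(y_{<T})]$, $G(Y)$, $M(Y)$ analogously ($n\times T$); $\|\cdot\|$ is the Frobenius norm, $\|\cdot\|_{\mathrm{op}}$ the spectral norm, $\|V\|_{2,1}$ the sum of Euclidean norms of the columns of $V$. Coupling construction: let $A,A'$ be i.i.d. $\mathsf{GOE}(n)$, fix an ordered basis $(v_1,\dots,v_n)$ of $\mathbb{R}^n$. For $t=1,\dots,T$: (1) if $f_t(y_{<t})\notin\operatorname{span}\{q_1,\dots,q_{t-1}\}$, let $q_t$ be the vector of norm $\sqrt n$ proportional to $f_t(y_{<t})-\sum_{s<t}\frac1n\langle q_s,f_t(y_{<t})\rangle q_s$; otherwise do the same with $f_t(y_{<t})$ replaced by the first $v_j$ not in that span. (2) Set $z_t=Aq_t+\tfrac12(A'_{tt}-\tfrac1n\langle q_t,Aq_t\rangle)q_t+\sum_{s<t}(A'_{st}-\tfrac1n\langle q_s,Aq_t\rangle)q_s$, $w_t=\sum_{s\le t}\Omega_{st}z_s$, $y_t=m_t(y_{<t})+w_t$. *)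

theory Defs
  imports "HOL-Probability.Probability"
begin

text \<open>Conventions. Vectors of R^n are functions nat => real, only the components
  i < n matter. Sequences of vectors (y_0,...,y_{T-1}) are functions nat => nat => real,
  ys s i = i-th component of y_s. Time indices are 0-based: the paper's t in [T] is t-1 here.
  Small T x T matrices are functions nat => nat => real with explicit bounds.\<close>

type_synonym vec = "nat \<Rightarrow> real"
type_synonym vecs = "nat \<Rightarrow> nat \<Rightarrow> real"

definition vinner :: "nat \<Rightarrow> vec \<Rightarrow> vec \<Rightarrow> real" where
  "vinner n x y = (\<Sum>i<n. x i * y i)"

definition vnorm :: "nat \<Rightarrow> vec \<Rightarrow> real" where
  "vnorm n x = sqrt (\<Sum>i<n. (x i)\<^sup>2)"

definition mv :: "nat \<Rightarrow> nat \<Rightarrow> vecs \<Rightarrow> vec \<Rightarrow> vec" where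
  "mv a b M x = (\<lambda>i. if i < a then (\<Sum>j<b. M i j * x j) else 0)"

definition mmul :: "nat \<Rightarrow> nat \<Rightarrow> nat \<Rightarrow> vecs \<Rightarrow> vecs \<Rightarrow> vecs" where
  "mmul a b c M N = (\<lambda>i j. if i < a \<and> j < c then (\<Sum>l<b. M i l * N l j) else 0)"

definition mtrans :: "vecs \<Rightarrow> vecs" where
  "mtrans M = (\<lambda>i j. M j i)"

definition idm :: "nat \<Rightarrow> vecs" where
  "idm k = (\<lambda>i j. if i < k \<and> j < k \<and> i = j then 1 else 0)"

definition minv :: "nat \<Rightarrow> vecs \<Rightarrow> vecs" where
  "minv k M = (THE N. (\<forall>i j. \<not> (i < k \<and> j < k) \<longrightarrow> N i j = 0)
                    \<and> mmul k k k M N = idm k \<and> mmul k k k N M = idm k)"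

definition frob :: "nat \<Rightarrow> nat \<Rightarrow> vecs \<Rightarrow> real" where
  "frob a b M = sqrt (\<Sum>i<a. \<Sum>j<b. (M i j)\<^sup>2)"

definition norm21 :: "nat \<Rightarrow> nat \<Rightarrow> vecs \<Rightarrow> real" where
  "norm21 a b M = (\<Sum>j<b. sqrt (\<Sum>i<a. (M i j)\<^sup>2))"

definition opnorm :: "nat \<Rightarrow> nat \<Rightarrow> vecs \<Rightarrow> real" where
  "opnorm a b M = Sup {vnorm a (mv a b M x) | x. vnorm b x \<le> 1}"

definition pos_def :: "nat \<Rightarrow> vecs \<Rightarrow> bool" where
  "pos_def k M \<longleftrightarrow> (\<forall>i<k. \<forall>j<k. M i j = M j i) \<and>
     (\<forall>x. (\<exists>i<k. x i \<noteq> 0) \<longrightarrow> 0 < (\<Sum>i<k. \<Sum>j<k. x i * M i j * x j))"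

definition cholesky :: "nat \<Rightarrow> vecs \<Rightarrow> vecs \<Rightarrow> bool" where
  "cholesky k Sig Om \<longleftrightarrow> (\<forall>i<k. \<forall>j<i. Om i j = 0) \<and> (\<forall>i<k. 0 < Om i i) \<and>
     (\<forall>i<k. \<forall>j<k. Sig i j = (\<Sum>l<k. Om l i * Om l j))"

definition eigenvalues :: "nat \<Rightarrow> vecs \<Rightarrow> real set" where
  "eigenvalues k M = {e. \<exists>x. (\<exists>i<k. x i \<noteq> 0) \<and> (\<forall>i<k. (\<Sum>j<k. M i j * x j) = e * x i)}"

definition cond_num :: "nat \<Rightarrow> vecs \<Rightarrow> real" where
  "cond_num k M = Max (eigenvalues k M) / Min (eigenvalues k M)"

text \<open>Lipschitz continuity of h : (R^n)^t -> R^n w.r.t. the Euclidean norm of the stacked input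
  y_0,...,y_{t-1} (so h depends only on these inputs)\<close>
definition lipschitz_on_prefix :: "nat \<Rightarrow> nat \<Rightarrow> real \<Rightarrow> (vecs \<Rightarrow> vec) \<Rightarrow> bool" where
  "lipschitz_on_prefix n t L h \<longleftrightarrow> (\<forall>ys ys'.
     vnorm n (\<lambda>i. h ys i - h ys' i) \<le> L * sqrt (\<Sum>s<t. \<Sum>i<n. (ys s i - ys' s i)\<^sup>2))"

definition is_basis :: "nat \<Rightarrow> vecs \<Rightarrow> bool" where
  "is_basis n v \<longleftrightarrow> (\<forall>c. (\<forall>i<n. (\<Sum>j<n. c j * v j i) = 0) \<longrightarrow> (\<forall>j<n. c j = 0))"

definition in_span :: "nat \<Rightarrow> vecs \<Rightarrow> nat \<Rightarrow> vec \<Rightarrow> bool" where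
  "in_span n Q k u \<longleftrightarrow> (\<exists>c. \<forall>i<n. u i = (\<Sum>s<k. c s * Q s i))"

definition GOE :: "nat \<Rightarrow> vecs measure" where
  "GOE n = distr
     (Pi\<^sub>M {(i, j). j \<le> i \<and> i < n}
        (\<lambda>(i, j). if i = j then density lborel (normal_density 0 (sqrt (2 / real n)))
                  else density lborel (normal_density 0 (sqrt (1 / real n)))))
     (Pi\<^sub>M UNIV (\<lambda>_. Pi\<^sub>M UNIV (\<lambda>_. borel)))
     (\<lambda>x i j. if i < n \<and> j < n then x (max i j, min i j) else 0)"

primrec coupling :: "nat \<Rightarrow> vecs \<Rightarrow> (nat \<Rightarrow> vecs \<Rightarrow> vec) \<Rightarrow> (nat \<Rightarrow> vecs \<Rightarrow> vec)
    \<Rightarrow> vecs \<Rightarrow> vecs \<Rightarrow> vecs \<Rightarrow> nat \<Rightarrow> vecs \<times> vecs \<times> vecs" where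
  "coupling n v f m Om A A' 0 = ((\<lambda>_ _. 0), (\<lambda>_ _. 0), (\<lambda>_ _. 0))"
| "coupling n v f m Om A A' (Suc t) =
    (let (Q, Z, Y) = coupling n v f m Om A A' t;
         fv = f t Y;
         u = (if \<not> in_span n Q t fv then fv
              else v (LEAST j. j < n \<and> \<not> in_span n Q t (v j)));
         res = (\<lambda>i. u i - (\<Sum>s<t. (vinner n (Q s) u / real n) * Q s i));
         q = (\<lambda>i. sqrt (real n) / vnorm n res * res i);
         Aq = mv n n A q;
         z = (\<lambda>i. Aq i + (A' t t - vinner n q Aq / real n) / 2 * q i
                 + (\<Sum>s<t. (A' s t - vinner n (Q s) Aq / real n) * Q s i));
         Q' = Q(t := q);
         Z' = Z(t := z);
         w = (\<lambda>i. \<Sum>s\<le>t. Om s t * Z' s i);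
         y = (\<lambda>i. m t Y i + w i)
     in (Q', Z', Y(t := y)))"

definition coupledY :: "nat \<Rightarrow> nat \<Rightarrow> vecs \<Rightarrow> (nat \<Rightarrow> vecs \<Rightarrow> vec) \<Rightarrow> (nat \<Rightarrow> vecs \<Rightarrow> vec)
    \<Rightarrow> vecs \<Rightarrow> vecs \<times> vecs \<Rightarrow> vecs" where
  "coupledY n T v f m Om AA' = snd (snd (coupling n v f m Om (fst AA') (snd AA') T))"

primrec iterX :: "nat \<Rightarrow> (nat \<Rightarrow> vecs \<Rightarrow> vec) \<Rightarrow> (nat \<Rightarrow> vecs \<Rightarrow> vec) \<Rightarrow> vecs \<Rightarrow> nat \<Rightarrow> vecs" where
  "iterX n f g A 0 = (\<lambda>_ _. 0)"
| "iterX n f g A (Suc t) = (let X = iterX n f g A t in X(t := (\<lambda>i. mv n n A (f t X) i + g t X i)))"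

definition colmat :: "nat \<Rightarrow> nat \<Rightarrow> (nat \<Rightarrow> vecs \<Rightarrow> vec) \<Rightarrow> vecs \<Rightarrow> vecs" where
  "colmat n T h Y = (\<lambda>i t. if i < n \<and> t < T then h t Y i else 0)"

definition seqmat :: "nat \<Rightarrow> nat \<Rightarrow> vecs \<Rightarrow> vecs" where
  "seqmat n T Y = (\<lambda>i t. if i < n \<and> t < T then Y t i else 0)"

end

theory Submission
  imports Defs
begin

text \<open>Given the past, \<open>A\<close> is fresh only on the orthogonal complement of the directions used so far, and
  \<open>A'\<close> supplies the missing components: hence the columns \<open>Z\<close> of the coupling are i.i.d. standard Gaussian, and
  \<open>Y\<close>, \<open>F(Y)\<close> are Lipschitz functions of a Gaussian vector. Put \<open>H = F \<Omega>\<^sup>-\<^sup>1\<close> and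
  \<open>K = E[Z\<^sup>T H] / n\<close>. Then \<open>Y - A F - G = (M - G - F B) + V \<Omega>\<close> with
  \<open>V x = Z x - A H x + H K x\<close>. Write \<open>Z = A Q + Q R\<close> and \<open>H = Q C\<close> with \<open>C\<close> upper triangular. Every
  part of \<open>V\<close> is then governed by the norm of \<open>A\<close>, the leading block of \<open>A'\<close>, the fluctuation of the Gram
  matrix of \<open>[Z, H]\<close>, and \<open>C - I\<close>, which \<open>C\<^sup>T C = H\<^sup>T H / n\<close> controls up to a factor \<open>log T\<close> (triangular
  truncation). A Gronwall argument transfers the error to \<open>X - Y\<close>. Gaussian concentration is derived from
  Maurey's property (tau), that is from the one-dimensional Prekopa-Leindler inequality.\<close>

text \<open>Two obstacles shape the proof. The directions depend on the past: the induction
  therefore carries the joint law of the columns, of \<open>A\<close> compressed to the complement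
  of the past directions, and of the unread columns of \<open>A'\<close>. Once the columns are fixed
  the directions are deterministic, everything is linear in \<open>A\<close> and \<open>A'\<close>,
  and laws are compared through covariances. Secondly, \<open>S\<close> need not be close to the
  identity. With \<sigma> the norm of S - I and \<beta> = sqrt n \<sigma> + L^2 sqrt(T + r), the
  error operator is of order L \<beta> for two different reasons: if \<beta> \<le> sqrt n, the
  cancellation between \<open>H K\<close> and its empirical counterpart is exploited; otherwise a
  termwise estimate is enough, since quantities of order sqrt n are then below \<beta>. In L^3, two
  factors come from the square of a Lipschitz constant in the fluctuation of the Gram matrix and one
  from the logarithm. The 5 in the probability is 2 + 1 + 1 + 1, for the norm of \<open>A\<close>,
  the block of \<open>A'\<close>, the Gram matrix and M - G - F B; the 4 in the growth factor is the
  bound on the norm of \<open>A\<close>.\<close>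

section \<open>One-dimensional Brunn-Minkowski and Prekopa-Leindler inequalities\<close>

lemma emeasure_midpoint_ge:
  fixes A B C :: "real set"
  assumes A[measurable]: "A \<in> sets borel" and B[measurable]: "B \<in> sets borel"
    and C[measurable]: "C \<in> sets borel"
    and "A \<noteq> {}" "B \<noteq> {}" "bounded A" "bounded B"
    and mid: "\<And>x y. x \<in> A ==> y \<in> B ==> (x + y) / 2 \<in> C"
  shows "emeasure lborel A + emeasure lborel B \<le> 2 * emeasure lborel C"
proof (rule ennreal_le_epsilon)
  fix e :: real assume e: "0 < e"
  have bA: "bdd_above A" and bB: "bdd_below B"
    using \<open>bounded A\<close> \<open>bounded B\<close> bounded_imp_bdd_above bounded_imp_bdd_below by auto
  obtain a where a: "a \<in> A" "Sup A - e/2 < a"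
    using less_cSupD[OF \<open>A \<noteq> {}\<close>, of "Sup A - e/2"] e by auto
  obtain b where b: "b \<in> B" "b < Inf B + e/2"
    using cInf_lessD[OF \<open>B \<noteq> {}\<close>, of "Inf B + e/2"] e by auto
  \<comment> \<open>\<open>D1\<close> and \<open>D2\<close> collect the midpoints of
    \<open>A\<close> with \<open>b\<close> and of \<open>B\<close> with \<open>a\<close>. Both are
    half-size copies lying in \<open>C\<close>; as \<open>a\<close> is almost the top of
    \<open>A\<close> and \<open>b\<close> almost the bottom of \<open>B\<close>, they overlap in an
    interval of length at most e/2, so their measures nearly add up.\<close>
  define D1 where "D1 = {z. - b + 2 * z \<in> A}"
  define D2 where "D2 = {z. - a + 2 * z \<in> B}"
  have [measurable]: "D1 \<in> sets borel" "D2 \<in> sets borel"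
    unfolding D1_def D2_def by measurable
  have half: "emeasure lborel S = 2 * emeasure lborel {z. t + 2 * z \<in> S}"
    if [measurable]: "S \<in> sets borel" for S :: "real set" and t
  proof -
    have "emeasure lborel S = (\<integral>\<^sup>+x. indicator S x \<partial>lborel)" by simp
    also have "... = ennreal \<bar>2\<bar> * (\<integral>\<^sup>+x. indicator S (t + 2 * x) \<partial>lborel)"
      by (rule nn_integral_real_affine) auto
    also have "(\<integral>\<^sup>+x. indicator S (t + 2 * x) \<partial>lborel) = (\<integral>\<^sup>+x. indicator {z. t + 2 * z \<in> S} x \<partial>lborel)"
      by (intro nn_integral_cong) (auto simp: indicator_def)
    also have "... = emeasure lborel {z. t + 2 * z \<in> S}"
      by (subst nn_integral_indicator) auto
    finally show ?thesis by simp
  qed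
  have sub: "D1 \<union> D2 \<subseteq> C"
  proof
    fix z assume "z \<in> D1 \<union> D2"
    then show "z \<in> C"
    proof
      assume "z \<in> D1" then show ?thesis using mid[of "-b+2*z" b] b by (simp add: D1_def)
    next
      assume "z \<in> D2" then show ?thesis using mid[of a "-a+2*z"] a by (simp add: D2_def)
    qed
  qed
  have int: "D1 \<inter> D2 \<subseteq> {(a+b)/2 - e/4 .. (a+b)/2 + e/4}"
  proof
    fix z assume z: "z \<in> D1 \<inter> D2"
    have "-b + 2*z \<le> Sup A" using z bA by (auto simp: D1_def intro: cSup_upper)
    moreover have "Inf B \<le> -a + 2*z" using z bB by (auto simp: D2_def intro: cInf_lower)
    ultimately show "z \<in> {(a+b)/2 - e/4 .. (a+b)/2 + e/4}" using a b by (simp add: field_simps)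
  qed
  have "emeasure lborel D1 + emeasure lborel D2 = emeasure lborel (D1 \<union> D2) + emeasure lborel (D1 \<inter> D2)"
    by (rule emeasure_Un_Int) auto
  also have "... \<le> emeasure lborel C + emeasure lborel {(a+b)/2 - e/4 .. (a+b)/2 + e/4}"
    by (intro add_mono emeasure_mono sub int) auto
  also have "emeasure lborel {(a+b)/2 - e/4 .. (a+b)/2 + e/4} = ennreal (e/2)"
    using e by simp
  finally have "2 * (emeasure lborel D1 + emeasure lborel D2) \<le> 2 * (emeasure lborel C + ennreal (e/2))"
    by (intro mult_left_mono) auto
  then have "2 * emeasure lborel D1 + 2 * emeasure lborel D2 \<le> 2 * emeasure lborel C + 2 * ennreal (e/2)"
    by (simp add: distrib_left)
  moreover have "2 * ennreal (e/2) = ennreal e"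
    using e ennreal_mult[of 2 "e/2"] by simp
  ultimately show "emeasure lborel A + emeasure lborel B \<le> 2 * emeasure lborel C + ennreal e"
    using half[OF A, of "-b"] half[OF B, of "-a"] unfolding D1_def D2_def by simp
qed

text \<open>Levels are confined to (0,1), a range common to all functions bounded by 1. The
  comparison of level sets needs both sets nonempty at the same level, which normalised suprema
  guarantee exactly there.\<close>

lemma nn_integral_layer_cake_le1:
  fixes u :: "real => real"
  assumes [measurable]: "u \<in> borel_measurable borel" and u: "\<And>x. 0 \<le> u x" "\<And>x. u x \<le> 1"
  shows "(\<integral>\<^sup>+x. ennreal (u x) \<partial>lborel) = (\<integral>\<^sup>+s. indicator {0<..<1} s * emeasure lborel {x. s < u x} \<partial>lborel)"
proof -
  have "(\<integral>\<^sup>+x. ennreal (u x) \<partial>lborel) = (\<integral>\<^sup>+x. (\<integral>\<^sup>+s. (if 0 < s \<and> s < 1 \<and> s < u x then 1 else 0) \<partial>lborel) \<partial>lborel)"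
  proof (intro nn_integral_cong)
    fix x
    have "(\<integral>\<^sup>+s. (if 0 < s \<and> s < 1 \<and> s < u x then 1 else 0) \<partial>lborel) = (\<integral>\<^sup>+s. indicator {0<..<u x} s \<partial>lborel)"
      using u[of x] by (intro nn_integral_cong) (auto simp: indicator_def)
    then show "ennreal (u x) = (\<integral>\<^sup>+s. (if 0 < s \<and> s < 1 \<and> s < u x then 1 else 0) \<partial>lborel)"
      using u[of x] by simp
  qed
  also have "... = (\<integral>\<^sup>+s. (\<integral>\<^sup>+x. (if 0 < s \<and> s < 1 \<and> s < u x then 1 else 0) \<partial>lborel) \<partial>lborel)"
    by (rule lborel_pair.Fubini') measurable
  also have "... = (\<integral>\<^sup>+s. indicator {0<..<1} s * emeasure lborel {x. s < u x} \<partial>lborel)"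
  proof (intro nn_integral_cong)
    fix s :: real
    have "(\<integral>\<^sup>+x. (if 0 < s \<and> s < 1 \<and> s < u x then 1 else 0) \<partial>lborel) = (\<integral>\<^sup>+x. indicator {0<..<1} s * indicator {x. s < u x} x \<partial>lborel)"
      by (intro nn_integral_cong) (auto simp: indicator_def)
    also have "... = indicator {0<..<1} s * emeasure lborel {x. s < u x}"
      by (subst nn_integral_cmult_indicator) auto
    finally show "(\<integral>\<^sup>+x. (if 0 < s \<and> s < 1 \<and> s < u x then 1 else 0) \<partial>lborel) = indicator {0<..<1} s * emeasure lborel {x. s < u x}" .
  qed
  finally show ?thesis .
qed

text \<open>With both suprema equal to 1, the superlevel sets of \<open>u\<close> and
  \<open>v\<close> at a common level s < 1 are nonempty, and their midpoints lie in the one of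
  \<open>w\<close> because the product u x * v y exceeds s^2. Integrating the set inequality over
  the levels gives an arithmetic-mean bound, stronger than the geometric one.\<close>

lemma prekopa_leindler_normalised:
  fixes u v w :: "real => real"
  assumes [measurable]: "u \<in> borel_measurable borel" "v \<in> borel_measurable borel" "w \<in> borel_measurable borel"
    and u: "\<And>x. 0 \<le> u x" "\<And>x. u x \<le> 1" "\<And>s. s < 1 ==> \<exists>x. s < u x"
    and v: "\<And>x. 0 \<le> v x" "\<And>x. v x \<le> 1" "\<And>s. s < 1 ==> \<exists>x. s < v x"
    and w: "\<And>x. 0 \<le> w x"
    and supp: "\<And>x. N < \<bar>x\<bar> ==> u x = 0" "\<And>x. N < \<bar>x\<bar> ==> v x = 0"
    and uvw: "\<And>x y. u x * v y \<le> (w ((x + y) / 2))\<^sup>2"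
  shows "(\<integral>\<^sup>+x. ennreal (u x) \<partial>lborel) + (\<integral>\<^sup>+x. ennreal (v x) \<partial>lborel) \<le> 2 * (\<integral>\<^sup>+x. ennreal (w x) \<partial>lborel)"
proof -
  \<comment> \<open>The layer-cake formula runs over levels below 1, and truncation of
    \<open>w\<close> at 1 does not change those superlevel sets.\<close>
  define w1 where "w1 x = min 1 (w x)" for x
  have [measurable]: "w1 \<in> borel_measurable borel" unfolding w1_def by measurable
  have w1: "0 \<le> w1 x" "w1 x \<le> 1" for x using w by (auto simp: w1_def)
  have m[measurable]: "(%s. emeasure lborel {x. s < f x}) \<in> borel_measurable borel"
    if [measurable]: "f \<in> borel_measurable borel" for f :: "real => real"
  proof -
    have "(%s. \<integral>\<^sup>+x. (if s < f x then 1 else 0) \<partial>lborel) \<in> borel_measurable borel"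
      by measurable
    also have "(%s. \<integral>\<^sup>+x. (if s < f x then 1 else 0) \<partial>lborel) = (%s. emeasure lborel {x. s < f x})"
    proof
      fix s
      have "(\<integral>\<^sup>+x. (if s < f x then 1 else 0) \<partial>lborel) = (\<integral>\<^sup>+x. indicator {x. s < f x} x \<partial>lborel)"
        by (intro nn_integral_cong) auto
      then show "(\<integral>\<^sup>+x. (if s < f x then 1 else 0) \<partial>lborel) = emeasure lborel {x. s < f x}"
        by (subst (asm) nn_integral_indicator) auto
    qed
    finally show ?thesis .
  qed
  have "(\<integral>\<^sup>+x. ennreal (u x) \<partial>lborel) + (\<integral>\<^sup>+x. ennreal (v x) \<partial>lborel)
     = (\<integral>\<^sup>+s. indicator {0<..<1} s * emeasure lborel {x. s < u x} + indicator {0<..<1} s * emeasure lborel {x. s < v x} \<partial>lborel)"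
    using u v by (simp add: nn_integral_layer_cake_le1 nn_integral_add)
  also have "... \<le> (\<integral>\<^sup>+s. 2 * (indicator {0<..<1} s * emeasure lborel {x. s < w1 x}) \<partial>lborel)"
  proof (intro nn_integral_mono)
    fix s :: real
    show "indicator {0<..<1} s * emeasure lborel {x. s < u x} + indicator {0<..<1} s * emeasure lborel {x. s < v x}
       \<le> 2 * (indicator {0<..<1} s * emeasure lborel {x. s < w1 x})"
    proof (cases "0 < s \<and> s < 1")
      case True
      have "emeasure lborel {x. s < u x} + emeasure lborel {x. s < v x} \<le> 2 * emeasure lborel {x. s < w1 x}"
      proof (rule emeasure_midpoint_ge)
        show "{x. s < u x} \<noteq> {}" "{x. s < v x} \<noteq> {}" using u(3) v(3) True by auto
        show "bounded {x. s < u x}" "bounded {x. s < v x}"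
          using supp True unfolding bounded_iff by (smt (verit) mem_Collect_eq real_norm_def)+
        fix x y assume "x \<in> {x. s < u x}" "y \<in> {x. s < v x}"
        then have "s * s < u x * v y" using True by (intro mult_strict_mono) auto
        then have "s\<^sup>2 < (w ((x+y)/2))\<^sup>2" using uvw[of x y] by (simp add: power2_eq_square)
        then have "s < w ((x+y)/2)" using w by (rule power2_less_imp_less)
        then show "(x + y) / 2 \<in> {x. s < w1 x}" using True by (simp add: w1_def)
      qed auto
      then show ?thesis using True by (simp add: indicator_def)
    qed auto
  qed
  also have "... = 2 * (\<integral>\<^sup>+x. ennreal (w1 x) \<partial>lborel)"
    using w1 by (simp add: nn_integral_layer_cake_le1 nn_integral_cmult)
  also have "... \<le> 2 * (\<integral>\<^sup>+x. ennreal (w x) \<partial>lborel)"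
    by (intro mult_left_mono nn_integral_mono ennreal_leI) (auto simp: w1_def)
  finally show ?thesis .
qed

text \<open>Dividing \<open>u\<close> and \<open>v\<close> by their suprema a and c, and
  \<open>w\<close> by sqrt(a c), preserves the hypothesis. The additive inequality p/a + q/c \<le>
  2/sqrt(a c) together with AM-GM eliminates the unknown suprema and leaves p q \<le> 1.\<close>

lemma prekopa_leindler_bounded:
  fixes u v w :: "real => real"
  assumes [measurable]: "u \<in> borel_measurable borel" "v \<in> borel_measurable borel" "w \<in> borel_measurable borel"
    and u: "\<And>x. 0 \<le> u x" "\<And>x. u x \<le> b"
    and v: "\<And>x. 0 \<le> v x" "\<And>x. v x \<le> b"
    and w: "\<And>x. 0 \<le> w x"
    and supp: "\<And>x. N < \<bar>x\<bar> ==> u x = 0" "\<And>x. N < \<bar>x\<bar> ==> v x = 0"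
    and uvw: "\<And>x y. u x * v y \<le> (w ((x + y) / 2))\<^sup>2"
    and w1: "(\<integral>\<^sup>+x. ennreal (w x) \<partial>lborel) = 1"
  shows "(\<integral>\<^sup>+x. ennreal (u x) \<partial>lborel) * (\<integral>\<^sup>+x. ennreal (v x) \<partial>lborel) \<le> 1"
proof -
  define a where "a = (SUP x. u x)"
  define c where "c = (SUP x. v x)"
  have bdd: "bdd_above (range u)" "bdd_above (range v)" using u v by (auto intro!: bdd_aboveI2)
  have ua: "u x \<le> a" and vc: "v x \<le> c" for x
    unfolding a_def c_def using bdd by (auto intro: cSUP_upper)
  have a0: "0 \<le> a" and c0: "0 \<le> c" using u(1)[of 0] ua[of 0] v(1)[of 0] vc[of 0] by auto
  show ?thesis
  proof (cases "a = 0 \<or> c = 0")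
    case True
    then have "(\<forall>x. u x = 0) \<or> (\<forall>x. v x = 0)" using u(1) v(1) ua vc by (metis antisym)
    then show ?thesis by auto
  next
    case False
    then have pos: "a > 0" "c > 0" using a0 c0 by auto
    let ?Iu = "\<integral>\<^sup>+x. ennreal (u x) \<partial>lborel" and ?Iv = "\<integral>\<^sup>+x. ennreal (v x) \<partial>lborel"
    have "(\<integral>\<^sup>+x. ennreal (u x / a) \<partial>lborel) + (\<integral>\<^sup>+x. ennreal (v x / c) \<partial>lborel)
        \<le> 2 * (\<integral>\<^sup>+x. ennreal (w x / sqrt (a * c)) \<partial>lborel)"
    proof (rule prekopa_leindler_normalised[where N = N])
      fix s :: real assume "s < 1"
      then have "s * a < a" "s * c < c" using pos by auto
      then show "\<exists>x. s < u x / a" "\<exists>x. s < v x / c"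
        using pos less_cSUP_iff[OF _ bdd(1), of "s * a"] less_cSUP_iff[OF _ bdd(2), of "s * c"]
        by (auto simp: field_simps a_def[symmetric] c_def[symmetric])
    next
      fix x y
      have "(w ((x + y) / 2) / sqrt (a * c))\<^sup>2 = (w ((x + y) / 2))\<^sup>2 / (a * c)"
        using pos by (simp add: power_divide)
      then show "u x / a * (v y / c) \<le> (w ((x + y) / 2) / sqrt (a * c))\<^sup>2"
        using uvw[of x y] pos by (simp add: divide_right_mono)
    qed (use u v w ua vc pos supp in auto)
    moreover have "(\<integral>\<^sup>+x. ennreal (f x / d) \<partial>lborel) = ennreal (1/d) * (\<integral>\<^sup>+x. ennreal (f x) \<partial>lborel)"
      if [measurable]: "f \<in> borel_measurable borel" and "d > 0" "\<And>x. f x \<ge> 0" for f :: "real => real" and d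
    proof -
      have "(\<integral>\<^sup>+x. ennreal (f x / d) \<partial>lborel) = (\<integral>\<^sup>+x. ennreal (1/d) * ennreal (f x) \<partial>lborel)"
        using that by (intro nn_integral_cong) (simp add: ennreal_mult[symmetric])
      then show ?thesis by (simp add: nn_integral_cmult)
    qed
    ultimately have le: "ennreal (1/a) * ?Iu + ennreal (1/c) * ?Iv \<le> 2 * ennreal (1 / sqrt (a * c))"
      using u v w pos w1 by (simp add: mult.commute)
    have two: "2 * ennreal (1 / sqrt (a * c)) = ennreal (2 / sqrt (a * c))"
      using pos ennreal_mult[of 2 "1 / sqrt (a * c)"] by simp
    \<comment> \<open>Finiteness of both integrals is itself a consequence of the additive bound,
      whose right side is finite.\<close>
    have fin: "?Iu < \<infinity>" "?Iv < \<infinity>"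
    proof -
      have "ennreal (1/a) * ?Iu + ennreal (1/c) * ?Iv < \<infinity>"
        unfolding infinity_ennreal_def by (rule le_less_trans[OF le]) (simp add: two)
      then have "ennreal (1/a) * ?Iu < \<infinity>" "ennreal (1/c) * ?Iv < \<infinity>"
        unfolding infinity_ennreal_def ennreal_add_less_top by blast+
      then show "?Iu < \<infinity>" "?Iv < \<infinity>" using pos by (auto simp: ennreal_mult_less_top less_top)
    qed
    obtain p q where p: "p \<ge> 0" "?Iu = ennreal p" and q: "q \<ge> 0" "?Iv = ennreal q"
      using fin by (metis ennreal_cases infinity_ennreal_def less_irrefl)
    have "p / a + q / c \<le> 2 / sqrt (a * c)"
    proof -
      have "ennreal (1/a) * ?Iu + ennreal (1/c) * ?Iv = ennreal (p / a + q / c)"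
        using p q pos by (simp add: ennreal_mult[symmetric] ennreal_plus[symmetric] del: ennreal_plus)
      then show ?thesis using le two pos by simp
    qed
    then have "(p / a + q / c)\<^sup>2 \<le> (2 / sqrt (a * c))\<^sup>2" using p q pos by (intro power_mono) auto
    also have "... = 4 / (a * c)" using pos by (simp add: power_divide)
    finally have "(p / a + q / c)\<^sup>2 \<le> 4 / (a * c)" .
    moreover have "4 * (p / a * (q / c)) \<le> (p / a + q / c)\<^sup>2"
      using zero_le_power2[of "p/a - q/c"] unfolding power2_sum power2_diff by linarith
    ultimately have "p * q / (a * c) \<le> 1 / (a * c)" by simp
    then have "p * q \<le> 1" using pos by (simp add: divide_le_cancel)
    then show ?thesis using p q by (simp add: ennreal_mult[symmetric])
  qed
qed

section \<open>Property (tau) of the standard Gaussian measure\<close>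

abbreviation N01 :: "real measure" where "N01 \<equiv> density lborel (%x. ennreal (std_normal_density x))"

lemma prob_space_N01: "prob_space N01"
  using prob_space_normal_density[of 1 0] by simp

text \<open>The parallelogram law in the exponent. The cost (x - y)^2/4 is exactly the defect that
  lets the density at the midpoint play the role of \<open>w\<close> in Prekopa-Leindler.\<close>

lemma std_normal_midpoint:
  "exp ((x - y)\<^sup>2 / 4) * (std_normal_density x * std_normal_density y) = (std_normal_density ((x + y) / 2))\<^sup>2"
proof -
  have e: "(x - y)\<^sup>2 / 4 + (- x\<^sup>2 / 2 + - y\<^sup>2 / 2) = 2 * (- ((x + y) / 2)\<^sup>2 / 2)"
    by (simp add: power2_eq_square field_simps)
  have "exp ((x - y)\<^sup>2 / 4) * (exp (- x\<^sup>2 / 2) * exp (- y\<^sup>2 / 2)) = (exp (- ((x + y) / 2)\<^sup>2 / 2))\<^sup>2"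
    unfolding mult_exp_exp e by (rule exp_double)
  then show ?thesis
    unfolding std_normal_density_def power_mult_distrib power2_eq_square[of "1 / sqrt (2 * pi)"]
    by (simp only: ac_simps)
qed

text \<open>Property (tau) of Maurey: the hypothesis is the inf-convolution inequality without the infimum,
  so that no measurability of an infimum is needed and tensorisation is Fubini.\<close>
lemma gauss_property_tau_1:
  fixes u v :: "real => ennreal"
  assumes [measurable]: "u \<in> borel_measurable borel" "v \<in> borel_measurable borel"
    and uv: "\<And>x y. u x * v y \<le> ennreal (exp ((x - y)\<^sup>2 / 4))"
  shows "(\<integral>\<^sup>+x. u x \<partial>N01) * (\<integral>\<^sup>+x. v x \<partial>N01) \<le> 1"
proof -
  \<comment> \<open>Truncation in height and in space with the density absorbed: bounded, compactly
    supported, and increasing in \<open>N\<close> to the full integrand, as the bounded inequality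
    requires.\<close>
  define t where "t f N x = enn2real (min (f x) (of_nat N)) * std_normal_density x * indicator {- real N..real N} x"
    for f :: "real => ennreal" and N :: nat and x
  have [measurable]: "t f N \<in> borel_measurable borel" if [measurable]: "f \<in> borel_measurable borel" for f N
    unfolding t_def by measurable
  have t0: "0 \<le> t f N x" for f N x unfolding t_def by simp
  have minfin: "min (f x) (of_nat N) < (\<top>::ennreal)" for f :: "real => ennreal" and N x
    by (metis ennreal_of_nat_eq_real_of_nat ennreal_less_top min_less_iff_disj)
  have lim: "(\<integral>\<^sup>+x. f x \<partial>N01) = (SUP N. \<integral>\<^sup>+x. ennreal (t f N x) \<partial>lborel)"
    if [measurable]: "f \<in> borel_measurable borel" for f
  proof -
    have e: "ennreal (t f N x) = min (f x) (of_nat N) * ennreal (std_normal_density x) * indicator {- real N..real N} x" for N x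
      unfolding t_def using minfin[of f x N] by (auto simp: ennreal_mult indicator_def)
    have "(SUP N. \<integral>\<^sup>+x. ennreal (t f N x) \<partial>lborel) = (\<integral>\<^sup>+x. (SUP N. ennreal (t f N x)) \<partial>lborel)"
    proof (rule nn_integral_monotone_convergence_SUP[symmetric])
      show "incseq (%N x. ennreal (t f N x))"
        unfolding e by (auto simp: incseq_def le_fun_def indicator_def intro!: mult_right_mono min.mono)
    qed auto
    also have "... = (\<integral>\<^sup>+x. ennreal (std_normal_density x) * f x \<partial>lborel)"
    proof (intro nn_integral_cong)
      fix x
      show "(SUP N. ennreal (t f N x)) = ennreal (std_normal_density x) * f x"
      proof (rule antisym)
        show "(SUP N. ennreal (t f N x)) \<le> ennreal (std_normal_density x) * f x"
          unfolding e by (intro SUP_least) (auto simp: indicator_def mult.commute[of "f x"] mult.commute[of "min _ _"] intro!: mult_left_mono)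
        have "ennreal (std_normal_density x) * f x = ennreal (std_normal_density x) * (SUP N. min (f x) (of_nat N))"
        proof -
          have "f x = (SUP N. min (f x) (of_nat N))"
          proof (rule antisym)
            have "f x = inf (f x) (SUP N. of_nat N)" by (simp add: ennreal_SUP_of_nat_eq_top)
            also have "... = (SUP N. inf (f x) (of_nat N))" by (rule inf_SUP)
            finally show "f x \<le> (SUP N. min (f x) (of_nat N))" by (simp add: inf_min)
          qed (auto intro: SUP_least)
          then show ?thesis by simp
        qed
        also have "... = (SUP N. ennreal (std_normal_density x) * min (f x) (of_nat N))"
          by (rule SUP_mult_left_ennreal)
        also have "... \<le> (SUP N. ennreal (t f N x))"
        proof (rule SUP_mono)
          fix N :: nat
          obtain M :: nat where M: "\<bar>x\<bar> \<le> real M" using real_arch_simple by blast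
          have "ennreal (std_normal_density x) * min (f x) (of_nat N) \<le> ennreal (t f (max N M) x)"
            unfolding e using M by (auto simp: indicator_def mult.commute[of "min _ _"] intro!: mult_left_mono min.mono)
          then show "\<exists>m\<in>UNIV. ennreal (std_normal_density x) * min (f x) (of_nat N) \<le> ennreal (t f m x)" by blast
        qed
        finally show "ennreal (std_normal_density x) * f x \<le> (SUP N. ennreal (t f N x))" .
      qed
    qed
    finally show ?thesis by (simp add: nn_integral_density)
  qed
  have inc: "incseq (%N. \<integral>\<^sup>+x. ennreal (t f N x) \<partial>lborel)" for f
    unfolding incseq_def
  proof (intro allI impI nn_integral_mono ennreal_leI)
    fix M N :: nat and x :: real assume "M \<le> N"
    have "enn2real (min (f x) (of_nat M)) \<le> enn2real (min (f x) (of_nat N))"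
      using \<open>M \<le> N\<close> minfin by (intro enn2real_mono min.mono) auto
    then show "t f M x \<le> t f N x"
      unfolding t_def using \<open>M \<le> N\<close> by (auto simp: indicator_def intro!: mult_right_mono)
  qed
  have one: "(\<integral>\<^sup>+x. ennreal (t u N x) \<partial>lborel) * (\<integral>\<^sup>+x. ennreal (t v N x) \<partial>lborel) \<le> 1" for N
  proof (rule prekopa_leindler_bounded[where w = std_normal_density and N = "real N" and b = "real N"])
    have den: "std_normal_density x \<le> 1" for x :: real
    proof -
      have "1 \<le> sqrt (2 * pi)" using pi_gt3 by simp
      then have "std_normal_density x \<le> 1 * 1"
        unfolding std_normal_density_def by (intro mult_mono) auto
      then show ?thesis by simp
    qed
    have er: "enn2real (min (f x) (of_nat N)) \<le> real N" for f :: "real => ennreal" and x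
      using enn2real_mono[of "min (f x) (of_nat N)" "of_nat N"] by (simp add: ennreal_of_nat_eq_real_of_nat)
    have "t f N x \<le> real N * 1 * 1" for f x
      unfolding t_def by (intro mult_mono er den) (auto simp: indicator_def)
    then show "t u N x \<le> real N" "t v N x \<le> real N" for x by auto
    fix x y
    have "enn2real (min (u x) (of_nat N)) * enn2real (min (v y) (of_nat N)) \<le> exp ((x - y)\<^sup>2 / 4)"
    proof -
      have "min (u x) (of_nat N) * min (v y) (of_nat N) \<le> ennreal (exp ((x - y)\<^sup>2 / 4))"
        by (rule order_trans[OF mult_mono uv]) auto
      from enn2real_mono[OF this] show ?thesis by (simp add: enn2real_mult)
    qed
    then have "enn2real (min (u x) (of_nat N)) * enn2real (min (v y) (of_nat N)) * (std_normal_density x * std_normal_density y)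
       \<le> (std_normal_density ((x + y) / 2))\<^sup>2"
      unfolding std_normal_midpoint[symmetric] by (intro mult_right_mono) auto
    moreover have "t u N x * t v N y \<le> enn2real (min (u x) (of_nat N)) * enn2real (min (v y) (of_nat N)) * (std_normal_density x * std_normal_density y)"
      unfolding t_def by (auto simp: indicator_def)
    ultimately show "t u N x * t v N y \<le> (std_normal_density ((x + y) / 2))\<^sup>2" by simp
  next
    interpret prob_space N01 by (rule prob_space_N01)
    show "(\<integral>\<^sup>+x. ennreal (std_normal_density x) \<partial>lborel) = 1"
      using emeasure_space_1 by (simp add: emeasure_density)
  qed (auto simp: t0, auto simp: t_def indicator_def)
  have "(\<integral>\<^sup>+x. u x \<partial>N01) * (\<integral>\<^sup>+x. v x \<partial>N01)
      = (SUP N. SUP M. (\<integral>\<^sup>+x. ennreal (t u N x) \<partial>lborel) * (\<integral>\<^sup>+x. ennreal (t v M x) \<partial>lborel))"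
    unfolding lim[OF assms(1)] lim[OF assms(2)]
    by (subst SUP_mult_right_ennreal) (simp add: SUP_mult_left_ennreal)
  also have "... \<le> 1"
  proof (intro SUP_least)
    fix N M
    have "(\<integral>\<^sup>+x. ennreal (t u N x) \<partial>lborel) * (\<integral>\<^sup>+x. ennreal (t v M x) \<partial>lborel)
       \<le> (\<integral>\<^sup>+x. ennreal (t u (max N M) x) \<partial>lborel) * (\<integral>\<^sup>+x. ennreal (t v (max N M) x) \<partial>lborel)"
      using inc[of u] inc[of v] by (intro mult_mono) (auto simp: incseq_def)
    also have "... \<le> 1" by (rule one)
    finally show "(\<integral>\<^sup>+x. ennreal (t u N x) \<partial>lborel) * (\<integral>\<^sup>+x. ennreal (t v M x) \<partial>lborel) \<le> 1" .
  qed
  finally show ?thesis .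
qed

abbreviation gauss :: "'i set => ('i => real) measure" where "gauss I \<equiv> PiM I (%_. N01)"

lemma prob_space_gauss: "prob_space (gauss I)"
  by (intro prob_space_PiM prob_space_N01)

lemma sets_gauss: "sets (gauss I) = sets (PiM I (%_. borel))"
  by (intro sets_PiM_cong) auto

text \<open>The cost is additive over coordinates. With the new coordinates frozen at a and b, their
  share exp((a - b)^2/4) is moved as a constant into the first function; the induction hypothesis
  then bounds the product of the inner integrals by this share, which is the one-dimensional
  hypothesis for the partial integrals \<open>U\<close> and \<open>V\<close>.\<close>

lemma gauss_property_tau:
  fixes u v :: "('i => real) => ennreal"
  assumes "finite I" "u \<in> borel_measurable (gauss I)" "v \<in> borel_measurable (gauss I)"
    and uv: "\<And>x y. x \<in> space (gauss I) ==> y \<in> space (gauss I) ==>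
      u x * v y \<le> ennreal (exp ((\<Sum>i\<in>I. (x i - y i)\<^sup>2) / 4))"
  shows "(\<integral>\<^sup>+x. u x \<partial>gauss I) * (\<integral>\<^sup>+x. v x \<partial>gauss I) \<le> 1"
  using assms
proof (induction I arbitrary: u v rule: finite_induct)
  case empty
  then show ?case by (simp add: PiM_empty nn_integral_count_space_finite)
next
  case (insert j I)
  interpret product_sigma_finite "%_::'i. N01"
    by (rule product_sigma_finite.intro) (intro prob_space_imp_sigma_finite prob_space_N01)
  interpret I: prob_space "gauss I" by (rule prob_space_gauss)
  note [measurable] = insert.prems(1,2)
  have m: "(%(a, x). f (x(j := a))) \<in> borel_measurable (N01 \<Otimes>\<^sub>M gauss I)"
    if [measurable]: "f \<in> borel_measurable (gauss (insert j I))" for f :: "('i => real) => ennreal"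
  proof -
    have "(%p. (snd p)(j := fst p)) \<in> measurable (N01 \<Otimes>\<^sub>M gauss I) (gauss (insert j I))"
      by (rule measurable_fun_upd[where J = I]) auto
    from measurable_compose[OF this that] show ?thesis by (simp add: split_beta)
  qed
  have m1[measurable]: "(%x. f (x(j := a))) \<in> borel_measurable (gauss I)"
    if [measurable]: "f \<in> borel_measurable (gauss (insert j I))" for f :: "('i => real) => ennreal" and a
  proof -
    have "(%x. x(j := a)) \<in> measurable (gauss I) (gauss (insert j I))"
      by (rule measurable_fun_upd[where J = I]) auto
    from measurable_compose[OF this that] show ?thesis .
  qed
  define U where "U a = (\<integral>\<^sup>+x. u (x(j := a)) \<partial>gauss I)" for a
  define V where "V a = (\<integral>\<^sup>+x. v (x(j := a)) \<partial>gauss I)" for a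
  have "U \<in> borel_measurable N01" "V \<in> borel_measurable N01"
    unfolding U_def V_def
    using I.borel_measurable_nn_integral[OF m[OF insert.prems(1)]]
      I.borel_measurable_nn_integral[OF m[OF insert.prems(2)]] by auto
  then have [measurable]: "U \<in> borel_measurable borel" "V \<in> borel_measurable borel" by auto
  have UV: "U a * V b \<le> ennreal (exp ((a - b)\<^sup>2 / 4))" for a b
  proof -
    let ?c = "exp ((a - b)\<^sup>2 / 4)"
    have "(\<integral>\<^sup>+x. ennreal (1 / ?c) * u (x(j := a)) \<partial>gauss I) * (\<integral>\<^sup>+x. v (x(j := b)) \<partial>gauss I) \<le> 1"
    proof (rule insert.IH)
      fix x y assume x: "x \<in> space (gauss I)" "y \<in> space (gauss I)"
      then have "x(j := a) \<in> space (gauss (insert j I))" "y(j := b) \<in> space (gauss (insert j I))"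
        by (auto simp: space_PiM PiE_def extensional_def)
      from insert.prems(3)[OF this]
      have "u (x(j := a)) * v (y(j := b)) \<le> ennreal (exp ((\<Sum>i\<in>insert j I. ((x(j := a)) i - (y(j := b)) i)\<^sup>2) / 4))" .
      also have "(\<Sum>i\<in>insert j I. ((x(j := a)) i - (y(j := b)) i)\<^sup>2) = (a - b)\<^sup>2 + (\<Sum>i\<in>I. (x i - y i)\<^sup>2)"
        using insert.hyps by (auto intro!: sum.cong)
      also have "exp (((a - b)\<^sup>2 + (\<Sum>i\<in>I. (x i - y i)\<^sup>2)) / 4) = ?c * exp ((\<Sum>i\<in>I. (x i - y i)\<^sup>2) / 4)"
        by (simp add: exp_add[symmetric] add_divide_distrib)
      finally have "ennreal (1 / ?c) * (u (x(j := a)) * v (y(j := b)))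
          \<le> ennreal (1 / ?c) * ennreal (?c * exp ((\<Sum>i\<in>I. (x i - y i)\<^sup>2) / 4))"
        by (rule mult_left_mono) simp
      also have "... = ennreal (exp ((\<Sum>i\<in>I. (x i - y i)\<^sup>2) / 4))"
        by (simp add: ennreal_mult[symmetric])
      finally show "ennreal (1 / ?c) * u (x(j := a)) * v (y(j := b)) \<le> ennreal (exp ((\<Sum>i\<in>I. (x i - y i)\<^sup>2) / 4))"
        by (simp add: mult.assoc)
    qed (use insert.prems in measurable)
    then have le: "ennreal (1 / ?c) * (U a * V b) \<le> 1"
      unfolding U_def V_def using insert.prems by (simp add: nn_integral_cmult mult.assoc)
    have "U a * V b = ennreal ?c * (ennreal (1 / ?c) * (U a * V b))"
      by (simp add: mult.assoc[symmetric] ennreal_mult[symmetric])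
    also have "... \<le> ennreal ?c * 1" by (rule mult_left_mono[OF le]) simp
    finally show ?thesis by simp
  qed
  have "(\<integral>\<^sup>+x. u x \<partial>gauss (insert j I)) = (\<integral>\<^sup>+a. U a \<partial>N01)"
    unfolding U_def using insert by (intro product_nn_integral_insert_rev) auto
  moreover have "(\<integral>\<^sup>+x. v x \<partial>gauss (insert j I)) = (\<integral>\<^sup>+a. V a \<partial>N01)"
    unfolding V_def using insert by (intro product_nn_integral_insert_rev) auto
  moreover have "(\<integral>\<^sup>+a. U a \<partial>N01) * (\<integral>\<^sup>+a. V a \<partial>N01) \<le> 1"
    by (rule gauss_property_tau_1) (auto intro: UV)
  ultimately show ?case by simp
qed

section \<open>Concentration of Lipschitz functions of a Gaussian vector\<close>

text \<open>Precomposed with restriction to \<open>I\<close>, such a function is continuous on the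
  whole function space. The index type being countable, the Borel sets of the product topology are
  those of the product sigma-algebra, so continuity gives measurability.\<close>

lemma lipschitz_imp_measurable_PiM:
  fixes h :: "('i::countable => real) => real"
  assumes fin: "finite I"
    and lip: "\<And>x y. x \<in> space (PiM I (%_. borel)) ==> y \<in> space (PiM I (%_. borel)) ==>
      \<bar>h x - h y\<bar> \<le> L * L2_set (%i. x i - y i) I"
  shows "h \<in> borel_measurable (PiM I (%_. borel))"
proof -
  define k where "k y = h (restrict y I)" for y
  have "continuous_on UNIV k"
    unfolding continuous_on_def
  proof
    fix y0 :: "'i => real"
    have c: "((%y. y i) \<longlongrightarrow> y0 i) (at y0)" for i
      using continuous_on_product_coordinates[of i] unfolding continuous_on_def by auto
    have "((%y. L * L2_set (%i. y i - y0 i) I) \<longlongrightarrow> L * L2_set (%i. y0 i - y0 i) I) (at y0)"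
      unfolding L2_set_def by (intro tendsto_intros c)
    then have "((%y. L * L2_set (%i. y i - y0 i) I) \<longlongrightarrow> 0) (at y0)" by (simp add: L2_set_def)
    moreover have "\<forall>\<^sub>F y in at y0. norm (k y - k y0) \<le> L * L2_set (%i. y i - y0 i) I"
    proof (rule always_eventually, rule allI)
      fix y
      have "\<bar>h (restrict y I) - h (restrict y0 I)\<bar> \<le> L * L2_set (%i. restrict y I i - restrict y0 I i) I"
        by (rule lip) (auto simp: space_PiM)
      also have "L2_set (%i. restrict y I i - restrict y0 I i) I = L2_set (%i. y i - y0 i) I"
        by (intro L2_set_cong) auto
      finally show "norm (k y - k y0) \<le> L * L2_set (%i. y i - y0 i) I" unfolding k_def real_norm_def .
    qed
    ultimately have "((%y. k y - k y0) \<longlongrightarrow> 0) (at y0)" by (rule Lim_null_comparison[rotated])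
    then show "(k \<longlongrightarrow> k y0) (at y0 within UNIV)" by (simp add: LIM_zero_iff)
  qed
  then have km: "k \<in> borel_measurable borel" by (rule borel_measurable_continuous_onI)
  have ext0: "(%x i. if i \<in> I then x i else (0::real)) \<in> measurable (PiM I (%_. borel)) (PiM UNIV (%_. borel))"
  proof (rule measurable_abs_UNIV)
    fix i show "(%x. if i \<in> I then x i else (0::real)) \<in> borel_measurable (PiM I (%_. borel))"
      by (cases "i \<in> I") auto
  qed
  have e: "(%x i. if i \<in> I then x i else (0::real)) \<in> measurable (PiM I (%_. borel)) borel"
  proof -
    have "measurable (PiM I (%_. borel)) (PiM UNIV (%_. borel)) = measurable (PiM I (%_. borel :: real measure)) (borel :: ('i => real) measure)"
      by (rule measurable_cong_sets[OF refl sets_PiM_equal_borel])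
    then show ?thesis using ext0 by simp
  qed
  define k' where "k' x = k (%i. if i \<in> I then x i else (0::real))" for x
  have "k' \<in> borel_measurable (PiM I (%_. borel))"
    unfolding k'_def by (rule measurable_compose[OF e km])
  moreover have "k' x = h x" if "x \<in> space (PiM I (%_. borel))" for x
  proof -
    have "x \<in> extensional I" using that by (simp add: space_PiM PiE_def)
    then have "restrict (%i. if i \<in> I then x i else (0::real)) I = x"
      by (intro extensionalityI[of _ I]) auto
    then show ?thesis by (simp only: k_def k'_def)
  qed
  ultimately show ?thesis
    using measurable_cong[of "PiM I (%_. borel)" k' h borel] by blast
qed

locale gauss_lipschitz =
  fixes I :: "'i::countable set" and h :: "('i => real) => real" and L :: real
  assumes fin: "finite I" and L: "0 < L"
    and lip: "\<And>x y. x \<in> space (PiM I (%_. borel)) ==> y \<in> space (PiM I (%_. borel)) ==>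
      \<bar>h x - h y\<bar> \<le> L * L2_set (%i. x i - y i) I"
begin

lemma meas[measurable]: "h \<in> borel_measurable (gauss I)"
  using lipschitz_imp_measurable_PiM[OF fin lip] unfolding measurable_cong_sets[OF sets_gauss refl] .

sublocale prob_space "gauss I" by (rule prob_space_gauss)

text \<open>Property (tau) for exp(l h - l^2 L^2) and exp(- l h): with d the distance of x and y, l
  (h x - h y) \<le> |l| L d \<le> l^2 L^2 + d^2/4. The integrals are extended-valued because
  integrability is only deduced from this bound.\<close>

lemma nn_exp_prod:
  "(\<integral>\<^sup>+x. ennreal (exp (l * h x)) \<partial>gauss I) * (\<integral>\<^sup>+x. ennreal (exp (- (l * h x))) \<partial>gauss I) \<le> ennreal (exp (l\<^sup>2 * L\<^sup>2))"
proof -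
  let ?c = "exp (l\<^sup>2 * L\<^sup>2)"
  have "(\<integral>\<^sup>+x. ennreal (1 / ?c) * ennreal (exp (l * h x)) \<partial>gauss I) * (\<integral>\<^sup>+x. ennreal (exp (- (l * h x))) \<partial>gauss I) \<le> 1"
  proof (rule gauss_property_tau[OF fin])
    fix x y assume "x \<in> space (gauss I)" "y \<in> space (gauss I)"
    then have "\<bar>h x - h y\<bar> \<le> L * L2_set (%i. x i - y i) I" by (intro lip) (auto simp: space_PiM)
    then have "\<bar>l\<bar> * \<bar>h x - h y\<bar> \<le> \<bar>l\<bar> * (L * L2_set (%i. x i - y i) I)" by (intro mult_left_mono) auto
    moreover have "l * h x - l * h y \<le> \<bar>l\<bar> * \<bar>h x - h y\<bar>"
      using abs_ge_self[of "l * (h x - h y)"] unfolding abs_mult by (simp add: algebra_simps)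
    moreover have "(\<bar>l\<bar> * L) * L2_set (%i. x i - y i) I \<le> (\<bar>l\<bar> * L)\<^sup>2 + (L2_set (%i. x i - y i) I)\<^sup>2 / 4"
      using zero_le_power2[of "\<bar>l\<bar> * L - L2_set (%i. x i - y i) I / 2"] by (simp add: power2_eq_square algebra_simps)
    moreover have "(L2_set (%i. x i - y i) I)\<^sup>2 = (\<Sum>i\<in>I. (x i - y i)\<^sup>2)"
      by (simp add: L2_set_def sum_nonneg)
    ultimately have "l * h x - l * h y - l\<^sup>2 * L\<^sup>2 \<le> (\<Sum>i\<in>I. (x i - y i)\<^sup>2) / 4"
      by (simp add: power_mult_distrib algebra_simps)
    then have "exp (l * h x - l * h y - l\<^sup>2 * L\<^sup>2) \<le> exp ((\<Sum>i\<in>I. (x i - y i)\<^sup>2) / 4)" by simp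
    then show "ennreal (1 / ?c) * ennreal (exp (l * h x)) * ennreal (exp (- (l * h y))) \<le> ennreal (exp ((\<Sum>i\<in>I. (x i - y i)\<^sup>2) / 4))"
      by (simp add: ennreal_mult[symmetric] exp_diff exp_minus exp_add field_simps)
  qed auto
  then have le: "ennreal (1 / ?c) * ((\<integral>\<^sup>+x. ennreal (exp (l * h x)) \<partial>gauss I) * (\<integral>\<^sup>+x. ennreal (exp (- (l * h x))) \<partial>gauss I)) \<le> 1"
    by (simp add: nn_integral_cmult mult.assoc)
  have "ennreal ?c * (ennreal (1 / ?c) * ((\<integral>\<^sup>+x. ennreal (exp (l * h x)) \<partial>gauss I) * (\<integral>\<^sup>+x. ennreal (exp (- (l * h x))) \<partial>gauss I))) \<le> ennreal ?c * 1"
    by (rule mult_left_mono[OF le]) simp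
  then show ?thesis by (simp add: mult.assoc[symmetric] ennreal_mult[symmetric])
qed

lemma nn_exp_pos: "0 < (\<integral>\<^sup>+x. ennreal (exp (l * h x)) \<partial>gauss I)"
proof (rule ccontr)
  assume "\<not> ?thesis"
  then have "(\<integral>\<^sup>+x. ennreal (exp (l * h x)) \<partial>gauss I) = 0" by simp
  then have "AE x in gauss I. ennreal (exp (l * h x)) = 0" by (subst (asm) nn_integral_0_iff_AE) auto
  then have "AE x in gauss I. False" by simp
  then show False by simp
qed

text \<open>The product bound is finite while the factor for -l is strictly positive, so the factor
  for l cannot be infinite.\<close>

lemma integrable_exp: "integrable (gauss I) (%x. exp (l * h x))"
proof -
  have "(\<integral>\<^sup>+x. ennreal (exp (l * h x)) \<partial>gauss I) \<noteq> \<infinity>"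
  proof
    assume "(\<integral>\<^sup>+x. ennreal (exp (l * h x)) \<partial>gauss I) = \<infinity>"
    moreover have "(\<integral>\<^sup>+x. ennreal (exp (- (l * h x))) \<partial>gauss I) \<noteq> 0" using nn_exp_pos[of "-l"] by auto
    ultimately show False using nn_exp_prod[of l] by (simp add: ennreal_top_mult top_unique)
  qed
  then show ?thesis by (intro integrableI_nonneg) (auto simp: less_top)
qed

lemma integrable_h: "integrable (gauss I) h"
proof (rule Bochner_Integration.integrable_bound)
  show "integrable (gauss I) (%x. exp (1 * h x) + exp ((-1) * h x))"
    by (intro Bochner_Integration.integrable_add integrable_exp)
  show "AE x in gauss I. norm (h x) \<le> norm (exp (1 * h x) + exp ((-1) * h x))"
  proof (rule AE_I2)
    fix x
    have "\<bar>h x\<bar> \<le> exp (h x) + exp (- h x)"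
      using exp_ge_add_one_self[of "h x"] exp_ge_add_one_self[of "- h x"] exp_gt_zero[of "h x"] exp_gt_zero[of "- h x"]
      by linarith
    then show "norm (h x) \<le> norm (exp (1 * h x) + exp ((-1) * h x))" by simp
  qed
qed auto

lemma mgf_bound: "expectation (%x. exp (l * (h x - expectation h))) \<le> exp (l\<^sup>2 * L\<^sup>2)"
proof -
  have ex: "exp (k * (h x - expectation h)) = exp (- k * expectation h) * exp (k * h x)" for k x
    by (simp add: exp_add[symmetric] algebra_simps)
  have int: "integrable (gauss I) (%x. exp (k * (h x - expectation h)))" for k
    unfolding ex by (intro integrable_mult_right integrable_exp)
  have one: "1 \<le> expectation (%x. exp (- l * (h x - expectation h)))"
  proof -
    have "expectation (%x. 1 + - l * (h x - expectation h)) \<le> expectation (%x. exp (- l * (h x - expectation h)))"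
      by (intro integral_mono int Bochner_Integration.integrable_add integrable_mult_right
          Bochner_Integration.integrable_diff integrable_h) (simp_all only: exp_ge_add_one_self integrable_const)
    moreover have "expectation (%x. 1 + - l * (h x - expectation h)) = 1"
      using integrable_h by (simp add: prob_space)
    ultimately show ?thesis by simp
  qed
  have prod: "expectation (%x. exp (l * h x)) * expectation (%x. exp (- l * h x)) \<le> exp (l\<^sup>2 * L\<^sup>2)"
  proof -
    have "ennreal (expectation (%x. exp (l * h x)) * expectation (%x. exp (- l * h x)))
       = (\<integral>\<^sup>+x. ennreal (exp (l * h x)) \<partial>gauss I) * (\<integral>\<^sup>+x. ennreal (exp (- (l * h x))) \<partial>gauss I)"
      using integrable_exp[of l] integrable_exp[of "-l"]
      by (simp add: nn_integral_eq_integral ennreal_mult integral_nonneg_AE)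
    also have "... \<le> ennreal (exp (l\<^sup>2 * L\<^sup>2))" by (rule nn_exp_prod)
    finally show ?thesis by (subst (asm) ennreal_le_iff) auto
  qed
  have "expectation (%x. exp (l * (h x - expectation h))) * 1
     \<le> expectation (%x. exp (l * (h x - expectation h))) * expectation (%x. exp (- l * (h x - expectation h)))"
    by (intro mult_left_mono one) (auto intro: integral_nonneg_AE)
  also have "... = expectation (%x. exp (l * h x)) * expectation (%x. exp (- l * h x))"
    unfolding ex by (simp add: exp_minus)
  also have "... \<le> exp (l\<^sup>2 * L\<^sup>2)" by (rule prod)
  finally show ?thesis by simp
qed

lemma integrable_exp_centered: "integrable (gauss I) (%x. exp (l * (h x - expectation h)))"
proof -
  have "exp (l * (h x - expectation h)) = exp (- l * expectation h) * exp (l * h x)" for x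
    by (simp add: exp_add[symmetric] algebra_simps)
  then show ?thesis by (simp add: integrable_exp)
qed

lemma concentration_upper:
  assumes "0 \<le> s"
  shows "prob {x \<in> space (gauss I). s \<le> h x - expectation h} \<le> exp (- s\<^sup>2 / (4 * L\<^sup>2))"
proof (cases "s = 0")
  case False
  \<comment> \<open>The minimiser of l^2 L^2 - l s.\<close>
  define l where "l = s / (2 * L\<^sup>2)"
  have l: "l > 0" using False assms L by (simp add: l_def)
  have eq: "{x \<in> space (gauss I). s \<le> h x - expectation h} = {x \<in> space (gauss I). exp (l * s) \<le> exp (l * (h x - expectation h))}"
    using l by (simp add: mult_le_cancel_left_pos)
  have "prob {x \<in> space (gauss I). exp (l * s) \<le> exp (l * (h x - expectation h))}
      \<le> expectation (%x. exp (l * (h x - expectation h))) / exp (l * s)"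
    by (rule integral_Markov_inequality_measure[where A = "{}"]) (auto intro: integrable_exp_centered)
  also have "... \<le> exp (l\<^sup>2 * L\<^sup>2) / exp (l * s)"
    by (rule divide_right_mono[OF mgf_bound]) simp
  also have "... = exp (l\<^sup>2 * L\<^sup>2 - l * s)" by (simp add: exp_diff)
  also have "... = exp (- s\<^sup>2 / (4 * L\<^sup>2))"
  proof -
    define X where "X = L\<^sup>2"
    have X: "X > 0" using L by (simp add: X_def)
    show ?thesis unfolding l_def X_def[symmetric] using X by (simp add: power2_eq_square field_simps)
  qed
  finally show ?thesis unfolding eq .
next
  case True
  have "exp (- s\<^sup>2 / (4 * L\<^sup>2)) = 1" using True by simp
  then show ?thesis using prob_le_1 by (simp only:)
qed

lemma uminus: "gauss_lipschitz I (%x. - h x) L"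
proof -
  have "\<bar>- h x - - h y\<bar> = \<bar>h x - h y\<bar>" for x y by linarith
  then show ?thesis using gauss_lipschitz.intro[OF fin L, of "%x. - h x"] lip by presburger
qed

lemma concentration:
  assumes "0 \<le> s"
  shows "prob {x \<in> space (gauss I). s \<le> \<bar>h x - expectation h\<bar>} \<le> 2 * exp (- s\<^sup>2 / (4 * L\<^sup>2))"
proof -
  have "prob {x \<in> space (gauss I). s \<le> \<bar>h x - expectation h\<bar>}
     \<le> prob ({x \<in> space (gauss I). s \<le> h x - expectation h} \<union> {x \<in> space (gauss I). s \<le> - h x - expectation (%x. - h x)})"
    by (intro finite_measure_mono) auto
  also have "... \<le> prob {x \<in> space (gauss I). s \<le> h x - expectation h} + prob {x \<in> space (gauss I). s \<le> - h x - expectation (%x. - h x)}"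
    by (intro measure_Un_le) auto
  also have "... \<le> exp (- s\<^sup>2 / (4 * L\<^sup>2)) + exp (- s\<^sup>2 / (4 * L\<^sup>2))"
    using concentration_upper[OF assms] gauss_lipschitz.concentration_upper[OF uminus assms] by (intro add_mono)
  finally show ?thesis by simp
qed

lemma exp_plus_exp_minus_ge: "2 + (x::real)\<^sup>2 \<le> exp x + exp (- x)"
proof -
  have *: "2 + y\<^sup>2 \<le> exp y + exp (-y)" if "0 \<le> y" for y :: real
  proof -
    \<comment> \<open>The product equals (2 sinh(y/2))^2 - y^2, and 2 sinh(y/2) \<ge> y holds by
      comparison of derivatives.\<close>
    have "0 \<le> (exp (y/2) - exp (-(y/2)) - y) * (exp (y/2) - exp (-(y/2)) + y)"
    proof (intro mult_nonneg_nonneg)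
      have d: "((%y. exp (y/2) - exp (-(y/2)) - y) has_real_derivative (exp (z/2)/2 + exp (-(z/2))/2 - 1)) (at z)" for z :: real
        by (auto intro!: derivative_eq_intros)
      have "exp (z/2)/2 + exp (-(z/2))/2 - 1 \<ge> 0" for z :: real
        using exp_ge_add_one_self[of "z/2"] exp_ge_add_one_self[of "-(z/2)"] by linarith
      then have "exp (0/2) - exp (-(0/2)) - 0 \<le> exp (y/2) - exp (-(y/2)) - y"
        using d by (intro DERIV_nonneg_imp_nondecreasing[OF that]) blast
      then show "0 \<le> exp (y/2) - exp (-(y/2)) - y" by simp
      then show "0 \<le> exp (y/2) - exp (-(y/2)) + y" using that by simp
    qed
    also have "... = exp y + exp (-y) - 2 - y\<^sup>2"
      by (simp add: algebra_simps power2_eq_square exp_add[symmetric])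
    finally show ?thesis by simp
  qed
  show ?thesis using *[of x] *[of "-x"] by (cases "0 \<le> x") (auto simp: add.commute)
qed

lemma integrable_square: "integrable (gauss I) (%x. (h x)\<^sup>2)"
proof (rule Bochner_Integration.integrable_bound)
  show "integrable (gauss I) (%x. exp (1 * h x) + exp ((-1) * h x))"
    by (intro Bochner_Integration.integrable_add integrable_exp)
  show "AE x in gauss I. norm ((h x)\<^sup>2) \<le> norm (exp (1 * h x) + exp ((-1) * h x))"
  proof (rule AE_I2)
    fix x
    have "(h x)\<^sup>2 \<le> exp (h x) + exp (- h x)" using exp_plus_exp_minus_ge[of "h x"] by linarith
    then show "norm ((h x)\<^sup>2) \<le> norm (exp (1 * h x) + exp ((-1) * h x))" by simp
  qed
qed auto

text \<open>The exponential moments at l = 1/L and l = -1/L are each at most e \<le> 3. As 2 + x^2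
  \<le> exp x + exp(-x), the second moment of the centred function over L is at most 6 - 2 =
  4.\<close>

lemma variance_bound: "expectation (%x. (h x - expectation h)\<^sup>2) \<le> 4 * L\<^sup>2"
proof -
  let ?g = "%x. h x - expectation h"
  have e: "exp (1::real) \<le> 3" by (rule exp_le)
  have i2: "integrable (gauss I) (%x. (?g x)\<^sup>2)"
    by (simp add: power2_diff integrable_square integrable_h)
  have "expectation (%x. 2 + (1/L * ?g x)\<^sup>2) \<le> expectation (%x. exp (1/L * ?g x) + exp (- 1/L * ?g x))"
  proof (intro integral_mono Bochner_Integration.integrable_add integrable_exp_centered)
    show "integrable (gauss I) (%x. (1/L * ?g x)\<^sup>2)"
      unfolding power_mult_distrib by (intro integrable_mult_right i2)
    fix x show "2 + (1/L * ?g x)\<^sup>2 \<le> exp (1/L * ?g x) + exp (- 1/L * ?g x)"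
      using exp_plus_exp_minus_ge[of "1/L * ?g x"] by simp
  qed auto
  also have "... = expectation (%x. exp (1/L * ?g x)) + expectation (%x. exp (- 1/L * ?g x))"
    by (intro Bochner_Integration.integral_add integrable_exp_centered)
  also have "... \<le> exp ((1/L)\<^sup>2 * L\<^sup>2) + exp ((- 1/L)\<^sup>2 * L\<^sup>2)"
    by (intro add_mono mgf_bound)
  also have "... \<le> 6" using L e by (simp add: power_divide)
  also have "expectation (%x. 2 + (1/L * ?g x)\<^sup>2) = 2 + (1/L)\<^sup>2 * expectation (%x. (?g x)\<^sup>2)"
    unfolding power_mult_distrib using i2 by (simp add: prob_space)
  finally show ?thesis using L by (simp add: power_divide field_simps)
qed

end

section \<open>Uniqueness of finite-dimensional characteristic functions\<close>

text \<open>The value at frequency 0 is the total mass; after division by it the uniqueness theorem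
  for probability measures applies. Mass zero is treated apart.\<close>

lemma finite_measure_eqI_char:
  fixes M1 M2 :: "real measure"
  assumes "finite_measure M1" "finite_measure M2" "sets M1 = sets borel" "sets M2 = sets borel"
    and eq: "\<And>t. (\<integral>x. iexp (t * x) \<partial>M1) = (\<integral>x. iexp (t * x) \<partial>M2)"
  shows "M1 = M2"
proof -
  interpret M1: finite_measure M1 by fact
  interpret M2: finite_measure M2 by fact
  define c where "c = measure M1 (space M1)"
  have c2: "c = measure M2 (space M2)" using eq[of 0] by (simp add: c_def)
  have e1: "emeasure M1 (space M1) = ennreal c" and e2: "emeasure M2 (space M2) = ennreal c"
    unfolding c2 by (simp_all add: M1.emeasure_eq_measure M2.emeasure_eq_measure c2[symmetric] c_def)
  have s: "space M1 = UNIV" "space M2 = UNIV" using assms(3,4) by (metis sets_eq_imp_space_eq space_borel)+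
  show ?thesis
  proof (cases "c = 0")
    case True
    show ?thesis
    proof (rule measure_eqI)
      fix A assume "A \<in> sets M1"
      have "emeasure M1 A \<le> 0" using emeasure_space[of M1 A] e1 True by simp
      moreover have "emeasure M2 A \<le> 0" using emeasure_space[of M2 A] e2 True by simp
      ultimately show "emeasure M1 A = emeasure M2 A" by simp
    qed (simp add: assms)
  next
    case False
    then have c: "c > 0" by (simp add: c_def less_le)
    define N where "N M = density M (%_. ennreal (1/c))" for M :: "real measure"
    have rd: "real_distribution (N M)" if "sets M = sets borel" "emeasure M (space M) = ennreal c" for M
    proof -
      have "emeasure (N M) (space (N M)) = 1"
        using that c sets.top[of M] unfolding N_def space_density
        by (subst emeasure_density_const) (auto simp: ennreal_mult[symmetric])
      moreover have "sets (N M) = sets borel" "space (N M) = UNIV"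
        unfolding N_def using that by (auto dest: sets_eq_imp_space_eq)
      ultimately show ?thesis
        by (auto simp: real_distribution_def real_distribution_axioms_def intro: prob_spaceI)
    qed
    have ch: "char (N M) t = (1/c) *\<^sub>R (\<integral>x. iexp (t * x) \<partial>M)" if [measurable_cong]: "sets M = sets borel" for M t
      unfolding char_def N_def using c by (subst integral_density) auto
    have "N M1 = N M2"
      by (rule Levy_uniqueness) (use rd e1 e2 assms in \<open>auto intro!: ext simp: ch\<close>)
    show ?thesis
    proof (rule measure_eqI)
      fix A assume A: "A \<in> sets M1"
      have "emeasure (N M1) A = emeasure (N M2) A" by (simp add: \<open>N M1 = N M2\<close>)
      then have "ennreal (1/c) * emeasure M1 A = ennreal (1/c) * emeasure M2 A"
        using A assms unfolding N_def by (simp add: emeasure_density_const)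
      then have "ennreal c * (ennreal (1/c) * emeasure M1 A) = ennreal c * (ennreal (1/c) * emeasure M2 A)" by simp
      then show "emeasure M1 A = emeasure M2 A"
        using c by (simp add: mult.assoc[symmetric] ennreal_mult[symmetric])
    qed (simp add: assms)
  qed
qed

text \<open>Both sides are the mass of \<open>A\<close> under the image by \<open>X\<close> of the
  measure with density \<open>g\<close>, and the hypothesis is equality of the characteristic
  functions of these finite measures on the line. Nonnegativity of the weight makes this reading
  possible.\<close>

lemma integral_weight_indicator_eqI:
  fixes \<mu> \<nu> :: "'a measure" and g X :: "'a => real"
  assumes "prob_space \<mu>" "prob_space \<nu>" and sets[measurable_cong]: "sets \<nu> = sets \<mu>"
    and [measurable]: "g \<in> borel_measurable \<mu>" "X \<in> borel_measurable \<mu>" "A \<in> sets borel"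
    and g: "\<And>x. 0 \<le> g x" "\<And>x. g x \<le> b"
    and eq: "\<And>s. (\<integral>x. complex_of_real (g x) * iexp (s * X x) \<partial>\<mu>) = (\<integral>x. complex_of_real (g x) * iexp (s * X x) \<partial>\<nu>)"
  shows "(\<integral>x. g x * indicator A (X x) \<partial>\<mu>) = (\<integral>x. g x * indicator A (X x) \<partial>\<nu>)"
proof -
  interpret \<mu>: prob_space \<mu> by fact
  interpret \<nu>: prob_space \<nu> by fact
  define D where "D M = distr (density M (%x. ennreal (g x))) borel X" for M :: "'a measure"
  have fin: "finite_measure (D M)" if "prob_space M" and [measurable_cong]: "sets M = sets \<mu>" for M
  proof -
    interpret prob_space M by fact
    have "emeasure (D M) UNIV = (\<integral>\<^sup>+x. ennreal (g x) \<partial>M)"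
      unfolding D_def by (simp add: emeasure_distr emeasure_density)
    also have "... \<le> (\<integral>\<^sup>+x. ennreal b \<partial>M)" by (intro nn_integral_mono ennreal_leI g)
    also have "... < \<infinity>" by (simp add: emeasure_space_1)
    finally show ?thesis by (intro finite_measureI) (auto simp: D_def)
  qed
  have int: "(\<integral>x. f x \<partial>D M) = (\<integral>x. g x *\<^sub>R f (X x) \<partial>M)"
    if [measurable_cong]: "sets M = sets \<mu>" and [measurable]: "f \<in> borel_measurable borel"
    for M and f :: "real => 'b :: {banach, second_countable_topology}"
    unfolding D_def using g by (simp add: integral_distr integral_density)
  have "D \<mu> = D \<nu>"
  proof (rule finite_measure_eqI_char)
    fix t
    show "(\<integral>x. iexp (t * x) \<partial>D \<mu>) = (\<integral>x. iexp (t * x) \<partial>D \<nu>)"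
      using eq[of t] by (simp add: int sets scaleR_conv_of_real)
  qed (use fin assms in \<open>auto simp: D_def\<close>)
  then have "(\<integral>x. (indicator A x :: real) \<partial>D \<mu>) = (\<integral>x. indicator A x \<partial>D \<nu>)" by simp
  then show ?thesis by (subst (asm) (1 2) int) (auto simp: sets)
qed

text \<open>Uniqueness of multivariate characteristic functions: the coordinates are converted one at a time
  from exponentials to indicators with the one-dimensional uniqueness theorem.\<close>
lemma measure_eqI_char_PiM:
  fixes \<mu> \<nu> :: "('i => real) measure"
  assumes fin: "finite I" and "prob_space \<mu>" "prob_space \<nu>"
    and s1: "sets \<mu> = sets (PiM I (%_. borel))" and s2: "sets \<nu> = sets (PiM I (%_. borel))"
    and eq: "\<And>\<theta>. (\<integral>x. iexp (\<Sum>i\<in>I. \<theta> i * x i) \<partial>\<mu>) = (\<integral>x. iexp (\<Sum>i\<in>I. \<theta> i * x i) \<partial>\<nu>)"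
  shows "\<mu> = \<nu>"
proof -
  interpret \<mu>: prob_space \<mu> by fact
  interpret \<nu>: prob_space \<nu> by fact
  have s12: "sets \<nu> = sets \<mu>" using s1 s2 by simp
  note [measurable_cong] = s1 s2
  have claim: "(\<integral>x. complex_of_real (\<Prod>k\<in>K. indicator (A k) (x k)) * iexp (\<Sum>i\<in>I-K. \<theta> i * x i) \<partial>\<mu>)
     = (\<integral>x. complex_of_real (\<Prod>k\<in>K. indicator (A k) (x k)) * iexp (\<Sum>i\<in>I-K. \<theta> i * x i) \<partial>\<nu>)"
    if "finite K" "K \<subseteq> I" "\<And>k. k \<in> K ==> A k \<in> sets borel" for K and A :: "'i => real set" and \<theta>
    using that
  proof (induction K arbitrary: \<theta> rule: finite_induct)
    case empty
    then show ?case using eq by simp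
  next
    case (insert k K)
    define w where "w x = (\<Prod>k\<in>K. indicator (A k) (x k) :: real)" for x
    define c where "c x = (\<Sum>i\<in>I - insert k K. \<theta> i * x i)" for x
    have kI: "k \<in> I" and KI: "K \<subseteq> I" and Ak[measurable]: "A k \<in> sets borel" using insert.prems by auto
    have w01: "0 \<le> w x" "w x \<le> 1" for x
      unfolding w_def by (auto intro!: prod_nonneg prod_le_1 simp: indicator_def)
    have wm: "w \<in> borel_measurable (PiM I (%_. borel))" unfolding w_def
    proof (rule borel_measurable_prod)
      fix j assume "j \<in> K"
      then have [measurable]: "A j \<in> sets borel" "j \<in> I" using insert.prems by auto
      show "(%x. indicator (A j) (x j) :: real) \<in> borel_measurable (PiM I (%_. borel))" by measurable
    qed
    have cm: "c \<in> borel_measurable (PiM I (%_. borel))" unfolding c_def by measurable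
    have [measurable]: "w \<in> borel_measurable \<mu>" "c \<in> borel_measurable \<mu>" "(%x. x k) \<in> borel_measurable \<mu>"
      "w \<in> borel_measurable \<nu>" "c \<in> borel_measurable \<nu>" "(%x. x k) \<in> borel_measurable \<nu>"
      using wm cm kI by (auto simp: measurable_cong_sets[OF s1 refl] measurable_cong_sets[OF s2 refl])
    \<comment> \<open>The remaining frequencies are scaled by \<open>a\<close> because Euler's
      formula will express 1, cos c and sin c through the values a = 0, 1, -1.\<close>
    define J where "J M a s = (\<integral>x. complex_of_real (w x) * iexp (a * c x + s * x k) \<partial>M)" for M a s
    have J: "J \<mu> a s = J \<nu> a s" for a s
    proof -
      have "(\<Sum>i\<in>I - K. (if i = k then s else a * \<theta> i) * x i) = a * c x + s * x k" for x
      proof -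
        have "I - K = insert k (I - insert k K)" using kI insert.hyps by auto
        then have "(\<Sum>i\<in>I - K. (if i = k then s else a * \<theta> i) * x i)
            = (\<Sum>i\<in>insert k (I - insert k K). (if i = k then s else a * \<theta> i) * x i)"
          by (rule arg_cong)
        also have "... = s * x k + (\<Sum>i\<in>I - insert k K. (if i = k then s else a * \<theta> i) * x i)"
          using fin by (subst sum.insert) auto
        also have "(\<Sum>i\<in>I - insert k K. (if i = k then s else a * \<theta> i) * x i) = a * c x"
          unfolding c_def sum_distrib_left by (intro sum.cong) (auto simp: mult.assoc)
        finally show ?thesis by simp
      qed
      then show ?thesis
        using insert.IH[OF KI, of "%i. if i = k then s else a * \<theta> i"] insert.prems
        unfolding J_def w_def by auto
    qed
    have Ji: "integrable M (%x. complex_of_real (w x) * iexp (a * c x + s * x k))"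
      if "M = \<mu> \<or> M = \<nu>" for M a s
    proof -
      have "integrable M (%x. complex_of_real (w x) * iexp (a * c x + s * x k))"
        if [measurable]: "w \<in> borel_measurable M" "c \<in> borel_measurable M" "(%x. x k) \<in> borel_measurable M"
          and "prob_space M" for M
      proof -
        interpret prob_space M by fact
        show ?thesis
          by (rule integrable_const_bound[where B = 1]) (use w01 in \<open>auto simp: norm_mult\<close>)
      qed
      then show ?thesis using that \<open>prob_space \<mu>\<close> \<open>prob_space \<nu>\<close> by auto
    qed
    \<comment> \<open>Weights have to be nonnegative, so cos and sin of the remaining phase are
      shifted by 1; with 0 \<le> w \<le> 1 the shifted weights are at most 2. Subtracting the case
      of the plain weight recovers cos and sin afterwards.\<close>
    have W: "(\<integral>x. g x * indicator (A k) (x k) \<partial>\<mu>) = (\<integral>x. g x * indicator (A k) (x k) \<partial>\<nu>)"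
      if g: "g = w \<or> g = (%x. w x * (1 + cos (c x))) \<or> g = (%x. w x * (1 + sin (c x)))" for g :: "('i => real) => real"
    proof (rule integral_weight_indicator_eqI[where b = 2])
      show "g \<in> borel_measurable \<mu>" using g by auto
      have b: "w x * y \<le> 2" if "y \<le> 2" "0 \<le> y" for x y
        using mult_mono[of "w x" 1 y 2] w01[of x] that by simp
      have cs: "0 \<le> 1 + cos y" "0 \<le> 1 + sin y" for y :: real
        using cos_ge_minus_one[of y] sin_ge_minus_one[of y] by linarith+
      show "0 \<le> g x" "g x \<le> 2" for x
        using g w01[of x] cs[of "c x"]
        by (auto intro!: b mult_nonneg_nonneg)
      fix s
      have ie: "iexp (a * c x + s * x k) = exp (\<i> * complex_of_real a * c x) * iexp (s * x k)" for a x
        by (simp add: exp_add[symmetric] algebra_simps)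
      have e1: "complex_of_real (w x * (1 + cos (c x))) * iexp (s * x k)
          = complex_of_real (w x) * iexp (0 * c x + s * x k)
            + (1/2) * (complex_of_real (w x) * iexp (1 * c x + s * x k))
            + (1/2) * (complex_of_real (w x) * iexp ((-1) * c x + s * x k))" for x
        unfolding ie by (simp add: cos_of_real[symmetric] cos_exp_eq algebra_simps)
      have e2: "complex_of_real (w x * (1 + sin (c x))) * iexp (s * x k)
          = complex_of_real (w x) * iexp (0 * c x + s * x k)
            + (-\<i>/2) * (complex_of_real (w x) * iexp (1 * c x + s * x k))
            + (\<i>/2) * (complex_of_real (w x) * iexp ((-1) * c x + s * x k))" for x
        unfolding ie by (simp add: sin_of_real[symmetric] sin_exp_eq field_simps)
      have lin3: "(\<integral>x. F x + a * G x + b * H x \<partial>M) = (\<integral>x. F x \<partial>M) + a * (\<integral>x. G x \<partial>M) + b * (\<integral>x. H x \<partial>M)"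
        if "integrable M F" "integrable M G" "integrable M H" for F G H :: "('i => real) => complex" and a b M
        using that by simp
      have c1: "(\<integral>x. complex_of_real (w x * (1 + cos (c x))) * iexp (s * x k) \<partial>M) = J M 0 s + (1/2) * J M 1 s + (1/2) * J M (-1) s"
        if "M = \<mu> \<or> M = \<nu>" for M
        unfolding e1 J_def by (rule lin3; rule Ji[OF that])
      have c2: "(\<integral>x. complex_of_real (w x * (1 + sin (c x))) * iexp (s * x k) \<partial>M) = J M 0 s + (-\<i>/2) * J M 1 s + (\<i>/2) * J M (-1) s"
        if "M = \<mu> \<or> M = \<nu>" for M
        unfolding e2 J_def by (rule lin3; rule Ji[OF that])
      have c0: "(\<integral>x. complex_of_real (w x) * iexp (s * x k) \<partial>M) = J M 0 s" for M
        unfolding J_def by simp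
      show "(\<integral>x. complex_of_real (g x) * iexp (s * x k) \<partial>\<mu>) = (\<integral>x. complex_of_real (g x) * iexp (s * x k) \<partial>\<nu>)"
        using g
      proof (elim disjE)
        assume "g = w" then show ?thesis by (simp only: c0 J)
      next
        assume "g = (%x. w x * (1 + cos (c x)))"
        then show ?thesis by (simp only: c1 J simp_thms)
      next
        assume "g = (%x. w x * (1 + sin (c x)))"
        then show ?thesis by (simp only: c2 J simp_thms)
      qed
    qed (use \<open>prob_space \<mu>\<close> \<open>prob_space \<nu>\<close> s12 in auto)
    have iw: "integrable M (%x. w x * t (c x) * indicator (A k) (x k))"
      if "M = \<mu> \<or> M = \<nu>" "t \<in> borel_measurable borel" "\<And>y. \<bar>t y\<bar> \<le> 1" for M and t :: "real => real"
    proof -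
      have *: "integrable M (%x. w x * t (c x) * indicator (A k) (x k))"
        if [measurable]: "w \<in> borel_measurable M" "c \<in> borel_measurable M" "(%x. x k) \<in> borel_measurable M" "t \<in> borel_measurable borel"
          and "prob_space M" and t: "\<And>y. \<bar>t y\<bar> \<le> 1" for M
      proof -
        interpret prob_space M by fact
        have b: "\<bar>w x * t (c x) * indicator (A k) (x k)\<bar> \<le> 1" for x
        proof -
          have "\<bar>w x\<bar> * \<bar>t (c x)\<bar> * \<bar>indicator (A k) (x k)\<bar> \<le> 1 * 1 * 1"
            by (intro mult_mono t) (use w01[of x] in \<open>auto simp: indicator_def\<close>)
          then show ?thesis by (simp add: abs_mult)
        qed
        show ?thesis
          by (rule integrable_const_bound[where B = 1]) (use b in auto)
      qed
      show ?thesis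
        using that(1)
      proof
        assume M: "M = \<mu>"
        show ?thesis unfolding M by (rule *) (use that(2,3) \<open>prob_space \<mu>\<close> in auto)
      next
        assume M: "M = \<nu>"
        show ?thesis unfolding M by (rule *) (use that(2,3) \<open>prob_space \<nu>\<close> in auto)
      qed
    qed
    define T where "T t M = (\<integral>x. w x * t (c x) * indicator (A k) (x k) \<partial>M)" for t :: "real => real" and M
    have T1: "T (%_. 1) \<mu> = T (%_. 1) \<nu>" using W[of w] by (simp add: T_def)
    have T2: "T t \<mu> = T t \<nu>" if "t = cos \<or> t = sin" for t
    proof -
      have tm: "t \<in> borel_measurable borel" "\<And>y. \<bar>t y\<bar> \<le> 1" using that by auto
      have "(\<integral>x. w x * (1 + t (c x)) * indicator (A k) (x k) \<partial>M) = T (%_. 1) M + T t M" if M: "M = \<mu> \<or> M = \<nu>" for M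
      proof -
        have "(\<integral>x. w x * (1 + t (c x)) * indicator (A k) (x k) \<partial>M)
            = (\<integral>x. w x * 1 * indicator (A k) (x k) + w x * t (c x) * indicator (A k) (x k) \<partial>M)"
          by (intro Bochner_Integration.integral_cong) (auto simp: algebra_simps)
        also have "... = T (%_. 1) M + T t M"
          unfolding T_def using iw[OF M, of "%_. 1"] iw[OF M tm] by (intro Bochner_Integration.integral_add) auto
        finally show ?thesis .
      qed
      moreover have "(\<integral>x. w x * (1 + t (c x)) * indicator (A k) (x k) \<partial>\<mu>) = (\<integral>x. w x * (1 + t (c x)) * indicator (A k) (x k) \<partial>\<nu>)"
        using that by (intro W) auto
      ultimately show ?thesis using T1 by simp
    qed
    have fin: "(\<integral>x. complex_of_real (\<Prod>k\<in>insert k K. indicator (A k) (x k)) * iexp (\<Sum>i\<in>I-insert k K. \<theta> i * x i) \<partial>M)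
        = complex_of_real (T cos M) + \<i> * complex_of_real (T sin M)" if M: "M = \<mu> \<or> M = \<nu>" for M
    proof -
      have "complex_of_real (\<Prod>k\<in>insert k K. indicator (A k) (x k)) * iexp (\<Sum>i\<in>I-insert k K. \<theta> i * x i)
         = complex_of_real (w x * cos (c x) * indicator (A k) (x k)) + \<i> * complex_of_real (w x * sin (c x) * indicator (A k) (x k))" for x
        using insert.hyps unfolding c_def[symmetric] w_def[symmetric]
        by (simp add: w_def[symmetric] exp_Euler cos_of_real sin_of_real algebra_simps)
      then have "(\<integral>x. complex_of_real (\<Prod>k\<in>insert k K. indicator (A k) (x k)) * iexp (\<Sum>i\<in>I-insert k K. \<theta> i * x i) \<partial>M)
        = (\<integral>x. complex_of_real (w x * cos (c x) * indicator (A k) (x k)) + \<i> * complex_of_real (w x * sin (c x) * indicator (A k) (x k)) \<partial>M)"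
        by presburger
      also have "... = (\<integral>x. complex_of_real (w x * cos (c x) * indicator (A k) (x k)) \<partial>M) + (\<integral>x. \<i> * complex_of_real (w x * sin (c x) * indicator (A k) (x k)) \<partial>M)"
        using iw[OF M, of cos] iw[OF M, of sin]
        by (intro Bochner_Integration.integral_add integrable_mult_right integrable_of_real) auto
      also have "... = complex_of_real (T cos M) + \<i> * complex_of_real (T sin M)"
        unfolding T_def by (simp only: integral_mult_right_zero integral_complex_of_real)
      finally show ?thesis .
    qed
    show ?case using fin[of \<mu>] fin[of \<nu>] T2 by simp
  qed
  show ?thesis
  proof (rule measure_eqI_PiM_finite[OF fin s1 s2])
    fix A :: "'i => real set" assume A: "\<And>i. i \<in> I ==> A i \<in> sets borel"
    have pe: "PiE I A \<in> sets (PiM I (%_. borel))" using A fin by (intro sets_PiM_I_finite) auto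
    have box: "complex_of_real (measure M (PiE I A)) = (\<integral>x. complex_of_real (\<Prod>k\<in>I. indicator (A k) (x k)) * iexp (\<Sum>i\<in>I-I. 0 * x i) \<partial>M)"
      if sM: "sets M = sets (PiM I (%_. borel))" for M
    proof -
      have sp: "space M = space (PiM I (%_. borel))" using sM by (rule sets_eq_imp_space_eq)
      have "(\<integral>x. complex_of_real (\<Prod>k\<in>I. indicator (A k) (x k)) * iexp (\<Sum>i\<in>I-I. 0 * x i) \<partial>M)
          = (\<integral>x. complex_of_real (indicator (PiE I A) x) \<partial>M)"
      proof (intro Bochner_Integration.integral_cong refl)
        fix x assume "x \<in> space M"
        then have ex: "x \<in> extensional I" by (auto simp: sp space_PiM PiE_def)
        have "(\<Prod>k\<in>I. indicator (A k) (x k) :: real) = indicator (PiE I A) x"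
        proof (cases "x \<in> PiE I A")
          case True then show ?thesis by (auto simp: PiE_def Pi_def intro!: prod.neutral)
        next
          case False
          then obtain k where k: "k \<in> I" "x k \<notin> A k" using ex by (auto simp: PiE_def)
          have "(\<Prod>k\<in>I. indicator (A k) (x k) :: real) = 0"
            using k by (intro prod_zero[OF fin] bexI[of _ k]) auto
          then show ?thesis using False by simp
        qed
        then show "complex_of_real (\<Prod>k\<in>I. indicator (A k) (x k)) * iexp (\<Sum>i\<in>I-I. 0 * x i) = complex_of_real (indicator (PiE I A) x)"
          by simp
      qed
      also have "... = complex_of_real (\<integral>x. indicator (PiE I A) x \<partial>M)" by (rule integral_complex_of_real)
      also have "(\<integral>x. indicator (PiE I A) x \<partial>M) = measure M (PiE I A)"
        using pe sM sets.sets_into_space[of "PiE I A" M] by (simp add: Int_absorb2)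
      finally show ?thesis by simp
    qed
    have "measure \<mu> (PiE I A) = measure \<nu> (PiE I A)"
    proof -
      have "(\<integral>x. complex_of_real (\<Prod>k\<in>I. indicator (A k) (x k)) * iexp (\<Sum>i\<in>I-I. (%_. 0) i * x i) \<partial>\<mu>)
         = (\<integral>x. complex_of_real (\<Prod>k\<in>I. indicator (A k) (x k)) * iexp (\<Sum>i\<in>I-I. (%_. 0) i * x i) \<partial>\<nu>)"
        by (rule claim[OF fin order_refl]) (rule A)
      then have "complex_of_real (measure \<mu> (PiE I A)) = complex_of_real (measure \<nu> (PiE I A))"
        unfolding box[OF s1] box[OF s2] by simp
      then show ?thesis by simp
    qed
    then show "emeasure \<mu> (PiE I A) = emeasure \<nu> (PiE I A)"
      by (simp add: \<mu>.emeasure_eq_measure \<nu>.emeasure_eq_measure)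
  next
    show "range (%_::nat. space (PiM I (%_. borel))) \<subseteq> prod_algebra I (%_. borel)"
      using prod_algebraI_finite[OF fin, of "%_. UNIV" "%_. borel"] by (auto simp: space_PiM)
    show "(\<Union>i::nat. space (PiM I (%_. borel))) = space (PiM I (%_. borel))" by auto
    show "\<And>i::nat. emeasure \<mu> (space (PiM I (%_. borel))) \<noteq> \<infinity>" by auto
  qed
qed

subsection \<open>Vectors and quadratic forms\<close>

lemma vnorm_L2: "vnorm n x = L2_set x {..<n}"
  by (simp add: vnorm_def L2_set_def)

lemma vnorm_nonneg[simp]: "0 \<le> vnorm n x" by (simp add: vnorm_L2)

lemma vnorm_sq: "(vnorm n x)\<^sup>2 = (\<Sum>i<n. (x i)\<^sup>2)"
  by (simp add: vnorm_def sum_nonneg)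

lemma vinner_self: "vinner n x x = (vnorm n x)\<^sup>2"
  unfolding vnorm_sq vinner_def by (simp add: power2_eq_square)

lemma vnorm_triangle: "vnorm n (%i. x i + y i) \<le> vnorm n x + vnorm n y"
  by (simp add: vnorm_L2 L2_set_triangle_ineq)

lemma vnorm_uminus[simp]: "vnorm n (%i. - x i) = vnorm n x"
  by (simp add: vnorm_def)

lemma vnorm_diff: "vnorm n (%i. x i - y i) \<le> vnorm n x + vnorm n y"
  using vnorm_triangle[of n x "%i. - y i"] by simp

lemma vnorm_minus_commute: "vnorm n (%i. x i - y i) = vnorm n (%i. y i - x i)"
  by (simp add: vnorm_def power2_commute)

lemma vnorm_scale: "vnorm n (%i. c * x i) = \<bar>c\<bar> * vnorm n x"
  by (simp add: vnorm_def power_mult_distrib sum_distrib_left[symmetric] real_sqrt_mult)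

lemma vnorm_cong: "(\<And>i. i < n ==> x i = y i) ==> vnorm n x = vnorm n y"
  by (simp add: vnorm_def)

lemma vinner_cong: "(\<And>i. i < n ==> x i = x' i) ==> (\<And>i. i < n ==> y i = y' i) ==> vinner n x y = vinner n x' y'"
  by (simp add: vinner_def)

lemma vnorm_zero_iff: "vnorm n x = 0 \<longleftrightarrow> (\<forall>i<n. x i = 0)"
  by (simp add: vnorm_L2 L2_set_eq_0_iff Ball_def lessThan_def)

lemma vinner_commute: "vinner n x y = vinner n y x"
  by (simp add: vinner_def mult.commute)

lemma vinner_CS: "\<bar>vinner n x y\<bar> \<le> vnorm n x * vnorm n y"
proof -
  have "\<bar>vinner n x y\<bar> \<le> (\<Sum>i<n. \<bar>x i\<bar> * \<bar>y i\<bar>)"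
    unfolding vinner_def using sum_abs[of "%i. x i * y i" "{..<n}"] by (simp add: abs_mult)
  also have "... \<le> vnorm n x * vnorm n y" unfolding vnorm_L2 by (rule L2_set_mult_ineq)
  finally show ?thesis .
qed

lemma vinner_add_left: "vinner n (%i. x i + y i) z = vinner n x z + vinner n y z"
  and vinner_diff_left: "vinner n (%i. x i - y i) z = vinner n x z - vinner n y z"
  and vinner_add_right: "vinner n z (%i. x i + y i) = vinner n z x + vinner n z y"
  and vinner_diff_right: "vinner n z (%i. x i - y i) = vinner n z x - vinner n z y"
  and vinner_scale_left: "vinner n (%i. c * x i) z = c * vinner n x z"
  and vinner_scale_right: "vinner n z (%i. c * x i) = c * vinner n z x"
  by (simp_all add: vinner_def algebra_simps sum.distrib sum_subtractf sum_distrib_left)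

lemma vinner_sum_right: "vinner n z (%i. \<Sum>s\<in>S. c s * Q s i) = (\<Sum>s\<in>S. c s * vinner n z (Q s))"
  unfolding vinner_def sum_distrib_left by (subst sum.swap) (simp add: mult_ac)

lemma vinner_sum_left: "vinner n (%i. \<Sum>s\<in>S. c s * Q s i) z = (\<Sum>s\<in>S. c s * vinner n (Q s) z)"
  unfolding vinner_commute[of n _ z] by (rule vinner_sum_right)

lemmas vinner_linear = vinner_add_left vinner_diff_left vinner_add_right vinner_diff_right
  vinner_scale_left vinner_scale_right vinner_sum_left vinner_sum_right

lemma vnorm_add_sq: "(vnorm n (%i. x i + y i))\<^sup>2 = (vnorm n x)\<^sup>2 + 2 * vinner n x y + (vnorm n y)\<^sup>2"
  unfolding vinner_self[symmetric] by (simp add: vinner_linear vinner_commute[of n y x])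

lemma vnorm_diff_sq: "(vnorm n (%i. x i - y i))\<^sup>2 = (vnorm n x)\<^sup>2 - 2 * vinner n x y + (vnorm n y)\<^sup>2"
  unfolding vinner_self[symmetric] by (simp add: vinner_linear vinner_commute[of n y x])

text \<open>The matrix with columns Q 0, ..., Q (k-1) applied to x. The first index of
  \<open>vecs\<close> counts columns here, in contrast to \<open>mv\<close>.\<close>

definition lc :: "nat => vecs => vec => vec" where
  "lc k Q x = (%i. \<Sum>s<k. x s * Q s i)"

lemma lc_add: "lc k Q (%s. x s + y s) = (%i. lc k Q x i + lc k Q y i)"
  and lc_diff: "lc k Q (%s. x s - y s) = (%i. lc k Q x i - lc k Q y i)"
  and lc_scale: "lc k Q (%s. c * x s) = (%i. c * lc k Q x i)"
  by (auto simp: lc_def algebra_simps sum.distrib sum_subtractf sum_distrib_left)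

lemma vnorm_lc_le: "vnorm n (lc k Q x) \<le> vnorm k x * sqrt (\<Sum>s<k. \<Sum>i<n. (Q s i)\<^sup>2)"
proof (rule power2_le_imp_le)
  have "(vnorm n (lc k Q x))\<^sup>2 = (\<Sum>i<n. (vinner k x (%s. Q s i))\<^sup>2)"
    by (simp add: vnorm_sq lc_def vinner_def)
  also have "... \<le> (\<Sum>i<n. (vnorm k x)\<^sup>2 * (vnorm k (%s. Q s i))\<^sup>2)"
    unfolding power_mult_distrib[symmetric]
    by (intro sum_mono) (metis vinner_CS abs_ge_zero power2_abs power_mono)
  also have "... = (vnorm k x)\<^sup>2 * (\<Sum>i<n. \<Sum>s<k. (Q s i)\<^sup>2)"
    by (simp add: sum_distrib_left vnorm_sq)
  also have "(\<Sum>i<n. \<Sum>s<k. (Q s i)\<^sup>2) = (\<Sum>s<k. \<Sum>i<n. (Q s i)\<^sup>2)" by (rule sum.swap)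
  finally show "(vnorm n (lc k Q x))\<^sup>2 \<le> (vnorm k x * sqrt (\<Sum>s<k. \<Sum>i<n. (Q s i)\<^sup>2))\<^sup>2"
    by (simp add: power_mult_distrib sum_nonneg)
qed (simp add: sum_nonneg)

definition orth :: "nat => nat => vecs => bool" where
  "orth n k Q \<longleftrightarrow> (\<forall>s<k. \<forall>t<k. vinner n (Q s) (Q t) = (if s = t then real n else 0))"

lemma orthD: "orth n k Q ==> s < k ==> t < k ==> vinner n (Q s) (Q t) = (if s = t then real n else 0)"
  by (simp add: orth_def)

lemma vinner_orth_lc: "orth n k Q ==> s < k ==> vinner n (Q s) (lc k Q x) = real n * x s"
  unfolding lc_def vinner_sum_right by (simp add: orthD if_distrib sum.delta cong: if_cong)

lemma vnorm_orth_lc: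
  assumes "orth n k Q" shows "vnorm n (lc k Q x) = sqrt (real n) * vnorm k x"
proof -
  have "vinner n (lc k Q x) (lc k Q x) = (\<Sum>s<k. x s * vinner n (Q s) (lc k Q x))"
    by (subst (1) lc_def) (rule vinner_sum_left)
  also have "... = (\<Sum>s<k. real n * (x s)\<^sup>2)"
    using assms by (intro sum.cong) (auto simp: vinner_orth_lc power2_eq_square)
  finally have "(vnorm n (lc k Q x))\<^sup>2 = (sqrt (real n) * vnorm k x)\<^sup>2"
    by (simp add: vinner_self power_mult_distrib vnorm_sq sum_distrib_left)
  then show ?thesis by (simp add: power2_eq_iff_nonneg)
qed

definition resid :: "nat => vecs => nat => vec => vec" where
  "resid n Q t u = (%i. u i - (\<Sum>s<t. (vinner n (Q s) u / real n) * Q s i))"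

lemma vinner_resid:
  assumes "orth n t Q" "0 < n" "s < t" shows "vinner n (Q s) (resid n Q t u) = 0"
proof -
  have "resid n Q t u = (%i. u i - lc t Q (%s. vinner n (Q s) u / real n) i)"
    by (simp add: resid_def lc_def)
  then show ?thesis using assms by (simp add: vinner_diff_right vinner_orth_lc)
qed

text \<open>Orthogonality forces the coefficients of a combination. Besides serving Gram-Schmidt,
  this rewrites membership in the span as the vanishing of a norm, and thus as a measurable
  event.\<close>

lemma in_span_iff_resid:
  assumes "orth n t Q" "0 < n"
  shows "in_span n Q t u \<longleftrightarrow> vnorm n (resid n Q t u) = 0"
proof
  assume "in_span n Q t u"
  then obtain c where c: "\<And>i. i < n ==> u i = lc t Q c i" by (auto simp: in_span_def lc_def)
  have "vinner n (Q s) u = real n * c s" if "s < t" for s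
    using vinner_orth_lc[OF assms(1) that, of c] vinner_cong[of n "Q s" "Q s" u "lc t Q c"] c by simp
  then show "vnorm n (resid n Q t u) = 0"
    unfolding vnorm_zero_iff using c assms by (simp add: resid_def lc_def)
next
  assume "vnorm n (resid n Q t u) = 0"
  then show "in_span n Q t u"
    unfolding vnorm_zero_iff in_span_def
    by (intro exI[of _ "%s. vinner n (Q s) u / real n"]) (simp add: resid_def)
qed

lemma orth_extend:
  assumes o: "orth n t Q" and n: "0 < n" and u: "\<not> in_span n Q t u"
  shows "orth n (Suc t) (Q(t := (%i. sqrt (real n) / vnorm n (resid n Q t u) * resid n Q t u i)))"
proof -
  let ?r = "resid n Q t u" and ?q = "%i. sqrt (real n) / vnorm n (resid n Q t u) * resid n Q t u i"
  have r: "vnorm n ?r > 0" using u in_span_iff_resid[OF o n] by (simp add: less_le)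
  have "vinner n ?q ?q = (sqrt (real n) / vnorm n ?r)\<^sup>2 * (vnorm n ?r)\<^sup>2"
    unfolding vinner_scale_left vinner_scale_right vinner_self
    by (simp only: power2_eq_square mult.assoc)
  then have qq: "vinner n ?q ?q = real n" using r by (simp add: power_divide)
  have "vinner n (Q s) ?q = 0" if "s < t" for s
    unfolding vinner_scale_right vinner_resid[OF o n that] by simp
  moreover from this have "vinner n ?q (Q s) = 0" if "s < t" for s using that by (metis vinner_commute)
  ultimately show ?thesis using o qq unfolding orth_def by (auto simp: less_Suc_eq)
qed

text \<open>Gaussian elimination: a pivot j0 removes one equation and one unknown. This is the
  source of every dimension count below: a basis vector outside the span, finiteness of the
  spectrum, nonzero pivots of a Cholesky factor.\<close>

lemma homogeneous_system_solution:
  fixes a :: "'s => 'j => real"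
  assumes "finite S" "finite J" "card S < card J"
  shows "\<exists>c. (\<exists>j\<in>J. c j \<noteq> 0) \<and> (\<forall>s\<in>S. (\<Sum>j\<in>J. a s j * c j) = 0)"
  using assms
proof (induction S arbitrary: J a rule: finite_induct)
  case empty
  then have "J \<noteq> {}" by auto
  then show ?case by (intro exI[of _ "%_. 1"]) auto
next
  case (insert s0 S)
  show ?case
  proof (cases "\<forall>j\<in>J. a s0 j = 0")
    case True
    from insert have "card S < card J" by simp
    from insert.IH[OF insert.prems(1) this] True show ?thesis by auto
  next
    case False
    then obtain j0 where j0: "j0 \<in> J" "a s0 j0 \<noteq> 0" by auto
    have "card S < card (J - {j0})" using insert j0 by simp
    from insert.IH[OF _ this, of "%s j. a s j - a s j0 * a s0 j / a s0 j0"] insert.prems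
    obtain c where c: "\<exists>j\<in>J - {j0}. c j \<noteq> 0"
      "\<And>s. s \<in> S ==> (\<Sum>j\<in>J - {j0}. (a s j - a s j0 * a s0 j / a s0 j0) * c j) = 0" by auto
    define d where "d = c(j0 := - (\<Sum>j\<in>J - {j0}. a s0 j * c j) / a s0 j0)"
    have sp: "(\<Sum>j\<in>J. a s j * d j) = a s j0 * d j0 + (\<Sum>j\<in>J - {j0}. a s j * c j)" for s
      using insert.prems(1) j0(1) by (subst sum.remove[of _ j0]) (auto simp: d_def intro!: sum.cong)
    have "(\<Sum>j\<in>J. a s0 j * d j) = 0" unfolding sp using j0 by (simp add: d_def)
    moreover have "(\<Sum>j\<in>J. a s j * d j) = 0" if "s \<in> S" for s
    proof -
      have "(\<Sum>j\<in>J - {j0}. (a s j - a s j0 * a s0 j / a s0 j0) * c j)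
        = (\<Sum>j\<in>J - {j0}. a s j * c j) - (a s j0 / a s0 j0) * (\<Sum>j\<in>J - {j0}. a s0 j * c j)"
        unfolding sum_distrib_left sum_subtractf[symmetric] by (intro sum.cong) (auto simp: field_simps)
      then show ?thesis unfolding sp using c(2)[OF that] by (simp add: d_def)
    qed
    moreover have "\<exists>j\<in>J. d j \<noteq> 0" using c(1) by (auto simp: d_def)
    ultimately show ?thesis by auto
  qed
qed

lemma basis_not_in_span:
  assumes b: "is_basis n v" and t: "t < n"
  shows "\<exists>j<n. \<not> in_span n Q t (v j)"
proof (rule ccontr)
  assume "\<not> ?thesis"
  then have "\<forall>j. \<exists>c. j < n \<longrightarrow> (\<forall>i<n. v j i = (\<Sum>s<t. c s * Q s i))" by (auto simp: in_span_def)
  then obtain a where a: "\<And>j i. j < n ==> i < n ==> v j i = (\<Sum>s<t. a j s * Q s i)" by metis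
  obtain c where c: "\<exists>j<n. c j \<noteq> 0" "\<And>s. s < t ==> (\<Sum>j<n. a j s * c j) = 0"
    using homogeneous_system_solution[of "{..<t}" "{..<n}" "%s j. a j s"] t by auto
  have "(\<Sum>j<n. c j * v j i) = 0" if "i < n" for i
  proof -
    have "(\<Sum>j<n. c j * v j i) = (\<Sum>j<n. \<Sum>s<t. c j * (a j s * Q s i))"
      using that by (intro sum.cong) (auto simp: a sum_distrib_left)
    also have "... = (\<Sum>s<t. \<Sum>j<n. c j * (a j s * Q s i))" by (rule sum.swap)
    also have "... = (\<Sum>s<t. Q s i * (\<Sum>j<n. a j s * c j))"
      by (simp add: sum_distrib_left mult_ac)
    finally show ?thesis using c by simp
  qed
  then have "\<forall>j<n. c j = 0" using b unfolding is_basis_def by blast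
  with c(1) show False by auto
qed

definition bf :: "nat => vecs => vec => vec => real" where
  "bf k M x y = (\<Sum>i<k. \<Sum>j<k. x i * M i j * y j)"

text \<open>Spectral norm at most c, phrased through the bilinear form: sums and blocks are then
  immediate and no supremum has to be handled.\<close>

definition bbd :: "nat => vecs => real => bool" where
  "bbd k M c \<longleftrightarrow> (\<forall>x y. \<bar>bf k M x y\<bar> \<le> c * vnorm k x * vnorm k y)"

lemma bf_add_left: "bf k M (%i. x i + x' i) y = bf k M x y + bf k M x' y"
  and bf_diff_left: "bf k M (%i. x i - x' i) y = bf k M x y - bf k M x' y"
  and bf_add_right: "bf k M x (%i. y i + y' i) = bf k M x y + bf k M x y'"
  and bf_diff_right: "bf k M x (%i. y i - y' i) = bf k M x y - bf k M x y'"
  and bf_scale_left: "bf k M (%i. c * x i) y = c * bf k M x y"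
  and bf_scale_right: "bf k M x (%i. c * y i) = c * bf k M x y"
  by (simp_all add: bf_def algebra_simps sum.distrib sum_subtractf sum_distrib_left)

lemmas bf_linear = bf_add_left bf_diff_left bf_add_right bf_diff_right bf_scale_left bf_scale_right

lemma bf_cong: "(\<And>i. i < k ==> x i = x' i) ==> (\<And>i. i < k ==> y i = y' i) ==>
    (\<And>i j. i < k ==> j < k ==> M i j = M' i j) ==> bf k M x y = bf k M' x' y'"
  by (simp add: bf_def)

lemma bf_vinner_right: "bf k M x y = vinner k x (%i. \<Sum>j<k. M i j * y j)"
  by (simp add: bf_def vinner_def sum_distrib_left mult.assoc)

lemma bf_sym:
  assumes "\<And>i j. i < k ==> j < k ==> M i j = M j i" shows "bf k M x y = bf k M y x"
proof -
  have "bf k M x y = (\<Sum>j<k. \<Sum>i<k. x i * M i j * y j)" unfolding bf_def by (rule sum.swap)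
  also have "... = bf k M y x" unfolding bf_def using assms by (intro sum.cong) (auto simp: mult_ac)
  finally show ?thesis .
qed

lemma bf_trans: "bf k (%i j. M j i) x y = bf k M y x"
  unfolding bf_def by (subst sum.swap) (simp add: mult_ac)

lemma bbdD: "bbd k M c ==> \<bar>bf k M x y\<bar> \<le> c * vnorm k x * vnorm k y" by (simp add: bbd_def)

lemma bbd_mono: "bbd k M c ==> c \<le> d ==> bbd k M d"
  unfolding bbd_def by (meson mult_right_mono order_trans vnorm_nonneg)

lemma bbd_add: "bbd k M c ==> bbd k N d ==> bbd k (%i j. M i j + N i j) (c + d)"
proof (unfold bbd_def, intro allI)
  fix x y assume a: "\<forall>x y. \<bar>bf k M x y\<bar> \<le> c * vnorm k x * vnorm k y" "\<forall>x y. \<bar>bf k N x y\<bar> \<le> d * vnorm k x * vnorm k y"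
  have "bf k (%i j. M i j + N i j) x y = bf k M x y + bf k N x y"
    by (simp add: bf_def algebra_simps sum.distrib)
  then show "\<bar>bf k (%i j. M i j + N i j) x y\<bar> \<le> (c + d) * vnorm k x * vnorm k y"
    using a[rule_format, of x y] by (simp add: algebra_simps)
qed

lemma bbd_mv:
  assumes "bbd k M c" "0 \<le> c" shows "vnorm k (%i. \<Sum>j<k. M i j * y j) \<le> c * vnorm k y"
proof -
  let ?z = "%i. \<Sum>j<k. M i j * y j"
  have "(vnorm k ?z)\<^sup>2 = bf k M ?z y" by (simp add: bf_vinner_right vinner_self)
  also have "... \<le> c * vnorm k ?z * vnorm k y" using bbdD[OF assms(1), of ?z y] by linarith
  finally have "vnorm k ?z * vnorm k ?z \<le> (c * vnorm k y) * vnorm k ?z"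
    by (simp add: power2_eq_square mult_ac)
  then show ?thesis using assms(2) by (cases "vnorm k ?z = 0") (auto simp: mult_le_cancel_right less_le)
qed

lemma bbdI_mv:
  assumes "\<And>y. vnorm k (%i. \<Sum>j<k. M i j * y j) \<le> c * vnorm k y" shows "bbd k M c"
  unfolding bbd_def
proof (intro allI)
  fix x y
  have "\<bar>bf k M x y\<bar> \<le> vnorm k x * vnorm k (%i. \<Sum>j<k. M i j * y j)"
    unfolding bf_vinner_right by (rule vinner_CS)
  also have "... \<le> vnorm k x * (c * vnorm k y)" by (intro mult_left_mono assms) simp
  finally show "\<bar>bf k M x y\<bar> \<le> c * vnorm k x * vnorm k y" by (simp add: mult_ac)
qed

text \<open>Polarisation, after rescaling both arguments to the common norm |x| |y|, so that the
  parallelogram law loses nothing.\<close>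

lemma bbd_sym_qf:
  assumes sym: "\<And>i j. i < k ==> j < k ==> M i j = M j i"
    and q: "\<And>x. \<bar>bf k M x x\<bar> \<le> c * (vnorm k x)\<^sup>2"
  shows "bbd k M c"
  unfolding bbd_def
proof (intro allI)
  fix x y
  define a b where "a = vnorm k x" and "b = vnorm k y"
  show "\<bar>bf k M x y\<bar> \<le> c * vnorm k x * vnorm k y"
  proof (cases "a = 0 \<or> b = 0")
    case True
    then have "bf k M x y = 0" unfolding a_def b_def vnorm_zero_iff bf_def by auto
    then show ?thesis using True by (auto simp: a_def b_def)
  next
    case False
    then have pos: "a > 0" "b > 0" by (auto simp: a_def b_def less_le)
    let ?x = "%i. b * x i" and ?y = "%i. a * y i"
    have e4: "4 * (a * b * bf k M x y) = bf k M (%i. ?x i + ?y i) (%i. ?x i + ?y i) - bf k M (%i. ?x i - ?y i) (%i. ?x i - ?y i)"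
    proof -
      have s: "bf k M y x = bf k M x y" by (rule bf_sym) (rule sym)
      show ?thesis
        unfolding bf_add_left bf_diff_left bf_add_right bf_diff_right
        unfolding bf_scale_left bf_scale_right s
        by (simp add: algebra_simps)
    qed
    have "4 * (a * b * \<bar>bf k M x y\<bar>) \<le> \<bar>bf k M (%i. ?x i + ?y i) (%i. ?x i + ?y i)\<bar> + \<bar>bf k M (%i. ?x i - ?y i) (%i. ?x i - ?y i)\<bar>"
    proof -
      have "\<bar>4 * (a * b * bf k M x y)\<bar> = 4 * (a * b * \<bar>bf k M x y\<bar>)" using pos by (simp add: abs_mult)
      then show ?thesis using e4 by linarith
    qed
    also have "... \<le> c * (vnorm k (%i. ?x i + ?y i))\<^sup>2 + c * (vnorm k (%i. ?x i - ?y i))\<^sup>2"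
      by (intro add_mono q)
    also have "... = 2 * c * ((vnorm k ?x)\<^sup>2 + (vnorm k ?y)\<^sup>2)"
      unfolding vnorm_add_sq vnorm_diff_sq by (simp add: algebra_simps)
    also have "... = 4 * (a * b * (c * a * b))"
      unfolding vnorm_scale a_def[symmetric] b_def[symmetric] using pos by (simp add: power2_eq_square)
    finally have "a * b * \<bar>bf k M x y\<bar> \<le> a * b * (c * a * b)" by simp
    then show ?thesis using pos by (simp add: a_def b_def mult_le_cancel_left_pos)
  qed
qed

lemma continuous_on_coord: "continuous_on S (%x. x (i::nat) :: real)"
  by (rule continuous_on_subset[OF continuous_on_product_coordinates]) simp

lemma bf_maximiser:
  assumes k: "1 \<le> k"
  shows "\<exists>x. vnorm k x = 1 \<and> (\<forall>y. bf k M y y \<le> bf k M x x * (vnorm k y)\<^sup>2)"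
proof -
  \<comment> \<open>Vectors are functions on all naturals, so the unit sphere is compact only after
    the coordinates from \<open>k\<close> on are frozen at 0. The others lie in [-1,1], and the box
    is compact by Tychonoff.\<close>
  define C where "C = PiE (UNIV::nat set) (%i. if i < k then {-1..1::real} else {0})"
  define S where "S = C \<inter> {x. (\<Sum>i<k. (x i)\<^sup>2) = 1}"
  have "compactin (product_topology (%_. euclideanreal) UNIV) C"
    unfolding C_def by (subst compactin_PiE) auto
  then have "compact C" by (simp add: euclidean_product_topology)
  moreover have "closed {x::nat => real. (\<Sum>i<k. (x i)\<^sup>2) = 1}"
    by (intro closed_Collect_eq continuous_intros continuous_on_coord)
  ultimately have S: "compact S" unfolding S_def by (rule compact_Int_closed)
  have "(%i. if i = 0 then 1 else 0) \<in> S"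
    using k unfolding S_def C_def by (auto simp: if_distrib[of "%x. x\<^sup>2"] sum.delta cong: if_cong)
  then have "S \<noteq> {}" by auto
  moreover have "continuous_on S (%x. bf k M x x)"
    unfolding bf_def by (intro continuous_intros continuous_on_coord)
  ultimately obtain x where x: "x \<in> S" "\<And>y. y \<in> S ==> bf k M y y \<le> bf k M x x"
    using continuous_attains_sup[OF S] by blast
  have "vnorm k x = 1" using x(1) by (simp add: S_def vnorm_def)
  moreover have "bf k M y y \<le> bf k M x x * (vnorm k y)\<^sup>2" for y
  proof (cases "vnorm k y = 0")
    case True
    then have "bf k M y y = 0" unfolding vnorm_zero_iff bf_def by auto
    then show ?thesis using True by simp
  next
    case False
    then have p: "vnorm k y > 0" by (simp add: less_le)
    define z where "z i = (if i < k then 1 / vnorm k y * y i else 0)" for i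
    have zs: "(\<Sum>i<k. (z i)\<^sup>2) = 1"
    proof -
      have "(\<Sum>i<k. (z i)\<^sup>2) = (1 / vnorm k y)\<^sup>2 * (vnorm k y)\<^sup>2"
        by (simp add: z_def vnorm_sq sum_distrib_left power_divide)
      then show ?thesis using p by (simp add: power_divide)
    qed
    have "\<bar>z i\<bar> \<le> 1" if "i < k" for i
    proof -
      have "(z i)\<^sup>2 \<le> (\<Sum>i<k. (z i)\<^sup>2)" using that by (intro member_le_sum) auto
      then show ?thesis using zs by (simp add: abs_square_le_1)
    qed
    then have "-1 \<le> z i \<and> z i \<le> 1" if "i < k" for i using that by (auto simp: abs_le_iff)
    moreover have "z i = 0" if "\<not> i < k" for i using that by (simp add: z_def)
    ultimately have "z \<in> S" using zs unfolding S_def C_def by auto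
    then have "bf k M z z \<le> bf k M x x" by (rule x(2))
    moreover have "bf k M z z = (1 / vnorm k y)\<^sup>2 * bf k M y y"
    proof -
      have "bf k M z z = bf k M (%i. 1 / vnorm k y * y i) (%i. 1 / vnorm k y * y i)"
        by (intro bf_cong) (auto simp: z_def)
      then show ?thesis by (simp only: bf_linear power2_eq_square mult.assoc)
    qed
    ultimately show ?thesis using p by (simp add: power_divide field_simps)
  qed
  ultimately show ?thesis by blast
qed

text \<open>First variation of the Rayleigh quotient: moving from x by e w gives 2 e a \<le> e^2 b
  for every e, where a is the defect of the claimed identity. A small e of the sign of a forces a =
  0.\<close>

lemma bf_maximiser_first_order:
  assumes sym: "\<And>i j. i < k ==> j < k ==> M i j = M j i"
    and x: "vnorm k x = 1" and max: "\<And>y. bf k M y y \<le> bf k M x x * (vnorm k y)\<^sup>2"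
  shows "bf k M x w = bf k M x x * vinner k x w"
proof -
  let ?\<mu> = "bf k M x x"
  define a where "a = bf k M x w - ?\<mu> * vinner k x w"
  define b where "b = ?\<mu> * (vnorm k w)\<^sup>2 - bf k M w w"
  have *: "2 * e * a \<le> e\<^sup>2 * b" for e
  proof -
    have "bf k M (%i. x i + e * w i) (%i. x i + e * w i) \<le> ?\<mu> * (vnorm k (%i. x i + e * w i))\<^sup>2" by (rule max)
    then show ?thesis
      unfolding vnorm_add_sq vnorm_scale power_mult_distrib power2_abs vinner_scale_right x
      by (simp add: bf_linear bf_sym[where x = w and y = x, OF sym] a_def b_def algebra_simps power2_eq_square)
  qed
  define c where "c = \<bar>b\<bar> + 1"
  have c: "c > 0" "b < c" by (auto simp: c_def)
  have "2 * (a / c) * a \<le> (a / c)\<^sup>2 * b" by (rule *)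
  then have "2 * a\<^sup>2 * c \<le> a\<^sup>2 * b" using c by (simp add: power2_eq_square field_simps)
  also have "... \<le> a\<^sup>2 * c" using c by (intro mult_left_mono) auto
  finally have "a\<^sup>2 * c \<le> 0" by linarith
  then have "a = 0" using c by (simp add: mult_le_0_iff)
  then show ?thesis by (simp add: a_def)
qed

text \<open>Around a maximiser of the modulus of a quadratic form, the form loses only a factor of
  the cosine of twice the angle.\<close>
lemma qf_large_near_maximiser:
  assumes sym: "\<And>i j. i < k ==> j < k ==> M i j = M j i"
    and t: "0 < t" and big: "\<exists>y. \<bar>bf k M y y\<bar> > t * (vnorm k y)\<^sup>2"
  shows "\<exists>x. vnorm k x = 1 \<and> (\<forall>z. vnorm k (%i. z i - x i) \<le> 1/4 \<longrightarrow> 7/8 * t * (vnorm k z)\<^sup>2 \<le> \<bar>bf k M z z\<bar>)"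
proof -
  have k: "1 \<le> k"
  proof (rule ccontr)
    assume "\<not> 1 \<le> k" then have "k = 0" by simp
    then show False using big by (simp add: bf_def vnorm_def)
  qed
  have neg: "bf k (%i j. - M i j) y z = - bf k M y z" for y z by (simp add: bf_def sum_negf)
  \<comment> \<open>\<open>N\<close> stands for whichever of \<open>M\<close> and \<open>- M\<close>
    has the larger maximum; that maximum then bounds the modulus of the form in every
    direction.\<close>
  have wlog: "\<exists>x. vnorm k x = 1 \<and> (\<forall>z. vnorm k (%i. z i - x i) \<le> 1/4 \<longrightarrow> 7/8 * t * (vnorm k z)\<^sup>2 \<le> \<bar>bf k N z z\<bar>)"
    if symN: "\<And>i j. i < k ==> j < k ==> N i j = N j i"
      and x: "vnorm k x = 1" and max: "\<And>y. bf k N y y \<le> bf k N x x * (vnorm k y)\<^sup>2"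
      and min: "\<And>y. - bf k N y y \<le> bf k N x x * (vnorm k y)\<^sup>2"
      and bigN: "\<exists>y. \<bar>bf k N y y\<bar> > t * (vnorm k y)\<^sup>2" for N x
  proof (intro exI[of _ x] conjI allI impI x)
    fix z assume z: "vnorm k (%i. z i - x i) \<le> 1/4"
    define mu where "mu = bf k N x x"
    obtain y where "t * (vnorm k y)\<^sup>2 < \<bar>bf k N y y\<bar>" using bigN by blast
    also have "... \<le> mu * (vnorm k y)\<^sup>2" using max[of y] min[of y] by (auto simp: mu_def)
    finally have mu: "t < mu" by (simp add: mult_less_cancel_right)
    define a where "a = vinner k x z"
    define w where "w i = z i - a * x i" for i
    have zw: "z = (%i. a * x i + w i)" by (auto simp: w_def)
    have w: "w = (%i. z i - a * x i)" by (auto simp: w_def)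
    have xw: "vinner k x w = 0"
      unfolding w vinner_diff_right vinner_scale_right vinner_self x by (simp add: a_def)
    have bxw: "bf k N x w = 0"
      using bf_maximiser_first_order[OF symN x max, of w] xw by simp
    have bz: "bf k N z z = a\<^sup>2 * mu + bf k N w w"
    proof -
      have "bf k N z z = bf k N (%i. a * x i + w i) (%i. a * x i + w i)" by (simp add: zw[symmetric])
      then show ?thesis unfolding bf_linear
        using bxw bf_sym[where x = w and y = x, OF symN] by (simp add: mu_def power2_eq_square)
    qed
    have nz: "(vnorm k z)\<^sup>2 = a\<^sup>2 + (vnorm k w)\<^sup>2"
    proof -
      have "(vnorm k z)\<^sup>2 = (vnorm k (%i. a * x i + w i))\<^sup>2" by (simp add: zw[symmetric])
      then show ?thesis unfolding vnorm_add_sq vinner_linear xw vnorm_scale x by simp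
    qed
    \<comment> \<open>Distance at most 1/4 from the unit vector x makes the squared cosine of the
      angle at least 15/16. The component along x carries at least 15/16 of |z|^2, the orthogonal
      part w at most 1/16, and their difference is 7/8.\<close>
    have "(vnorm k (%i. z i - x i))\<^sup>2 \<le> (1/4)\<^sup>2" using z by (intro power_mono) auto
    then have "(vnorm k z)\<^sup>2 - 2 * a + 1 \<le> 1/16"
      unfolding vnorm_diff_sq x by (simp add: a_def vinner_commute power2_eq_square)
    moreover have "2 * sqrt (15/16) * vnorm k z \<le> (vnorm k z)\<^sup>2 + 15/16"
      using zero_le_power2[of "vnorm k z - sqrt (15/16)"] by (simp add: power2_eq_square algebra_simps)
    ultimately have "sqrt (15/16) * vnorm k z \<le> a" by simp
    then have "(sqrt (15/16) * vnorm k z)\<^sup>2 \<le> a\<^sup>2" by (intro power_mono) auto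
    then have a2: "15/16 * (vnorm k z)\<^sup>2 \<le> a\<^sup>2" by (simp add: power_mult_distrib)
    have "7/8 * t * (vnorm k z)\<^sup>2 \<le> 7/8 * mu * (vnorm k z)\<^sup>2" using mu by (intro mult_right_mono) auto
    also have "... = mu * (7/8 * (vnorm k z)\<^sup>2)" by simp
    also have "... \<le> mu * (a\<^sup>2 - (vnorm k w)\<^sup>2)"
      using a2 nz mu t by (intro mult_left_mono) auto
    also have "... \<le> bf k N z z" using min[of w] unfolding bz mu_def by (simp add: algebra_simps)
    finally show "7/8 * t * (vnorm k z)\<^sup>2 \<le> \<bar>bf k N z z\<bar>" by linarith
  qed
  obtain x1 where x1: "vnorm k x1 = 1" "\<And>y. bf k M y y \<le> bf k M x1 x1 * (vnorm k y)\<^sup>2"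
    using bf_maximiser[OF k, of M] by blast
  obtain x2 where x2: "vnorm k x2 = 1" "\<And>y. - bf k M y y \<le> - bf k M x2 x2 * (vnorm k y)\<^sup>2"
    using bf_maximiser[OF k, of "%i j. - M i j"] unfolding neg by blast
  show ?thesis
  proof (cases "- bf k M x2 x2 \<le> bf k M x1 x1")
    case True
    have "- bf k M y y \<le> bf k M x1 x1 * (vnorm k y)\<^sup>2" for y
      using order_trans[OF x2(2)[of y] mult_right_mono[OF True]] by simp
    from wlog[OF sym x1 this big] show ?thesis .
  next
    case False
    then have "bf k M x1 x1 \<le> - bf k M x2 x2" by simp
    then have "bf k M y y \<le> - bf k M x2 x2 * (vnorm k y)\<^sup>2" for y
      by (intro order_trans[OF x1(2)[of y]] mult_right_mono) auto
    then show ?thesis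
      using wlog[of "%i j. - M i j" x2] sym x2 big unfolding neg by auto
  qed
qed

text \<open>Eigenvectors of distinct eigenvalues of a symmetric matrix are orthogonal, while k + 1
  vectors in R^k are dependent. Finiteness gives meaning to \<open>Max\<close> and
  \<open>Min\<close> in \<open>cond_num\<close>.\<close>

lemma finite_eigenvalues:
  assumes sym: "\<And>i j. i < k ==> j < k ==> M i j = M j i"
  shows "finite (eigenvalues k M)"
proof (rule ccontr)
  assume "infinite (eigenvalues k M)"
  then obtain E where E: "E \<subseteq> eigenvalues k M" "finite E" "card E = Suc k"
    using infinite_arbitrarily_large by blast
  have "\<forall>e. \<exists>x. e \<in> E \<longrightarrow> (\<exists>i<k. x i \<noteq> 0) \<and> (\<forall>i<k. (\<Sum>j<k. M i j * x j) = e * x i)"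
    using E(1) by (auto simp: eigenvalues_def)
  then obtain X where X: "\<And>e. e \<in> E ==> \<exists>i<k. X e i \<noteq> 0"
      "\<And>e i. e \<in> E ==> i < k ==> (\<Sum>j<k. M i j * X e j) = e * X e i" by metis
  obtain c where c: "\<exists>e\<in>E. c e \<noteq> 0" "\<And>i. i < k ==> (\<Sum>e\<in>E. X e i * c e) = 0"
    using homogeneous_system_solution[of "{..<k}" E "%i e. X e i"] E by auto
  have bfX: "bf k M y (X e) = e * vinner k y (X e)" if "e \<in> E" for e y
    unfolding bf_vinner_right vinner_scale_right[symmetric] using X(2)[OF that] by (intro vinner_cong) auto
  have ort: "vinner k (X d) (X e) = 0" if "d \<in> E" "e \<in> E" "d \<noteq> e" for d e
  proof -
    have "e * vinner k (X d) (X e) = d * vinner k (X e) (X d)"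
      using bfX[OF that(2), of "X d"] bfX[OF that(1), of "X e"] bf_sym[where x = "X d" and y = "X e", OF sym] by simp
    then show ?thesis using that(3) by (simp add: vinner_commute[of k "X e"])
  qed
  obtain d where d: "d \<in> E" "c d \<noteq> 0" using c(1) by auto
  have "0 = vinner k (X d) (%i. \<Sum>e\<in>E. c e * X e i)"
    unfolding vinner_def using c(2) by (simp add: mult.commute)
  also have "... = (\<Sum>e\<in>E. c e * vinner k (X d) (X e))" by (rule vinner_sum_right)
  also have "... = c d * vinner k (X d) (X d)"
    using d ort E(2) by (subst sum.remove[OF _ d(1)]) auto
  finally have "vinner k (X d) (X d) = 0" using d by simp
  then have "\<forall>i<k. X d i = 0" by (simp add: vinner_self vnorm_zero_iff)
  then show False using X(1)[OF d(1)] by blast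
qed

text \<open>The extrema of the Rayleigh quotient are attained, the first-order condition makes the
  extremal vectors eigenvectors, and every eigenvalue is a value of the quotient. So the extreme
  eigenvalues are the extrema.\<close>

lemma cond_num_bounds:
  assumes pd: "pos_def k M" and k: "1 \<le> k"
  obtains lmin lmax where "0 < lmin" "lmin \<le> lmax" "cond_num k M = lmax / lmin"
    "\<And>x. lmin * (vnorm k x)\<^sup>2 \<le> bf k M x x" "\<And>x. bf k M x x \<le> lmax * (vnorm k x)\<^sup>2"
proof -
  have sym: "\<And>i j. i < k ==> j < k ==> M i j = M j i" using pd by (simp add: pos_def_def)
  have neg: "bf k (%i j. - M i j) y z = - bf k M y z" for y z by (simp add: bf_def sum_negf)
  note fin = finite_eigenvalues[OF sym]
  obtain x1 where x1: "vnorm k x1 = 1" "\<And>y. bf k M y y \<le> bf k M x1 x1 * (vnorm k y)\<^sup>2"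
    using bf_maximiser[OF k, of M] by blast
  obtain x2 where x2: "vnorm k x2 = 1" "\<And>y. - bf k M y y \<le> - bf k M x2 x2 * (vnorm k y)\<^sup>2"
    using bf_maximiser[OF k, of "%i j. - M i j"] unfolding neg by blast
  have ev: "bf k M x x \<in> eigenvalues k M"
    if x: "vnorm k x = 1" and fo: "\<And>w. bf k M x w = bf k M x x * vinner k x w" for x
  proof -
    have "(\<Sum>j<k. M i j * x j) = bf k M x x * x i" if i: "i < k" for i
    proof -
      let ?e = "%j. if j = i then 1 else 0::real"
      have "bf k M x ?e = bf k M ?e x" by (rule bf_sym[OF sym])
      also have "... = (\<Sum>j<k. M i j * x j)"
        unfolding bf_vinner_right vinner_def using i by (simp add: if_distrib[of "%c. c * _"] sum.delta cong: if_cong)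
      finally have "(\<Sum>j<k. M i j * x j) = bf k M x x * vinner k x ?e" unfolding fo[of ?e] by (rule HOL.sym)
      also have "vinner k x ?e = x i" unfolding vinner_def using i by (simp add: sum.delta if_distrib cong: if_cong)
      finally show ?thesis .
    qed
    moreover have "\<exists>i<k. x i \<noteq> 0" using x by (metis vnorm_zero_iff zero_neq_one)
    ultimately show ?thesis unfolding eigenvalues_def by blast
  qed
  have e1: "bf k M x1 x1 \<in> eigenvalues k M"
  proof (rule ev[OF x1(1)])
    fix w show "bf k M x1 w = bf k M x1 x1 * vinner k x1 w"
      by (rule bf_maximiser_first_order[where k = k and M = M and x = x1 and w = w]) (use sym x1 in blast)+
  qed
  have e2: "bf k M x2 x2 \<in> eigenvalues k M"
  proof (rule ev[OF x2(1)])
    fix w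
    have "bf k (%i j. - M i j) x2 w = bf k (%i j. - M i j) x2 x2 * vinner k x2 w"
      by (rule bf_maximiser_first_order[where k = k and M = "%i j. - M i j" and x = x2 and w = w])
        (use sym x2 neg in auto)
    then show "bf k M x2 w = bf k M x2 x2 * vinner k x2 w" unfolding neg by simp
  qed
  have rng: "bf k M x2 x2 \<le> e \<and> e \<le> bf k M x1 x1" if ev': "e \<in> eigenvalues k M" for e
  proof -
    obtain x where x: "\<exists>i<k. x i \<noteq> 0" "\<And>i. i < k ==> (\<Sum>j<k. M i j * x j) = e * x i"
      using ev' unfolding eigenvalues_def by auto
    have "vnorm k x \<noteq> 0" using x(1) unfolding vnorm_zero_iff by blast
    then have p: "(vnorm k x)\<^sup>2 > 0" by simp
    have "bf k M x x = vinner k x (%i. e * x i)" unfolding bf_vinner_right using x(2) by (intro vinner_cong) auto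
    then have "bf k M x x = e * (vnorm k x)\<^sup>2" by (simp add: vinner_linear vinner_self)
    then show ?thesis using x1(2)[of x] x2(2)[of x] p by (auto simp: mult_le_cancel_right)
  qed
  have "Max (eigenvalues k M) = bf k M x1 x1" by (rule Max_eqI[OF fin]) (use e1 rng in auto)
  moreover have "Min (eigenvalues k M) = bf k M x2 x2" by (rule Min_eqI[OF fin]) (use e2 rng in auto)
  moreover have "0 < bf k M x2 x2"
  proof -
    have "\<exists>i<k. x2 i \<noteq> 0" using x2(1) by (metis vnorm_zero_iff zero_neq_one)
    then show ?thesis using pd unfolding pos_def_def bf_def by blast
  qed
  moreover have "bf k M x2 x2 * (vnorm k x)\<^sup>2 \<le> bf k M x x" for x using x2(2)[of x] by simp
  ultimately show ?thesis
    using that[of "bf k M x2 x2" "bf k M x1 x1"] x1(2) rng[OF e2] unfolding cond_num_def by auto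
qed

subsection \<open>Triangular matrices\<close>

text \<open>Strict upper triangular truncation costs only a logarithm in operator norm: halve the index range;
  the off-diagonal block costs one, and the two diagonal blocks act on orthogonal subspaces.\<close>
lemma bbd_strict_upper:
  assumes B: "bbd k M c" and c: "0 \<le> c" and k: "1 \<le> k"
  shows "bbd k (%i j. if i < j then M i j else 0) (c * log 2 (2 * real k))"
proof -
  define M' where "M' i j = (if i < k \<and> j < k then M i j else 0)" for i j
  have H: "\<bar>\<Sum>i\<in>A. \<Sum>j\<in>A'. x i * M' i j * y j\<bar> \<le> c * L2_set x A * L2_set y A'"
    if fin: "finite A" "finite A'" for A A' :: "nat set" and x y :: vec
  proof -
    let ?x = "%i. if i \<in> A then x i else 0" and ?y = "%j. if j \<in> A' then y j else 0"
    have L: "vnorm k (%i. if i \<in> D then z i else 0) \<le> L2_set z D" if "finite D" for z :: vec and D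
    proof -
      have "(\<Sum>i<k. (if i \<in> D then z i else 0)\<^sup>2) = (\<Sum>i\<in>{..<k} \<inter> D. (z i)\<^sup>2)"
        by (simp add: sum.inter_restrict if_distrib[of "%x. x\<^sup>2"] cong: if_cong)
      also have "... \<le> (\<Sum>i\<in>D. (z i)\<^sup>2)" using that by (intro sum_mono2) auto
      finally show ?thesis by (simp add: vnorm_def L2_set_def)
    qed
    have "(\<Sum>i\<in>A. \<Sum>j\<in>A'. x i * M' i j * y j) = (\<Sum>i\<in>A. \<Sum>j\<in>A' \<inter> {..<k}. x i * M' i j * y j)"
      using fin by (intro sum.cong refl sum.mono_neutral_right) (auto simp: M'_def)
    also have "... = (\<Sum>i\<in>A \<inter> {..<k}. \<Sum>j\<in>A' \<inter> {..<k}. x i * M' i j * y j)"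
      using fin by (intro sum.mono_neutral_right) (auto simp: M'_def)
    also have "... = (\<Sum>i\<in>A \<inter> {..<k}. \<Sum>j\<in>A' \<inter> {..<k}. ?x i * M i j * ?y j)"
      by (intro sum.cong refl) (auto simp: M'_def)
    also have "... = (\<Sum>i\<in>A \<inter> {..<k}. \<Sum>j<k. ?x i * M i j * ?y j)"
      by (intro sum.cong refl sum.mono_neutral_left) auto
    also have "... = bf k M ?x ?y" unfolding bf_def by (intro sum.mono_neutral_left) auto
    finally have "\<bar>\<Sum>i\<in>A. \<Sum>j\<in>A'. x i * M' i j * y j\<bar> \<le> c * vnorm k ?x * vnorm k ?y"
      using bbdD[OF B, of ?x ?y] by simp
    also have "... \<le> c * L2_set x A * L2_set y A'"
      using c fin by (intro mult_mono L mult_left_mono) auto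
    finally show ?thesis .
  qed
  \<comment> \<open>Dyadic induction: an interval of length 2^m costs m times c, one unit per
    halving. The free offset \<open>a\<close> lets both halves use the induction hypothesis, and the
    zero padding in \<open>M'\<close> lets intervals reach beyond \<open>k\<close>.\<close>
  have claim: "\<bar>\<Sum>i\<in>{a..<a+2^m}. \<Sum>j\<in>{a..<a+2^m}. if i < j then x i * M' i j * y j else 0\<bar>
      \<le> real m * c * L2_set x {a..<a+2^m} * L2_set y {a..<a+2^m}" for m a and x y :: vec
  proof (induction m arbitrary: a)
    case 0
    have "{a..<a+2^0} = {a}" by auto
    then show ?case by simp
  next
    case (Suc m)
    let ?A = "{a..<a+2^m}" and ?B = "{a+2^m..<a+2^m+2^m}"
    define t where "t i j = (if i < j then x i * M' i j * y j else 0)" for i j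
    have U: "{a..<a+2^Suc m} = ?A \<union> ?B" by auto
    have dj: "?A \<inter> ?B = {}" by auto
    have dbl: "(\<Sum>i\<in>A \<union> B. \<Sum>j\<in>A \<union> B. t i j)
       = (\<Sum>i\<in>A. \<Sum>j\<in>A. t i j) + (\<Sum>i\<in>A. \<Sum>j\<in>B. t i j) + ((\<Sum>i\<in>B. \<Sum>j\<in>A. t i j) + (\<Sum>i\<in>B. \<Sum>j\<in>B. t i j))"
      if "finite A" "finite B" "A \<inter> B = {}" for A B
      using that by (simp add: sum.union_disjoint sum.distrib)
    have sq': "(L2_set z (A \<union> B))\<^sup>2 = (L2_set z A)\<^sup>2 + (L2_set z B)\<^sup>2"
      if "finite A" "finite B" "A \<inter> B = {}" for A B :: "nat set" and z :: vec
      unfolding L2_set_def using that by (simp add: sum.union_disjoint sum_nonneg)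
    have sq: "(L2_set z {a..<a+2^Suc m})\<^sup>2 = (L2_set z ?A)\<^sup>2 + (L2_set z ?B)\<^sup>2" for z :: vec
      unfolding U by (rule sq') (use dj in auto)
    have s3: "(\<Sum>i\<in>?B. \<Sum>j\<in>?A. t i j) = 0" by (intro sum.neutral ballI) (auto simp: t_def)
    have s2: "(\<Sum>i\<in>?A. \<Sum>j\<in>?B. t i j) = (\<Sum>i\<in>?A. \<Sum>j\<in>?B. x i * M' i j * y j)"
      by (intro sum.cong refl) (auto simp: t_def)
    have b2: "\<bar>\<Sum>i\<in>?A. \<Sum>j\<in>?B. x i * M' i j * y j\<bar> \<le> c * L2_set x ?A * L2_set y ?B" by (intro H) auto
    have b1: "\<bar>\<Sum>i\<in>?A. \<Sum>j\<in>?A. t i j\<bar> \<le> real m * c * L2_set x ?A * L2_set y ?A"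
      and b4: "\<bar>\<Sum>i\<in>?B. \<Sum>j\<in>?B. t i j\<bar> \<le> real m * c * L2_set x ?B * L2_set y ?B"
      using Suc.IH[of a] Suc.IH[of "a+2^m"] by (simp_all only: t_def)
    have S: "(\<Sum>i\<in>{a..<a+2^Suc m}. \<Sum>j\<in>{a..<a+2^Suc m}. t i j)
       = (\<Sum>i\<in>?A. \<Sum>j\<in>?A. t i j) + (\<Sum>i\<in>?A. \<Sum>j\<in>?B. t i j) + ((\<Sum>i\<in>?B. \<Sum>j\<in>?A. t i j) + (\<Sum>i\<in>?B. \<Sum>j\<in>?B. t i j))"
      unfolding U by (rule dbl) (use dj in auto)
    have "real m * c * L2_set x ?A * L2_set y ?A + real m * c * L2_set x ?B * L2_set y ?B
        = real m * c * (L2_set x ?A * L2_set y ?A + L2_set x ?B * L2_set y ?B)" by (simp only: distrib_left mult.assoc)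
    moreover have "c * L2_set x ?A * L2_set y ?B = c * (L2_set x ?A * L2_set y ?B)" by (rule mult.assoc)
    ultimately have le: "\<bar>\<Sum>i\<in>{a..<a+2^Suc m}. \<Sum>j\<in>{a..<a+2^Suc m}. t i j\<bar>
       \<le> real m * c * (L2_set x ?A * L2_set y ?A + L2_set x ?B * L2_set y ?B) + c * (L2_set x ?A * L2_set y ?B)"
      unfolding S s3 s2 using b1 b2 b4 by linarith
    let ?X = "L2_set x {a..<a+2^Suc m}" and ?Y = "L2_set y {a..<a+2^Suc m}"
    \<comment> \<open>Cauchy-Schwarz in the plane, applied to the pairs of norms over the two
      halves.\<close>
    have "(L2_set x ?A * L2_set y ?A + L2_set x ?B * L2_set y ?B)\<^sup>2 \<le> (?X * ?Y)\<^sup>2"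
    proof -
      have "(?X * ?Y)\<^sup>2 - (L2_set x ?A * L2_set y ?A + L2_set x ?B * L2_set y ?B)\<^sup>2
          = (L2_set x ?A * L2_set y ?B - L2_set x ?B * L2_set y ?A)\<^sup>2"
        unfolding power_mult_distrib sq by (simp add: power2_eq_square algebra_simps)
      then show ?thesis by (metis diff_ge_0_iff_ge zero_le_power2)
    qed
    then have 1: "L2_set x ?A * L2_set y ?A + L2_set x ?B * L2_set y ?B \<le> ?X * ?Y"
      by (rule power2_le_imp_le) simp
    have "L2_set x ?A \<le> ?X" by (rule power2_le_imp_le) (simp only: sq, simp_all)
    moreover have "L2_set y ?B \<le> ?Y" by (rule power2_le_imp_le) (simp only: sq, simp_all)
    ultimately have 2: "L2_set x ?A * L2_set y ?B \<le> ?X * ?Y" by (intro mult_mono) auto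
    have "real m * c * (L2_set x ?A * L2_set y ?A + L2_set x ?B * L2_set y ?B) + c * (L2_set x ?A * L2_set y ?B)
       \<le> real m * c * (?X * ?Y) + c * (?X * ?Y)"
      using c by (intro add_mono mult_left_mono 1 2) auto
    also have "... = real (Suc m) * c * ?X * ?Y" by (simp only: of_nat_Suc distrib_right mult_1 mult.assoc add.commute)
    finally have "\<bar>\<Sum>i\<in>{a..<a+2^Suc m}. \<Sum>j\<in>{a..<a+2^Suc m}. t i j\<bar> \<le> real (Suc m) * c * ?X * ?Y"
      using le by linarith
    then show ?case by (simp only: t_def)
  qed
  \<comment> \<open>The least exponent with k \<le> 2^m. Rounding up costs at most 1, which the 2
    inside log 2 (2 k) absorbs.\<close>
  define m where "m = nat \<lceil>log 2 (real k)\<rceil>"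
  have l0: "0 \<le> log 2 (real k)" using k by simp
  have mle: "real m \<le> log 2 (2 * real k)"
    using k l0 by (simp add: m_def log_mult) linarith
  have "real k = 2 powr (log 2 (real k))" using k by simp
  also have "... \<le> 2 powr (real m)" using l0 by (intro powr_mono) (auto simp: m_def)
  finally have "real k \<le> real (2 ^ m)" by (simp add: powr_realpow)
  then have km: "k \<le> 2 ^ m" by linarith
  show ?thesis unfolding bbd_def
  proof (intro allI)
    fix x y :: vec
    let ?x = "%i. if i < k then x i else 0" and ?y = "%i. if i < k then y i else 0"
    have L: "L2_set (%i. if i < k then z i else 0) {0..<0+2^m} = vnorm k z" for z :: vec
    proof -
      have "(\<Sum>i\<in>{0..<0+2^m}. (if i < k then z i else 0)\<^sup>2) = (\<Sum>i<k. (if i < k then z i else 0)\<^sup>2)"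
        using km by (intro sum.mono_neutral_right) auto
      then show ?thesis by (simp add: L2_set_def vnorm_def)
    qed
    have "bf k (%i j. if i < j then M i j else 0) x y = (\<Sum>i<k. \<Sum>j<k. if i < j then ?x i * M' i j * ?y j else 0)"
      unfolding bf_def by (intro sum.cong refl) (auto simp: M'_def)
    also have "... = (\<Sum>i<k. \<Sum>j\<in>{0..<0+2^m}. if i < j then ?x i * M' i j * ?y j else 0)"
      using km by (intro sum.cong refl sum.mono_neutral_left) auto
    also have "... = (\<Sum>i\<in>{0..<0+2^m}. \<Sum>j\<in>{0..<0+2^m}. if i < j then ?x i * M' i j * ?y j else 0)"
      using km by (intro sum.mono_neutral_left) (auto intro!: sum.neutral)
    finally have "\<bar>bf k (%i j. if i < j then M i j else 0) x y\<bar> \<le> real m * c * vnorm k x * vnorm k y"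
      using claim[where a = 0 and m = m and x = ?x and y = ?y] unfolding L by simp
    also have "... \<le> c * log 2 (2 * real k) * vnorm k x * vnorm k y"
      using mle c by (intro mult_right_mono) (auto simp: mult.commute[of c] intro: mult_right_mono)
    finally show "\<bar>bf k (%i j. if i < j then M i j else 0) x y\<bar> \<le> c * log 2 (2 * real k) * vnorm k x * vnorm k y" .
  qed
qed

text \<open>Bordering: the last column of the inverse is - D u / U k k above the diagonal, with u
  the last column of U. The inverse is padded by zero since \<open>minv\<close> selects the padded
  representative.\<close>

lemma upper_triangular_inverse:
  fixes U :: vecs
  assumes "\<And>i j. i < k ==> j < i ==> U i j = 0" "\<And>i. i < k ==> U i i \<noteq> 0"
  shows "\<exists>D. (\<forall>i j. \<not> (i < k \<and> j < k) \<longrightarrow> D i j = 0) \<and> (\<forall>i<k. \<forall>j<i. D i j = 0) \<and> (\<forall>i<k. D i i = 1 / U i i) \<and>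
    (\<forall>i<k. \<forall>j<k. (\<Sum>l<k. U i l * D l j) = of_bool (i = j)) \<and> (\<forall>i<k. \<forall>j<k. (\<Sum>l<k. D i l * U l j) = of_bool (i = j))"
  using assms
proof (induction k)
  case 0
  show ?case by (intro exI[of _ "%_ _. 0"]) auto
next
  case (Suc k)
  have "\<exists>D. (\<forall>i j. \<not> (i < k \<and> j < k) \<longrightarrow> D i j = 0) \<and> (\<forall>i<k. \<forall>j<i. D i j = 0) \<and> (\<forall>i<k. D i i = 1 / U i i) \<and>
    (\<forall>i<k. \<forall>j<k. (\<Sum>l<k. U i l * D l j) = of_bool (i = j)) \<and> (\<forall>i<k. \<forall>j<k. (\<Sum>l<k. D i l * U l j) = of_bool (i = j))"
    by (rule Suc.IH) (use Suc.prems in auto)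
  then obtain D where D0: "\<forall>i j. \<not> (i < k \<and> j < k) \<longrightarrow> D i j = 0" "\<forall>i<k. \<forall>j<i. D i j = 0"
    "\<forall>i<k. D i i = 1 / U i i"
    "\<forall>i<k. \<forall>j<k. (\<Sum>l<k. U i l * D l j) = of_bool (i = j)"
    "\<forall>i<k. \<forall>j<k. (\<Sum>l<k. D i l * U l j) = of_bool (i = j)" by blast
  note D = D0(1)[rule_format] D0(2)[rule_format] D0(3)[rule_format] D0(4)[rule_format] D0(5)[rule_format]
  have u: "U k k \<noteq> 0" and uk: "\<And>l. l < k ==> U k l = 0" using Suc.prems by auto
  define D' where "D' i j = (if i < k \<and> j < k then D i j
     else if i < k \<and> j = k then - (\<Sum>l<k. D i l * U l k) / U k k
     else if i = k \<and> j = k then 1 / U k k else 0)" for i j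
  have UD: "(\<Sum>l<Suc k. U i l * D' l j) = of_bool (i = j)" if ij: "i < Suc k" "j < Suc k" for i j
  proof -
    consider "i < k" "j < k" | "i < k" "j = k" | "i = k" using ij by linarith
    then show ?thesis
    proof cases
      case 1
      then show ?thesis using D(4)[of i j] by (simp add: D'_def)
    next
      case 2
      have "(\<Sum>l<k. U i l * D' l k) = (\<Sum>l<k. \<Sum>m<k. - (U i l * D l m * U m k) / U k k)"
        unfolding D'_def by (intro sum.cong refl) (simp add: sum_distrib_left sum_negf sum_divide_distrib mult.assoc)
      also have "... = (\<Sum>m<k. \<Sum>l<k. - (U i l * D l m * U m k) / U k k)" by (rule sum.swap)
      also have "... = (\<Sum>m<k. - ((\<Sum>l<k. U i l * D l m) * U m k) / U k k)"
        by (simp add: sum_distrib_right sum_negf sum_divide_distrib)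
      also have "... = (\<Sum>m<k. if m = i then - U i k / U k k else 0)"
        using 2 by (intro sum.cong refl) (simp add: D(4))
      also have "... = - U i k / U k k" using 2 by (simp add: sum.delta)
      finally show ?thesis using 2 by (simp add: D'_def)
    next
      case 3
      have "(\<Sum>l<k. U k l * D' l j) = 0" by (intro sum.neutral ballI) (simp add: uk)
      then show ?thesis using 3 ij u by (auto simp: D'_def)
    qed
  qed
  have DU: "(\<Sum>l<Suc k. D' i l * U l j) = of_bool (i = j)" if ij: "i < Suc k" "j < Suc k" for i j
  proof -
    consider "i < k" "j < k" | "i < k" "j = k" | "i = k" using ij by linarith
    then show ?thesis
    proof cases
      case 1
      then show ?thesis using D(5)[of i j] by (simp add: D'_def uk)
    next
      case 2
      then show ?thesis using u by (simp add: D'_def)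
    next
      case 3
      have "(\<Sum>l<k. D' k l * U l j) = 0" by (intro sum.neutral ballI) (simp add: D'_def)
      then show ?thesis using 3 ij u uk by (auto simp: D'_def less_Suc_eq)
    qed
  qed
  show ?case
    by (intro exI[of _ D'] conjI allI impI UD DU) (auto simp: D'_def D less_Suc_eq)
qed

lemma minv_eqI:
  assumes pad: "\<And>i j. \<not> (i < k \<and> j < k) ==> D i j = 0"
    and MD: "\<And>i j. i < k ==> j < k ==> (\<Sum>l<k. M i l * D l j) = of_bool (i = j)"
    and DM: "\<And>i j. i < k ==> j < k ==> (\<Sum>l<k. D i l * M l j) = of_bool (i = j)"
  shows "minv k M = D"
  unfolding minv_def
proof (rule the_equality)
  show "(\<forall>i j. \<not> (i < k \<and> j < k) \<longrightarrow> D i j = 0) \<and> mmul k k k M D = idm k \<and> mmul k k k D M = idm k"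
    using assms by (auto simp: mmul_def idm_def intro!: ext)
  fix N assume N: "(\<forall>i j. \<not> (i < k \<and> j < k) \<longrightarrow> N i j = 0) \<and> mmul k k k M N = idm k \<and> mmul k k k N M = idm k"
  then have NM: "(\<Sum>l<k. N i l * M l j) = of_bool (i = j)" if "i < k" "j < k" for i j
  proof -
    have "mmul k k k N M i j = idm k i j" using N by simp
    then show ?thesis using that by (simp add: mmul_def idm_def)
  qed
  show "N = D"
  proof (intro ext)
    fix i j
    show "N i j = D i j"
    proof (cases "i < k \<and> j < k")
      case True
      have "N i j = (\<Sum>l<k. N i l * of_bool (l = j))" using True by simp
      also have "... = (\<Sum>l<k. N i l * (\<Sum>m<k. M l m * D m j))" using True by (intro sum.cong refl) (simp add: MD)
      also have "... = (\<Sum>l<k. \<Sum>m<k. N i l * M l m * D m j)" by (simp add: sum_distrib_left mult.assoc)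
      also have "... = (\<Sum>m<k. \<Sum>l<k. N i l * M l m * D m j)" by (rule sum.swap)
      also have "... = (\<Sum>m<k. of_bool (i = m) * D m j)"
        using True by (intro sum.cong refl) (simp add: NM sum_distrib_right[symmetric])
      also have "... = D i j" using True by simp
      finally show ?thesis .
    next
      case False
      then show ?thesis using N pad by auto
    qed
  qed
qed

lemma bf_gram: "bf k (%i j. \<Sum>l<n. C l i * C l j) x y = vinner n (%l. \<Sum>i<k. C l i * x i) (%l. \<Sum>j<k. C l j * y j)"
proof -
  have "bf k (%i j. \<Sum>l<n. C l i * C l j) x y = (\<Sum>i<k. \<Sum>j<k. \<Sum>l<n. C l i * x i * (C l j * y j))"
    unfolding bf_def by (simp add: sum_distrib_left sum_distrib_right mult_ac)
  also have "... = (\<Sum>i<k. \<Sum>l<n. \<Sum>j<k. C l i * x i * (C l j * y j))"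
    by (rule sum.cong[OF refl], rule sum.swap)
  also have "... = (\<Sum>l<n. \<Sum>i<k. \<Sum>j<k. C l i * x i * (C l j * y j))" by (rule sum.swap)
  also have "... = vinner n (%l. \<Sum>i<k. C l i * x i) (%l. \<Sum>j<k. C l j * y j)"
    unfolding vinner_def by (simp add: sum_product)
  finally show ?thesis .
qed

lemma bf_id: "bf k (%i j. of_bool (i = j)) x y = vinner k x y"
  unfolding bf_vinner_right by (rule vinner_cong) auto

lemma bf_diff_mat: "bf k (%i j. M i j - N i j) x y = bf k M x y - bf k N x y"
  by (simp add: bf_def algebra_simps sum_subtractf)

text \<open>Perturbation of the Cholesky factor of the identity: \<open>C - C\<^sup>-\<^sup>T = C\<^sup>-\<^sup>T E\<close> with \<open>C\<close> upper and
  \<open>C\<^sup>-\<^sup>T\<close> lower triangular, so the strict upper part of \<open>C\<close> is that of \<open>C\<^sup>-\<^sup>T E\<close>.\<close>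
lemma cholesky_perturbation:
  fixes C :: vecs
  assumes k: "1 \<le> k" and up: "\<And>i j. i < k ==> j < i ==> C i j = 0" and dg: "\<And>i. i < k ==> 0 \<le> C i i"
    and E: "bbd k (%i j. (\<Sum>l<k. C l i * C l j) - of_bool (i = j)) e"
  shows "bbd k (%i j. C i j - of_bool (i = j)) (5 * log 2 (2 * real k) * e)"
proof -
  define El where "El i j = (\<Sum>l<k. C l i * C l j) - of_bool (i = j)" for i j
  have El: "bbd k El e" using E by (simp add: El_def[abs_def])
  define ap where "ap x i = (\<Sum>j<k. C i j * x j)" for x i
  have nrm: "(vnorm k (ap x))\<^sup>2 = (vnorm k x)\<^sup>2 + bf k El x x" for x
    unfolding El_def bf_diff_mat bf_gram bf_id ap_def[abs_def] by (simp add: vinner_self)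
  have e0: "0 \<le> e"
  proof -
    have "\<bar>bf k El (%_. 1) (%_. 1)\<bar> \<le> e * vnorm k (%_. 1) * vnorm k (%_. 1)" by (rule bbdD[OF El])
    then have "0 \<le> e * (vnorm k (%_. 1))\<^sup>2" by (simp add: power2_eq_square mult.assoc)
    then show ?thesis using k by (simp add: vnorm_sq zero_le_mult_iff)
  qed
  have lg: "1 \<le> log 2 (2 * real k)" using k by (simp add: log_mult)
  show ?thesis
  proof (cases "e < 1/2")
    \<comment> \<open>For e \<ge> 1/2 the crude bound 2 + e on the norm of C - I is already at most
      5 e.\<close>
    case False
    have "vnorm k (%i. \<Sum>j<k. (C i j - of_bool (i = j)) * y j) \<le> (2 + e) * vnorm k y" for y
    proof -
      have "vnorm k (%i. \<Sum>j<k. (C i j - of_bool (i = j)) * y j) = vnorm k (%i. ap y i - y i)"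
        by (intro vnorm_cong) (simp add: ap_def left_diff_distrib sum_subtractf)
      also have "... \<le> vnorm k (ap y) + vnorm k y" by (rule vnorm_diff)
      also have "vnorm k (ap y) \<le> (1 + e) * vnorm k y"
      proof (rule power2_le_imp_le)
        have "(vnorm k (ap y))\<^sup>2 \<le> (1 + e) * (vnorm k y)\<^sup>2"
          using nrm[of y] bbdD[OF El, of y y] by (simp add: algebra_simps power2_eq_square)
        also have "... \<le> (1 + e)\<^sup>2 * (vnorm k y)\<^sup>2"
          using e0 by (intro mult_right_mono) (auto simp: power2_eq_square algebra_simps)
        finally show "(vnorm k (ap y))\<^sup>2 \<le> ((1 + e) * vnorm k y)\<^sup>2" by (simp add: power_mult_distrib)
      qed (use e0 in simp)
      finally show ?thesis by (simp add: algebra_simps)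
    qed
    then have "bbd k (%i j. C i j - of_bool (i = j)) (2 + e)" by (rule bbdI_mv)
    moreover have "2 + e \<le> 5 * log 2 (2 * real k) * e"
    proof -
      have "2 + e \<le> 5 * 1 * e" using False by simp
      also have "... \<le> 5 * log 2 (2 * real k) * e" using lg e0 by (intro mult_right_mono mult_left_mono) auto
      finally show ?thesis .
    qed
    ultimately show ?thesis by (rule bbd_mono)
  next
    case True
    have low: "(vnorm k x)\<^sup>2 \<le> 2 * (vnorm k (ap x))\<^sup>2" for x
    proof -
      have "e * (vnorm k x)\<^sup>2 \<le> 1/2 * (vnorm k x)\<^sup>2" using True by (intro mult_right_mono) auto
      then show ?thesis using nrm[of x] bbdD[OF El, of x x] by (simp add: power2_eq_square mult.assoc)
    qed
    \<comment> \<open>If the diagonal entry at i vanished, C would kill a nonzero vector supported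
      on 0, ..., i: the rows of index less than i are i equations in i + 1 unknowns, and all other
      rows vanish on this support. That contradicts \<open>low\<close>.\<close>
    have dpos: "C i i \<noteq> 0" if i: "i < k" for i
    proof
      assume z: "C i i = 0"
      obtain c where c: "\<exists>j\<in>{..i}. c j \<noteq> 0" "\<And>s. s < i ==> (\<Sum>j\<le>i. C s j * c j) = 0"
        using homogeneous_system_solution[of "{..<i}" "{..i}" C] by auto
      define x where "x j = (if j \<le> i then c j else 0)" for j
      have "ap x s = 0" if s: "s < k" for s
      proof -
        have "ap x s = (\<Sum>j\<le>i. C s j * c j)"
          unfolding ap_def x_def using i by (intro sum.mono_neutral_cong_right) auto
        also have "... = 0"
        proof (cases "s < i")
          case False
          then have "C s j = 0" if "j \<le> i" for j
            using that z up[OF s, of j] by (cases "j = i \<and> s = i") auto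
          then show ?thesis by simp
        qed (rule c(2))
        finally show ?thesis .
      qed
      then have "vnorm k (ap x) = 0" by (simp add: vnorm_zero_iff)
      then have "vnorm k x = 0" using low[of x] by simp
      then have "x j = 0" if "j < k" for j using that by (simp add: vnorm_zero_iff)
      then show False using c(1) i by (metis atMost_iff le_less_trans x_def)
    qed
    obtain D where D0: "\<forall>i<k. \<forall>j<i. D i j = 0" "\<forall>i<k. D i i = 1 / C i i"
      "\<forall>i<k. \<forall>j<k. (\<Sum>l<k. C i l * D l j) = of_bool (i = j)"
      using upper_triangular_inverse[of k C, OF up dpos] by blast
    note D = D0(1)[rule_format] D0(2)[rule_format] D0(3)[rule_format]
    define W where "W i j = (\<Sum>l<k. D l i * El l j)" for i j
    have W: "W i j = C i j - D j i" if ij: "i < k" "j < k" for i j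
    proof -
      have "W i j = (\<Sum>l<k. D l i * (\<Sum>m<k. C m l * C m j)) - D j i"
        unfolding W_def El_def using ij by (simp add: right_diff_distrib sum_subtractf)
      also have "(\<Sum>l<k. D l i * (\<Sum>m<k. C m l * C m j)) = (\<Sum>l<k. \<Sum>m<k. C m l * D l i * C m j)"
        by (simp add: sum_distrib_left mult_ac)
      also have "... = (\<Sum>m<k. \<Sum>l<k. C m l * D l i * C m j)" by (rule sum.swap)
      also have "... = (\<Sum>m<k. of_bool (m = i) * C m j)"
        using ij by (intro sum.cong refl) (simp add: D(3) sum_distrib_right[symmetric])
      also have "... = C i j" using ij by simp
      finally show ?thesis .
    qed
    \<comment> \<open>As \<open>D\<close> inverts \<open>C\<close>, the estimate \<open>low\<close>
      bounds its norm by sqrt 2, rounded to 2.\<close>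
    have bW: "bbd k W (2 * e)" unfolding bbd_def
    proof (intro allI)
      fix x y
      define z where "z l = (\<Sum>i<k. D l i * x i)" for l
      have "bf k W x y = (\<Sum>i<k. \<Sum>j<k. \<Sum>l<k. D l i * x i * El l j * y j)"
        unfolding bf_def W_def by (simp add: sum_distrib_left sum_distrib_right mult_ac)
      also have "... = (\<Sum>i<k. \<Sum>l<k. \<Sum>j<k. D l i * x i * El l j * y j)"
        by (rule sum.cong[OF refl], rule sum.swap)
      also have "... = (\<Sum>l<k. \<Sum>i<k. \<Sum>j<k. D l i * x i * El l j * y j)" by (rule sum.swap)
      also have "... = (\<Sum>l<k. \<Sum>j<k. \<Sum>i<k. D l i * x i * El l j * y j)"
        by (rule sum.cong[OF refl], rule sum.swap)
      also have "... = bf k El z y" unfolding bf_def z_def by (simp add: sum_distrib_right)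
      finally have b: "\<bar>bf k W x y\<bar> \<le> e * vnorm k z * vnorm k y" using bbdD[OF El] by simp
      have "vnorm k (ap z) = vnorm k x"
      proof (intro vnorm_cong)
        fix i assume i: "i < k"
        have "ap z i = (\<Sum>l<k. \<Sum>j<k. C i l * D l j * x j)"
          unfolding ap_def z_def by (simp add: sum_distrib_left mult.assoc)
        also have "... = (\<Sum>j<k. \<Sum>l<k. C i l * D l j * x j)" by (rule sum.swap)
        also have "... = (\<Sum>j<k. of_bool (i = j) * x j)"
          using i by (intro sum.cong refl) (simp add: D(3) sum_distrib_right[symmetric])
        also have "... = x i" using i by simp
        finally show "ap z i = x i" .
      qed
      then have "(vnorm k z)\<^sup>2 \<le> 2 * (vnorm k x)\<^sup>2" using low[of z] by simp
      also have "... \<le> (2 * vnorm k x)\<^sup>2" by (simp add: power_mult_distrib)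
      finally have "vnorm k z \<le> 2 * vnorm k x" by (rule power2_le_imp_le) simp
      then have "e * vnorm k z * vnorm k y \<le> e * (2 * vnorm k x) * vnorm k y"
        using e0 by (intro mult_right_mono mult_left_mono) auto
      with b show "\<bar>bf k W x y\<bar> \<le> 2 * e * vnorm k x * vnorm k y" by (simp add: mult_ac)
    qed
    have u: "bbd k (%i j. if i < j then W i j else 0) (2 * e * log 2 (2 * real k))"
      by (rule bbd_strict_upper[OF bW _ k]) (use e0 in simp)
    have Wd: "\<bar>W i i\<bar> \<le> 2 * e" if i: "i < k" for i
    proof -
      let ?e = "%j. if j = i then 1 else 0 :: real"
      have "bf k W ?e ?e = W i i" unfolding bf_vinner_right vinner_def using i
        by (simp add: if_distrib[of "%c. c * _"] if_distrib[of "%c. _ * c"] sum.delta cong: if_cong)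
      moreover have "vnorm k ?e = 1" unfolding vnorm_def using i by (simp add: if_distrib[of "%x. x\<^sup>2"] sum.delta cong: if_cong)
      ultimately show ?thesis using bbdD[OF bW, of ?e ?e] by simp
    qed
    \<comment> \<open>The diagonal entry of \<open>W\<close> is C i i - 1 / C i i = (C i i - 1) (1 +
      1 / C i i), and the second factor exceeds 1 because the diagonal of \<open>C\<close> is
      positive.\<close>
    have Cd: "\<bar>C i i - 1\<bar> \<le> 2 * e" if i: "i < k" for i
    proof -
      have p: "C i i > 0" using dg[OF i] dpos[OF i] by simp
      have "W i i = C i i - 1 / C i i" using W[OF i i] D(2)[OF i] by simp
      then have "W i i = (C i i - 1) * (1 + 1 / C i i)" using p by (simp add: field_simps)
      then have "\<bar>W i i\<bar> = \<bar>C i i - 1\<bar> * (1 + 1 / C i i)" using p by (simp add: abs_mult)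
      moreover have "\<bar>C i i - 1\<bar> * 1 \<le> \<bar>C i i - 1\<bar> * (1 + 1 / C i i)" using p by (intro mult_left_mono) auto
      ultimately show ?thesis using Wd[OF i] by simp
    qed
    have d: "bbd k (%i j. if i = j then C i i - 1 else 0) (2 * e)"
    proof (rule bbdI_mv)
      fix y
      have "vnorm k (%i. \<Sum>j<k. (if i = j then C i i - 1 else 0) * y j) = vnorm k (%i. (C i i - 1) * y i)"
        by (intro vnorm_cong) (simp add: if_distrib[of "%c. c * _"] sum.delta' cong: if_cong)
      also have "... \<le> vnorm k (%i. 2 * e * y i)"
      proof -
        have "((C i i - 1) * y i)\<^sup>2 \<le> (2 * e * y i)\<^sup>2" if "i < k" for i
        proof -
          have "\<bar>C i i - 1\<bar>\<^sup>2 \<le> (2 * e)\<^sup>2" by (rule power_mono[OF Cd[OF that]]) simp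
          then have "(C i i - 1)\<^sup>2 * (y i)\<^sup>2 \<le> (2 * e)\<^sup>2 * (y i)\<^sup>2" by (intro mult_right_mono) auto
          then show ?thesis by (simp only: power_mult_distrib)
        qed
        then show ?thesis unfolding vnorm_def by (intro real_sqrt_le_mono sum_mono) auto
      qed
      also have "... = 2 * e * vnorm k y" using e0 by (simp add: vnorm_scale)
      finally show "vnorm k (%i. \<Sum>j<k. (if i = j then C i i - 1 else 0) * y j) \<le> 2 * e * vnorm k y" .
    qed
    have s: "bf k (%i j. C i j - of_bool (i = j)) x y
        = bf k (%i j. (if i < j then W i j else 0) + (if i = j then C i i - 1 else 0)) x y" for x y
    proof (rule bf_cong)
      fix i j assume ij: "i < k" "j < k"
      show "C i j - of_bool (i = j) = (if i < j then W i j else 0) + (if i = j then C i i - 1 else 0)"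
      proof (cases i j rule: linorder_cases)
        case less
        then show ?thesis using W[OF ij] D(1)[OF ij(2) less] by simp
      next
        case greater
        then show ?thesis using up[OF ij(1) greater] by simp
      qed simp
    qed auto
    have "bbd k (%i j. C i j - of_bool (i = j)) (2 * e * log 2 (2 * real k) + 2 * e)"
      using bbd_add[OF u d] unfolding bbd_def s .
    moreover have "2 * e * log 2 (2 * real k) + 2 * e \<le> 5 * log 2 (2 * real k) * e"
    proof -
      have 1: "e * 1 \<le> e * log 2 (2 * real k)"
        using lg e0 by (intro mult_left_mono) auto
      then have "0 \<le> e * log 2 (2 * real k)" using e0 by linarith
      moreover have "5 * log 2 (2 * real k) * e = 5 * (e * log 2 (2 * real k))"
        "2 * e * log 2 (2 * real k) = 2 * (e * log 2 (2 * real k))" by (simp_all only: mult_ac)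
      ultimately show ?thesis using 1 by linarith
    qed
    ultimately show ?thesis by (rule bbd_mono)
  qed
qed

lemma opnorm_bbd: "bbd k M (opnorm k k M)" "0 \<le> opnorm k k M"
proof -
  have mv: "vnorm k (mv k k M x) = vnorm k (%i. \<Sum>j<k. M i j * x j)" for x
    by (intro vnorm_cong) (simp add: mv_def)
  have le: "vnorm k (mv k k M x) \<le> vnorm k x * sqrt (\<Sum>s<k. \<Sum>i<k. (M i s)\<^sup>2)" for x
    using vnorm_lc_le[of k k "%j i. M i j" x] unfolding mv lc_def by (simp add: mult.commute)
  have bdd: "bdd_above {vnorm k (mv k k M x) | x. vnorm k x \<le> 1}"
  proof (rule bdd_aboveI)
    fix a assume "a \<in> {vnorm k (mv k k M x) | x. vnorm k x \<le> 1}"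
    then obtain x where x: "a = vnorm k (mv k k M x)" "vnorm k x \<le> 1" by auto
    have "vnorm k x * sqrt (\<Sum>s<k. \<Sum>i<k. (M i s)\<^sup>2) \<le> 1 * sqrt (\<Sum>s<k. \<Sum>i<k. (M i s)\<^sup>2)"
      using x by (intro mult_right_mono) (auto intro!: real_sqrt_ge_zero sum_nonneg)
    then show "a \<le> sqrt (\<Sum>s<k. \<Sum>i<k. (M i s)\<^sup>2)" using le[of x] x by simp
  qed
  have up: "vnorm k (mv k k M x) \<le> opnorm k k M" if "vnorm k x \<le> 1" for x
    unfolding opnorm_def by (rule cSup_upper[OF _ bdd]) (use that in auto)
  show "0 \<le> opnorm k k M" using up[of "%_. 0"] by (simp add: order_trans[OF vnorm_nonneg] vnorm_def)
  show "bbd k M (opnorm k k M)"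
  proof (rule bbdI_mv)
    fix y
    show "vnorm k (%i. \<Sum>j<k. M i j * y j) \<le> opnorm k k M * vnorm k y"
    proof (cases "vnorm k y = 0")
      case True
      then show ?thesis using le[of y] unfolding mv by simp
    next
      case False
      then have p: "vnorm k y > 0" by (simp add: less_le)
      have "vnorm k (mv k k M (%i. 1 / vnorm k y * y i)) \<le> opnorm k k M"
        by (rule up) (unfold vnorm_scale, use p in simp)
      moreover have "(%i. \<Sum>j<k. M i j * (1 / vnorm k y * y j)) = (%i. 1 / vnorm k y * (\<Sum>j<k. M i j * y j))"
        unfolding sum_distrib_left by (simp add: mult_ac)
      ultimately have "\<bar>1 / vnorm k y\<bar> * vnorm k (%i. \<Sum>j<k. M i j * y j) \<le> opnorm k k M"
        unfolding mv vnorm_scale[symmetric] by simp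
      then show ?thesis using p by (simp add: field_simps)
    qed
  qed
qed

section \<open>Averaging over Euclidean balls\<close>

text \<open>Supplies the scaling r^k of ball volumes, from which the factor 5^k of the averaging
  argument arises.\<close>

lemma nn_integral_lborel_PiM_affine:
  fixes f :: "('i => real) => ennreal"
  assumes "finite I" "f \<in> borel_measurable (PiM I (%_. lborel))" and c: "0 < c"
  shows "(\<integral>\<^sup>+y. f y \<partial>PiM I (%_. lborel)) = ennreal c ^ card I * (\<integral>\<^sup>+y. f (\<lambda>i\<in>I. x i + c * y i) \<partial>PiM I (%_. lborel))"
  using assms(1,2)
proof (induction I arbitrary: f rule: finite_induct)
  case empty
  then show ?case by (simp add: PiM_empty nn_integral_count_space_finite restrict_def)
next
  case (insert j I)
  interpret product_sigma_finite "%_::'i. lborel :: real measure" by standard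
  interpret I: sigma_finite_measure "PiM I (%_. lborel :: real measure)" using insert.hyps by (intro sigma_finite)
  note [measurable] = insert.prems
  let ?P = "%J. PiM J (%_. lborel :: real measure)"
  define g where "g y = (\<integral>\<^sup>+a. f (y(j := x j + c * a)) \<partial>lborel)" for y
  have upd: "(%p. (fst p)(j := x j + c * snd p)) \<in> measurable (?P I \<Otimes>\<^sub>M lborel) (?P (insert j I))"
    by (rule measurable_fun_upd[where J = I]) auto
  have gm[measurable]: "g \<in> borel_measurable (?P I)"
    unfolding g_def by (rule lborel.borel_measurable_nn_integral)
      (use measurable_compose[OF upd insert.prems] in \<open>simp add: split_beta\<close>)
  have fm: "(%a. f (y(j := a))) \<in> borel_measurable lborel" if "y \<in> space (?P I)" for y
  proof -
    have "(%a. y(j := a)) \<in> measurable lborel (?P (insert j I))"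
      by (rule measurable_fun_upd[where J = I]) (use that in auto)
    from measurable_compose[OF this insert.prems] show ?thesis .
  qed
  have rm: "(%y. \<lambda>i\<in>insert j I. x i + c * y i) \<in> measurable (?P (insert j I)) (?P (insert j I))"
    by (intro measurable_restrict) measurable
  have "(\<integral>\<^sup>+y. f y \<partial>?P (insert j I)) = (\<integral>\<^sup>+y. (\<integral>\<^sup>+a. f (y(j := a)) \<partial>lborel) \<partial>?P I)"
    by (rule product_nn_integral_insert) (use insert in auto)
  also have "... = (\<integral>\<^sup>+y. ennreal c * g y \<partial>?P I)"
  proof (intro nn_integral_cong)
    fix y assume "y \<in> space (?P I)"
    then show "(\<integral>\<^sup>+a. f (y(j := a)) \<partial>lborel) = ennreal c * g y"
      using nn_integral_real_affine[of "%a. f (y(j := a))" c "x j"] fm[of y] c unfolding g_def by simp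
  qed
  also have "... = ennreal c * (\<integral>\<^sup>+y. g y \<partial>?P I)" by (rule nn_integral_cmult) (rule gm)
  also have "(\<integral>\<^sup>+y. g y \<partial>?P I) = ennreal c ^ card I * (\<integral>\<^sup>+y. g (\<lambda>i\<in>I. x i + c * y i) \<partial>?P I)"
    by (rule insert.IH) (rule gm)
  also have "(\<integral>\<^sup>+y. g (\<lambda>i\<in>I. x i + c * y i) \<partial>?P I)
     = (\<integral>\<^sup>+y. (\<integral>\<^sup>+a. f (\<lambda>i\<in>insert j I. x i + c * (y(j := a)) i) \<partial>lborel) \<partial>?P I)"
    unfolding g_def
  proof (intro nn_integral_cong)
    fix y a
    have "(\<lambda>i\<in>I. x i + c * y i)(j := x j + c * a) = (\<lambda>i\<in>insert j I. x i + c * (y(j := a)) i)"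
      using insert.hyps by (auto simp: restrict_def)
    then show "f ((\<lambda>i\<in>I. x i + c * y i)(j := x j + c * a)) = f (\<lambda>i\<in>insert j I. x i + c * (y(j := a)) i)" by simp
  qed
  also have "... = (\<integral>\<^sup>+y. f (\<lambda>i\<in>insert j I. x i + c * y i) \<partial>?P (insert j I))"
    by (rule product_nn_integral_insert[symmetric]) (use insert measurable_compose[OF rm insert.prems] in auto)
  finally show ?case unfolding card_insert_disjoint[OF insert.hyps] power_Suc mult.assoc .
qed

definition lball :: "nat => vec => real => vec set" where
  "lball k x r = {y \<in> space (PiM {..<k} (%_. lborel)). vnorm k (%i. y i - x i) \<le> r}"

lemma sets_lball[measurable]: "lball k x r \<in> sets (PiM {..<k} (%_. lborel))"
  unfolding lball_def vnorm_def by measurable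

lemma emeasure_lball:
  assumes r: "0 < r"
  shows "emeasure (PiM {..<k} (%_. lborel)) (lball k x r) = ennreal r ^ k * emeasure (PiM {..<k} (%_. lborel)) (lball k (%_. 0) 1)"
proof -
  let ?P = "PiM {..<k} (%_. lborel :: real measure)"
  have "emeasure ?P (lball k x r) = (\<integral>\<^sup>+y. indicator (lball k x r) y \<partial>?P)" by simp
  also have "... = ennreal r ^ card {..<k} * (\<integral>\<^sup>+y. indicator (lball k x r) (\<lambda>i\<in>{..<k}. x i + r * y i) \<partial>?P)"
    by (rule nn_integral_lborel_PiM_affine) (use r in auto)
  also have "(\<integral>\<^sup>+y. indicator (lball k x r) (\<lambda>i\<in>{..<k}. x i + r * y i) \<partial>?P) = (\<integral>\<^sup>+y. indicator (lball k (%_. 0) 1) y \<partial>?P)"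
  proof (intro nn_integral_cong)
    fix y assume y: "y \<in> space ?P"
    have "vnorm k (%i. (\<lambda>i\<in>{..<k}. x i + r * y i) i - x i) = vnorm k (%i. r * y i)" by (intro vnorm_cong) auto
    also have "... = r * vnorm k y" using r by (simp add: vnorm_scale)
    finally have e: "vnorm k (%i. (\<lambda>i\<in>{..<k}. x i + r * y i) i - x i) \<le> r \<longleftrightarrow> vnorm k y \<le> 1"
      using r by simp
    have "(\<lambda>i\<in>{..<k}. x i + r * y i) \<in> space ?P" by (auto simp: space_PiM)
    then show "indicator (lball k x r) (\<lambda>i\<in>{..<k}. x i + r * y i) = (indicator (lball k (%_. 0) 1) y :: ennreal)"
      using y e unfolding lball_def indicator_def by auto
  qed
  also have "... = emeasure ?P (lball k (%_. 0) 1)" by simp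
  finally show ?thesis by simp
qed

text \<open>The ball is trapped between two cubes. Its volume cancels from the averaging argument
  once it is known to be positive and finite.\<close>

lemma emeasure_unit_lball:
  "0 < emeasure (PiM {..<k} (%_. lborel)) (lball k (%_. 0) 1)" "emeasure (PiM {..<k} (%_. lborel)) (lball k (%_. 0) 1) < \<infinity>"
proof -
  let ?P = "PiM {..<k} (%_. lborel :: real measure)"
  interpret product_sigma_finite "%_::nat. lborel :: real measure" by standard
  have box: "emeasure ?P (PiE {..<k} (%_. {-s..s})) = ennreal (2 * s) ^ k" if "0 \<le> s" for s
    using that by (subst emeasure_PiM) auto
  have bs: "PiE {..<k} (%_. {-s..s}) \<in> sets ?P" for s by (intro sets_PiM_I_finite) auto
  define s where "s = 1 / (real k + 1)"
  have s: "s > 0" "real k * s \<le> 1" by (auto simp: s_def field_simps)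
  have "PiE {..<k} (%_. {-s..s}) \<subseteq> lball k (%_. 0) 1"
  proof
    fix y assume y: "y \<in> PiE {..<k} (%_. {-s..s})"
    have "vnorm k y \<le> (\<Sum>i<k. \<bar>y i\<bar>)" unfolding vnorm_L2 by (rule L2_set_le_sum_abs)
    also have "... \<le> (\<Sum>i<k. s)" using y by (intro sum_mono) (auto simp: abs_le_iff PiE_def Pi_def)
    also have "... \<le> 1" using s by simp
    finally show "y \<in> lball k (%_. 0) 1" using y by (auto simp: lball_def space_PiM PiE_def)
  qed
  then have "ennreal (2 * s) ^ k \<le> emeasure ?P (lball k (%_. 0) 1)"
    using box[of s] s emeasure_mono[of _ "lball k (%_. 0) 1" ?P] by (metis less_imp_le sets_lball)
  moreover have "0 < ennreal (2 * s) ^ k" using s by (simp add: ennreal_power)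
  ultimately show "0 < emeasure ?P (lball k (%_. 0) 1)" by (rule order.strict_trans2[rotated])
  have "lball k (%_. 0) 1 \<subseteq> PiE {..<k} (%_. {-1..1})"
  proof
    fix y assume y: "y \<in> lball k (%_. 0) 1"
    have "\<bar>y i\<bar> \<le> 1" if "i < k" for i
    proof -
      have "L2_set (%i. \<bar>y i\<bar>) {..<k} \<le> 1" using y by (simp add: lball_def vnorm_L2 L2_set_def)
      then show ?thesis using member_le_L2_set[of "{..<k}" i "%i. \<bar>y i\<bar>"] that by simp
    qed
    then have "- 1 \<le> y i \<and> y i \<le> 1" if "i < k" for i using that by (auto simp: abs_le_iff)
    then show "y \<in> PiE {..<k} (%_. {-1..1})" using y by (auto simp: lball_def space_PiM PiE_def)
  qed
  then have "emeasure ?P (lball k (%_. 0) 1) \<le> ennreal (2 * 1) ^ k"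
    using box[of 1] emeasure_mono[OF _ bs[of 1]] by simp
  also have "... = ennreal ((2 * 1) ^ k)" by (rule ennreal_power) simp
  also have "... < \<infinity>" by simp
  finally show "emeasure ?P (lball k (%_. 0) 1) < \<infinity>" .
qed

text \<open>Passes from a tail bound in every fixed direction to a bound uniform in the direction. Instead of a union
  bound over a net, average over the ball of radius 5/4: when the form is large at some unit vector, it is
  large on a whole ball of radius 1/4.\<close>
lemma (in prob_space) quadratic_form_uniform_bound:
  fixes N :: "'a => vecs"
  assumes meas: "\<And>i j. i < k ==> j < k ==> (%\<omega>. N \<omega> i j) \<in> borel_measurable M"
    and sym: "\<And>\<omega> i j. \<omega> \<in> space M ==> i < k ==> j < k ==> N \<omega> i j = N \<omega> j i"
    and t: "0 < t" and p: "0 \<le> p"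
    and tail: "\<And>x. vnorm k x \<noteq> 0 ==> prob {\<omega> \<in> space M. t * (vnorm k x)\<^sup>2 \<le> \<bar>bf k (N \<omega>) x x\<bar>} \<le> p"
  shows "\<exists>B\<in>events. prob B \<le> 5 ^ k * p \<and> (\<forall>\<omega>\<in>space M - B. \<forall>x. \<bar>bf k (N \<omega>) x x\<bar> \<le> 8/7 * t * (vnorm k x)\<^sup>2)"
proof -
  let ?P = "PiM {..<k} (%_. lborel :: real measure)"
  interpret psf: product_sigma_finite "%_::nat. lborel :: real measure" by standard
  interpret P: sigma_finite_measure ?P by (rule psf.sigma_finite) simp
  interpret MP: pair_sigma_finite M ?P by standard
  define V where "V = emeasure ?P (lball k (%_. 0) 1)"
  have V: "0 < V" "V < \<infinity>" unfolding V_def by (rule emeasure_unit_lball)+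
  define Q where "Q \<omega> y \<longleftrightarrow> vnorm k y \<noteq> 0 \<and> t * (vnorm k y)\<^sup>2 \<le> \<bar>bf k (N \<omega>) y y\<bar>" for \<omega> y
  define F :: "'a => vec => ennreal" where "F \<omega> y = (if vnorm k (%i. y i - 0) \<le> 5/4 \<and> Q \<omega> y then 1 else 0)" for \<omega> y
  have m1: "(%p. vnorm k (snd p)) \<in> borel_measurable (M \<Otimes>\<^sub>M ?P)"
    unfolding vnorm_def by measurable
  have m2: "(%p. bf k (N (fst p)) (snd p) (snd p)) \<in> borel_measurable (M \<Otimes>\<^sub>M ?P)"
    unfolding bf_def
  proof (intro borel_measurable_sum borel_measurable_times)
    fix i j assume "i \<in> {..<k}" "j \<in> {..<k}"
    then have [measurable]: "(%\<omega>. N \<omega> i j) \<in> borel_measurable M" "i \<in> {..<k}" "j \<in> {..<k}" using meas by auto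
    show "(%p. snd p i) \<in> borel_measurable (M \<Otimes>\<^sub>M ?P)" "(%p. snd p j) \<in> borel_measurable (M \<Otimes>\<^sub>M ?P)"
      "(%p. N (fst p) i j) \<in> borel_measurable (M \<Otimes>\<^sub>M ?P)" by measurable
  qed
  have Fm: "(%p. F (fst p) (snd p)) \<in> borel_measurable (M \<Otimes>\<^sub>M ?P)"
    unfolding F_def Q_def using m1 m2 by simp
  then have Fm': "case_prod F \<in> borel_measurable (M \<Otimes>\<^sub>M ?P)" by (simp add: split_beta')
  define G where "G \<omega> = (\<integral>\<^sup>+y. F \<omega> y \<partial>?P)" for \<omega>
  have Gm[measurable]: "G \<in> borel_measurable M" unfolding G_def using Fm' by (rule P.borel_measurable_nn_integral)
  have EG: "(\<integral>\<^sup>+\<omega>. G \<omega> \<partial>M) \<le> ennreal p * (ennreal (5/4) ^ k * V)"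
  proof -
    have "(\<integral>\<^sup>+\<omega>. G \<omega> \<partial>M) = (\<integral>\<^sup>+y. (\<integral>\<^sup>+\<omega>. F \<omega> y \<partial>M) \<partial>?P)"
      unfolding G_def by (rule MP.Fubini'[symmetric]) (use Fm' in \<open>simp\<close>)
    also have "... \<le> (\<integral>\<^sup>+y. ennreal p * indicator (lball k (%_. 0) (5/4)) y \<partial>?P)"
    proof (intro nn_integral_mono)
      fix y assume y: "y \<in> space ?P"
      have bm: "(%\<omega>. bf k (N \<omega>) y y) \<in> borel_measurable M"
        unfolding bf_def using meas by (intro borel_measurable_sum borel_measurable_times) auto
      show "(\<integral>\<^sup>+\<omega>. F \<omega> y \<partial>M) \<le> ennreal p * indicator (lball k (%_. 0) (5/4)) y"
      proof (cases "y \<in> lball k (%_. 0) (5/4) \<and> vnorm k y \<noteq> 0")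
        case True
        have S: "{\<omega> \<in> space M. t * (vnorm k y)\<^sup>2 \<le> \<bar>bf k (N \<omega>) y y\<bar>} \<in> sets M" using bm by measurable
        have "(\<integral>\<^sup>+\<omega>. F \<omega> y \<partial>M) \<le> (\<integral>\<^sup>+\<omega>. indicator {\<omega> \<in> space M. t * (vnorm k y)\<^sup>2 \<le> \<bar>bf k (N \<omega>) y y\<bar>} \<omega> \<partial>M)"
          by (intro nn_integral_mono) (auto simp: F_def Q_def indicator_def)
        also have "... = emeasure M {\<omega> \<in> space M. t * (vnorm k y)\<^sup>2 \<le> \<bar>bf k (N \<omega>) y y\<bar>}" using S by simp
        also have "... \<le> ennreal p" using tail[of y] True by (simp add: emeasure_eq_measure ennreal_leI)
        finally show ?thesis using True by simp
      next
        case False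
        then have "F \<omega> y = 0" for \<omega> using y by (auto simp: F_def Q_def lball_def)
        then show ?thesis by simp
      qed
    qed
    also have "... = ennreal p * emeasure ?P (lball k (%_. 0) (5/4))" by (rule nn_integral_cmult_indicator) (rule sets_lball)
    also have "emeasure ?P (lball k (%_. 0) (5/4)) = ennreal (5/4) ^ k * V" unfolding V_def by (rule emeasure_lball) simp
    finally show ?thesis .
  qed
  \<comment> \<open>The volume of a ball of radius 1/4. At a bad outcome \<open>F\<close> is 1 on
    such a ball, so Markov's inequality against the mean over the ball of radius 5/4 yields the
    factor ((5/4)/(1/4))^k = 5^k.\<close>
  define c where "c = ennreal (1/4) ^ k * V"
  obtain v where v: "V = ennreal v" "0 < v" using V by (cases V) auto
  have c: "c = ennreal ((1/4) ^ k * v)" unfolding c_def v(1) by (simp add: ennreal_power ennreal_mult[symmetric] v less_imp_le)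
  define B where "B = {\<omega> \<in> space M. c \<le> G \<omega>}"
  have BM: "B \<in> events" unfolding B_def by measurable
  have "c * emeasure M B = (\<integral>\<^sup>+\<omega>. c * indicator B \<omega> \<partial>M)" using BM by (simp add: nn_integral_cmult_indicator)
  also have "... \<le> (\<integral>\<^sup>+\<omega>. G \<omega> \<partial>M)" by (intro nn_integral_mono) (auto simp: B_def indicator_def)
  also note EG
  finally have "ennreal ((1/4) ^ k * v) * ennreal (prob B) \<le> ennreal p * (ennreal (5/4) ^ k * ennreal v)"
    unfolding c v(1) by (simp add: emeasure_eq_measure)
  then have "ennreal ((1/4) ^ k * v * prob B) \<le> ennreal (p * ((5/4) ^ k * v))"
    using v p by (simp add: ennreal_mult[symmetric] ennreal_power)
  then have "(1/4) ^ k * v * prob B \<le> p * ((5/4) ^ k * v)" using v p by simp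
  then have "prob B \<le> 5 ^ k * p" using v by (simp add: power_divide field_simps)
  moreover have "\<bar>bf k (N \<omega>) x x\<bar> \<le> 8/7 * t * (vnorm k x)\<^sup>2" if \<omega>: "\<omega> \<in> space M - B" for \<omega> x
  proof (rule ccontr)
    assume "\<not> ?thesis"
    \<comment> \<open>A violation at level 8/7 t loses the factor 7/8 nearby and so stays at least t
      on a ball of radius 1/4 about a unit vector. That ball lies within radius 5/4 and avoids the
      origin.\<close>
    then have "\<exists>y. \<bar>bf k (N \<omega>) y y\<bar> > 8/7 * t * (vnorm k y)\<^sup>2" by (auto simp: not_le)
    from qf_large_near_maximiser[OF _ _ this] sym \<omega> t
    obtain x where x: "vnorm k x = 1"
      "\<And>z. vnorm k (%i. z i - x i) \<le> 1/4 ==> t * (vnorm k z)\<^sup>2 \<le> \<bar>bf k (N \<omega>) z z\<bar>" by auto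
    have F1: "F \<omega> z = 1" if z: "z \<in> lball k x (1/4)" for z
    proof -
      have zx: "vnorm k (%i. z i - x i) \<le> 1/4" using z by (simp add: lball_def)
      have "vnorm k z \<le> vnorm k x + vnorm k (%i. z i - x i)" using vnorm_triangle[of k x "%i. z i - x i"] by simp
      moreover have "vnorm k x \<le> vnorm k z + vnorm k (%i. z i - x i)"
        using vnorm_diff[of k z "%i. z i - x i"] by simp
      ultimately have "vnorm k z \<le> 5/4" "vnorm k z \<noteq> 0" using zx x(1) by auto
      then show ?thesis using x(2)[OF zx] by (simp add: F_def Q_def)
    qed
    have "c = emeasure ?P (lball k x (1/4))" unfolding c_def V_def by (rule emeasure_lball[symmetric]) simp
    also have "... = (\<integral>\<^sup>+z. indicator (lball k x (1/4)) z \<partial>?P)" by simp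
    also have "... \<le> G \<omega>" unfolding G_def by (intro nn_integral_mono) (auto simp: indicator_def F1)
    finally show False using \<omega> by (simp add: B_def)
  qed
  ultimately show ?thesis using BM by blast
qed

subsection \<open>The Gaussian orthogonal ensemble\<close>

definition lf :: "nat => vecs => vecs => real" where
  "lf n X A = (\<Sum>i<n. \<Sum>j<n. X i j * A i j)"

text \<open>The covariance of \<open>lf n X A\<close> and \<open>lf n Y A\<close> for
  \<open>A\<close> from the GOE. Only the symmetric parts of X and Y enter, since \<open>A\<close>
  is symmetric.\<close>

definition gcov :: "nat => vecs => vecs => real" where
  "gcov n X Y = (\<Sum>i<n. \<Sum>j<n. (X i j + X j i) * (Y i j + Y j i)) / (2 * real n)"

abbreviation VV :: "vecs measure" where "VV \<equiv> Pi\<^sub>M UNIV (%_. Pi\<^sub>M UNIV (%_. borel))"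

lemma lf_add_left: "lf n (%i j. X i j + Y i j) A = lf n X A + lf n Y A"
  by (simp add: lf_def algebra_simps sum.distrib)

lemma gcov_add:
  "gcov n (%i j. X i j + Y i j) (%i j. X i j + Y i j) = gcov n X X + 2 * gcov n X Y + gcov n Y Y"
proof -
  have "(\<Sum>i<n. \<Sum>j<n. (X i j + Y i j + (X j i + Y j i)) * (X i j + Y i j + (X j i + Y j i)))
     = (\<Sum>i<n. \<Sum>j<n. (X i j + X j i) * (X i j + X j i)) + 2 * (\<Sum>i<n. \<Sum>j<n. (X i j + X j i) * (Y i j + Y j i))
       + (\<Sum>i<n. \<Sum>j<n. (Y i j + Y j i) * (Y i j + Y j i))"
    unfolding sum_distrib_left sum.distrib[symmetric] by (intro sum.cong refl) algebra
  then show ?thesis unfolding gcov_def by (simp only: add_divide_distrib times_divide_eq_right)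
qed

definition lt_idx :: "nat => (nat \<times> nat) set" where "lt_idx n = {(i, j). j \<le> i \<and> i < n}"

lemma lt_idx_Sigma: "lt_idx n = Sigma {..<n} (%i. {..i})" by (auto simp: lt_idx_def)

lemma finite_lt_idx[simp]: "finite (lt_idx n)" by (simp add: lt_idx_Sigma)

text \<open>Folds a sum over the square onto the lower triangle, where the independent entries
  live.\<close>

lemma sum_square_lt_idx:
  fixes g :: "nat => nat => real"
  shows "(\<Sum>i<n. \<Sum>j<n. g i j) = (\<Sum>(i,j)\<in>lt_idx n. if i = j then g i i else g i j + g j i)"
proof -
  have "(\<Sum>i<n. \<Sum>j<n. g i j) = (\<Sum>i<n. \<Sum>j\<le>i. if i = j then g i i else g i j + g j i)"
  proof (induction n)
    case (Suc n)
    have "(\<Sum>j\<le>n. if n = j then g n n else g n j + g j n) = (\<Sum>j<n. g n j + g j n) + g n n"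
      by (simp add: lessThan_Suc_atMost[symmetric])
    then show ?case using Suc.IH by (simp add: sum.distrib)
  qed simp
  then show ?thesis unfolding lt_idx_Sigma by (subst sum.Sigma[symmetric]) auto
qed

definition goe_sd :: "nat => nat \<times> nat => real" where
  "goe_sd n p = (if fst p = snd p then sqrt (2 / real n) else sqrt (1 / real n))"

definition goe_entry :: "nat => nat \<times> nat => real measure" where
  "goe_entry n p = density lborel (normal_density 0 (goe_sd n p))"

definition goe_fill :: "nat => (nat \<times> nat => real) => vecs" where
  "goe_fill n x = (%i j. if i < n \<and> j < n then x (max i j, min i j) else 0)"

lemma GOE_alt: "GOE n = distr (PiM (lt_idx n) (goe_entry n)) VV (goe_fill n)"
proof -
  have "(%(i, j). if i = j then density lborel (normal_density 0 (sqrt (2 / real n)))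
                  else density lborel (normal_density 0 (sqrt (1 / real n)))) = goe_entry n"
    by (auto simp: goe_entry_def goe_sd_def fun_eq_iff)
  then show ?thesis unfolding GOE_def lt_idx_def goe_fill_def by simp
qed

lemma goe_sd_pos: "0 < n ==> 0 < goe_sd n p" by (simp add: goe_sd_def)

lemma prob_space_goe_entry: "0 < n ==> prob_space (goe_entry n p)"
  unfolding goe_entry_def by (rule prob_space_normal_density) (rule goe_sd_pos)

lemma sets_goe_entry[measurable_cong]: "sets (goe_entry n p) = sets borel"
  by (simp add: goe_entry_def)

lemma goe_fill_measurable[measurable]: "goe_fill n \<in> measurable (PiM (lt_idx n) (goe_entry n)) VV"
  unfolding goe_fill_def
proof (intro measurable_abs_UNIV)
  fix i j
  show "(%x. if i < n \<and> j < n then x (max i j, min i j) else 0) \<in> borel_measurable (PiM (lt_idx n) (goe_entry n))"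
  proof (cases "i < n \<and> j < n")
    case True
    then have "(max i j, min i j) \<in> lt_idx n" by (auto simp: lt_idx_def)
    then have "(%x. x (max i j, min i j)) \<in> measurable (PiM (lt_idx n) (goe_entry n)) (goe_entry n (max i j, min i j))"
      by (rule measurable_component_singleton)
    then show ?thesis using True by (simp add: measurable_cong_sets[OF refl sets_goe_entry])
  qed auto
qed

lemma prob_space_GOE: "0 < n ==> prob_space (GOE n)"
  unfolding GOE_alt by (intro prob_space.prob_space_distr prob_space_PiM prob_space_goe_entry goe_fill_measurable)

lemma sets_GOE[measurable_cong]: "sets (GOE n) = sets VV"
  by (simp add: GOE_alt)

lemma space_VV: "space VV = UNIV" by (simp add: space_PiM PiE_def extensional_def Pi_def fun_eq_iff)

lemma space_GOE[simp]: "space (GOE n) = UNIV"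
  using sets_eq_imp_space_eq[OF sets_GOE] space_VV by simp

lemma measurable_VV_coord[measurable]: "(%A. A i j) \<in> borel_measurable VV"
proof -
  have "(%A. A i) \<in> measurable VV (PiM UNIV (%_. borel))" by (rule measurable_component_singleton) simp
  from measurable_compose[OF this measurable_component_singleton[of j UNIV "%_. borel"]] show ?thesis by simp
qed

lemma measurable_VV_I:
  assumes "\<And>i j. (%\<omega>. F \<omega> i j) \<in> borel_measurable M" shows "F \<in> measurable M VV"
proof -
  have "(%\<omega> i j. F \<omega> i j) \<in> measurable M VV" by (intro measurable_abs_UNIV assms)
  then show ?thesis by simp
qed

lemma measurable_lf[measurable]: "(%A. lf n X A) \<in> borel_measurable VV"
  unfolding lf_def by measurable

lemma measurable_GOE_iff: "measurable (GOE n) N = measurable VV N"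
  by (rule measurable_cong_sets[OF sets_GOE refl])

lemma goe_fill_symmetric: "goe_fill n x i j = goe_fill n x j i"
  by (simp add: goe_fill_def max.commute min.commute conj_commute)

lemma AE_GOE_symmetric: "AE A in GOE n. \<forall>i j. A i j = A j i"
  unfolding AE_all_countable
proof (intro allI)
  fix i j
  have "{A \<in> space VV. A i j = A j i} \<in> sets VV" by measurable
  then show "AE A in GOE n. A i j = A j i"
    unfolding GOE_alt by (subst AE_distr_iff) (auto intro: goe_fill_symmetric)
qed

lemma measurable_goe_entry_iff: "measurable (goe_entry n p) N = measurable borel N"
  by (rule measurable_cong_sets[OF sets_goe_entry refl])

lemma lf_goe_fill:
  "lf n X (goe_fill n x) = (\<Sum>p\<in>lt_idx n. (if fst p = snd p then X (fst p) (snd p) else X (fst p) (snd p) + X (snd p) (fst p)) * x p)"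
proof -
  have "lf n X (goe_fill n x) = (\<Sum>i<n. \<Sum>j<n. X i j * x (max i j, min i j))"
    unfolding lf_def goe_fill_def by simp
  also have "... = (\<Sum>(i,j)\<in>lt_idx n. if i = j then X i i * x (max i i, min i i) else X i j * x (max i j, min i j) + X j i * x (max j i, min j i))"
    by (rule sum_square_lt_idx)
  also have "... = (\<Sum>p\<in>lt_idx n. (if fst p = snd p then X (fst p) (snd p) else X (fst p) (snd p) + X (snd p) (fst p)) * x p)"
    by (intro sum.cong refl) (auto simp: lt_idx_def max_def min_def algebra_simps)
  finally show ?thesis .
qed

lemma goe_variance_sum:
  assumes "0 < n"
  shows "(\<Sum>p\<in>lt_idx n. ((if fst p = snd p then X (fst p) (snd p) else X (fst p) (snd p) + X (snd p) (fst p)) * goe_sd n p)\<^sup>2) = gcov n X X"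
proof -
  have "gcov n X X = (\<Sum>i<n. \<Sum>j<n. (X i j + X j i) * (X i j + X j i) / (2 * real n))"
    by (simp add: gcov_def sum_divide_distrib)
  also have "... = (\<Sum>p\<in>lt_idx n. ((if fst p = snd p then X (fst p) (snd p) else X (fst p) (snd p) + X (snd p) (fst p)) * goe_sd n p)\<^sup>2)"
    unfolding sum_square_lt_idx using assms
    by (intro sum.cong refl) (auto simp: goe_sd_def power_mult_distrib power2_eq_square field_simps)
  finally show ?thesis by simp
qed

lemma normal_density_scale_std:
  assumes "0 < s" shows "s * normal_density 0 s (s * y) = std_normal_density y"
  using assms by (simp add: normal_density_def std_normal_density_def power_mult_distrib real_sqrt_mult)

lemma char_normal_centered:
  assumes s: "0 < s"
  shows "(\<integral>x. iexp (c * x) \<partial>density lborel (%x. ennreal (normal_density 0 s x))) = complex_of_real (exp (- (c * s)\<^sup>2 / 2))"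
proof -
  have "(\<integral>x. iexp (c * x) \<partial>density lborel (%x. ennreal (normal_density 0 s x)))
      = (\<integral>x. normal_density 0 s x *\<^sub>R iexp (c * x) \<partial>lborel)"
    by (subst integral_density) auto
  also have "... = \<bar>s\<bar> *\<^sub>R (\<integral>y. normal_density 0 s (0 + s * y) *\<^sub>R iexp (c * (0 + s * y)) \<partial>lborel)"
    using s by (intro lborel_integral_real_affine) auto
  also have "... = (\<integral>y. s *\<^sub>R (normal_density 0 s (s * y) *\<^sub>R iexp (c * (s * y))) \<partial>lborel)"
    using s by (simp only: integral_scaleR_right abs_of_pos add_0_left)
  also have "... = (\<integral>y. std_normal_density y *\<^sub>R iexp ((c * s) * y) \<partial>lborel)"
    by (intro Bochner_Integration.integral_cong refl)
      (simp only: scaleR_scaleR normal_density_scale_std[OF s] mult.assoc)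
  also have "... = char std_normal_distribution (c * s)"
    unfolding char_def by (subst integral_density) auto
  also have "... = complex_of_real (exp (- (c * s)\<^sup>2 / 2))" by (simp add: char_std_normal_distribution)
  finally show ?thesis .
qed

lemma mgf_normal_centered:
  assumes s: "0 < s"
  shows "(\<integral>\<^sup>+x. ennreal (exp (c * x)) \<partial>density lborel (%x. ennreal (normal_density 0 s x))) = ennreal (exp ((c * s)\<^sup>2 / 2))"
proof -
  have e: "normal_density 0 s x * exp (c * x) = exp ((c * s)\<^sup>2 / 2) * normal_density (c * s\<^sup>2) s x" for x
  proof -
    have "- (x - 0)\<^sup>2 / (2 * s\<^sup>2) + c * x = (c * s)\<^sup>2 / 2 + - (x - c * s\<^sup>2)\<^sup>2 / (2 * s\<^sup>2)"
      using s by (simp add: power2_eq_square field_simps)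
    then have "exp (- (x - 0)\<^sup>2 / (2 * s\<^sup>2)) * exp (c * x) = exp ((c * s)\<^sup>2 / 2) * exp (- (x - c * s\<^sup>2)\<^sup>2 / (2 * s\<^sup>2))"
      unfolding mult_exp_exp by simp
    then show ?thesis unfolding normal_density_def by simp
  qed
  interpret prob_space "density lborel (%x. ennreal (normal_density (c * s\<^sup>2) s x))" by (rule prob_space_normal_density[OF s])
  have one: "(\<integral>\<^sup>+x. ennreal (normal_density (c * s\<^sup>2) s x) \<partial>lborel) = 1"
    using emeasure_space_1 by (simp add: emeasure_density)
  have "(\<integral>\<^sup>+x. ennreal (exp (c * x)) \<partial>density lborel (%x. ennreal (normal_density 0 s x)))
     = (\<integral>\<^sup>+x. ennreal (exp ((c * s)\<^sup>2 / 2)) * ennreal (normal_density (c * s\<^sup>2) s x) \<partial>lborel)"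
    by (subst nn_integral_density) (auto simp: ennreal_mult[symmetric] e)
  also have "... = ennreal (exp ((c * s)\<^sup>2 / 2))" by (simp add: nn_integral_cmult one)
  finally show ?thesis .
qed

text \<open>A linear functional of the matrix is a sum of independent centred normals over the lower
  triangle, of total variance \<open>gcov n X X\<close>. The law of the coupling rests on this
  formula, the tail bounds on the exponential moment that follows.\<close>

lemma GOE_char:
  assumes n: "0 < n"
  shows "(\<integral>A. iexp (lf n X A) \<partial>GOE n) = complex_of_real (exp (- gcov n X X / 2))"
proof -
  interpret product_sigma_finite "goe_entry n"
    by (rule product_sigma_finite.intro) (intro prob_space_imp_sigma_finite prob_space_goe_entry n)
  define c where "c p = (if fst p = snd p then X (fst p) (snd p) else X (fst p) (snd p) + X (snd p) (fst p))" for p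
  have int: "integrable (goe_entry n p) (%x. iexp (c p * x))" for p
  proof -
    interpret prob_space "goe_entry n p" by (rule prob_space_goe_entry[OF n])
    have "(%x. iexp (c p * x)) \<in> borel_measurable (goe_entry n p)"
      unfolding measurable_goe_entry_iff by measurable
    then show ?thesis by (intro integrable_const_bound[where B = 1]) (auto intro: AE_I2)
  qed
  have "(\<integral>A. iexp (lf n X A) \<partial>GOE n) = (\<integral>x. iexp (lf n X (goe_fill n x)) \<partial>PiM (lt_idx n) (goe_entry n))"
    unfolding GOE_alt by (rule integral_distr) auto
  also have "... = (\<integral>x. (\<Prod>p\<in>lt_idx n. iexp (c p * x p)) \<partial>PiM (lt_idx n) (goe_entry n))"
    unfolding lf_goe_fill c_def[symmetric]
    by (simp add: exp_sum sum_distrib_left)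
  also have "... = (\<Prod>p\<in>lt_idx n. \<integral>x. iexp (c p * x) \<partial>goe_entry n p)"
    by (rule product_integral_prod) (simp, rule int)
  also have "... = (\<Prod>p\<in>lt_idx n. complex_of_real (exp (- (c p * goe_sd n p)\<^sup>2 / 2)))"
    unfolding goe_entry_def by (intro prod.cong refl char_normal_centered goe_sd_pos n)
  also have "... = complex_of_real (exp (\<Sum>p\<in>lt_idx n. - (c p * goe_sd n p)\<^sup>2 / 2))"
    by (simp add: exp_sum)
  also have "(\<Sum>p\<in>lt_idx n. - (c p * goe_sd n p)\<^sup>2 / 2) = - gcov n X X / 2"
    unfolding goe_variance_sum[OF n, symmetric] c_def[symmetric] by (simp add: sum_negf sum_divide_distrib)
  finally show ?thesis .
qed

lemma GOE_mgf:
  assumes n: "0 < n"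
  shows "(\<integral>\<^sup>+A. ennreal (exp (lf n X A)) \<partial>GOE n) = ennreal (exp (gcov n X X / 2))"
proof -
  interpret product_sigma_finite "goe_entry n"
    by (rule product_sigma_finite.intro) (intro prob_space_imp_sigma_finite prob_space_goe_entry n)
  define c where "c p = (if fst p = snd p then X (fst p) (snd p) else X (fst p) (snd p) + X (snd p) (fst p))" for p
  have "(\<integral>\<^sup>+A. ennreal (exp (lf n X A)) \<partial>GOE n) = (\<integral>\<^sup>+x. ennreal (exp (lf n X (goe_fill n x))) \<partial>PiM (lt_idx n) (goe_entry n))"
    unfolding GOE_alt by (rule nn_integral_distr) auto
  also have "... = (\<integral>\<^sup>+x. (\<Prod>p\<in>lt_idx n. ennreal (exp (c p * x p))) \<partial>PiM (lt_idx n) (goe_entry n))"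
    unfolding lf_goe_fill c_def[symmetric]
    by (simp add: exp_sum prod_ennreal)
  also have "... = (\<Prod>p\<in>lt_idx n. \<integral>\<^sup>+x. ennreal (exp (c p * x)) \<partial>goe_entry n p)"
  proof (rule product_nn_integral_prod)
    fix p show "(%x. ennreal (exp (c p * x))) \<in> borel_measurable (goe_entry n p)"
      unfolding measurable_goe_entry_iff by measurable
  qed simp
  also have "... = (\<Prod>p\<in>lt_idx n. ennreal (exp ((c p * goe_sd n p)\<^sup>2 / 2)))"
    unfolding goe_entry_def by (intro prod.cong refl mgf_normal_centered goe_sd_pos n)
  also have "... = ennreal (exp (\<Sum>p\<in>lt_idx n. (c p * goe_sd n p)\<^sup>2 / 2))"
    by (simp add: exp_sum prod_ennreal)
  also have "(\<Sum>p\<in>lt_idx n. (c p * goe_sd n p)\<^sup>2 / 2) = gcov n X X / 2"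
    unfolding goe_variance_sum[OF n, symmetric] c_def[symmetric] by (simp add: sum_divide_distrib)
  finally show ?thesis .
qed

lemma GOE_upper_tail:
  assumes n: "0 < n" and s: "0 \<le> s" and v: "0 < gcov n X X"
  shows "measure (GOE n) {A \<in> space (GOE n). s \<le> lf n X A} \<le> exp (- s\<^sup>2 / (2 * gcov n X X))"
proof -
  interpret prob_space "GOE n" by (rule prob_space_GOE[OF n])
  define v' where "v' = gcov n X X"
  define l where "l = s / v'"
  have l: "0 \<le> l" using s v by (simp add: l_def v'_def)
  have sc: "lf n (%i j. l * X i j) A = l * lf n X A" for A
    by (simp add: lf_def sum_distrib_left mult.assoc)
  have gc: "gcov n (%i j. l * X i j) (%i j. l * X i j) = l\<^sup>2 * v'"
    unfolding v'_def gcov_def by (simp add: sum_distrib_left power2_eq_square algebra_simps)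
  have "emeasure (GOE n) {A \<in> space (GOE n). s \<le> lf n X A} = (\<integral>\<^sup>+A. indicator {A \<in> space (GOE n). s \<le> lf n X A} A \<partial>GOE n)"
  proof -
    have "{A \<in> space (GOE n). s \<le> lf n X A} \<in> sets (GOE n)" by measurable
    then show ?thesis by (rule nn_integral_indicator[symmetric])
  qed
  also have "... \<le> (\<integral>\<^sup>+A. ennreal (exp (- (l * s))) * ennreal (exp (lf n (%i j. l * X i j) A)) \<partial>GOE n)"
  proof (intro nn_integral_mono)
    fix A
    have "1 \<le> exp (- (l * s)) * exp (lf n (%i j. l * X i j) A)" if "s \<le> lf n X A"
      using mult_left_mono[OF that l] unfolding sc mult_exp_exp by simp
    then show "indicator {A \<in> space (GOE n). s \<le> lf n X A} A \<le> ennreal (exp (- (l * s))) * ennreal (exp (lf n (%i j. l * X i j) A))"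
      by (auto simp: indicator_def ennreal_mult[symmetric] simp del: ennreal_1 simp: ennreal_1[symmetric])
  qed
  also have "... = ennreal (exp (- (l * s))) * ennreal (exp (l\<^sup>2 * v' / 2))"
    using GOE_mgf[OF n, of "%i j. l * X i j"] by (simp add: nn_integral_cmult gc)
  also have "... = ennreal (exp (- s\<^sup>2 / (2 * v')))"
  proof -
    have "- (l * s) + l\<^sup>2 * v' / 2 = - s\<^sup>2 / (2 * v')"
      using v unfolding l_def v'_def[symmetric] by (simp add: power2_eq_square field_simps)
    then show ?thesis by (simp add: ennreal_mult[symmetric] mult_exp_exp)
  qed
  finally show ?thesis unfolding v'_def by (simp add: emeasure_eq_measure)
qed

text \<open>The form pairs \<open>A\<close> with the rank-one matrix x x^T, so it is centred normal
  of variance 2 |x|^4 / n. The exponent t^2 n / 4 is the square of the threshold over twice this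
  variance.\<close>

lemma GOE_quadratic_form_tail:
  assumes n: "0 < n" and k: "k \<le> n" and x: "vnorm k x \<noteq> 0" and t: "0 \<le> t"
  shows "measure (GOE n) {A \<in> space (GOE n). t * (vnorm k x)\<^sup>2 \<le> \<bar>bf k A x x\<bar>} \<le> 2 * exp (- (t\<^sup>2 * real n / 4))"
proof -
  interpret prob_space "GOE n" by (rule prob_space_GOE[OF n])
  define y where "y i = (if i < k then x i else 0)" for i
  define X where "X i j = y i * y j" for i j
  have yn: "(\<Sum>i<n. (y i)\<^sup>2) = (vnorm k x)\<^sup>2"
  proof -
    have "(\<Sum>i<n. (y i)\<^sup>2) = (\<Sum>i<k. (y i)\<^sup>2)" using k by (intro sum.mono_neutral_right) (auto simp: y_def)
    then show ?thesis by (simp add: vnorm_sq y_def)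
  qed
  have bX: "bf k A x x = lf n X A" for A
  proof -
    have "lf n X A = (\<Sum>i<n. \<Sum>j<k. y i * A i j * y j)"
      unfolding lf_def X_def using k by (intro sum.cong refl sum.mono_neutral_cong_right) (auto simp: y_def)
    also have "... = (\<Sum>i<k. \<Sum>j<k. y i * A i j * y j)" using k by (intro sum.mono_neutral_right) (auto simp: y_def)
    finally show ?thesis unfolding bf_def by (simp add: y_def)
  qed
  have g: "gcov n X X = 2 * (vnorm k x) ^ 4 / real n"
  proof -
    have "(\<Sum>i<n. \<Sum>j<n. (X i j + X j i) * (X i j + X j i)) = (\<Sum>i<n. \<Sum>j<n. 4 * ((y i)\<^sup>2 * (y j)\<^sup>2))"
      unfolding X_def by (simp add: power2_eq_square algebra_simps)
    also have "... = 4 * ((\<Sum>i<n. (y i)\<^sup>2) * (\<Sum>j<n. (y j)\<^sup>2))" unfolding sum_product by (simp add: sum_distrib_left)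
    finally show ?thesis unfolding gcov_def yn by (simp add: power2_eq_square power4_eq_xxxx)
  qed
  have gm: "gcov n (%i j. - X i j) (%i j. - X i j) = gcov n X X"
    unfolding gcov_def by (intro arg_cong2[where f = "(/)"] sum.cong refl) (simp add: algebra_simps)
  have lm: "lf n (%i j. - X i j) A = - lf n X A" for A by (simp add: lf_def sum_negf)
  have gp: "0 < gcov n X X" using x n unfolding g by simp
  let ?s = "t * (vnorm k x)\<^sup>2"
  have ex: "exp (- ?s\<^sup>2 / (2 * gcov n X X)) = exp (- (t\<^sup>2 * real n / 4))"
  proof -
    define w where "w = (vnorm k x)\<^sup>2"
    have w: "w \<noteq> 0" "(vnorm k x)^4 = w\<^sup>2" using x by (auto simp: w_def power2_eq_square power4_eq_xxxx)
    show ?thesis unfolding g w(2) w_def[symmetric] using w(1) n by (simp add: power_mult_distrib field_simps)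
  qed
  have "{A \<in> space (GOE n). ?s \<le> \<bar>bf k A x x\<bar>}
      \<subseteq> {A \<in> space (GOE n). ?s \<le> lf n X A} \<union> {A \<in> space (GOE n). ?s \<le> lf n (%i j. - X i j) A}"
    unfolding bX lm by auto
  then have "prob {A \<in> space (GOE n). ?s \<le> \<bar>bf k A x x\<bar>}
     \<le> prob ({A \<in> space (GOE n). ?s \<le> lf n X A} \<union> {A \<in> space (GOE n). ?s \<le> lf n (%i j. - X i j) A})"
    by (intro finite_measure_mono) measurable
  also have "... \<le> prob {A \<in> space (GOE n). ?s \<le> lf n X A} + prob {A \<in> space (GOE n). ?s \<le> lf n (%i j. - X i j) A}"
    by (intro measure_Un_le) measurable
  also have "... \<le> exp (- ?s\<^sup>2 / (2 * gcov n X X)) + exp (- ?s\<^sup>2 / (2 * gcov n X X))"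
    using GOE_upper_tail[OF n _ gp, of ?s] GOE_upper_tail[OF n, of ?s "%i j. - X i j"] t gp
    unfolding gm by (intro add_mono) auto
  finally show ?thesis unfolding ex by simp
qed

lemma GOE_block_bound:
  assumes n: "0 < n" and k: "k \<le> n" and t: "0 < t"
  shows "\<exists>B\<in>sets (GOE n). measure (GOE n) B \<le> 5 ^ k * (2 * exp (- (t\<^sup>2 * real n / 4))) \<and>
    (\<forall>A. A \<notin> B \<longrightarrow> (\<forall>x. \<bar>bf k A x x\<bar> \<le> 8/7 * t * (vnorm k x)\<^sup>2))"
proof -
  interpret prob_space "GOE n" by (rule prob_space_GOE[OF n])
  \<comment> \<open>The uniform bound asks for a matrix that is symmetric at every outcome, whereas
    \<open>A\<close> is symmetric almost surely. Symmetrising leaves the quadratic form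
    unchanged.\<close>
  define N where "N A i j = (A i j + A j i) / 2" for A :: vecs and i j
  have N: "bf k (N A) x x = bf k A x x" for A x
  proof -
    have "bf k (N A) x x = (bf k A x x + bf k (%i j. A j i) x x) / 2"
      by (simp add: bf_def N_def algebra_simps sum.distrib add_divide_distrib sum_divide_distrib)
    then show ?thesis using bf_trans[of k A x x] by simp
  qed
  have "\<exists>B\<in>sets (GOE n). prob B \<le> 5 ^ k * (2 * exp (- (t\<^sup>2 * real n / 4))) \<and>
     (\<forall>A\<in>space (GOE n) - B. \<forall>x. \<bar>bf k (N A) x x\<bar> \<le> 8/7 * t * (vnorm k x)\<^sup>2)"
  proof (rule quadratic_form_uniform_bound)
    show "(%A. N A i j) \<in> borel_measurable (GOE n)" for i j unfolding N_def by measurable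
    fix x assume "vnorm k x \<noteq> 0"
    from GOE_quadratic_form_tail[OF n k this] t
    show "prob {A \<in> space (GOE n). t * (vnorm k x)\<^sup>2 \<le> \<bar>bf k (N A) x x\<bar>} \<le> 2 * exp (- (t\<^sup>2 * real n / 4))"
      unfolding N by simp
  qed (use t in \<open>auto simp: N_def add.commute\<close>)
  then show ?thesis unfolding N by auto
qed

lemma GOE_opnorm_bound:
  assumes n: "0 < n"
  shows "\<exists>B\<in>sets (GOE n). measure (GOE n) B \<le> 2 * exp (- real n) \<and>
    (\<forall>A. A \<notin> B \<longrightarrow> (\<forall>x. \<bar>bf n A x x\<bar> \<le> 4 * (vnorm n x)\<^sup>2))"
proof -
  \<comment> \<open>The level t = 7/2 gives 8/7 t = 4, and the exponent (7/2)^2 n / 4 exceeds 3 n,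
    so that 5^n \<le> exp(2 n) still leaves exp(- n).\<close>
  obtain B where B: "B \<in> sets (GOE n)" "measure (GOE n) B \<le> 5 ^ n * (2 * exp (- ((7/2)\<^sup>2 * real n / 4)))"
    "\<And>A x. A \<notin> B ==> \<bar>bf n A x x\<bar> \<le> 8/7 * (7/2) * (vnorm n x)\<^sup>2"
    using GOE_block_bound[OF n order_refl, of "7/2"] by auto
  have "(5::real) \<le> exp 1 ^ 2"
  proof -
    have "(5/2::real) \<le> exp 1" using exp_lower_Taylor_quadratic[of 1] by simp
    then have "(5/2::real)^2 \<le> exp 1 ^ 2" by (intro power_mono) auto
    then show ?thesis by (simp add: power2_eq_square)
  qed
  then have "(5::real) ^ n \<le> (exp 1 ^ 2) ^ n" by (intro power_mono) auto
  also have "... = exp (2 * real n)" by (simp add: exp_of_nat_mult[symmetric] power_mult[symmetric] mult.commute)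
  finally have "5 ^ n * (2 * exp (- ((7/2)\<^sup>2 * real n / 4))) \<le> exp (2 * real n) * (2 * exp (- ((7/2)\<^sup>2 * real n / 4)))"
    by (intro mult_right_mono) auto
  also have "... = 2 * exp (2 * real n - (7/2)\<^sup>2 * real n / 4)"
  proof -
    have "exp a * (2 * exp (- b)) = 2 * exp (a - b)" for a b :: real by (simp add: exp_diff exp_minus divide_inverse)
    then show ?thesis .
  qed
  also have "... \<le> 2 * exp (- real n)"
  proof -
    have "2 * real n - (7/2)\<^sup>2 * real n / 4 \<le> - real n" by (simp add: power2_eq_square)
    then show ?thesis by simp
  qed
  finally have b: "5 ^ n * (2 * exp (- ((7/2)\<^sup>2 * real n / 4))) \<le> 2 * exp (- real n)" .
  show ?thesis
  proof (intro bexI[of _ B] conjI allI impI B(1))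
    show "measure (GOE n) B \<le> 2 * exp (- real n)" using B(2) b by (rule order_trans)
    fix A x assume "A \<notin> B"
    from B(3)[OF this, of x] show "\<bar>bf n A x x\<bar> \<le> 4 * (vnorm n x)\<^sup>2" by simp
  qed
qed

subsection \<open>One step of the coupling for fixed directions\<close>

definition proj :: "nat => vecs => nat => vecs" where
  "proj n Q k = (%i j. of_bool (i = j) - (\<Sum>s<k. Q s i * Q s j) / real n)"

text \<open>Compression of \<open>A\<close> to the orthogonal complement of Q 0, ..., Q (k-1): the
  part of \<open>A\<close> about which the past has revealed nothing.\<close>

definition strip :: "nat => vecs => nat => vecs => vecs" where
  "strip n Q k A = (%i j. if i < n \<and> j < n then \<Sum>a<n. \<Sum>b<n. proj n Q k i a * A a b * proj n Q k b j else 0)"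

text \<open>The columns of \<open>A'\<close> not yet read. Step t reads column t down to the
  diagonal, that is the entries whose larger index is t.\<close>

definition cut :: "nat => nat => vecs => vecs" where
  "cut n k C = (%i j. if i < n \<and> j < n \<and> k \<le> j then C i j else 0)"

definition znext :: "nat => vecs => nat => vecs => vecs => vec" where
  "znext n Q t A C = (%i. mv n n A (Q t) i + (C t t - vinner n (Q t) (mv n n A (Q t)) / real n) / 2 * Q t i
     + (\<Sum>s<t. (C s t - vinner n (Q s) (mv n n A (Q t)) / real n) * Q s i))"

lemma proj_sym: "proj n Q k i j = proj n Q k j i"
proof -
  have "(\<Sum>s<k. Q s i * Q s j) = (\<Sum>s<k. Q s j * Q s i)" by (intro sum.cong refl mult.commute)
  then show ?thesis unfolding proj_def by (auto simp: of_bool_def)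
qed

lemma proj_orth:
  assumes o: "orth n k Q" and n: "0 < n" and s: "s < k" and i: "i < n"
  shows "(\<Sum>j<n. proj n Q k i j * Q s j) = 0"
proof -
  have "(\<Sum>j<n. proj n Q k i j * Q s j) = (\<Sum>j<n. of_bool (i = j) * Q s j) - (\<Sum>j<n. \<Sum>r<k. Q r i * (Q r j * Q s j)) / real n"
    by (simp add: proj_def left_diff_distrib sum_subtractf sum_divide_distrib sum_distrib_right mult.assoc)
  also have "(\<Sum>j<n. \<Sum>r<k. Q r i * (Q r j * Q s j)) = (\<Sum>r<k. \<Sum>j<n. Q r i * (Q r j * Q s j))" by (rule sum.swap)
  also have "... = (\<Sum>r<k. Q r i * vinner n (Q r) (Q s))" by (simp add: vinner_def sum_distrib_left)
  also have "... = (\<Sum>r<k. if r = s then Q s i * real n else 0)"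
    using s by (intro sum.cong refl) (simp add: orthD[OF o])
  also have "... = Q s i * real n" using s by (simp add: sum.delta)
  finally show ?thesis using n i by simp
qed

lemma sum4_swap:
  fixes g :: "nat => nat => nat => nat => real"
  shows "(\<Sum>i<n. \<Sum>j<n. \<Sum>a<n. \<Sum>b<n. g i j a b) = (\<Sum>a<n. \<Sum>b<n. \<Sum>i<n. \<Sum>j<n. g i j a b)"
proof -
  have "(\<Sum>i<n. \<Sum>j<n. \<Sum>a<n. \<Sum>b<n. g i j a b) = (\<Sum>i<n. \<Sum>a<n. \<Sum>j<n. \<Sum>b<n. g i j a b)"
    by (rule sum.cong[OF refl], rule sum.swap)
  also have "... = (\<Sum>a<n. \<Sum>i<n. \<Sum>j<n. \<Sum>b<n. g i j a b)" by (rule sum.swap)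
  also have "... = (\<Sum>a<n. \<Sum>i<n. \<Sum>b<n. \<Sum>j<n. g i j a b)"
    by (rule sum.cong[OF refl], rule sum.cong[OF refl], rule sum.swap)
  also have "... = (\<Sum>a<n. \<Sum>b<n. \<Sum>i<n. \<Sum>j<n. g i j a b)"
    by (rule sum.cong[OF refl], rule sum.swap)
  finally show ?thesis .
qed

text \<open>Compression is self-adjoint for the pairing, so the projections pass from the random
  matrix to the test matrix and covariances become deterministic computations.\<close>

lemma lf_strip: "lf n X (strip n Q k A) = lf n (strip n Q k X) A"
proof -
  have "lf n X (strip n Q k A) = (\<Sum>i<n. \<Sum>j<n. \<Sum>a<n. \<Sum>b<n. X i j * proj n Q k i a * A a b * proj n Q k b j)"
    unfolding lf_def strip_def by (simp add: sum_distrib_left mult.assoc)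
  also have "... = (\<Sum>a<n. \<Sum>b<n. \<Sum>i<n. \<Sum>j<n. X i j * proj n Q k i a * A a b * proj n Q k b j)"
    by (rule sum4_swap)
  also have "... = (\<Sum>a<n. \<Sum>b<n. (\<Sum>i<n. \<Sum>j<n. proj n Q k a i * X i j * proj n Q k j b) * A a b)"
    unfolding sum_distrib_right
  proof (intro sum.cong refl)
    fix a b i j
    show "X i j * proj n Q k i a * A a b * proj n Q k b j = proj n Q k a i * X i j * proj n Q k j b * A a b"
      unfolding proj_sym[of n Q k a i] proj_sym[of n Q k j b] by (simp only: mult_ac)
  qed
  also have "... = lf n (strip n Q k X) A" unfolding lf_def strip_def by simp
  finally show ?thesis .
qed

lemma strip_orth_right:
  assumes o: "orth n k Q" and n: "0 < n" and s: "s < k" and i: "i < n"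
  shows "(\<Sum>j<n. strip n Q k A i j * Q s j) = 0"
proof -
  have "(\<Sum>j<n. strip n Q k A i j * Q s j) = (\<Sum>j<n. \<Sum>a<n. \<Sum>b<n. proj n Q k i a * A a b * (proj n Q k b j * Q s j))"
    unfolding strip_def using i by (simp add: sum_distrib_right mult.assoc)
  also have "... = (\<Sum>a<n. \<Sum>j<n. \<Sum>b<n. proj n Q k i a * A a b * (proj n Q k b j * Q s j))" by (rule sum.swap)
  also have "... = (\<Sum>a<n. \<Sum>b<n. \<Sum>j<n. proj n Q k i a * A a b * (proj n Q k b j * Q s j))"
    by (rule sum.cong[OF refl], rule sum.swap)
  also have "... = (\<Sum>a<n. \<Sum>b<n. proj n Q k i a * A a b * (\<Sum>j<n. proj n Q k b j * Q s j))"
    by (simp only: sum_distrib_left)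
  also have "... = 0" using proj_orth[OF o n s] by simp
  finally show ?thesis .
qed

lemma strip_transpose: "strip n Q k (%i j. A j i) i j = strip n Q k A j i"
proof -
  have "(\<Sum>a<n. \<Sum>b<n. proj n Q k i a * A b a * proj n Q k b j) = (\<Sum>b<n. \<Sum>a<n. proj n Q k i a * A b a * proj n Q k b j)"
    by (rule sum.swap)
  also have "... = (\<Sum>b<n. \<Sum>a<n. proj n Q k j b * A b a * proj n Q k a i)"
  proof (intro sum.cong refl)
    fix a b
    show "proj n Q k i a * A b a * proj n Q k b j = proj n Q k j b * A b a * proj n Q k a i"
      unfolding proj_sym[of n Q k i a] proj_sym[of n Q k b j] by (simp only: mult_ac)
  qed
  finally show ?thesis unfolding strip_def by auto
qed

lemma strip_orth_left:
  assumes o: "orth n k Q" and n: "0 < n" and s: "s < k" and j: "j < n"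
  shows "(\<Sum>i<n. strip n Q k A i j * Q s i) = 0"
proof -
  have "(\<Sum>i<n. strip n Q k A i j * Q s i) = (\<Sum>i<n. strip n Q k (%i j. A j i) j i * Q s i)"
    by (rule sum.cong[OF refl]) (subst strip_transpose, rule refl)
  also have "... = 0" by (rule strip_orth_right[OF o n s j])
  finally show ?thesis .
qed

lemma gcov_rank_one:
  assumes n: "0 < n"
  shows "gcov n (%i j. x i * y j) (%i j. x i * y j) = ((vnorm n x)\<^sup>2 * (vnorm n y)\<^sup>2 + (vinner n x y)\<^sup>2) / real n"
proof -
  have "(\<Sum>i<n. \<Sum>j<n. (x i * y j + x j * y i) * (x i * y j + x j * y i))
    = (\<Sum>i<n. \<Sum>j<n. (x i)\<^sup>2 * (y j)\<^sup>2) + (\<Sum>i<n. \<Sum>j<n. (y i)\<^sup>2 * (x j)\<^sup>2) + 2 * (\<Sum>i<n. \<Sum>j<n. (x i * y i) * (x j * y j))"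
    unfolding sum_distrib_left sum.distrib[symmetric] by (intro sum.cong refl) algebra
  also have "... = 2 * ((vnorm n x)\<^sup>2 * (vnorm n y)\<^sup>2 + (vinner n x y)\<^sup>2)"
    unfolding sum_product[symmetric] vnorm_sq[symmetric] vinner_def[of n x y, symmetric]
    by (simp add: power2_eq_square mult.commute)
  finally show ?thesis unfolding gcov_def by (simp only:)
qed

lemma gcov_rank_one_zero:
  assumes r: "\<And>i. i < n ==> (\<Sum>j<n. Y i j * y j) = 0" and l: "\<And>j. j < n ==> (\<Sum>i<n. Y i j * y i) = 0"
  shows "gcov n (%i j. x i * y j) Y = 0"
proof -
  have s1: "(\<Sum>i<n. \<Sum>j<n. x i * (Y i j * y j)) = 0" using r by (simp add: sum_distrib_left[symmetric])
  have s2: "(\<Sum>i<n. \<Sum>j<n. x i * (Y j i * y j)) = 0" using l by (simp add: sum_distrib_left[symmetric])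
  have s3: "(\<Sum>i<n. \<Sum>j<n. x j * (Y i j * y i)) = 0" by (subst sum.swap) (use s2 in simp)
  have s4: "(\<Sum>i<n. \<Sum>j<n. x j * (Y j i * y i)) = 0" by (subst sum.swap) (use s1 in simp)
  have "(\<Sum>i<n. \<Sum>j<n. (x i * y j + x j * y i) * (Y i j + Y j i))
    = (\<Sum>i<n. \<Sum>j<n. x i * (Y i j * y j)) + (\<Sum>i<n. \<Sum>j<n. x i * (Y j i * y j))
     + (\<Sum>i<n. \<Sum>j<n. x j * (Y i j * y i)) + (\<Sum>i<n. \<Sum>j<n. x j * (Y j i * y i))"
    unfolding sum.distrib[symmetric] by (intro sum.cong refl) algebra
  then show ?thesis unfolding gcov_def s1 s2 s3 s4 by simp
qed

lemma gcov_disjoint: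
  assumes "\<And>i j. i < n ==> j < n ==> X i j + X j i = 0 \<or> Y i j + Y j i = 0"
  shows "gcov n X Y = 0"
proof -
  have "(\<Sum>i<n. \<Sum>j<n. (X i j + X j i) * (Y i j + Y j i)) = 0"
  proof (intro sum.neutral ballI)
    fix i j assume "i \<in> {..<n}" "j \<in> {..<n}"
    then show "(X i j + X j i) * (Y i j + Y j i) = 0" using assms[of i j] by auto
  qed
  then show ?thesis unfolding gcov_def by simp
qed

definition zcol :: "nat => vec => vecs" where
  "zcol t w = (%i j. if j = t \<and> i \<le> t then w i else 0)"

lemma gcov_zcol:
  assumes t: "t < n"
  shows "gcov n (zcol t w) (zcol t w) = ((\<Sum>i\<le>t. (w i)\<^sup>2) + (w t)\<^sup>2) / real n"
proof -
  let ?W = "zcol t w"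
  have "(\<Sum>i<n. \<Sum>j<n. (?W i j + ?W j i) * (?W i j + ?W j i))
    = (\<Sum>i<n. \<Sum>j<n. (?W i j)\<^sup>2) + (\<Sum>i<n. \<Sum>j<n. (?W j i)\<^sup>2) + 2 * (\<Sum>i<n. \<Sum>j<n. ?W i j * ?W j i)"
    unfolding sum_distrib_left sum.distrib[symmetric] by (intro sum.cong refl) algebra
  also have "(\<Sum>i<n. \<Sum>j<n. (?W j i)\<^sup>2) = (\<Sum>i<n. \<Sum>j<n. (?W i j)\<^sup>2)" by (rule sum.swap)
  also have "(\<Sum>i<n. \<Sum>j<n. (?W i j)\<^sup>2) = (\<Sum>i<n. if i \<le> t then (w i)\<^sup>2 else 0)"
  proof (intro sum.cong refl)
    fix i
    have "(\<Sum>j<n. (?W i j)\<^sup>2) = (\<Sum>j<n. if j = t then (if i \<le> t then (w i)\<^sup>2 else 0) else 0)"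
      by (intro sum.cong refl) (auto simp: zcol_def)
    then show "(\<Sum>j<n. (?W i j)\<^sup>2) = (if i \<le> t then (w i)\<^sup>2 else 0)" using t by (simp add: sum.delta)
  qed
  also have "(\<Sum>i<n. if i \<le> t then (w i)\<^sup>2 else 0) = (\<Sum>i\<le>t. (w i)\<^sup>2)"
    using t by (intro sum.mono_neutral_cong_right) auto
  also have "(\<Sum>i<n. \<Sum>j<n. ?W i j * ?W j i) = (\<Sum>i<n. if i = t then (w t)\<^sup>2 else 0)"
  proof (intro sum.cong refl)
    fix i
    have "(\<Sum>j<n. ?W i j * ?W j i) = (\<Sum>j<n. if j = t then (if i = t then (w t)\<^sup>2 else 0) else 0)"
      by (intro sum.cong refl) (auto simp: zcol_def power2_eq_square)
    then show "(\<Sum>j<n. ?W i j * ?W j i) = (if i = t then (w t)\<^sup>2 else 0)" using t by (simp add: sum.delta)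
  qed
  also have "... = (w t)\<^sup>2" using t by (simp add: sum.delta)
  finally have "(\<Sum>i<n. \<Sum>j<n. (?W i j + ?W j i) * (?W i j + ?W j i)) = 2 * ((\<Sum>i\<le>t. (w i)\<^sup>2) + (w t)\<^sup>2)"
    by simp
  then show ?thesis unfolding gcov_def by (simp only:)
qed

lemma lf_zcol: assumes t: "t < n" shows "lf n (zcol t w) C = (\<Sum>i\<le>t. w i * C i t)"
proof -
  have "lf n (zcol t w) C = (\<Sum>i<n. if i \<le> t then w i * C i t else 0)"
    unfolding lf_def
  proof (intro sum.cong refl)
    fix i
    have "(\<Sum>j<n. zcol t w i j * C i j) = (\<Sum>j<n. if j = t then (if i \<le> t then w i * C i t else 0) else 0)"
      by (intro sum.cong refl) (auto simp: zcol_def)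
    then show "(\<Sum>j<n. zcol t w i j * C i j) = (if i \<le> t then w i * C i t else 0)" using t by (simp add: sum.delta)
  qed
  also have "... = (\<Sum>i\<le>t. w i * C i t)" using t by (intro sum.mono_neutral_cong_right) auto
  finally show ?thesis .
qed

text \<open>\<open>zadj\<close> and \<open>zwt\<close> form the adjoint of one step: they carry a
  test vector \<theta> for z_t to test data for \<open>A\<close> and for column t of
  \<open>A'\<close>. The coefficient at q_t is halved because the step replaces half of the q_t
  component of A q_t.\<close>

definition zadj :: "nat => vecs => nat => vec => vec" where
  "zadj n Q t \<theta> = (%i. \<theta> i - lc (Suc t) Q (%s. if s = t then vinner n \<theta> (Q t) / (2 * real n) else vinner n \<theta> (Q s) / real n) i)"

definition zwt :: "nat => vecs => nat => vec => vec" where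
  "zwt n Q t \<theta> = (%s. if s = t then vinner n \<theta> (Q t) / 2 else vinner n \<theta> (Q s))"

lemma lf_rank_one: "lf n (%i j. x i * y j) A = vinner n x (mv n n A y)"
  unfolding lf_def vinner_def mv_def by (simp add: sum_distrib_left mult_ac)

lemma vinner_znext:
  assumes t: "t < n"
  shows "vinner n \<theta> (znext n Q t A C) = lf n (%i j. zadj n Q t \<theta> i * Q t j) A + lf n (zcol t (zwt n Q t \<theta>)) C"
proof -
  let ?g = "mv n n A (Q t)"
  have "vinner n \<theta> (znext n Q t A C) = vinner n \<theta> ?g + (C t t - vinner n (Q t) ?g / real n) / 2 * vinner n \<theta> (Q t)
     + (\<Sum>s<t. (C s t - vinner n (Q s) ?g / real n) * vinner n \<theta> (Q s))"
    unfolding znext_def by (simp only: vinner_add_right vinner_scale_right vinner_sum_right)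
  moreover have "lf n (%i j. zadj n Q t \<theta> i * Q t j) A = vinner n \<theta> ?g
     - ((\<Sum>s<t. vinner n \<theta> (Q s) / real n * vinner n (Q s) ?g) + vinner n \<theta> (Q t) / (2 * real n) * vinner n (Q t) ?g)"
    unfolding lf_rank_one zadj_def vinner_diff_left lc_def vinner_sum_left
    unfolding sum.lessThan_Suc by simp
  moreover have "lf n (zcol t (zwt n Q t \<theta>)) C = (\<Sum>s<t. vinner n \<theta> (Q s) * C s t) + vinner n \<theta> (Q t) / 2 * C t t"
    unfolding lf_zcol[OF t] lessThan_Suc_atMost[symmetric] sum.lessThan_Suc zwt_def by simp
  moreover have "(\<Sum>s<t. (C s t - vinner n (Q s) ?g / real n) * vinner n \<theta> (Q s))
     = (\<Sum>s<t. vinner n \<theta> (Q s) * C s t) - (\<Sum>s<t. vinner n \<theta> (Q s) / real n * vinner n (Q s) ?g)"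
    unfolding sum_subtractf[symmetric] by (intro sum.cong refl) (simp add: field_simps)
  ultimately show ?thesis by (simp add: field_simps)
qed

text \<open>Along earlier directions \<open>A'\<close> supplies the variance removed from
  \<open>A\<close>. The numbers <q_t, A q_t>/n and A'_tt both have variance 2/n, so their average
  has 1/n, which is variance 1 along the unit vector q_t / sqrt n. In all other directions A q_t is
  standard already.\<close>

lemma zstep_variance:
  assumes o: "orth n (Suc t) Q" and t: "t < n"
  shows "gcov n (%i j. zadj n Q t \<theta> i * Q t j) (%i j. zadj n Q t \<theta> i * Q t j)
     + gcov n (zcol t (zwt n Q t \<theta>)) (zcol t (zwt n Q t \<theta>)) = (vnorm n \<theta>)\<^sup>2"
proof -
  have n: "real n > 0" "0 < n" using t by auto
  define a where "a s = vinner n \<theta> (Q s)" for s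
  define b where "b s = (if s = t then a t / (2 * real n) else a s / real n)" for s
  define S where "S = (\<Sum>s<t. (a s)\<^sup>2)"
  have z: "zadj n Q t \<theta> = (%i. \<theta> i - lc (Suc t) Q b i)" unfolding zadj_def b_def a_def by simp
  have qq: "(vnorm n (Q t))\<^sup>2 = real n" using orthD[OF o, of t t] by (simp add: vinner_self)
  have zq: "vinner n (zadj n Q t \<theta>) (Q t) = a t / 2"
    unfolding z vinner_diff_left vinner_commute[of n "lc (Suc t) Q b"] using n
    by (simp add: vinner_orth_lc[OF o] a_def[symmetric] b_def)
  have tl: "vinner n \<theta> (lc (Suc t) Q b) = (a t)\<^sup>2 / (2 * real n) + S / real n"
    unfolding lc_def vinner_sum_right
    unfolding sum.lessThan_Suc a_def[symmetric] S_def
    by (simp add: b_def power2_eq_square sum_divide_distrib)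
  have ll: "(vnorm n (lc (Suc t) Q b))\<^sup>2 = (a t)\<^sup>2 / (4 * real n) + S / real n"
  proof -
    have "(vnorm n (lc (Suc t) Q b))\<^sup>2 = real n * (\<Sum>s<Suc t. (b s)\<^sup>2)"
      by (simp add: vnorm_orth_lc[OF o] power_mult_distrib vnorm_sq)
    also have "(\<Sum>s<Suc t. (b s)\<^sup>2) = S / (real n)\<^sup>2 + (a t)\<^sup>2 / (4 * (real n)\<^sup>2)"
      unfolding sum.lessThan_Suc S_def by (simp add: b_def power_divide sum_divide_distrib power_mult_distrib)
    also have "real n * (S / (real n)\<^sup>2 + (a t)\<^sup>2 / (4 * (real n)\<^sup>2)) = (a t)\<^sup>2 / (4 * real n) + S / real n"
      using n by (simp add: power2_eq_square distrib_left)
    finally show ?thesis .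
  qed
  have zz: "(vnorm n (zadj n Q t \<theta>))\<^sup>2 = (vnorm n \<theta>)\<^sup>2 - 2 * ((a t)\<^sup>2 / (2 * real n) + S / real n) + ((a t)\<^sup>2 / (4 * real n) + S / real n)"
    unfolding z vnorm_diff_sq tl ll by simp
  have g1: "gcov n (%i j. zadj n Q t \<theta> i * Q t j) (%i j. zadj n Q t \<theta> i * Q t j)
     = (vnorm n (zadj n Q t \<theta>))\<^sup>2 + (a t / 2)\<^sup>2 / real n"
    unfolding gcov_rank_one[OF n(2)] zq qq using n by (simp add: add_divide_distrib)
  have g2: "gcov n (zcol t (zwt n Q t \<theta>)) (zcol t (zwt n Q t \<theta>)) = (S + (a t / 2)\<^sup>2 + (a t / 2)\<^sup>2) / real n"
    unfolding gcov_zcol[OF t] lessThan_Suc_atMost[symmetric] sum.lessThan_Suc S_def a_def zwt_def by simp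
  show ?thesis unfolding g1 g2 zz using n by (simp add: power2_eq_square field_simps)
qed

text \<open>Uncorrelated linear functionals of a Gaussian matrix are independent, so this vanishing
  expresses that z_t is independent of what remains of \<open>A\<close>.\<close>

lemma gcov_zadj_strip:
  assumes o: "orth n (Suc t) Q" and t: "t < n"
  shows "gcov n (%i j. zadj n Q t \<theta> i * Q t j) (strip n Q (Suc t) X) = 0"
proof -
  have n: "0 < n" using t by simp
  show ?thesis
    by (rule gcov_rank_one_zero) (use strip_orth_right[OF o n, of t] strip_orth_left[OF o n, of t] in auto)
qed

lemma gcov_zcol_cut: "gcov n (zcol t w) (cut n (Suc t) X) = 0"
  by (rule gcov_disjoint) (auto simp: zcol_def cut_def)

lemma lf_cut: "lf n X (cut n k C) = lf n (cut n k X) C"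
  unfolding lf_def cut_def by (intro sum.cong refl) auto

lemma GOE_pair_char:
  assumes n: "0 < n"
  shows "(\<integral>\<omega>. iexp (lf n X (fst \<omega>) + lf n X' (snd \<omega>)) \<partial>(GOE n \<Otimes>\<^sub>M GOE n))
    = complex_of_real (exp (- (gcov n X X + gcov n X' X') / 2))"
proof -
  interpret G: prob_space "GOE n" by (rule prob_space_GOE[OF n])
  interpret GG: pair_prob_space "GOE n" "GOE n" ..
  have m: "(%\<omega>. iexp (lf n X (fst \<omega>) + lf n X' (snd \<omega>))) \<in> borel_measurable (GOE n \<Otimes>\<^sub>M GOE n)"
  proof -
    have "(%\<omega>. lf n X (fst \<omega>)) \<in> borel_measurable (GOE n \<Otimes>\<^sub>M GOE n)"
      by (rule measurable_compose[OF measurable_fst]) (simp add: measurable_GOE_iff)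
    moreover have "(%\<omega>. lf n X' (snd \<omega>)) \<in> borel_measurable (GOE n \<Otimes>\<^sub>M GOE n)"
      by (rule measurable_compose[OF measurable_snd]) (simp add: measurable_GOE_iff)
    ultimately show ?thesis by measurable
  qed
  have int: "integrable (GOE n \<Otimes>\<^sub>M GOE n) (%(A, C). iexp (lf n X A + lf n X' C))"
    unfolding split_def by (rule GG.integrable_const_bound[where B = 1]) (use m in auto)
  have "(\<integral>\<omega>. iexp (lf n X (fst \<omega>) + lf n X' (snd \<omega>)) \<partial>(GOE n \<Otimes>\<^sub>M GOE n))
     = (\<integral>\<omega>. (case \<omega> of (A, C) => iexp (lf n X A + lf n X' C)) \<partial>(GOE n \<Otimes>\<^sub>M GOE n))"
    by (simp add: split_def)
  also have "... = (\<integral>A. (\<integral>C. iexp (lf n X A + lf n X' C) \<partial>GOE n) \<partial>GOE n)"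
    using GG.integral_fst'[OF int] by simp
  also have "... = (\<integral>A. iexp (lf n X A) * (\<integral>C. iexp (lf n X' C) \<partial>GOE n) \<partial>GOE n)"
  proof (intro Bochner_Integration.integral_cong refl)
    fix A
    have "iexp (lf n X A + lf n X' C) = iexp (lf n X A) * iexp (lf n X' C)" for C
      by (simp add: exp_add[symmetric] distrib_left)
    then show "(\<integral>C. iexp (lf n X A + lf n X' C) \<partial>GOE n) = iexp (lf n X A) * (\<integral>C. iexp (lf n X' C) \<partial>GOE n)"
      by (simp only: integral_mult_right_zero)
  qed
  also have "... = complex_of_real (exp (- gcov n X X / 2)) * complex_of_real (exp (- gcov n X' X' / 2))"
    unfolding GOE_char[OF n] integral_mult_left_zero ..
  also have "... = complex_of_real (exp (- (gcov n X X + gcov n X' X') / 2))"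
    unfolding of_real_mult[symmetric] mult_exp_exp by (simp add: add_divide_distrib)
  finally show ?thesis .
qed

lemma gauss_char:
  assumes I: "finite I"
  shows "(\<integral>x. iexp (\<Sum>i\<in>I. \<theta> i * x i) \<partial>PiM I (%_. std_normal_distribution)) = complex_of_real (exp (- (\<Sum>i\<in>I. (\<theta> i)\<^sup>2) / 2))"
proof -
  interpret product_sigma_finite "%_. std_normal_distribution"
    by (rule product_sigma_finite.intro) (intro prob_space_imp_sigma_finite prob_space_normal_density, simp)
  have int: "integrable std_normal_distribution (%x. iexp (c * x))" for c
  proof -
    interpret prob_space std_normal_distribution by (rule prob_space_normal_density) simp
    show ?thesis by (rule integrable_const_bound[where B = 1]) auto
  qed
  have "(\<integral>x. iexp (\<Sum>i\<in>I. \<theta> i * x i) \<partial>PiM I (%_. std_normal_distribution))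
     = (\<integral>x. (\<Prod>i\<in>I. iexp (\<theta> i * x i)) \<partial>PiM I (%_. std_normal_distribution))"
    using I by (simp add: exp_sum sum_distrib_left)
  also have "... = (\<Prod>i\<in>I. \<integral>x. iexp (\<theta> i * x) \<partial>std_normal_distribution)"
    by (rule product_integral_prod) (rule I, rule int)
  also have "... = (\<Prod>i\<in>I. complex_of_real (exp (- (\<theta> i)\<^sup>2 / 2)))"
    using char_std_normal_distribution unfolding char_def fun_eq_iff by simp
  also have "... = complex_of_real (exp (- (\<Sum>i\<in>I. (\<theta> i)\<^sup>2) / 2))"
    using I by (simp add: exp_sum[symmetric] sum_negf sum_divide_distrib of_real_prod[symmetric] del: of_real_prod)
  finally show ?thesis .
qed

subsection \<open>Law of one step\<close>

lemma strip_measurable[measurable]: "strip n Q k \<in> measurable VV VV"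
proof (rule measurable_VV_I)
  fix i j show "(%A. strip n Q k A i j) \<in> borel_measurable VV"
    unfolding strip_def by measurable
qed

lemma cut_measurable[measurable]: "cut n k \<in> measurable VV VV"
proof (rule measurable_VV_I)
  fix i j show "(%A. cut n k A i j) \<in> borel_measurable VV"
    unfolding cut_def by measurable
qed

abbreviation (input) GOE2 :: "nat => (vecs \<times> vecs) measure" where
  "GOE2 n \<equiv> GOE n \<Otimes>\<^sub>M GOE n"

lemma measurable_pair_GOE_iff: "measurable (GOE2 n) N = measurable (VV \<Otimes>\<^sub>M VV) N"
  by (rule measurable_cong_sets[OF sets_pair_measure_cong[OF sets_GOE sets_GOE] refl])

lemma znext_measurable[measurable]: "(%\<omega>. znext n Q t (fst \<omega>) (snd \<omega>) i) \<in> borel_measurable (VV \<Otimes>\<^sub>M VV)"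
proof -
  have [measurable]: "(%\<omega>. fst \<omega> i j) \<in> borel_measurable (VV \<Otimes>\<^sub>M VV)" "(%\<omega>. snd \<omega> i j) \<in> borel_measurable (VV \<Otimes>\<^sub>M VV)" for i j
    by (rule measurable_compose[OF measurable_fst measurable_VV_coord], rule measurable_compose[OF measurable_snd measurable_VV_coord])
  show ?thesis unfolding znext_def vinner_def mv_def by measurable
qed

text \<open>Codes the triple of new column, compressed \<open>A\<close> and unread part of
  \<open>A'\<close> as one finite real vector, to which uniqueness of characteristic functions
  applies. The tags 0, 1, 2 tell the components apart; the column keeps its time index t to fit the
  coordinates of the Gaussian columns.\<close>

definition pidx :: "nat => nat => (nat \<times> nat \<times> nat) set" where
  "pidx n t = {0} \<times> {t} \<times> {..<n} \<union> ({1} \<times> {..<n} \<times> {..<n} \<union> {2} \<times> {..<n} \<times> {..<n})"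

definition pack :: "nat => nat => (nat \<times> nat => real) => vecs => vecs => (nat \<times> nat \<times> nat => real)" where
  "pack n t z B C = restrict (%p. if fst p = 0 then z (snd p) else if fst p = 1 then B (fst (snd p)) (snd (snd p)) else C (fst (snd p)) (snd (snd p))) (pidx n t)"

definition unpack :: "nat => nat => (nat \<times> nat \<times> nat => real) => (nat \<times> nat => real) \<times> (vecs \<times> vecs)" where
  "unpack n t y = (restrict (%p. y (0, p)) ({t} \<times> {..<n}),
     ((%i j. if i < n \<and> j < n then y (1, i, j) else 0), (%i j. if i < n \<and> j < n then y (2, i, j) else 0)))"

lemma finite_pidx[simp]: "finite (pidx n t)" by (simp add: pidx_def)

lemma unpack_measurable: "unpack n t \<in> measurable (PiM (pidx n t) (%_. borel)) (PiM ({t} \<times> {..<n}) (%_. borel) \<Otimes>\<^sub>M (VV \<Otimes>\<^sub>M VV))"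
proof -
  have c: "(%y. if i < n \<and> j < n then y (c, i, j) else (0::real)) \<in> borel_measurable (PiM (pidx n t) (%_. borel))"
    if "c = 1 \<or> c = 2" for c i j :: nat
  proof (cases "i < n \<and> j < n")
    case True
    then have "(c, i, j) \<in> pidx n t" using that by (auto simp: pidx_def)
    then show ?thesis using True by simp
  next
    case False
    then have e: "(%y. if i < n \<and> j < n then y (c, i, j) else (0::real)) = (%_. 0)" by auto
    show ?thesis unfolding e by simp
  qed
  have z: "(%y. restrict (%p. y (0, p)) ({t} \<times> {..<n})) \<in> measurable (PiM (pidx n t) (%_. borel :: real measure)) (PiM ({t} \<times> {..<n}) (%_. borel))"
    by (intro measurable_restrict measurable_component_singleton) (auto simp: pidx_def)
  show ?thesis unfolding unpack_def
    by (intro measurable_Pair z measurable_VV_I) (use c in auto)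
qed

lemma unpack_pack:
  assumes "z \<in> extensional ({t} \<times> {..<n})" "\<And>i j. \<not> (i < n \<and> j < n) ==> B i j = 0" "\<And>i j. \<not> (i < n \<and> j < n) ==> C i j = 0"
  shows "unpack n t (pack n t z B C) = (z, (B, C))"
proof -
  have "restrict (%p. pack n t z B C (0, p)) ({t} \<times> {..<n}) = z"
    by (rule extensionalityI[OF _ assms(1)]) (auto simp: pack_def pidx_def)
  moreover have "(%i j. if i < n \<and> j < n then pack n t z B C (1, i, j) else 0) = B"
    using assms(2) by (intro ext) (auto simp: pack_def pidx_def)
  moreover have "(%i j. if i < n \<and> j < n then pack n t z B C (2, i, j) else 0) = C"
    using assms(3) by (intro ext) (auto simp: pack_def pidx_def)
  ultimately show ?thesis unfolding unpack_def by simp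
qed

lemma sum_pack:
  "(\<Sum>p\<in>pidx n t. \<theta> p * pack n t z B C p)
   = (\<Sum>p\<in>{t} \<times> {..<n}. \<theta> (0, p) * z p) + (lf n (%i j. \<theta> (1, i, j)) B + lf n (%i j. \<theta> (2, i, j)) C)"
proof -
  let ?g = "%p. \<theta> p * (if fst p = 0 then z (snd p) else if fst p = 1 then B (fst (snd p)) (snd (snd p)) else C (fst (snd p)) (snd (snd p)))"
  have im: "(\<Sum>p\<in>{c} \<times> S. h p) = (\<Sum>q\<in>S. h (c, q))" for c :: nat and S :: "(nat \<times> nat) set" and h :: "nat \<times> nat \<times> nat => real"
    by (rule sum.reindex_bij_witness[of _ "%q. (c, q)" snd]) auto
  have "(\<Sum>p\<in>pidx n t. \<theta> p * pack n t z B C p) = (\<Sum>p\<in>pidx n t. ?g p)"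
    by (intro sum.cong refl) (simp add: pack_def)
  also have "... = (\<Sum>p\<in>{0} \<times> {t} \<times> {..<n}. ?g p) + ((\<Sum>p\<in>{1} \<times> {..<n} \<times> {..<n}. ?g p) + (\<Sum>p\<in>{2} \<times> {..<n} \<times> {..<n}. ?g p))"
    unfolding pidx_def by (subst sum.union_disjoint, simp, simp, force, subst sum.union_disjoint) auto
  also have "(\<Sum>p\<in>{1} \<times> {..<n} \<times> {..<n}. ?g p) = lf n (%i j. \<theta> (1, i, j)) B"
    unfolding im lf_def sum.cartesian_product by (intro sum.cong refl) auto
  also have "(\<Sum>p\<in>{2} \<times> {..<n} \<times> {..<n}. ?g p) = lf n (%i j. \<theta> (2, i, j)) C"
    unfolding im lf_def sum.cartesian_product by (intro sum.cong refl) auto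
  also have "(\<Sum>p\<in>{0} \<times> {t} \<times> {..<n}. ?g p) = (\<Sum>p\<in>{t} \<times> {..<n}. \<theta> (0, p) * z p)"
    unfolding im by simp
  finally show ?thesis .
qed

lemma pack_measurable:
  assumes "\<And>p. p \<in> {t} \<times> {..<n} ==> (%\<omega>. z \<omega> p) \<in> borel_measurable M"
    "B \<in> measurable M VV" "C \<in> measurable M VV"
  shows "(%\<omega>. pack n t (z \<omega>) (B \<omega>) (C \<omega>)) \<in> measurable M (PiM (pidx n t) (%_. borel))"
  unfolding pack_def
proof (intro measurable_restrict)
  fix p assume p: "p \<in> pidx n t"
  have "(%\<omega>. B \<omega> (fst (snd p)) (snd (snd p))) \<in> borel_measurable M"
    by (rule measurable_compose[OF assms(2) measurable_VV_coord])
  moreover have "(%\<omega>. C \<omega> (fst (snd p)) (snd (snd p))) \<in> borel_measurable M"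
    by (rule measurable_compose[OF assms(3) measurable_VV_coord])
  moreover have "fst p = 0 ==> (%\<omega>. z \<omega> (snd p)) \<in> borel_measurable M" using p assms(1) by (auto simp: pidx_def)
  ultimately show "(%\<omega>. if fst p = 0 then z \<omega> (snd p) else if fst p = 1 then B \<omega> (fst (snd p)) (snd (snd p)) else C \<omega> (fst (snd p)) (snd (snd p))) \<in> borel_measurable M"
    by (cases "fst p = 0") auto
qed

text \<open>With fixed directions the triple is linear in (A, A'), so both laws are centred Gaussian
  and equality of characteristic functions reduces to covariances: the column has variance
  |\<theta>|^2 in direction \<theta> and is uncorrelated with the other two parts.\<close>

lemma one_step_distr_eq:
  assumes o: "orth n (Suc t) Q" and t: "t < n"
  shows "distr (GOE2 n) (PiM (pidx n t) (%_. borel))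
      (%\<omega>. pack n t (%p. znext n Q t (fst \<omega>) (snd \<omega>) (snd p)) (strip n Q (Suc t) (fst \<omega>)) (cut n (Suc t) (snd \<omega>)))
    = distr (gauss ({t} \<times> {..<n}) \<Otimes>\<^sub>M GOE2 n) (PiM (pidx n t) (%_. borel))
      (%x. pack n t (fst x) (strip n Q (Suc t) (fst (snd x))) (cut n (Suc t) (snd (snd x))))"
    (is "distr ?\<Omega> ?P ?F = distr (?G \<Otimes>\<^sub>M ?\<Omega>) ?P ?H")
proof -
  have n: "0 < n" using t by simp
  interpret G: prob_space "GOE n" by (rule prob_space_GOE[OF n])
  interpret GG: pair_prob_space "GOE n" "GOE n" ..
  interpret g: prob_space ?G by (rule prob_space_gauss)
  interpret gGG: pair_prob_space ?G ?\<Omega> ..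
  have Fm: "?F \<in> measurable ?\<Omega> ?P"
    unfolding measurable_pair_GOE_iff by (rule pack_measurable) measurable
  have sg: "sets ?G = sets (PiM ({t} \<times> {..<n}) (%_. borel))" by (rule sets_gauss)
  have stm: "strip n Q (Suc t) \<in> measurable (GOE n) VV" "cut n (Suc t) \<in> measurable (GOE n) VV"
    unfolding measurable_GOE_iff by (rule strip_measurable, rule cut_measurable)
  have f: "(%x. fst (snd x)) \<in> measurable (?G \<Otimes>\<^sub>M ?\<Omega>) (GOE n)" "(%x. snd (snd x)) \<in> measurable (?G \<Otimes>\<^sub>M ?\<Omega>) (GOE n)"
    by measurable
  note f' = measurable_compose[OF f(1) stm(1)] measurable_compose[OF f(2) stm(2)]
  have Hm: "?H \<in> measurable (?G \<Otimes>\<^sub>M ?\<Omega>) ?P"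
  proof (rule pack_measurable[OF _ f'])
    fix p assume "p \<in> {t} \<times> {..<n}"
    then have "(%x. x p) \<in> borel_measurable ?G"
      unfolding measurable_cong_sets[OF sg refl] by (rule measurable_component_singleton)
    then show "(%x. fst x p) \<in> borel_measurable (?G \<Otimes>\<^sub>M ?\<Omega>)" by (rule measurable_compose[OF measurable_fst])
  qed
  have eq: "(\<integral>y. iexp (\<Sum>p\<in>pidx n t. \<theta> p * y p) \<partial>distr ?\<Omega> ?P ?F) = (\<integral>y. iexp (\<Sum>p\<in>pidx n t. \<theta> p * y p) \<partial>distr (?G \<Otimes>\<^sub>M ?\<Omega>) ?P ?H)"
    for \<theta> :: "nat \<times> nat \<times> nat => real"
  proof -
  let ?e = "%y. iexp (\<Sum>p\<in>pidx n t. \<theta> p * y p)"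
  have em: "?e \<in> borel_measurable ?P" by measurable
  define th where "th i = \<theta> (0, t, i)" for i
  define X1 where "X1 = strip n Q (Suc t) (%i j. \<theta> (1, i, j))"
  define X2 where "X2 = cut n (Suc t) (%i j. \<theta> (2, i, j))"
  define Y1 where "Y1 i j = zadj n Q t th i * Q t j" for i j
  define Y2 where "Y2 = zcol t (zwt n Q t th)"
  have s0: "(\<Sum>p\<in>{t} \<times> {..<n}. \<theta> (0, p) * z (snd p)) = vinner n th z" for z :: vec
    unfolding th_def vinner_def by (rule sum.reindex_bij_witness[of _ "%i. (t, i)" snd]) auto
  have "(\<integral>y. ?e y \<partial>distr ?\<Omega> ?P ?F) = (\<integral>\<omega>. ?e (?F \<omega>) \<partial>?\<Omega>)" by (rule integral_distr[OF Fm em])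
  also have "... = (\<integral>\<omega>. iexp (lf n (%i j. Y1 i j + X1 i j) (fst \<omega>) + lf n (%i j. Y2 i j + X2 i j) (snd \<omega>)) \<partial>?\<Omega>)"
  proof (intro Bochner_Integration.integral_cong refl)
    fix \<omega>
    have "(\<Sum>p\<in>pidx n t. \<theta> p * ?F \<omega> p) = lf n (%i j. Y1 i j + X1 i j) (fst \<omega>) + lf n (%i j. Y2 i j + X2 i j) (snd \<omega>)"
      unfolding sum_pack s0 vinner_znext[OF t] lf_strip lf_cut[of n _ "Suc t"] lf_add_left X1_def X2_def Y1_def Y2_def
      by simp
    then show "?e (?F \<omega>) = iexp (lf n (%i j. Y1 i j + X1 i j) (fst \<omega>) + lf n (%i j. Y2 i j + X2 i j) (snd \<omega>))" by simp
  qed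
  also have "... = complex_of_real (exp (- (gcov n (%i j. Y1 i j + X1 i j) (%i j. Y1 i j + X1 i j) + gcov n (%i j. Y2 i j + X2 i j) (%i j. Y2 i j + X2 i j)) / 2))"
    by (rule GOE_pair_char[OF n])
  also have "gcov n (%i j. Y1 i j + X1 i j) (%i j. Y1 i j + X1 i j) + gcov n (%i j. Y2 i j + X2 i j) (%i j. Y2 i j + X2 i j)
     = (vnorm n th)\<^sup>2 + (gcov n X1 X1 + gcov n X2 X2)"
  proof -
    have a: "gcov n Y1 X1 = 0" unfolding Y1_def[abs_def] X1_def by (rule gcov_zadj_strip[OF o t])
    have b: "gcov n Y2 X2 = 0" unfolding Y2_def X2_def by (rule gcov_zcol_cut)
    have c: "gcov n Y1 Y1 + gcov n Y2 Y2 = (vnorm n th)\<^sup>2" unfolding Y1_def[abs_def] Y2_def by (rule zstep_variance[OF o t])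
    show ?thesis unfolding gcov_add a b using c by simp
  qed
  finally have L: "(\<integral>y. ?e y \<partial>distr ?\<Omega> ?P ?F) = complex_of_real (exp (- ((vnorm n th)\<^sup>2 + (gcov n X1 X1 + gcov n X2 X2)) / 2))" .
  define u where "u z = iexp (\<Sum>p\<in>{t} \<times> {..<n}. \<theta> (0, p) * z p)" for z :: "nat \<times> nat => real"
  define w where "w \<omega> = iexp (lf n X1 (fst \<omega>) + lf n X2 (snd \<omega>))" for \<omega> :: "vecs \<times> vecs"
  have eH: "?e (?H x) = u (fst x) * w (snd x)" for x
    unfolding sum_pack lf_strip lf_cut[of n _ "Suc t"] X1_def[symmetric] X2_def[symmetric] u_def w_def
    by (simp add: exp_add[symmetric] distrib_left)
  have int: "integrable (?G \<Otimes>\<^sub>M ?\<Omega>) (%x. u (fst x) * w (snd x))"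
    by (rule gGG.integrable_const_bound[where B = 1])
      (use measurable_compose[OF Hm em] in \<open>simp_all only: eH\<close>, simp add: u_def w_def norm_mult)
  have "(\<integral>y. ?e y \<partial>distr (?G \<Otimes>\<^sub>M ?\<Omega>) ?P ?H) = (\<integral>x. ?e (?H x) \<partial>(?G \<Otimes>\<^sub>M ?\<Omega>))" by (rule integral_distr[OF Hm em])
  also have "... = (\<integral>x. u (fst x) * w (snd x) \<partial>(?G \<Otimes>\<^sub>M ?\<Omega>))" by (simp only: eH)
  also have "... = (\<integral>z. (\<integral>\<omega>. u z * w \<omega> \<partial>?\<Omega>) \<partial>?G)"
    using gGG.integral_fst'[OF int] by simp
  also have "... = (\<integral>z. u z \<partial>?G) * (\<integral>\<omega>. w \<omega> \<partial>?\<Omega>)" by simp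
  also have "(\<integral>\<omega>. w \<omega> \<partial>?\<Omega>) = complex_of_real (exp (- (gcov n X1 X1 + gcov n X2 X2) / 2))"
    unfolding w_def by (rule GOE_pair_char[OF n])
  also have "(\<integral>z. u z \<partial>?G) = complex_of_real (exp (- (vnorm n th)\<^sup>2 / 2))"
  proof -
    have "(\<Sum>p\<in>{t} \<times> {..<n}. (\<theta> (0, p))\<^sup>2) = (vnorm n th)\<^sup>2"
      unfolding vnorm_sq th_def by (rule sum.reindex_bij_witness[of _ "%i. (t, i)" snd]) auto
    then show ?thesis unfolding u_def using gauss_char[of "{t} \<times> {..<n}" "%p. \<theta> (0, p)"] by simp
  qed
  finally have R: "(\<integral>y. ?e y \<partial>distr (?G \<Otimes>\<^sub>M ?\<Omega>) ?P ?H)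
      = complex_of_real (exp (- (vnorm n th)\<^sup>2 / 2)) * complex_of_real (exp (- (gcov n X1 X1 + gcov n X2 X2) / 2))" .
  have "exp (- ((vnorm n th)\<^sup>2 + (gcov n X1 X1 + gcov n X2 X2)) / 2)
      = exp (- (vnorm n th)\<^sup>2 / 2) * exp (- (gcov n X1 X1 + gcov n X2 X2) / 2)"
    unfolding mult_exp_exp by (simp add: add_divide_distrib)
  then show ?thesis unfolding L R by simp
  qed
  show ?thesis
    by (rule measure_eqI_char_PiM[OF finite_pidx GG.prob_space_distr[OF Fm] gGG.prob_space_distr[OF Hm] _ _ eq]) simp_all
qed

text \<open>The equality of laws as an iterated integral: the new column is integrated over its own
  Gaussian measure with the rest of the randomness kept as a fresh pair.\<close>

lemma one_step_law:
  assumes o: "orth n (Suc t) Q" and t: "t < n"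
    and h: "h \<in> borel_measurable (PiM ({t} \<times> {..<n}) (%_. borel) \<Otimes>\<^sub>M (VV \<Otimes>\<^sub>M VV))"
  shows "(\<integral>\<^sup>+\<omega>. h (restrict (%p. znext n Q t (fst \<omega>) (snd \<omega>) (snd p)) ({t} \<times> {..<n}), (strip n Q (Suc t) (fst \<omega>), cut n (Suc t) (snd \<omega>))) \<partial>(GOE2 n))
    = (\<integral>\<^sup>+z. (\<integral>\<^sup>+\<omega>. h (z, (strip n Q (Suc t) (fst \<omega>), cut n (Suc t) (snd \<omega>))) \<partial>(GOE2 n)) \<partial>gauss ({t} \<times> {..<n}))"
    (is "(\<integral>\<^sup>+\<omega>. ?l \<omega> \<partial>?\<Omega>) = (\<integral>\<^sup>+z. (\<integral>\<^sup>+\<omega>. ?r z \<omega> \<partial>?\<Omega>) \<partial>?G)")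
proof -
  have n: "0 < n" using t by simp
  interpret G: prob_space "GOE n" by (rule prob_space_GOE[OF n])
  interpret GG: pair_prob_space "GOE n" "GOE n" ..
  interpret g: prob_space ?G by (rule prob_space_gauss)
  interpret gGG: pair_prob_space ?G ?\<Omega> ..
  let ?P = "PiM (pidx n t) (%_. borel :: real measure)"
  let ?F = "%\<omega>. pack n t (%p. znext n Q t (fst \<omega>) (snd \<omega>) (snd p)) (strip n Q (Suc t) (fst \<omega>)) (cut n (Suc t) (snd \<omega>))"
  let ?F' = "%\<omega>. pack n t (restrict (%p. znext n Q t (fst \<omega>) (snd \<omega>) (snd p)) ({t} \<times> {..<n})) (strip n Q (Suc t) (fst \<omega>)) (cut n (Suc t) (snd \<omega>))"
  let ?H = "%x. pack n t (fst x) (strip n Q (Suc t) (fst (snd x))) (cut n (Suc t) (snd (snd x)))"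
  have FF: "?F \<omega> = ?F' \<omega>" for \<omega> unfolding pack_def by (rule restrict_ext) (auto simp: pidx_def)
  have sg: "sets ?G = sets (PiM ({t} \<times> {..<n}) (%_. borel))" by (rule sets_gauss)
  have Fm: "?F \<in> measurable ?\<Omega> ?P"
    unfolding measurable_pair_GOE_iff by (rule pack_measurable) measurable
  have stm: "strip n Q (Suc t) \<in> measurable (GOE n) VV" "cut n (Suc t) \<in> measurable (GOE n) VV"
    unfolding measurable_GOE_iff by (rule strip_measurable, rule cut_measurable)
  have f: "(%x. fst (snd x)) \<in> measurable (?G \<Otimes>\<^sub>M ?\<Omega>) (GOE n)" "(%x. snd (snd x)) \<in> measurable (?G \<Otimes>\<^sub>M ?\<Omega>) (GOE n)"
    by measurable
  note f' = measurable_compose[OF f(1) stm(1)] measurable_compose[OF f(2) stm(2)]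
  have Hm: "?H \<in> measurable (?G \<Otimes>\<^sub>M ?\<Omega>) ?P"
  proof (rule pack_measurable[OF _ f'])
    fix p assume "p \<in> {t} \<times> {..<n}"
    then have "(%x. x p) \<in> borel_measurable ?G"
      unfolding measurable_cong_sets[OF sg refl] by (rule measurable_component_singleton)
    then show "(%x. fst x p) \<in> borel_measurable (?G \<Otimes>\<^sub>M ?\<Omega>)" by (rule measurable_compose[OF measurable_fst])
  qed
  have hu: "(%y. h (unpack n t y)) \<in> borel_measurable ?P" by (rule measurable_compose[OF unpack_measurable h])
  have up: "unpack n t (pack n t z (strip n Q (Suc t) A) (cut n (Suc t) C)) = (z, (strip n Q (Suc t) A, cut n (Suc t) C))"
    if "z \<in> extensional ({t} \<times> {..<n})" for z A C
    by (rule unpack_pack[OF that]) (auto simp: strip_def cut_def)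
  have "(\<integral>\<^sup>+\<omega>. ?l \<omega> \<partial>?\<Omega>) = (\<integral>\<^sup>+\<omega>. h (unpack n t (?F \<omega>)) \<partial>?\<Omega>)"
    unfolding FF by (subst up) auto
  also have "... = (\<integral>\<^sup>+y. h (unpack n t y) \<partial>distr ?\<Omega> ?P ?F)" by (rule nn_integral_distr[symmetric, OF Fm]) (use hu in simp)
  also have "... = (\<integral>\<^sup>+y. h (unpack n t y) \<partial>distr (?G \<Otimes>\<^sub>M ?\<Omega>) ?P ?H)" unfolding one_step_distr_eq[OF o t] ..
  also have "... = (\<integral>\<^sup>+x. h (unpack n t (?H x)) \<partial>(?G \<Otimes>\<^sub>M ?\<Omega>))" by (rule nn_integral_distr[OF Hm]) (use hu in simp)
  also have "... = (\<integral>\<^sup>+x. (case x of (z, \<omega>) => ?r z \<omega>) \<partial>(?G \<Otimes>\<^sub>M ?\<Omega>))"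
  proof (intro nn_integral_cong)
    fix x assume "x \<in> space (?G \<Otimes>\<^sub>M ?\<Omega>)"
    then have "fst x \<in> extensional ({t} \<times> {..<n})" by (auto simp: space_pair_measure space_PiM PiE_def)
    then show "h (unpack n t (?H x)) = (case x of (z, \<omega>) => ?r z \<omega>)" by (subst up) (auto simp: split_def)
  qed
  also have "... = (\<integral>\<^sup>+z. (\<integral>\<^sup>+\<omega>. ?r z \<omega> \<partial>?\<Omega>) \<partial>?G)"
  proof -
    have m: "(%x. h (fst x, (strip n Q (Suc t) (fst (snd x)), cut n (Suc t) (snd (snd x))))) \<in> borel_measurable (?G \<Otimes>\<^sub>M ?\<Omega>)"
    proof (rule measurable_compose[OF _ h])
      have "fst \<in> measurable (?G \<Otimes>\<^sub>M ?\<Omega>) (PiM ({t} \<times> {..<n}) (%_. borel))"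
        using measurable_fst measurable_cong_sets[OF refl sg] by blast
      then show "(%x. (fst x, (strip n Q (Suc t) (fst (snd x)), cut n (Suc t) (snd (snd x))))) \<in> measurable (?G \<Otimes>\<^sub>M ?\<Omega>) (PiM ({t} \<times> {..<n}) (%_. borel) \<Otimes>\<^sub>M (VV \<Otimes>\<^sub>M VV))"
        by (intro measurable_Pair f')
    qed
    show ?thesis using GG.nn_integral_fst[of "%x. h (fst x, (strip n Q (Suc t) (fst (snd x)), cut n (Suc t) (snd (snd x))))" ?G] m
      by (simp add: split_def)
  qed
  finally show ?thesis .
qed

subsection \<open>Compatibility of the step with projections\<close>

lemma orth_cong:
  assumes "\<And>s i. s < k ==> i < n ==> Q s i = Q' s i" shows "orth n k Q = orth n k Q'"
proof -
  have "vinner n (Q s) (Q t) = vinner n (Q' s) (Q' t)" if "s < k" "t < k" for s t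
    using assms that by (intro vinner_cong) auto
  then show ?thesis unfolding orth_def by auto
qed

lemma strip_cong:
  assumes "\<And>s i. s < k ==> i < n ==> Q s i = Q' s i" shows "strip n Q k A = strip n Q' k A"
proof -
  have p: "proj n Q k i j = proj n Q' k i j" if "i < n" "j < n" for i j
    unfolding proj_def using assms that by simp
  show ?thesis unfolding strip_def
  proof (intro ext)
    fix i j
    have "(\<Sum>a<n. \<Sum>b<n. proj n Q k i a * A a b * proj n Q k b j) = (\<Sum>a<n. \<Sum>b<n. proj n Q' k i a * A a b * proj n Q' k b j)"
      if "i < n" "j < n"
      by (intro sum.cong refl) (use p that in auto)
    then show "(if i < n \<and> j < n then \<Sum>a<n. \<Sum>b<n. proj n Q k i a * A a b * proj n Q k b j else 0)
      = (if i < n \<and> j < n then \<Sum>a<n. \<Sum>b<n. proj n Q' k i a * A a b * proj n Q' k b j else 0)" by auto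
  qed
qed

lemma proj_fix:
  assumes "\<And>s. s < k ==> vinner n (Q s) y = 0" "i < n"
  shows "(\<Sum>j<n. proj n Q k i j * y j) = y i"
proof -
  have "(\<Sum>j<n. proj n Q k i j * y j) = (\<Sum>j<n. of_bool (i = j) * y j) - (\<Sum>j<n. \<Sum>r<k. Q r i * (Q r j * y j)) / real n"
    by (simp add: proj_def left_diff_distrib sum_subtractf sum_divide_distrib sum_distrib_right mult.assoc)
  also have "(\<Sum>j<n. \<Sum>r<k. Q r i * (Q r j * y j)) = (\<Sum>r<k. \<Sum>j<n. Q r i * (Q r j * y j))" by (rule sum.swap)
  also have "... = (\<Sum>r<k. Q r i * vinner n (Q r) y)" by (simp add: vinner_def sum_distrib_left)
  also have "... = 0" using assms(1) by simp
  finally show ?thesis using assms(2) by simp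
qed

lemma strip_fix:
  assumes r: "\<And>s a. s < k ==> a < n ==> (\<Sum>b<n. B a b * Q s b) = 0"
    and l: "\<And>s b. s < k ==> b < n ==> (\<Sum>a<n. B a b * Q s a) = 0"
    and ij: "i < n" "j < n"
  shows "strip n Q k B i j = B i j"
proof -
  have R: "(\<Sum>b<n. B a b * proj n Q k b j) = B a j" if "a < n" for a
  proof -
    have "(\<Sum>b<n. B a b * proj n Q k b j) = (\<Sum>b<n. proj n Q k j b * B a b)"
    proof (rule sum.cong[OF refl])
      fix b show "B a b * proj n Q k b j = proj n Q k j b * B a b" by (subst proj_sym) (rule mult.commute)
    qed
    also have "... = B a j"
      by (rule proj_fix) (use r[OF _ that] ij in \<open>auto simp: vinner_def mult.commute\<close>)
    finally show ?thesis .
  qed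
  have "strip n Q k B i j = (\<Sum>a<n. proj n Q k i a * (\<Sum>b<n. B a b * proj n Q k b j))"
    unfolding strip_def using ij by (simp add: sum_distrib_left mult.assoc)
  also have "... = (\<Sum>a<n. proj n Q k i a * B a j)" by (intro sum.cong refl) (simp add: R)
  also have "... = B i j"
    by (rule proj_fix) (use l[OF _ ij(2)] ij in \<open>auto simp: vinner_def mult.commute\<close>)
  finally show ?thesis .
qed

lemma lf_unit:
  assumes "i < n" "j < n" shows "lf n (%a b. if a = i \<and> b = j then 1 else 0) A = A i j"
proof -
  have "lf n (%a b. if a = i \<and> b = j then 1 else 0) A = (\<Sum>a<n. if a = i then A i j else 0)"
    unfolding lf_def
  proof (rule sum.cong[OF refl])
    fix a
    have "(\<Sum>b<n. (if a = i \<and> b = j then 1 else 0) * A a b) = (\<Sum>b<n. if b = j then (if a = i then A i j else 0) else 0)"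
      by (intro sum.cong refl) auto
    then show "(\<Sum>b<n. (if a = i \<and> b = j then 1 else 0) * A a b) = (if a = i then A i j else 0)"
      using assms by (simp add: sum.delta)
  qed
  then show ?thesis using assms by (simp add: sum.delta)
qed

text \<open>Tested against unit matrices: by self-adjointness it is enough that a test matrix
  compressed along k directions is fixed by the compression along the first j of them.\<close>

lemma strip_strip:
  assumes o: "orth n k Q" and n: "0 < n" and jk: "j \<le> k"
  shows "strip n Q k (strip n Q j A) = strip n Q k A"
proof (intro ext)
  fix a b
  show "strip n Q k (strip n Q j A) a b = strip n Q k A a b"
  proof (cases "a < n \<and> b < n")
    case True
    define X :: vecs where "X = (%c d. if c = a \<and> d = b then 1 else 0)"
    have fx: "lf n (strip n Q j (strip n Q k X)) A = lf n (strip n Q k X) A"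
      unfolding lf_def
    proof (intro sum.cong refl)
      fix c d assume "c \<in> {..<n}" "d \<in> {..<n}"
      then have "strip n Q j (strip n Q k X) c d = strip n Q k X c d"
        by (intro strip_fix) (use strip_orth_right[OF o n] strip_orth_left[OF o n] jk in auto)
      then show "strip n Q j (strip n Q k X) c d * A c d = strip n Q k X c d * A c d" by simp
    qed
    have "strip n Q k (strip n Q j A) a b = lf n X (strip n Q k (strip n Q j A))"
      unfolding X_def using True by (simp add: lf_unit)
    also have "... = lf n (strip n Q k X) A" unfolding lf_strip[of n X Q k] lf_strip[of n "strip n Q k X" Q j] fx ..
    also have "... = lf n X (strip n Q k A)" by (rule lf_strip[symmetric])
    also have "... = strip n Q k A a b" unfolding X_def using True by (simp add: lf_unit)
    finally show ?thesis .
  qed (auto simp: strip_def)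
qed

lemma cut_cut: "j \<le> k ==> cut n k (cut n j C) = cut n k C"
  unfolding cut_def by (intro ext) auto

text \<open>Step t sees \<open>A\<close> only through its compression. As q_t is orthogonal to the
  earlier directions, compression removes from A q_t just the earlier components, which the step
  subtracts anyway; the unread columns of \<open>A'\<close> contain column t.\<close>

lemma znext_strip:
  assumes o: "orth n (Suc t) Q" and t: "t < n" and i: "i < n"
  shows "znext n Q t (strip n Q t A) (cut n t C) i = znext n Q t A C i"
proof -
  have n: "0 < n" using t by simp
  let ?q = "Q t" and ?g = "mv n n A (Q t)"
  define g' where "g' = mv n n (strip n Q t A) (Q t)"
  have g': "g' a = ?g a - (\<Sum>s<t. vinner n (Q s) ?g / real n * Q s a)" if a: "a < n" for a
  proof -
    have "g' a = (\<Sum>j<n. \<Sum>c<n. \<Sum>d<n. proj n Q t a c * A c d * (proj n Q t d j * ?q j))"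
      unfolding g'_def mv_def strip_def using a by (simp add: sum_distrib_right mult.assoc)
    also have "... = (\<Sum>c<n. \<Sum>j<n. \<Sum>d<n. proj n Q t a c * A c d * (proj n Q t d j * ?q j))" by (rule sum.swap)
    also have "... = (\<Sum>c<n. \<Sum>d<n. \<Sum>j<n. proj n Q t a c * A c d * (proj n Q t d j * ?q j))"
      by (rule sum.cong[OF refl], rule sum.swap)
    also have "... = (\<Sum>c<n. \<Sum>d<n. proj n Q t a c * A c d * (\<Sum>j<n. proj n Q t d j * ?q j))"
      by (simp only: sum_distrib_left)
    also have "... = (\<Sum>c<n. \<Sum>d<n. proj n Q t a c * A c d * ?q d)"
    proof (intro sum.cong refl)
      fix c d assume "d \<in> {..<n}"
      then have "(\<Sum>j<n. proj n Q t d j * ?q j) = ?q d"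
        by (intro proj_fix) (use orthD[OF o] in auto)
      then show "proj n Q t a c * A c d * (\<Sum>j<n. proj n Q t d j * ?q j) = proj n Q t a c * A c d * ?q d" by simp
    qed
    also have "... = (\<Sum>c<n. proj n Q t a c * ?g c)"
      by (intro sum.cong refl) (simp add: mv_def sum_distrib_left mult.assoc)
    also have "... = (\<Sum>c<n. of_bool (a = c) * ?g c) - (\<Sum>c<n. \<Sum>s<t. Q s a * (Q s c * ?g c)) / real n"
      by (simp add: proj_def left_diff_distrib sum_subtractf sum_divide_distrib sum_distrib_right mult.assoc)
    also have "(\<Sum>c<n. \<Sum>s<t. Q s a * (Q s c * ?g c)) = (\<Sum>s<t. \<Sum>c<n. Q s a * (Q s c * ?g c))" by (rule sum.swap)
    also have "... = (\<Sum>s<t. Q s a * vinner n (Q s) ?g)" by (simp add: vinner_def sum_distrib_left)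
    finally show ?thesis using a by (simp add: sum_divide_distrib mult.commute)
  qed
  have ip: "vinner n (Q r) g' = vinner n (Q r) ?g - (\<Sum>s<t. vinner n (Q s) ?g / real n * vinner n (Q r) (Q s))" for r
  proof -
    have "vinner n (Q r) g' = vinner n (Q r) (%a. ?g a - (\<Sum>s<t. vinner n (Q s) ?g / real n * Q s a))"
      by (intro vinner_cong refl g')
    then show ?thesis by (simp only: vinner_diff_right vinner_sum_right)
  qed
  have it: "vinner n (Q t) g' = vinner n (Q t) ?g"
  proof -
    have "(\<Sum>s<t. vinner n (Q s) ?g / real n * vinner n (Q t) (Q s)) = 0"
      by (intro sum.neutral) (use orthD[OF o] in auto)
    then show ?thesis unfolding ip by simp
  qed
  have is0: "vinner n (Q r) g' = 0" if "r < t" for r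
  proof -
    have "(\<Sum>s<t. vinner n (Q s) ?g / real n * vinner n (Q r) (Q s)) = (\<Sum>s<t. if s = r then vinner n (Q r) ?g else 0)"
      using that n by (intro sum.cong refl) (use orthD[OF o] in auto)
    also have "... = vinner n (Q r) ?g" using that by (simp add: sum.delta)
    finally show ?thesis unfolding ip by simp
  qed
  have C: "cut n t C s t = C s t" if "s \<le> t" for s using that t by (simp add: cut_def)
  have "(\<Sum>s<t. (cut n t C s t - vinner n (Q s) g' / real n) * Q s i) = (\<Sum>s<t. C s t * Q s i)"
    by (intro sum.cong refl) (simp add: C is0)
  moreover have "(\<Sum>s<t. (C s t - vinner n (Q s) ?g / real n) * Q s i) = (\<Sum>s<t. C s t * Q s i) - (\<Sum>s<t. vinner n (Q s) ?g / real n * Q s i)"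
    by (simp only: left_diff_distrib sum_subtractf)
  ultimately show ?thesis unfolding znext_def g'_def[symmetric] it C[OF order_refl] g'[OF i] by simp
qed

lemma znext_cong:
  assumes "\<And>s i. s \<le> t ==> i < n ==> Q s i = Q' s i" "i < n"
  shows "znext n Q t A C i = znext n Q' t A C i"
proof -
  have g: "mv n n A (Q t) = mv n n A (Q' t)" unfolding mv_def using assms(1)[of t] by (intro ext) auto
  have "vinner n (Q s) y = vinner n (Q' s) y" if "s \<le> t" for s y using assms(1)[OF that] by (intro vinner_cong) auto
  then show ?thesis unfolding znext_def g using assms by (auto intro!: sum.cong)
qed

subsection \<open>Lipschitz maps of a prefix\<close>

lemma lip_prefix_cong:
  assumes "lipschitz_on_prefix n t L h" "\<And>s i. s < t ==> i < n ==> ys s i = ys' s i" "i < n"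
  shows "h ys i = h ys' i"
proof -
  have "vnorm n (%i. h ys i - h ys' i) \<le> L * sqrt (\<Sum>s<t. \<Sum>i<n. (ys s i - ys' s i)\<^sup>2)"
    using assms(1) unfolding lipschitz_on_prefix_def by blast
  also have "... = 0" using assms(2) by simp
  finally have "vnorm n (%i. h ys i - h ys' i) = 0" by (simp add: antisym)
  then show ?thesis using assms(3) by (simp add: vnorm_zero_iff)
qed

lemma abs_le_vnorm: "i < n ==> \<bar>x i\<bar> \<le> vnorm n x"
  unfolding vnorm_def using member_le_sum[of i "{..<n}" "%i. (x i)\<^sup>2"] by (intro real_le_rsqrt) auto

lemma lip_prefix_measurable:
  assumes lip: "lipschitz_on_prefix n t L h"
    and Y: "\<And>s i. s < t ==> i < n ==> (%\<omega>. Y \<omega> s i) \<in> borel_measurable M" and i: "i < n"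
  shows "(%\<omega>. h (Y \<omega>) i) \<in> borel_measurable M"
proof -
  let ?I = "{..<t} \<times> {..<n}"
  define k where "k x = h (%s i. x (s, i)) i" for x
  have km: "k \<in> borel_measurable (PiM ?I (%_. borel))"
  proof (rule lipschitz_imp_measurable_PiM[where L = L])
    fix x y :: "nat \<times> nat => real"
    have "\<bar>k x - k y\<bar> \<le> vnorm n (%i. h (%s i. x (s, i)) i - h (%s i. y (s, i)) i)"
      unfolding k_def using abs_le_vnorm[OF i, of "%i. h (%s i. x (s, i)) i - h (%s i. y (s, i)) i"] by simp
    also have "... \<le> L * sqrt (\<Sum>s<t. \<Sum>i<n. (x (s, i) - y (s, i))\<^sup>2)"
      using lip unfolding lipschitz_on_prefix_def by blast
    also have "(\<Sum>s<t. \<Sum>i<n. (x (s, i) - y (s, i))\<^sup>2) = (\<Sum>p\<in>?I. (x p - y p)\<^sup>2)"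
      by (simp add: sum.cartesian_product split_def)
    finally show "\<bar>k x - k y\<bar> \<le> L * L2_set (%i. x i - y i) ?I" by (simp add: L2_set_def)
  qed simp
  have "(%\<omega>. restrict (%p. Y \<omega> (fst p) (snd p)) ?I) \<in> measurable M (PiM ?I (%_. borel))"
    by (rule measurable_restrict) (use Y in auto)
  from measurable_compose[OF this km]
  have "(%\<omega>. k (restrict (%p. Y \<omega> (fst p) (snd p)) ?I)) \<in> borel_measurable M" by simp
  moreover have "k (restrict (%p. Y \<omega> (fst p) (snd p)) ?I) = h (Y \<omega>) i" for \<omega>
    unfolding k_def by (rule lip_prefix_cong[OF lip _ i]) auto
  ultimately show ?thesis by simp
qed

lemma measurable_vinner:
  assumes "\<And>i. i < n ==> (%\<omega>. x \<omega> i) \<in> borel_measurable M" "\<And>i. i < n ==> (%\<omega>. y \<omega> i) \<in> borel_measurable M"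
  shows "(%\<omega>. vinner n (x \<omega>) (y \<omega>)) \<in> borel_measurable M"
  unfolding vinner_def using assms by (intro borel_measurable_sum borel_measurable_times) auto

lemma measurable_vnorm:
  assumes "\<And>i. i < n ==> (%\<omega>. x \<omega> i) \<in> borel_measurable M"
  shows "(%\<omega>. vnorm n (x \<omega>)) \<in> borel_measurable M"
proof -
  have "(%\<omega>. \<Sum>i<n. (x \<omega> i)\<^sup>2) \<in> borel_measurable M"
    using assms by (intro borel_measurable_sum borel_measurable_power) auto
  then show ?thesis unfolding vnorm_def by measurable
qed

lemma measurable_resid:
  assumes Q: "\<And>s i. s < t ==> i < n ==> (%\<omega>. Q \<omega> s i) \<in> borel_measurable M"
    and u: "\<And>i. i < n ==> (%\<omega>. u \<omega> i) \<in> borel_measurable M" and i: "i < n"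
  shows "(%\<omega>. resid n (Q \<omega>) t (u \<omega>) i) \<in> borel_measurable M"
  unfolding resid_def using Q u i
  by (intro borel_measurable_diff borel_measurable_sum borel_measurable_times borel_measurable_divide measurable_vinner) auto

lemma measurable_pair_VV_coord:
  "(%\<omega>. fst \<omega> i j) \<in> borel_measurable (VV \<Otimes>\<^sub>M VV)" "(%\<omega>. snd \<omega> i j) \<in> borel_measurable (VV \<Otimes>\<^sub>M VV)"
  by (rule measurable_compose[OF measurable_fst measurable_VV_coord], rule measurable_compose[OF measurable_snd measurable_VV_coord])

lemma measurable_mv:
  assumes "\<And>i j. (%\<omega>. A \<omega> i j) \<in> borel_measurable M" "\<And>i. i < n ==> (%\<omega>. x \<omega> i) \<in> borel_measurable M"
  shows "(%\<omega>. mv k n (A \<omega>) (x \<omega>) i) \<in> borel_measurable M"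
proof (cases "i < k")
  case True
  have "(%\<omega>. \<Sum>j<n. A \<omega> i j * x \<omega> j) \<in> borel_measurable M"
    by (intro borel_measurable_sum borel_measurable_times) (use assms in auto)
  then show ?thesis unfolding mv_def using True by simp
qed (simp add: mv_def)

lemma measurable_znext:
  assumes Q: "\<And>s i. s \<le> t ==> i < n ==> (%\<omega>. Q \<omega> s i) \<in> borel_measurable M"
    and A: "\<And>i j. (%\<omega>. A \<omega> i j) \<in> borel_measurable M" and C: "\<And>i j. (%\<omega>. C \<omega> i j) \<in> borel_measurable M"
    and i: "i < n"
  shows "(%\<omega>. znext n (Q \<omega>) t (A \<omega>) (C \<omega>) i) \<in> borel_measurable M"
proof -
  have g: "(%\<omega>. mv n n (A \<omega>) (Q \<omega> t) i) \<in> borel_measurable M" for i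
    by (rule measurable_mv) (use A Q in auto)
  show ?thesis unfolding znext_def using i
    by (intro borel_measurable_add borel_measurable_diff borel_measurable_sum borel_measurable_times
      borel_measurable_divide measurable_vinner A C Q g borel_measurable_const) auto
qed

subsection \<open>The directions and iterates as functions of the Gaussian columns\<close>

locale amp =
  fixes n T :: nat and f m :: "nat => vecs => vec" and Om v :: vecs and Lf Lm :: real
  assumes T1: "1 \<le> T" and Tn: "T \<le> n"
    and lipf: "\<And>t. t < T ==> lipschitz_on_prefix n t Lf (f t)"
    and lipm: "\<And>t. t < T ==> lipschitz_on_prefix n t Lm (m t)"
    and basis: "is_basis n v"
begin

lemma n0: "0 < n" using T1 Tn by simp

definition qsel :: "vecs => nat => vecs => vec" where
  "qsel Q t Y = (if \<not> in_span n Q t (f t Y) then f t Y else v (LEAST j. j < n \<and> \<not> in_span n Q t (v j)))"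

text \<open>Components from \<open>n\<close> on are set to zero, here and in \<open>Yz\<close> and
  \<open>zc\<close>. Agreement of the columns on the relevant entries then gives equality of
  functions, which the congruence lemmas below exploit.\<close>

definition qdir :: "vecs => nat => vecs => vec" where
  "qdir Q t Y = (%i. if i < n then sqrt (real n) / vnorm n (resid n Q t (qsel Q t Y)) * resid n Q t (qsel Q t Y) i else 0)"

primrec Yz :: "vecs => nat => vecs" where
  "Yz Z 0 = (%_ _. 0)"
| "Yz Z (Suc t) = (Yz Z t)(t := (%i. if i < n then m t (Yz Z t) i + (\<Sum>s\<le>t. Om s t * Z s i) else 0))"

primrec Qz :: "vecs => nat => vecs" where
  "Qz Z 0 = (%_ _. 0)"
| "Qz Z (Suc t) = (Qz Z t)(t := qdir (Qz Z t) t (Yz Z t))"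

text \<open>The Gaussian columns as a function of (A, A'). Column t uses the directions up to index
  t, and these need only earlier columns: hence \<open>Suc t\<close> directions computed from
  \<open>zc \<omega> t\<close>.\<close>

primrec zc :: "vecs \<times> vecs => nat => vecs" where
  "zc \<omega> 0 = (%_ _. 0)"
| "zc \<omega> (Suc t) = (zc \<omega> t)(t := (%i. if i < n then znext n (Qz (zc \<omega> t) (Suc t)) t (fst \<omega>) (snd \<omega>) i else 0))"

declare Yz.simps(2)[simp del] Qz.simps(2)[simp del] zc.simps(2)[simp del]

lemma Yz_cong: "(\<And>s i. s < t ==> i < n ==> Z s i = Z' s i) ==> Yz Z t = Yz Z' t"
proof (induction t)
  case (Suc t)
  then have e: "Yz Z t = Yz Z' t" by simp
  have "(if i < n then m t (Yz Z' t) i + (\<Sum>s\<le>t. Om s t * Z s i) else 0)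
     = (if i < n then m t (Yz Z' t) i + (\<Sum>s\<le>t. Om s t * Z' s i) else 0)" for i
    using Suc.prems by (auto intro!: sum.cong)
  then show ?case by (simp only: Yz.simps e)
qed simp

text \<open>The direction q_t is predictable: it depends on the columns strictly before t. This
  off-by-one is what allows the law of one step to be applied with the directions held
  fixed.\<close>

lemma Qz_cong_Suc: "(\<And>s i. s < t ==> i < n ==> Z s i = Z' s i) ==> Qz Z (Suc t) = Qz Z' (Suc t)"
proof (induction t)
  case (Suc t)
  have "Qz Z (Suc t) = Qz Z' (Suc t)" by (rule Suc.IH) (use Suc.prems in auto)
  moreover have "Yz Z (Suc t) = Yz Z' (Suc t)" by (rule Yz_cong) (rule Suc.prems)
  ultimately show ?case by (simp only: Qz.simps(2)[of _ "Suc t"])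
qed (simp add: Qz.simps(2))

lemma Qz_prefix: "s < t ==> t \<le> t' ==> Qz Z t' s = Qz Z t s"
proof (induction t')
  case (Suc t') then show ?case by (cases "t = Suc t'") (auto simp: Qz.simps(2))
qed simp

lemma Yz_prefix: "s < t ==> t \<le> t' ==> Yz Z t' s = Yz Z t s"
proof (induction t')
  case (Suc t') then show ?case by (cases "t = Suc t'") (auto simp: Yz.simps(2))
qed simp

lemma qsel_not_in_span:
  assumes "t < n" shows "\<not> in_span n Q t (qsel Q t Y)"
proof (cases "in_span n Q t (f t Y)")
  case True
  have "\<exists>j. j < n \<and> \<not> in_span n Q t (v j)" using basis_not_in_span[OF basis assms] by blast
  from LeastI_ex[OF this] True show ?thesis unfolding qsel_def by simp
qed (simp add: qsel_def)

lemma orth_Qz: "t \<le> n ==> orth n t (Qz Z t)"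
proof (induction t)
  case (Suc t)
  then have o: "orth n t (Qz Z t)" and t: "t < n" by auto
  from orth_extend[OF o n0 qsel_not_in_span[OF t, of "Qz Z t" "Yz Z t"]]
  show ?case
  proof (rule iffD1[OF orth_cong, rotated])
    fix s i assume "i < n"
    then show "((Qz Z t)(t := (%i. sqrt (real n) / vnorm n (resid n (Qz Z t) t (qsel (Qz Z t) t (Yz Z t))) * resid n (Qz Z t) t (qsel (Qz Z t) t (Yz Z t)) i))) s i = Qz Z (Suc t) s i"
      by (simp add: qdir_def Qz.simps(2))
  qed
qed (simp add: orth_def)

text \<open>The coefficient at q_t is the norm of the residual over sqrt n, or 0 when a basis vector
  had to replace f_t. Its sign later gives the triangular factor of \<open>H\<close> a nonnegative
  diagonal.\<close>

lemma f_decomposition: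
  assumes t: "t < T"
  shows "\<exists>U. (\<forall>i<n. f t (Yz Z t) i = (\<Sum>s\<le>t. U s * Qz Z (Suc t) s i)) \<and> 0 \<le> U t"
proof -
  have tn: "t < n" using t Tn by simp
  let ?Q = "Qz Z t" and ?f = "f t (Yz Z t)"
  have pre: "Qz Z (Suc t) s = ?Q s" if "s < t" for s using that by (simp add: Qz.simps(2))
  show ?thesis
  proof (cases "in_span n ?Q t ?f")
    case True
    then obtain c where c: "\<forall>i<n. ?f i = (\<Sum>s<t. c s * ?Q s i)" by (auto simp: in_span_def)
    show ?thesis
    proof (intro exI[of _ "c(t := 0)"] conjI allI impI)
      fix i assume "i < n"
      then show "?f i = (\<Sum>s\<le>t. (c(t := 0)) s * Qz Z (Suc t) s i)"
        using c unfolding lessThan_Suc_atMost[symmetric] sum.lessThan_Suc by (auto simp: pre intro!: sum.cong)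
    qed simp
  next
    case False
    let ?r = "resid n ?Q t ?f"
    have o: "orth n t ?Q" using tn by (intro orth_Qz) simp
    have r: "vnorm n ?r > 0" using False in_span_iff_resid[OF o n0] by (simp add: less_le)
    have q: "Qz Z (Suc t) t i = sqrt (real n) / vnorm n ?r * ?r i" if "i < n" for i
      using False that by (simp add: qdir_def qsel_def Qz.simps(2))
    define U where "U s = (if s = t then vnorm n ?r / sqrt (real n) else vinner n (?Q s) ?f / real n)" for s
    show ?thesis
    proof (intro exI[of _ U] conjI allI impI)
      fix i assume i: "i < n"
      have "U t * Qz Z (Suc t) t i = ?r i" unfolding q[OF i] using r n0 by (simp add: U_def)
      moreover have "(\<Sum>s<t. U s * Qz Z (Suc t) s i) = (\<Sum>s<t. vinner n (?Q s) ?f / real n * ?Q s i)"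
        by (intro sum.cong refl) (auto simp: U_def pre)
      ultimately show "?f i = (\<Sum>s\<le>t. U s * Qz Z (Suc t) s i)"
        unfolding lessThan_Suc_atMost[symmetric] sum.lessThan_Suc by (simp add: resid_def)
    qed (simp add: U_def)
  qed
qed

lemma measurable_Yz:
  assumes "t \<le> T" and Z: "\<And>s i. s < t ==> i < n ==> (%\<omega>. Z \<omega> s i) \<in> borel_measurable M"
  shows "(%\<omega>. Yz (Z \<omega>) t s i) \<in> borel_measurable M"
  using assms
proof (induction t arbitrary: s i)
  case (Suc t)
  have IH: "(%\<omega>. Yz (Z \<omega>) t s i) \<in> borel_measurable M" for s i using Suc by auto
  show ?case
  proof (cases "s = t \<and> i < n")
    case True
    have 1: "(%\<omega>. m t (Yz (Z \<omega>) t) i) \<in> borel_measurable M"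
      by (rule lip_prefix_measurable[OF lipm]) (use Suc.prems True IH in auto)
    have 2: "(%\<omega>. \<Sum>s\<le>t. Om s t * Z \<omega> s i) \<in> borel_measurable M"
      using Suc.prems True by (intro borel_measurable_sum borel_measurable_times) auto
    have e: "(%\<omega>. Yz (Z \<omega>) (Suc t) s i) = (%\<omega>. m t (Yz (Z \<omega>) t) i + (\<Sum>s\<le>t. Om s t * Z \<omega> s i))" using True by (simp add: Yz.simps(2))
    show ?thesis unfolding e by (rule borel_measurable_add[OF 1 2])
  next
    case False
    show ?thesis
    proof (cases "s = t")
      case True
      then have e: "(%\<omega>. Yz (Z \<omega>) (Suc t) s i) = (%\<omega>. 0)" using False by (simp add: Yz.simps(2))
      show ?thesis unfolding e by simp
    next
      case False
      then have e: "(%\<omega>. Yz (Z \<omega>) (Suc t) s i) = (%\<omega>. Yz (Z \<omega>) t s i)" by (simp add: Yz.simps(2))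
      show ?thesis unfolding e by (rule IH)
    qed
  qed
qed simp

text \<open>The directions are discontinuous where f_t enters the span, so measurability goes
  through the case distinction and the least basis index, both described by vanishing
  residuals.\<close>

lemma measurable_Qz:
  assumes "t < T" and Z: "\<And>s i. s < t ==> i < n ==> (%\<omega>. Z \<omega> s i) \<in> borel_measurable M"
  shows "(%\<omega>. Qz (Z \<omega>) (Suc t) s i) \<in> borel_measurable M"
  using assms
proof (induction t arbitrary: s i)
  case 0
  have e: "Qz (Z \<omega>) (Suc 0) = Qz (%_ _. 0) (Suc 0)" for \<omega> by (rule Qz_cong_Suc) simp
  show ?case unfolding e by simp
next
  case (Suc t)
  let ?Q = "%\<omega>. Qz (Z \<omega>) (Suc t)" and ?Y = "%\<omega>. Yz (Z \<omega>) (Suc t)"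
  have tT: "t < T" "Suc t \<le> n" using Suc.prems Tn by auto
  have Q: "(%\<omega>. ?Q \<omega> s i) \<in> borel_measurable M" for s i
    by (rule Suc.IH[OF tT(1)]) (use Suc.prems in auto)
  have Y: "(%\<omega>. ?Y \<omega> s i) \<in> borel_measurable M" for s i
    using Suc.prems by (intro measurable_Yz) auto
  have F: "(%\<omega>. f (Suc t) (?Y \<omega>) i) \<in> borel_measurable M" if "i < n" for i
    by (rule lip_prefix_measurable[OF lipf[OF Suc.prems(1)] _ that]) (rule Y)
  have sp: "Measurable.pred M (%\<omega>. in_span n (?Q \<omega>) (Suc t) (u \<omega>))"
    if u: "\<And>i. i < n ==> (%\<omega>. u \<omega> i) \<in> borel_measurable M" for u
  proof -
    have "(%\<omega>. vnorm n (resid n (?Q \<omega>) (Suc t) (u \<omega>))) \<in> borel_measurable M"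
      by (rule measurable_vnorm, rule measurable_resid, rule Q, rule u)
    then have "Measurable.pred M (%\<omega>. vnorm n (resid n (?Q \<omega>) (Suc t) (u \<omega>)) = 0)" by measurable
    then show ?thesis unfolding in_span_iff_resid[OF orth_Qz[OF tT(2)] n0] .
  qed
  have L: "(%\<omega>. LEAST j. j < n \<and> \<not> in_span n (?Q \<omega>) (Suc t) (v j)) \<in> measurable M (count_space UNIV)"
  proof (rule measurable_Least)
    fix j
    have [measurable]: "Measurable.pred M (%\<omega>. in_span n (?Q \<omega>) (Suc t) (v j))" by (rule sp) simp
    show "Measurable.pred M (%\<omega>. j < n \<and> \<not> in_span n (?Q \<omega>) (Suc t) (v j))" by measurable
  qed
  have S: "(%\<omega>. qsel (?Q \<omega>) (Suc t) (?Y \<omega>) i) \<in> borel_measurable M" if i: "i < n" for i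
  proof -
    have 1: "(%\<omega>. v (LEAST j. j < n \<and> \<not> in_span n (?Q \<omega>) (Suc t) (v j)) i) \<in> borel_measurable M"
      by (rule measurable_compose[OF L, of "%j. v j i"]) simp
    have e: "(%\<omega>. qsel (?Q \<omega>) (Suc t) (?Y \<omega>) i) = (%\<omega>. if \<not> in_span n (?Q \<omega>) (Suc t) (f (Suc t) (?Y \<omega>))
        then f (Suc t) (?Y \<omega>) i else v (LEAST j. j < n \<and> \<not> in_span n (?Q \<omega>) (Suc t) (v j)) i)"
      unfolding qsel_def by auto
    have p: "Measurable.pred M (%\<omega>. in_span n (?Q \<omega>) (Suc t) (f (Suc t) (?Y \<omega>)))" by (rule sp) (rule F)
    show ?thesis unfolding e by (rule measurable_If[OF F[OF i] 1]) (use p in measurable)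
  qed
  have R: "(%\<omega>. resid n (?Q \<omega>) (Suc t) (qsel (?Q \<omega>) (Suc t) (?Y \<omega>)) i) \<in> borel_measurable M" if "i < n" for i
    by (rule measurable_resid[OF _ _ that], rule Q, rule S)
  have D: "(%\<omega>. qdir (?Q \<omega>) (Suc t) (?Y \<omega>) i) \<in> borel_measurable M"
  proof (cases "i < n")
    case True
    have e: "(%\<omega>. qdir (?Q \<omega>) (Suc t) (?Y \<omega>) i)
      = (%\<omega>. sqrt (real n) / vnorm n (resid n (?Q \<omega>) (Suc t) (qsel (?Q \<omega>) (Suc t) (?Y \<omega>))) * resid n (?Q \<omega>) (Suc t) (qsel (?Q \<omega>) (Suc t) (?Y \<omega>)) i)"
      using True unfolding qdir_def by simp
    show ?thesis unfolding e
      by (intro borel_measurable_times borel_measurable_divide borel_measurable_const measurable_vnorm R True)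
  next
    case False
    then have e: "(%\<omega>. qdir (?Q \<omega>) (Suc t) (?Y \<omega>) i) = (%_. 0)" unfolding qdir_def by simp
    show ?thesis unfolding e by simp
  qed
  show ?case
  proof (cases "s = Suc t")
    case True
    then have e: "(%\<omega>. Qz (Z \<omega>) (Suc (Suc t)) s i) = (%\<omega>. qdir (?Q \<omega>) (Suc t) (?Y \<omega>) i)"
      by (simp only: Qz.simps(2)[of _ "Suc t"] fun_upd_same)
    show ?thesis unfolding e by (rule D)
  next
    case False
    then have e: "(%\<omega>. Qz (Z \<omega>) (Suc (Suc t)) s i) = (%\<omega>. ?Q \<omega> s i)"
      by (simp only: Qz.simps(2)[of _ "Suc t"] fun_upd_apply if_False)
    show ?thesis unfolding e by (rule Q)
  qed
qed

lemma measurable_zc: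
  "t \<le> T ==> (%\<omega>. zc \<omega> t s i) \<in> borel_measurable (VV \<Otimes>\<^sub>M VV)"
proof (induction t arbitrary: s i)
  case (Suc t)
  have IH: "(%\<omega>. zc \<omega> t s i) \<in> borel_measurable (VV \<Otimes>\<^sub>M VV)" for s i
    by (rule Suc.IH) (use Suc.prems in simp)
  have tT: "t < T" using Suc.prems by simp
  have q: "(%\<omega>. Qz (zc \<omega> t) (Suc t) s i) \<in> borel_measurable (VV \<Otimes>\<^sub>M VV)" for s i
    by (rule measurable_Qz[OF tT]) (rule IH)
  have zn: "(%\<omega>. znext n (Qz (zc \<omega> t) (Suc t)) t (fst \<omega>) (snd \<omega>) i) \<in> borel_measurable (VV \<Otimes>\<^sub>M VV)" if "i < n" for i
    by (rule measurable_znext[OF q measurable_pair_VV_coord that])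
  show ?case
  proof (cases "s = t")
    case True
    then have e: "(%\<omega>. zc \<omega> (Suc t) s i) = (%\<omega>. if i < n then znext n (Qz (zc \<omega> t) (Suc t)) t (fst \<omega>) (snd \<omega>) i else 0)"
      by (simp only: zc.simps fun_upd_same)
    show ?thesis unfolding e by (cases "i < n") (simp_all only: if_True if_False borel_measurable_const zn)
  next
    case False
    then have e: "(%\<omega>. zc \<omega> (Suc t) s i) = (%\<omega>. zc \<omega> t s i)"
      by (simp only: zc.simps fun_upd_apply if_False)
    show ?thesis unfolding e by (rule IH)
  qed
qed simp

end

subsection \<open>The law of the Gaussian columns\<close>

lemma measurable_strip:
  assumes Q: "\<And>s i. s < k ==> i < n ==> (%\<omega>. Q \<omega> s i) \<in> borel_measurable M"
    and A: "\<And>i j. (%\<omega>. A \<omega> i j) \<in> borel_measurable M"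
  shows "(%\<omega>. strip n (Q \<omega>) k (A \<omega>)) \<in> measurable M VV"
proof (rule measurable_VV_I)
  fix i j
  have p: "(%\<omega>. proj n (Q \<omega>) k i j) \<in> borel_measurable M" if "i < n" "j < n" for i j
    unfolding proj_def using that
    by (intro borel_measurable_diff borel_measurable_divide borel_measurable_sum borel_measurable_times borel_measurable_const Q) auto
  show "(%\<omega>. strip n (Q \<omega>) k (A \<omega>) i j) \<in> borel_measurable M"
  proof (cases "i < n \<and> j < n")
    case True
    have "(%\<omega>. \<Sum>a<n. \<Sum>b<n. proj n (Q \<omega>) k i a * A \<omega> a b * proj n (Q \<omega>) k b j) \<in> borel_measurable M"
      using True by (intro borel_measurable_sum borel_measurable_times p A) auto
    moreover have "(%\<omega>. strip n (Q \<omega>) k (A \<omega>) i j) = (%\<omega>. \<Sum>a<n. \<Sum>b<n. proj n (Q \<omega>) k i a * A \<omega> a b * proj n (Q \<omega>) k b j)"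
      unfolding strip_def using True by (simp only: if_True simp_thms)
    ultimately show ?thesis by (simp only:)
  next
    case False
    then have "(%\<omega>. strip n (Q \<omega>) k (A \<omega>) i j) = (%\<omega>. 0)" unfolding strip_def by (simp only: if_False)
    then show ?thesis by (simp only: borel_measurable_const)
  qed
qed

definition cu :: "(nat \<times> nat => real) => vecs" where "cu x = (%s i. x (s, i))"

context amp begin

definition rs :: "nat => vecs => nat \<times> nat => real" where
  "rs t Z = restrict (%p. Z (fst p) (snd p)) ({..<t} \<times> {..<n})"

lemma cu_rs: "s < t ==> i < n ==> cu (rs t Z) s i = Z s i" by (simp add: cu_def rs_def)

text \<open>The law of the columns alone does not pass through the induction. The strengthened claim
  says that, given the columns, the compressed \<open>A\<close> and the unread part of
  \<open>A'\<close> are distributed as for a fresh pair compressed along the directions that the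
  columns determine.\<close>

lemma columns_law:
  assumes "t \<le> T" and "h \<in> borel_measurable (PiM ({..<t} \<times> {..<n}) (%_. borel) \<Otimes>\<^sub>M (VV \<Otimes>\<^sub>M VV))"
  shows "(\<integral>\<^sup>+\<omega>. h (rs t (zc \<omega> t), (strip n (Qz (zc \<omega> t) t) t (fst \<omega>), cut n t (snd \<omega>))) \<partial>(GOE2 n))
    = (\<integral>\<^sup>+x. (\<integral>\<^sup>+\<omega>. h (x, (strip n (Qz (cu x) t) t (fst \<omega>), cut n t (snd \<omega>))) \<partial>(GOE2 n)) \<partial>gauss ({..<t} \<times> {..<n}))"
  using assms
proof (induction t arbitrary: h)
  case 0
  interpret product_sigma_finite "%_::nat \<times> nat. N01"
    by (rule product_sigma_finite.intro) (rule prob_space_imp_sigma_finite[OF prob_space_N01])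
  have e: "{..<0::nat} \<times> {..<n} = {}" by simp
  have r: "rs 0 Z = (%_. undefined)" for Z unfolding rs_def e by (simp add: restrict_def)
  have q: "Qz Z 0 = (%_ _. 0)" for Z by simp
  show ?case unfolding e r q by (subst nn_integral_empty) (rule zero_le | rule refl)+
next
  case (Suc t)
  let ?I = "{..<t} \<times> {..<n}" and ?J = "{t} \<times> {..<n}" and ?K = "{..<Suc t} \<times> {..<n}"
  let ?\<Omega> = "GOE2 n"
  have tT: "t < T" "t < n" "t \<le> T" "Suc t \<le> n" using Suc.prems Tn by auto
  have IJ: "?I \<inter> ?J = {}" "?I \<union> ?J = ?K" by (auto simp: less_Suc_eq)
  interpret psf: product_sigma_finite "%_::nat \<times> nat. N01"
    by (rule product_sigma_finite.intro) (rule prob_space_imp_sigma_finite[OF prob_space_N01])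
  interpret G: prob_space "GOE n" by (rule prob_space_GOE[OF n0])
  interpret GG: pair_prob_space "GOE n" "GOE n" ..
  note hm = Suc.prems(2)
  have mer: "(%x. merge ?I ?J x) \<in> measurable (PiM ?I (%_. borel :: real measure) \<Otimes>\<^sub>M PiM ?J (%_. borel)) (PiM ?K (%_. borel))"
    using measurable_merge[of ?I ?J "%_. borel :: real measure"] unfolding IJ by simp
  \<comment> \<open>The test function of time t + 1 expressed in data available at time t: the next
    column and the finer compressions are recomputed from the coarser ones.\<close>
  define h' where "h' y = h (merge ?I ?J (fst y, restrict (%p. znext n (Qz (cu (fst y)) (Suc t)) t (fst (snd y)) (snd (snd y)) (snd p)) ?J),
      (strip n (Qz (cu (fst y)) (Suc t)) (Suc t) (fst (snd y)), cut n (Suc t) (snd (snd y))))" for y :: "(nat \<times> nat => real) \<times> vecs \<times> vecs"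
  let ?N = "PiM ?I (%_. borel :: real measure) \<Otimes>\<^sub>M (VV \<Otimes>\<^sub>M VV)"
  have cuI: "(%x. cu x s i) \<in> borel_measurable (PiM ?I (%_. borel))" if "s < t" "i < n" for s i
    unfolding cu_def using that by (intro measurable_component_singleton) auto
  have QI: "(%x. Qz (cu x) (Suc t) s i) \<in> borel_measurable (PiM ?I (%_. borel))" for s i
    by (rule measurable_Qz[OF tT(1)]) (rule cuI)
  have QN: "(%y. Qz (cu (fst y)) (Suc t) s i) \<in> borel_measurable ?N" for s i
    by (rule measurable_compose[OF measurable_fst QI])
  have AN: "(%y. fst (snd y) i j) \<in> borel_measurable ?N" "(%y. snd (snd y) i j) \<in> borel_measurable ?N" for i j
    by (rule measurable_compose[OF measurable_snd measurable_pair_VV_coord(1)], rule measurable_compose[OF measurable_snd measurable_pair_VV_coord(2)])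
  have h'm: "h' \<in> borel_measurable ?N"
  proof -
    have 1: "(%y. restrict (%p. znext n (Qz (cu (fst y)) (Suc t)) t (fst (snd y)) (snd (snd y)) (snd p)) ?J) \<in> measurable ?N (PiM ?J (%_. borel))"
      by (rule measurable_restrict, rule measurable_znext, rule QN, rule AN, rule AN, auto)
    have 2: "(%y. strip n (Qz (cu (fst y)) (Suc t)) (Suc t) (fst (snd y))) \<in> measurable ?N VV"
      by (rule measurable_strip, rule QN, rule AN)
    have 3: "(%y. cut n (Suc t) (snd (snd y))) \<in> measurable ?N VV"
      by (rule measurable_compose[OF _ cut_measurable]) measurable
    have 4: "(%y. (fst y, restrict (%p. znext n (Qz (cu (fst y)) (Suc t)) t (fst (snd y)) (snd (snd y)) (snd p)) ?J))
      \<in> measurable ?N (PiM ?I (%_. borel) \<Otimes>\<^sub>M PiM ?J (%_. borel))"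
      by (rule measurable_Pair[OF measurable_fst 1])
    show ?thesis unfolding h'_def
      by (rule measurable_compose[OF _ hm], rule measurable_Pair[OF measurable_compose[OF 4 mer] measurable_Pair[OF 2 3]])
  qed
  \<comment> \<open>Recomputing from compressed data agrees with computing from the full matrices,
    because the step sees only the compression and repeated compression collapses.\<close>
  have key: "h' (rs t Z, (strip n (Qz Z t) t A, cut n t C))
     = h (merge ?I ?J (rs t Z, restrict (%p. znext n (Qz Z (Suc t)) t A C (snd p)) ?J), (strip n (Qz Z (Suc t)) (Suc t) A, cut n (Suc t) C))" for Z A C
  proof -
    have q: "Qz (cu (rs t Z)) (Suc t) = Qz Z (Suc t)" by (rule Qz_cong_Suc) (rule cu_rs)
    have s: "strip n (Qz Z t) t A = strip n (Qz Z (Suc t)) t A"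
      by (rule strip_cong) (simp add: Qz_prefix[of _ t "Suc t"])
    have o: "orth n (Suc t) (Qz Z (Suc t))" by (rule orth_Qz[OF tT(4)])
    have z: "restrict (%p. znext n (Qz Z (Suc t)) t (strip n (Qz Z (Suc t)) t A) (cut n t C) (snd p)) ?J
       = restrict (%p. znext n (Qz Z (Suc t)) t A C (snd p)) ?J"
      by (rule restrict_ext) (auto intro: znext_strip[OF o tT(2)])
    show ?thesis unfolding h'_def fst_conv snd_conv q s z strip_strip[OF o n0 le_SucI[OF order_refl]] cut_cut[OF le_SucI[OF order_refl]] ..
  qed
  have L: "h (rs (Suc t) (zc \<omega> (Suc t)), (strip n (Qz (zc \<omega> (Suc t)) (Suc t)) (Suc t) (fst \<omega>), cut n (Suc t) (snd \<omega>)))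
     = h' (rs t (zc \<omega> t), (strip n (Qz (zc \<omega> t) t) t (fst \<omega>), cut n t (snd \<omega>)))" for \<omega>
  proof -
    have q: "Qz (zc \<omega> (Suc t)) (Suc t) = Qz (zc \<omega> t) (Suc t)" by (rule Qz_cong_Suc) (simp add: zc.simps(2))
    have m: "rs (Suc t) (zc \<omega> (Suc t)) = merge ?I ?J (rs t (zc \<omega> t), restrict (%p. znext n (Qz (zc \<omega> t) (Suc t)) t (fst \<omega>) (snd \<omega>) (snd p)) ?J)"
    proof (rule ext)
      fix p :: "nat \<times> nat"
      obtain s i where p: "p = (s, i)" by (cases p)
      show "rs (Suc t) (zc \<omega> (Suc t)) p = merge ?I ?J (rs t (zc \<omega> t), restrict (%p. znext n (Qz (zc \<omega> t) (Suc t)) t (fst \<omega>) (snd \<omega>) (snd p)) ?J) p"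
        unfolding p by (cases "i < n"; cases "s < t"; cases "s = t") (simp_all add: merge_def rs_def zc.simps(2))
    qed
    show ?thesis unfolding key q m ..
  qed
  have Km: "(%x. \<integral>\<^sup>+\<omega>. h (x, (strip n (Qz (cu x) (Suc t)) (Suc t) (fst \<omega>), cut n (Suc t) (snd \<omega>))) \<partial>?\<Omega>) \<in> borel_measurable (gauss ?K)" (is "?g \<in> _")
  proof -
    have cuK: "(%x. cu x s i) \<in> borel_measurable (PiM ?K (%_. borel))" if "s < t" "i < n" for s i
      unfolding cu_def using that by (intro measurable_component_singleton) auto
    have QK: "(%x. Qz (cu x) (Suc t) s i) \<in> borel_measurable (PiM ?K (%_. borel))" for s i
      by (rule measurable_Qz[OF tT(1)]) (rule cuK)
    let ?N = "PiM ?K (%_. borel :: real measure) \<Otimes>\<^sub>M (VV \<Otimes>\<^sub>M VV)"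
    have QN: "(%y. Qz (cu (fst y)) (Suc t) s i) \<in> borel_measurable ?N" for s i
      by (rule measurable_compose[OF measurable_fst QK])
    have AN: "(%y. fst (snd y) i j) \<in> borel_measurable ?N" for i j
      by (rule measurable_compose[OF measurable_snd measurable_pair_VV_coord(1)])
    have 2: "(%y. strip n (Qz (cu (fst y)) (Suc t)) (Suc t) (fst (snd y))) \<in> measurable ?N VV"
      by (rule measurable_strip, rule QN, rule AN)
    have 3: "(%y. cut n (Suc t) (snd (snd y))) \<in> measurable ?N VV"
      by (rule measurable_compose[OF _ cut_measurable]) measurable
    have 4: "(%y. h (fst y, (strip n (Qz (cu (fst y)) (Suc t)) (Suc t) (fst (snd y)), cut n (Suc t) (snd (snd y))))) \<in> borel_measurable ?N"
      by (rule measurable_compose[OF _ hm], rule measurable_Pair[OF measurable_fst measurable_Pair[OF 2 3]])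
    have sN: "sets (PiM ?K (%_. borel :: real measure) \<Otimes>\<^sub>M ?\<Omega>) = sets ?N"
      by (intro sets_pair_measure_cong refl sets_GOE)
    have 5: "(%y. h (fst y, (strip n (Qz (cu (fst y)) (Suc t)) (Suc t) (fst (snd y)), cut n (Suc t) (snd (snd y))))) \<in> borel_measurable (PiM ?K (%_. borel) \<Otimes>\<^sub>M ?\<Omega>)"
      unfolding measurable_cong_sets[OF sN refl] by (rule 4)
    have "?g \<in> borel_measurable (PiM ?K (%_. borel))"
      using GG.borel_measurable_nn_integral_fst[OF 5] by simp
    then show ?thesis unfolding measurable_cong_sets[OF sets_gauss refl] .
  qed
  \<comment> \<open>With the past columns \<open>x\<close> fixed, the direction family
    \<open>?Q\<close> is deterministic and the law of one step applies to it.\<close>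
  have R: "(\<integral>\<^sup>+\<omega>. h' (x, (strip n (Qz (cu x) t) t (fst \<omega>), cut n t (snd \<omega>))) \<partial>?\<Omega>)
     = (\<integral>\<^sup>+z. ?g (merge ?I ?J (x, z)) \<partial>gauss ?J)" if x: "x \<in> space (gauss ?I)" for x
  proof -
    let ?Q = "Qz (cu x) (Suc t)"
    have xe: "x \<in> extensional ?I" using x by (simp add: space_PiM PiE_def)
    have xr: "rs t (cu x) = x"
      using xe unfolding rs_def cu_def by (auto simp: extensional_def fun_eq_iff restrict_def)
    define h2 where "h2 y = h (merge ?I ?J (x, fst y), snd y)" for y :: "(nat \<times> nat => real) \<times> vecs \<times> vecs"
    have xs: "x \<in> space (PiM ?I (%_. borel :: real measure))" using xe by (simp add: space_PiM PiE_def)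
    have h2m: "h2 \<in> borel_measurable (PiM ?J (%_. borel) \<Otimes>\<^sub>M (VV \<Otimes>\<^sub>M VV))"
    proof -
      have "(%y. merge ?I ?J (x, fst y)) \<in> measurable (PiM ?J (%_. borel) \<Otimes>\<^sub>M (VV \<Otimes>\<^sub>M VV)) (PiM ?K (%_. borel))"
        by (rule measurable_compose[OF _ mer], rule measurable_Pair[OF measurable_const[OF xs] measurable_fst])
      from measurable_compose[OF measurable_Pair[OF this measurable_snd] hm]
      show ?thesis unfolding h2_def .
    qed
    have o: "orth n (Suc t) ?Q" by (rule orth_Qz[OF tT(4)])
    have "(\<integral>\<^sup>+\<omega>. h' (x, (strip n (Qz (cu x) t) t (fst \<omega>), cut n t (snd \<omega>))) \<partial>?\<Omega>)
      = (\<integral>\<^sup>+\<omega>. h2 (restrict (%p. znext n ?Q t (fst \<omega>) (snd \<omega>) (snd p)) ?J, (strip n ?Q (Suc t) (fst \<omega>), cut n (Suc t) (snd \<omega>))) \<partial>?\<Omega>)"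
    proof (rule nn_integral_cong)
      fix \<omega>
      show "h' (x, (strip n (Qz (cu x) t) t (fst \<omega>), cut n t (snd \<omega>)))
        = h2 (restrict (%p. znext n ?Q t (fst \<omega>) (snd \<omega>) (snd p)) ?J, (strip n ?Q (Suc t) (fst \<omega>), cut n (Suc t) (snd \<omega>)))"
        using key[of "cu x" "fst \<omega>" "snd \<omega>"] unfolding xr h2_def fst_conv snd_conv .
    qed
    also have "... = (\<integral>\<^sup>+z. (\<integral>\<^sup>+\<omega>. h2 (z, (strip n ?Q (Suc t) (fst \<omega>), cut n (Suc t) (snd \<omega>))) \<partial>?\<Omega>) \<partial>gauss ?J)"
      by (rule one_step_law[OF o tT(2) h2m])
    also have "... = (\<integral>\<^sup>+z. ?g (merge ?I ?J (x, z)) \<partial>gauss ?J)"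
    proof (rule nn_integral_cong)
      fix z
      have "Qz (cu (merge ?I ?J (x, z))) (Suc t) = ?Q" by (rule Qz_cong_Suc) (simp add: cu_def merge_def)
      then show "(\<integral>\<^sup>+\<omega>. h2 (z, (strip n ?Q (Suc t) (fst \<omega>), cut n (Suc t) (snd \<omega>))) \<partial>?\<Omega>) = ?g (merge ?I ?J (x, z))"
        unfolding h2_def fst_conv snd_conv by simp
    qed
    finally show ?thesis .
  qed
  have "(\<integral>\<^sup>+\<omega>. h (rs (Suc t) (zc \<omega> (Suc t)), (strip n (Qz (zc \<omega> (Suc t)) (Suc t)) (Suc t) (fst \<omega>), cut n (Suc t) (snd \<omega>))) \<partial>?\<Omega>)
    = (\<integral>\<^sup>+x. (\<integral>\<^sup>+\<omega>. h' (x, (strip n (Qz (cu x) t) t (fst \<omega>), cut n t (snd \<omega>))) \<partial>?\<Omega>) \<partial>gauss ?I)"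
    unfolding L by (rule Suc.IH[OF tT(3) h'm])
  also have "... = (\<integral>\<^sup>+x. (\<integral>\<^sup>+z. ?g (merge ?I ?J (x, z)) \<partial>gauss ?J) \<partial>gauss ?I)"
    by (rule nn_integral_cong) (rule R)
  also have "... = (\<integral>\<^sup>+x. ?g x \<partial>gauss ?K)"
    using psf.product_nn_integral_fold[OF IJ(1) _ _ Km[folded IJ(2)]] unfolding IJ(2) by simp
  finally show ?case .
qed

lemma rs_zc_measurable: "(%\<omega>. rs T (zc \<omega> T)) \<in> measurable (GOE2 n) (PiM ({..<T} \<times> {..<n}) (%_. borel))"
  unfolding rs_def measurable_pair_GOE_iff
  by (rule measurable_restrict) (rule measurable_zc[OF order_refl])

theorem columns_gauss:
  "distr (GOE2 n) (PiM ({..<T} \<times> {..<n}) (%_. borel)) (%\<omega>. rs T (zc \<omega> T)) = gauss ({..<T} \<times> {..<n})"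
    (is "distr ?\<Omega> ?P ?Z = ?G")
proof (rule measure_eqI)
  interpret G: prob_space "GOE n" by (rule prob_space_GOE[OF n0])
  interpret GG: pair_prob_space "GOE n" "GOE n" ..
  show "sets (distr ?\<Omega> ?P ?Z) = sets ?G" by (simp add: sets_gauss)
  fix A assume "A \<in> sets (distr ?\<Omega> ?P ?Z)"
  then have A: "A \<in> sets ?P" by simp
  have Ag: "A \<in> sets ?G" using A by (simp only: sets_gauss)
  have hm: "(%x. indicator A (fst x) :: ennreal) \<in> borel_measurable (?P \<Otimes>\<^sub>M (VV \<Otimes>\<^sub>M VV))"
    by (rule measurable_compose[OF measurable_fst]) (rule borel_measurable_indicator[OF A])
  have "emeasure (distr ?\<Omega> ?P ?Z) A = (\<integral>\<^sup>+x. indicator A x \<partial>distr ?\<Omega> ?P ?Z)"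
    using A by simp
  also have "... = (\<integral>\<^sup>+\<omega>. indicator A (?Z \<omega>) \<partial>?\<Omega>)"
    by (rule nn_integral_distr[OF rs_zc_measurable]) (use A in simp)
  also have "... = (\<integral>\<^sup>+x. (\<integral>\<^sup>+\<omega>. indicator A x \<partial>?\<Omega>) \<partial>?G)"
    using columns_law[OF order_refl hm] by (simp only: fst_conv)
  also have "... = (\<integral>\<^sup>+x. indicator A x \<partial>?G)"
    by (simp add: GG.emeasure_space_1)
  also have "... = emeasure ?G A" using Ag by simp
  finally show "emeasure (distr ?\<Omega> ?P ?Z) A = emeasure ?G A" .
qed

subsection \<open>The coupling in terms of the Gaussian columns\<close>

lemma in_span_cong:
  assumes "\<And>s i. s < t ==> i < n ==> Q s i = Q' s i" "\<And>i. i < n ==> u i = u' i"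
  shows "in_span n Q t u = in_span n Q' t u'"
proof -
  have "(\<forall>i<n. u i = (\<Sum>s<t. c s * Q s i)) = (\<forall>i<n. u' i = (\<Sum>s<t. c s * Q' s i))" for c
  proof -
    have "(u i = (\<Sum>s<t. c s * Q s i)) = (u' i = (\<Sum>s<t. c s * Q' s i))" if "i < n" for i
    proof -
      have "(\<Sum>s<t. c s * Q s i) = (\<Sum>s<t. c s * Q' s i)" by (rule sum.cong[OF refl]) (use assms(1) that in simp)
      then show ?thesis using assms(2)[OF that] by simp
    qed
    then show ?thesis by blast
  qed
  then show ?thesis unfolding in_span_def by blast
qed

lemma resid_cong:
  assumes "\<And>s i. s < t ==> i < n ==> Q s i = Q' s i" "\<And>i. i < n ==> u i = u' i" "i < n"
  shows "resid n Q t u i = resid n Q' t u' i"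
proof -
  have "(\<Sum>s<t. vinner n (Q s) u / real n * Q s i) = (\<Sum>s<t. vinner n (Q' s) u' / real n * Q' s i)"
  proof (rule sum.cong[OF refl])
    fix s assume "s \<in> {..<t}"
    then have "vinner n (Q s) u = vinner n (Q' s) u'" "Q s i = Q' s i" using assms by (auto intro: vinner_cong)
    then show "vinner n (Q s) u / real n * Q s i = vinner n (Q' s) u' / real n * Q' s i" by simp
  qed
  then show ?thesis unfolding resid_def using assms(2,3) by simp
qed

text \<open>The given recursion does not clear components from \<open>n\<close> on, whereas
  \<open>Qz\<close>, \<open>Yz\<close> and \<open>zc\<close> do. Agreement is therefore claimed for
  i < n, and the Lipschitz maps do not see the difference.\<close>

lemma coupling_columns:
  assumes "t \<le> T" "coupling n v f m Om A A' t = (Q, Z, Y)"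
  shows "s < t ==> i < n ==> Q s i = Qz (zc (A, A') t) t s i"
    "s < t ==> i < n ==> Z s i = zc (A, A') t s i"
    "s < t ==> i < n ==> Y s i = Yz (zc (A, A') t) t s i"
proof -
  have "\<forall>s<t. \<forall>i<n. Q s i = Qz (zc (A, A') t) t s i \<and> Z s i = zc (A, A') t s i \<and> Y s i = Yz (zc (A, A') t) t s i"
    using assms
  proof (induction t arbitrary: Q Z Y)
    case (Suc t)
    have tT: "t < T" "t \<le> T" using Suc.prems(1) by auto
    obtain Q0 Z0 Y0 where c0: "coupling n v f m Om A A' t = (Q0, Z0, Y0)" by (metis prod_cases3)
    define W where "W = zc (A, A') t"
    define W1 where "W1 = zc (A, A') (Suc t)"
    have ih: "Q0 s i = Qz W t s i" "Z0 s i = W s i" "Y0 s i = Yz W t s i" if "s < t" "i < n" for s i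
      using Suc.IH[OF tT(2) c0] that unfolding W_def by blast+
    define u where "u = (if \<not> in_span n Q0 t (f t Y0) then f t Y0 else v (LEAST j. j < n \<and> \<not> in_span n Q0 t (v j)))"
    define q where "q = (%i. sqrt (real n) / vnorm n (resid n Q0 t u) * resid n Q0 t u i)"
    define z where "z = znext n (Q0(t := q)) t A A'"
    have ZZ: "(Q, Z, Y) = (Q0(t := q), Z0(t := z), Y0(t := (%i. m t Y0 i + (\<Sum>s\<le>t. Om s t * (Z0(t := z)) s i))))"
    proof -
      have "(\<Sum>s<t. (A' s t - vinner n (Q0 s) (mv n n A q) / real n) * Q0 s i)
         = (\<Sum>s<t. (A' s t - vinner n ((Q0(t := q)) s) (mv n n A q) / real n) * (Q0(t := q)) s i)" for i
        by (intro sum.cong refl) auto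
      then have zz: "z = (%i. mv n n A q i + (A' t t - vinner n q (mv n n A q) / real n) / 2 * q i
            + (\<Sum>s<t. (A' s t - vinner n (Q0 s) (mv n n A q) / real n) * Q0 s i))"
        unfolding z_def znext_def by simp
      show ?thesis unfolding Suc.prems(2)[symmetric] zz q_def resid_def u_def by (simp only: coupling.simps c0 Let_def prod.case)
    qed
    have fe: "f t Y0 i = f t (Yz W t) i" if "i < n" for i
      by (rule lip_prefix_cong[OF lipf[OF tT(1)] _ that]) (rule ih)
    have me: "m t Y0 i = m t (Yz W t) i" if "i < n" for i
      by (rule lip_prefix_cong[OF lipm[OF tT(1)] _ that]) (rule ih)
    have sp: "in_span n Q0 t x = in_span n (Qz W t) t x'" if "\<And>i. i < n ==> x i = x' i" for x x'
      by (rule in_span_cong[OF ih(1) that])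
    have spv: "in_span n Q0 t (v j) = in_span n (Qz W t) t (v j)" for j by (rule sp) simp
    have spf: "in_span n Q0 t (f t Y0) = in_span n (Qz W t) t (f t (Yz W t))" by (rule sp) (rule fe)
    have ue: "u i = qsel (Qz W t) t (Yz W t) i" if "i < n" for i
      unfolding u_def qsel_def spv spf using fe[OF that] by simp
    have re: "resid n Q0 t u i = resid n (Qz W t) t (qsel (Qz W t) t (Yz W t)) i" if "i < n" for i
      by (rule resid_cong[OF ih(1) ue that])
    have qe: "q i = qdir (Qz W t) t (Yz W t) i" if "i < n" for i
    proof -
      have "vnorm n (resid n Q0 t u) = vnorm n (resid n (Qz W t) t (qsel (Qz W t) t (Yz W t)))"
        by (rule vnorm_cong) (rule re)
      then show ?thesis unfolding q_def qdir_def using that re[OF that] by simp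
    qed
    have W1: "W1 s i = W s i" if "s < t" for s i using that unfolding W1_def W_def by (simp add: zc.simps(2))
    have QW1: "Qz W1 (Suc t) = Qz W (Suc t)" by (rule Qz_cong_Suc) (rule W1)
    have YW1: "Yz W1 t = Yz W t" by (rule Yz_cong) (rule W1)
    have Qe: "(Q0(t := q)) s i = Qz W (Suc t) s i" if "s \<le> t" "i < n" for s i
      using that qe ih(1) by (cases "s = t") (auto simp: Qz.simps(2))
    have ze: "z i = W1 t i" if "i < n" for i
    proof -
      have "z i = znext n (Qz W (Suc t)) t A A' i" unfolding z_def by (rule znext_cong[OF Qe that])
      then show ?thesis unfolding W1_def W_def using that by (simp add: zc.simps(2))
    qed
    have Ze: "(Z0(t := z)) s i = W1 s i" if "s \<le> t" "i < n" for s i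
      using that ze ih(2) W1 by (cases "s = t") auto
    have Ye: "(Y0(t := (%i. m t Y0 i + (\<Sum>s\<le>t. Om s t * (Z0(t := z)) s i)))) s i = Yz W1 (Suc t) s i" if "s < Suc t" "i < n" for s i
    proof (cases "s = t")
      case True
      have "(\<Sum>s\<le>t. Om s t * (Z0(t := z)) s i) = (\<Sum>s\<le>t. Om s t * W1 s i)"
        by (rule sum.cong[OF refl]) (use Ze that in auto)
      then show ?thesis using True that me[OF that(2)] YW1 by (simp add: Yz.simps(2))
    next
      case False
      then show ?thesis using that ih(3)[of s i] YW1 by (simp add: Yz.simps(2))
    qed
    show ?case
    proof (intro allI impI)
      fix s i assume si: "s < Suc t" "i < n"
      have "Q = Q0(t := q)" "Z = Z0(t := z)" "Y = Y0(t := (%i. m t Y0 i + (\<Sum>s\<le>t. Om s t * (Z0(t := z)) s i)))" using ZZ by simp_all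
      then show "Q s i = Qz (zc (A, A') (Suc t)) (Suc t) s i \<and> Z s i = zc (A, A') (Suc t) s i \<and> Y s i = Yz (zc (A, A') (Suc t)) (Suc t) s i"
        using Qe[of s i] Ze[of s i] Ye[of s i] si unfolding W1_def[symmetric] QW1 by simp
    qed
  qed simp
  then show "s < t ==> i < n ==> Q s i = Qz (zc (A, A') t) t s i"
    "s < t ==> i < n ==> Z s i = zc (A, A') t s i"
    "s < t ==> i < n ==> Y s i = Yz (zc (A, A') t) t s i" by blast+
qed

lemma zc_step:
  assumes "t < T" "i < n"
  shows "zc \<omega> T t i = znext n (Qz (zc \<omega> T) T) t (fst \<omega>) (snd \<omega>) i"
proof -
  have pre: "zc \<omega> k s = zc \<omega> j s" if "s < j" "j \<le> k" for k j s
    using that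
  proof (induction k)
    case (Suc k) then show ?case by (cases "j = Suc k") (auto simp: zc.simps(2))
  qed simp
  have "zc \<omega> T t i = zc \<omega> (Suc t) t i" using assms by (simp add: pre[of t "Suc t" T])
  also have "... = znext n (Qz (zc \<omega> t) (Suc t)) t (fst \<omega>) (snd \<omega>) i" using assms by (simp add: zc.simps(2))
  also have "Qz (zc \<omega> t) (Suc t) = Qz (zc \<omega> T) (Suc t)" using assms by (intro Qz_cong_Suc) (simp add: pre[of _ t T])
  also have "znext n (Qz (zc \<omega> T) (Suc t)) t (fst \<omega>) (snd \<omega>) i = znext n (Qz (zc \<omega> T) T) t (fst \<omega>) (snd \<omega>) i"
    using assms by (intro znext_cong) (auto simp: Qz_prefix[of _ "Suc t" T])
  finally show ?thesis .
qed

end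

subsection \<open>Gaussian second moments\<close>

lemma N01_moments:
  "integrable N01 (%x. x)" "(\<integral>x. x \<partial>N01) = 0" "integrable N01 (%x. x\<^sup>2)" "(\<integral>x. x\<^sup>2 \<partial>N01) = 1"
proof -
  have o: "has_bochner_integral lborel (%x. std_normal_density x * x ^ (2 * 0 + 1)) 0" by (rule std_normal_moment_odd)
  have e: "has_bochner_integral lborel (%x. std_normal_density x * x ^ (2 * 1)) (fact (2 * 1) / (2 ^ 1 * fact 1))"
    by (rule std_normal_moment_even)
  show "integrable N01 (%x. x)" "(\<integral>x. x \<partial>N01) = 0"
    using o by (simp_all add: has_bochner_integral_iff integrable_density integral_density)
  show "integrable N01 (%x. x\<^sup>2)" "(\<integral>x. x\<^sup>2 \<partial>N01) = 1"
    using e by (simp_all add: has_bochner_integral_iff integrable_density integral_density)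
qed

lemma gauss_second_moment:
  assumes fin: "finite I" and p: "p \<in> I" and q: "q \<in> I"
  shows "(\<integral>x. x p * x q \<partial>gauss I) = of_bool (p = q)"
proof -
  interpret product_sigma_finite "%_. N01"
    by (rule product_sigma_finite.intro) (rule prob_space_imp_sigma_finite[OF prob_space_N01])
  interpret N: prob_space N01 by (rule prob_space_N01)
  define g where "g i x = (if i = p then x else 1) * (if i = q then x else (1::real))" for i and x :: real
  have gi: "integrable N01 (g i)" for i
    unfolding g_def using N01_moments by (cases "i = p"; cases "i = q") (simp_all add: power2_eq_square)
  have e: "(\<Prod>i\<in>I. g i (x i)) = x p * x q" for x
    unfolding g_def prod.distrib using fin p q by (simp add: prod.delta)
  have v: "integral\<^sup>L N01 (g i) = (if i = p \<or> i = q then of_bool (p = q) else 1)" for i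
    unfolding g_def using N01_moments N.prob_space by (cases "i = p"; cases "i = q") (simp_all add: power2_eq_square)
  have "(\<integral>x. x p * x q \<partial>gauss I) = (\<Prod>i\<in>I. integral\<^sup>L N01 (g i))"
    unfolding e[symmetric] by (rule product_integral_prod[OF fin gi])
  also have "... = of_bool (p = q)"
  proof (cases "p = q")
    case True then show ?thesis unfolding v by simp
  next
    case False
    then have "integral\<^sup>L N01 (g p) = 0" by (simp add: v)
    then show ?thesis using prod_zero[OF fin, of "%i. integral\<^sup>L N01 (g i)"] p False by auto
  qed
  finally show ?thesis .
qed

subsection \<open>Gram matrices of Lipschitz families\<close>

lemma vnorm_coord_diff:
  assumes "i < n" "j < k"
  shows "\<bar>W j i\<bar> \<le> vnorm n (lc k W (%l. of_bool (l = j)))"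
proof -
  have "lc k W (%l. of_bool (l = j)) i = (\<Sum>l<k. if l = j then W j i else 0)"
    unfolding lc_def by (intro sum.cong refl) auto
  also have "... = W j i" using assms by (simp add: sum.delta)
  finally show ?thesis using abs_le_vnorm[OF assms(1), of "lc k W (%l. of_bool (l = j))"] by simp
qed

lemma vnorm_unit: "j < k ==> vnorm k (%l. of_bool (l = j)) = 1"
proof -
  assume j: "j < k"
  have "(\<Sum>l<k. (of_bool (l = j) :: real)\<^sup>2) = (\<Sum>l<k. if l = j then 1 else 0)" by (intro sum.cong refl) auto
  also have "... = 1" using j by (simp add: sum.delta)
  finally show ?thesis unfolding vnorm_def by simp
qed

lemma vnorm_diff_abs: "\<bar>vnorm n x - vnorm n y\<bar> \<le> vnorm n (%i. x i - y i)"
  using vnorm_triangle[of n "%i. x i - y i" y] vnorm_triangle[of n "%i. y i - x i" x] vnorm_minus_commute[of n x y] by simp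

lemma vinner_lc_lc: "vinner n (lc k W u) (lc k W' v) = (\<Sum>j<k. \<Sum>l<k. u j * vinner n (W j) (W' l) * v l)"
  unfolding lc_def vinner_sum_left vinner_sum_right by (simp add: sum_distrib_left mult_ac)

text \<open>An operator-type Lipschitz condition: each combination \<open>u\<close> of the columns
  is Lipschitz with constant \<Lambda> |u|, as concentration of the norm of W u requires.\<close>

locale lipschitz_family =
  fixes I :: "'i::countable set" and n k :: nat and W :: "('i => real) => vecs" and \<Lambda> :: real
  assumes fin: "finite I" and pos: "0 < \<Lambda>"
    and lip: "\<And>x y u. x \<in> space (PiM I (%_. borel)) ==> y \<in> space (PiM I (%_. borel)) ==>
      vnorm n (lc k (%j i. W x j i - W y j i) u) \<le> \<Lambda> * vnorm k u * L2_set (%i. x i - y i) I"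
begin

sublocale prob_space "gauss I" by (rule prob_space_gauss)

lemma coord_lipschitz: "j < k ==> i < n ==> gauss_lipschitz I (%x. W x j i) \<Lambda>"
proof (rule gauss_lipschitz.intro[OF fin pos])
  fix x y assume ji: "j < k" "i < n" and xy: "x \<in> space (PiM I (%_. borel :: real measure))" "y \<in> space (PiM I (%_. borel :: real measure))"
  show "\<bar>W x j i - W y j i\<bar> \<le> \<Lambda> * L2_set (%i. x i - y i) I"
    using order_trans[OF vnorm_coord_diff[OF ji(2,1), of "%j i. W x j i - W y j i"] lip[OF xy]]
    by (simp add: vnorm_unit[OF ji(1)])
qed

lemma norm_lipschitz: "0 < vnorm k u ==> gauss_lipschitz I (%x. vnorm n (lc k (W x) u)) (\<Lambda> * vnorm k u)"
proof (rule gauss_lipschitz.intro[OF fin])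
  assume u: "0 < vnorm k u"
  then show "0 < \<Lambda> * vnorm k u" using pos by simp
  fix x y assume xy: "x \<in> space (PiM I (%_. borel :: real measure))" "y \<in> space (PiM I (%_. borel :: real measure))"
  have eq: "(%i. lc k (W x) u i - lc k (W y) u i) = lc k (%j i. W x j i - W y j i) u"
    unfolding lc_def by (simp add: sum_subtractf right_diff_distrib)
  show "\<bar>vnorm n (lc k (W x) u) - vnorm n (lc k (W y) u)\<bar> \<le> \<Lambda> * vnorm k u * L2_set (%i. x i - y i) I"
    using order_trans[OF vnorm_diff_abs[of n "lc k (W x) u" "lc k (W y) u"] lip[OF xy, of u, folded eq]] .
qed

lemma coord_measurable: "j < k ==> i < n ==> (%x. W x j i) \<in> borel_measurable (gauss I)"
  using gauss_lipschitz.meas[OF coord_lipschitz] .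

lemma integrable_mult:
  assumes "j < k" "i < n" "l < k" "i' < n" shows "integrable (gauss I) (%x. W x j i * W x l i')"
proof (rule Bochner_Integration.integrable_bound)
  show "integrable (gauss I) (%x. (W x j i)\<^sup>2 + (W x l i')\<^sup>2)"
    using assms by (intro Bochner_Integration.integrable_add gauss_lipschitz.integrable_square[OF coord_lipschitz])
  show "(%x. W x j i * W x l i') \<in> borel_measurable (gauss I)"
    using assms by (intro borel_measurable_times coord_measurable)
  show "AE x in gauss I. norm (W x j i * W x l i') \<le> norm ((W x j i)\<^sup>2 + (W x l i')\<^sup>2)"
  proof (rule AE_I2)
    fix x
    have "2 * \<bar>W x j i\<bar> * \<bar>W x l i'\<bar> \<le> \<bar>W x j i\<bar>\<^sup>2 + \<bar>W x l i'\<bar>\<^sup>2" by (rule sum_squares_bound)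
    then have "2 * (\<bar>W x j i\<bar> * \<bar>W x l i'\<bar>) \<le> (W x j i)\<^sup>2 + (W x l i')\<^sup>2" by simp
    moreover have "0 \<le> \<bar>W x j i\<bar> * \<bar>W x l i'\<bar>" "0 \<le> (W x j i)\<^sup>2 + (W x l i')\<^sup>2" by simp_all
    ultimately show "norm (W x j i * W x l i') \<le> norm ((W x j i)\<^sup>2 + (W x l i')\<^sup>2)"
      unfolding real_norm_def abs_mult by linarith
  qed
qed

definition gram :: "vecs" where "gram j l = expectation (%x. vinner n (W x j) (W x l))"

lemma integrable_vinner: "j < k ==> l < k ==> integrable (gauss I) (%x. vinner n (W x j) (W x l))"
  unfolding vinner_def by (intro Bochner_Integration.integrable_sum integrable_mult) auto

lemma vinner_lc_integral:
  "integrable (gauss I) (%x. vinner n (lc k (W x) u) (lc k (W x) v))" (is ?A)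
  "expectation (%x. vinner n (lc k (W x) u) (lc k (W x) v)) = bf k gram u v" (is ?B)
proof -
  have i: "integrable (gauss I) (%x. u j * vinner n (W x j) (W x l) * v l)" if "j < k" "l < k" for j l
    by (intro integrable_mult_left integrable_mult_right integrable_vinner that)
  have i1: "integrable (gauss I) (%x. \<Sum>l<k. u j * vinner n (W x j) (W x l) * v l)" if "j < k" for j
    using that by (intro Bochner_Integration.integrable_sum i) auto
  show ?A unfolding vinner_lc_lc by (intro Bochner_Integration.integrable_sum i) auto
  have "expectation (%x. vinner n (lc k (W x) u) (lc k (W x) v))
     = (\<Sum>j<k. expectation (%x. \<Sum>l<k. u j * vinner n (W x j) (W x l) * v l))"
    unfolding vinner_lc_lc by (rule Bochner_Integration.integral_sum) (use i1 in auto)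
  also have "... = (\<Sum>j<k. \<Sum>l<k. expectation (%x. u j * vinner n (W x j) (W x l) * v l))"
    by (intro sum.cong refl Bochner_Integration.integral_sum) (use i in auto)
  also have "... = bf k gram u v" unfolding bf_def gram_def
    by (intro sum.cong refl) (simp add: mult_ac)
  finally show ?B .
qed

text \<open>For fixed u the norm of W u is Lipschitz and stays within \<tau> |u| of its mean, so its
  square moves by at most 2 \<tau> b + \<tau>^2 in units of |u|^2. The squared mean differs from the
  mean square by the variance, at most 4 \<Lambda>^2 |u|^2. Uniformity in u comes from the averaging
  over balls, with its 5^k and 8/7.\<close>

lemma gram_concentration:
  assumes tau: "0 < \<tau>" and b0: "0 \<le> b" and b: "\<And>u. bf k gram u u \<le> (b * vnorm k u)\<^sup>2"
  shows "\<exists>B\<in>sets (gauss I). prob B \<le> 5 ^ k * (2 * exp (- \<tau>\<^sup>2 / (4 * \<Lambda>\<^sup>2))) \<and>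
    (\<forall>x\<in>space (gauss I) - B. \<forall>u. \<bar>bf k (%j l. vinner n (W x j) (W x l) - gram j l) u u\<bar>
        \<le> 8/7 * (2 * \<tau> * b + \<tau>\<^sup>2 + 4 * \<Lambda>\<^sup>2) * (vnorm k u)\<^sup>2)"
proof (rule quadratic_form_uniform_bound)
  let ?t = "2 * \<tau> * b + \<tau>\<^sup>2 + 4 * \<Lambda>\<^sup>2"
  show "0 < ?t" using tau b0 pos by (intro add_nonneg_pos add_nonneg_nonneg) auto
  show "vinner n (W x j) (W x l) - gram j l = vinner n (W x l) (W x j) - gram l j" for x j l
    unfolding gram_def by (simp only: vinner_commute[of n "W _ j" "W _ l"])
  show "(%x. vinner n (W x j) (W x l) - gram j l) \<in> borel_measurable (gauss I)" if "j < k" "l < k" for j l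
    using integrable_vinner[OF that] by (intro borel_measurable_diff borel_measurable_const borel_measurable_integrable)
  fix u :: vec assume "vnorm k u \<noteq> 0"
  then have u: "0 < vnorm k u" by (simp add: less_le)
  let ?h = "%x. vnorm n (lc k (W x) u)" and ?s = "vnorm k u"
  interpret h: gauss_lipschitz I ?h "\<Lambda> * ?s" by (rule norm_lipschitz[OF u])
  let ?m = "expectation ?h"
  have m0: "0 \<le> ?m" by (rule Bochner_Integration.integral_nonneg) simp
  have h2: "expectation (%x. (?h x)\<^sup>2) = bf k gram u u"
    using vinner_lc_integral(2)[of u u] unfolding vinner_self .
  have var: "expectation (%x. (?h x - ?m)\<^sup>2) = bf k gram u u - ?m\<^sup>2"
    unfolding h2[symmetric] by (rule variance_eq[OF h.integrable_h h.integrable_square])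
  have "0 \<le> expectation (%x. (?h x - ?m)\<^sup>2)" by (rule Bochner_Integration.integral_nonneg) simp
  then have v0: "?m\<^sup>2 \<le> bf k gram u u" unfolding var by simp
  have v1: "bf k gram u u - ?m\<^sup>2 \<le> 4 * (\<Lambda> * ?s)\<^sup>2" using h.variance_bound unfolding var .
  have mb: "?m \<le> b * ?s" by (rule power2_le_imp_le[OF order_trans[OF v0 b]]) (use b0 u in simp)
  have sub: "{x \<in> space (gauss I). ?t * ?s\<^sup>2 \<le> \<bar>bf k (%j l. vinner n (W x j) (W x l) - gram j l) u u\<bar>}
     \<subseteq> {x \<in> space (gauss I). \<tau> * ?s \<le> \<bar>?h x - ?m\<bar>}"
  proof (intro subsetI, rule ccontr)
    fix x assume x: "x \<in> {x \<in> space (gauss I). ?t * ?s\<^sup>2 \<le> \<bar>bf k (%j l. vinner n (W x j) (W x l) - gram j l) u u\<bar>}"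
      and nx: "x \<notin> {x \<in> space (gauss I). \<tau> * ?s \<le> \<bar>?h x - ?m\<bar>}"
    have d: "\<bar>?h x - ?m\<bar> < \<tau> * ?s" using x nx by auto
    have "bf k (%j l. vinner n (W x j) (W x l) - gram j l) u u = (?h x)\<^sup>2 - bf k gram u u"
      unfolding bf_diff_mat vinner_self[symmetric] vinner_lc_lc bf_def by simp
    then have "\<bar>bf k (%j l. vinner n (W x j) (W x l) - gram j l) u u\<bar> \<le> \<bar>(?h x)\<^sup>2 - ?m\<^sup>2\<bar> + 4 * (\<Lambda> * ?s)\<^sup>2"
      using v0 v1 by linarith
    also have "(?h x)\<^sup>2 - ?m\<^sup>2 = (?h x - ?m) * (?h x + ?m)" by (simp add: power2_eq_square algebra_simps)
    also have "\<bar>(?h x - ?m) * (?h x + ?m)\<bar> < (\<tau> * ?s) * (2 * (b * ?s) + \<tau> * ?s)"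
    proof -
      have s: "\<bar>?h x + ?m\<bar> \<le> 2 * (b * ?s) + \<tau> * ?s" using d mb m0 vnorm_nonneg[of n "lc k (W x) u"] by linarith
      have p: "0 < 2 * (b * ?s) + \<tau> * ?s" using tau u b0 by (intro add_nonneg_pos) auto
      show ?thesis unfolding abs_mult
        using mult_left_mono[OF s abs_ge_zero[of "?h x - ?m"]] mult_strict_right_mono[OF d p] by linarith
    qed
    also have "(\<tau> * ?s) * (2 * (b * ?s) + \<tau> * ?s) + 4 * (\<Lambda> * ?s)\<^sup>2 = ?t * ?s\<^sup>2"
      by (simp add: power2_eq_square algebra_simps)
    finally show False using x by simp
  qed
  have "prob {x \<in> space (gauss I). ?t * ?s\<^sup>2 \<le> \<bar>bf k (%j l. vinner n (W x j) (W x l) - gram j l) u u\<bar>}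
     \<le> prob {x \<in> space (gauss I). \<tau> * ?s \<le> \<bar>?h x - ?m\<bar>}"
    by (rule finite_measure_mono[OF sub]) measurable
  also have "... \<le> 2 * exp (- (\<tau> * ?s)\<^sup>2 / (4 * (\<Lambda> * ?s)\<^sup>2))"
    by (rule h.concentration) (use tau u in auto)
  also have "- (\<tau> * ?s)\<^sup>2 / (4 * (\<Lambda> * ?s)\<^sup>2) = - \<tau>\<^sup>2 / (4 * \<Lambda>\<^sup>2)"
    using u pos by (simp add: power_mult_distrib)
  finally show "prob {x \<in> space (gauss I). ?t * ?s\<^sup>2 \<le> \<bar>bf k (%j l. vinner n (W x j) (W x l) - gram j l) u u\<bar>} \<le> 2 * exp (- \<tau>\<^sup>2 / (4 * \<Lambda>\<^sup>2))" .
qed simp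

end

subsection \<open>The error operator of the coupling\<close>

lemma vnorm_mv_le:
  assumes "bbd n A c" "0 \<le> c" shows "vnorm n (mv n n A y) \<le> c * vnorm n y"
proof -
  have "vnorm n (mv n n A y) = vnorm n (%i. \<Sum>j<n. A i j * y j)" by (rule vnorm_cong) (simp add: mv_def)
  then show ?thesis using bbd_mv[OF assms, of y] by simp
qed

lemma vnorm_adjoint_le:
  assumes Z: "\<And>u. vnorm n (lc k Z u) \<le> c * vnorm k u" and c0: "0 \<le> c"
  shows "vnorm k (%s. vinner n (Z s) y) \<le> c * vnorm n y"
proof -
  let ?a = "%s. vinner n (Z s) y"
  have "(vnorm k ?a)\<^sup>2 = vinner n (lc k Z ?a) y"
    unfolding lc_def vinner_sum_left vnorm_sq by (simp add: power2_eq_square)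
  also have "... \<le> vnorm n (lc k Z ?a) * vnorm n y" using vinner_CS[of n "lc k Z ?a" y] by linarith
  also have "... \<le> c * vnorm k ?a * vnorm n y" by (rule mult_right_mono[OF Z]) simp
  finally have "vnorm k ?a * vnorm k ?a \<le> (c * vnorm n y) * vnorm k ?a" by (simp add: power2_eq_square mult_ac)
  moreover have "0 \<le> c * vnorm n y" using c0 by simp
  ultimately show ?thesis by (cases "vnorm k ?a = 0") (simp_all add: less_le)
qed

text \<open>The sum may run over all s < T because <z_s, q_t>/n equals A'_ts for s > t, so that
  those terms cancel. Hence the triangular correction is a difference of the full matrices
  \<open>A'\<close> and Z^T Q / n, whose norms are controlled without any truncation.\<close>

lemma columns_identity:
  assumes n: "0 < n" and o: "orth n T Q"
    and A: "\<And>i j. A i j = A j i" and A': "\<And>i j. A' i j = A' j i"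
    and Z: "\<And>s i. s < T ==> i < n ==> Z s i = znext n Q s A A' i" and t: "t < T" and i: "i < n"
  shows "Z t i = mv n n A (Q t) i + (\<Sum>s<T. (A' s t - vinner n (Z s) (Q t) / real n) * Q s i)"
proof -
  define a where "a r s = vinner n (Q r) (mv n n A (Q s)) / real n" for r s
  have a_sym: "a r s = a s r" for r s
  proof -
    have "vinner n (Q r) (mv n n A (Q s)) = bf n A (Q r) (Q s)" for r s
      unfolding bf_vinner_right by (rule vinner_cong) (auto simp: mv_def)
    then show ?thesis unfolding a_def using bf_sym[of n A "Q r" "Q s"] A by simp
  qed
  have ip: "vinner n (Z s) (Q t) / real n = (if t < s then A' t s else if t = s then (a t t + A' t t) / 2 else a t s)" if s: "s < T" for s
  proof -
    have "vinner n (Z s) (Q t) = vinner n (%i. mv n n A (Q s) i + (A' s s - a s s) / 2 * Q s i + (\<Sum>r<s. (A' r s - a r s) * Q r i)) (Q t)"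
      by (rule vinner_cong) (simp_all add: Z s znext_def a_def)
    also have "... = real n * a t s + (A' s s - a s s) / 2 * vinner n (Q s) (Q t) + (\<Sum>r<s. (A' r s - a r s) * vinner n (Q r) (Q t))"
      unfolding vinner_linear using n by (simp add: a_def vinner_commute[of n "mv n n A (Q s)"])
    also have "(\<Sum>r<s. (A' r s - a r s) * vinner n (Q r) (Q t)) = (\<Sum>r<s. if r = t then (A' t s - a t s) * real n else 0)"
      using s t by (intro sum.cong refl) (auto simp: orthD[OF o])
    also have "... = (if t < s then (A' t s - a t s) * real n else 0)" by (simp add: sum.delta)
    finally show ?thesis using n s t by (auto simp: orthD[OF o] field_simps)
  qed
  have "(\<Sum>s<T. (A' s t - vinner n (Z s) (Q t) / real n) * Q s i)
    = (\<Sum>s<T. (if s = t then (A' t t - a t t) / 2 * Q t i else 0) + (if s < t then (A' s t - a s t) * Q s i else 0))"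
  proof (rule sum.cong[OF refl])
    fix s assume "s \<in> {..<T}"
    then have s: "s < T" by simp
    consider "s < t" | "s = t" | "t < s" by linarith
    then show "(A' s t - vinner n (Z s) (Q t) / real n) * Q s i
      = (if s = t then (A' t t - a t t) / 2 * Q t i else 0) + (if s < t then (A' s t - a s t) * Q s i else 0)"
    proof cases
      case 1 then show ?thesis unfolding ip[OF s] by (simp add: a_sym[of t s])
    next
      case 2 then show ?thesis unfolding ip[OF s] by (simp add: field_simps)
    next
      case 3 then show ?thesis unfolding ip[OF s] by (simp add: A'[of t s])
    qed
  qed
  also have "... = (A' t t - a t t) / 2 * Q t i + (\<Sum>s<t. (A' s t - a s t) * Q s i)"
  proof -
    have "(\<Sum>s<T. if s < t then (A' s t - a s t) * Q s i else 0) = (\<Sum>s<t. (A' s t - a s t) * Q s i)"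
      using t by (intro sum.mono_neutral_cong_right) auto
    moreover have "(\<Sum>s<T. if s = t then (A' t t - a t t) / 2 * Q t i else 0) = (A' t t - a t t) / 2 * Q t i"
      using t by (simp add: sum.delta)
    ultimately show ?thesis unfolding sum.distrib by simp
  qed
  finally show ?thesis unfolding Z[OF t i] znext_def a_def by simp
qed

text \<open>Two estimates for two regimes. The fine one pairs H K with the empirical matrix Z^T H /
  n, so that only the deviation \<open>y\<close> and terms containing d remain; the crude one bounds
  H K and Q Z^T Q / n separately and serves when \<open>S\<close> is far from the identity.\<close>

lemma error_operator_bound:
  fixes V :: "vec => vec"
  assumes n: "0 < n" and T: "1 \<le> T" and o: "orth n T Q"
    and A: "\<And>i j. A i j = A j i" and A': "\<And>i j. A' i j = A' j i"
    and An: "bbd n A 4" and A'n: "bbd T A' a" and a0: "0 \<le> a"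
    and Z: "\<And>s i. s < T ==> i < n ==> Z s i = znext n Q s A A' i"
    and H: "\<And>s i. s < T ==> i < n ==> H s i = lc T Q (%r. C r s) i"
    and up: "\<And>i j. i < T ==> j < i ==> C i j = 0" and dg: "\<And>i. i < T ==> 0 \<le> C i i"
    and ZZ: "\<And>u. vnorm n (lc T Z u) \<le> z * vnorm T u" and z0: "0 \<le> z"
    and HH: "bbd T (%j l. vinner n (H j) (H l) / real n - of_bool (j = l)) e" and e0: "0 \<le> e"
    and ZH: "bbd T (%s t. vinner n (Z s) (H t) / real n - K s t) (y / sqrt (real n))" and y0: "0 \<le> y"
    and K: "bbd T K \<kappa>" and k0: "0 \<le> \<kappa>"
    and V: "\<And>x i. V x i = lc T Z x i - mv n n A (lc T H x) i + lc T H (%s. \<Sum>t<T. K s t * x t) i"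
    and d: "d = 5 * log 2 (2 * real T) * e"
  shows "vnorm n (V x) \<le> (4 * sqrt (real n) * d + sqrt (real n) * a + sqrt (real n) * d * \<kappa> + y + z * d) * vnorm T x" (is ?fine)
    and "vnorm n (V x) \<le> (4 * sqrt (real n) * d + sqrt (real n) * a + z + sqrt (real n * (1 + e)) * \<kappa>) * vnorm T x" (is ?crude)
proof -
  let ?n = "real n" and ?s = "sqrt (real n)"
  let ?C = "%x r. \<Sum>s<T. C r s * x s"
  have l0: "0 \<le> log 2 (2 * real T)" using T by simp
  have d0: "0 \<le> d" unfolding d using l0 e0 by simp
  have lcH: "lc T H x i = lc T Q (?C x) i" if "i < n" for x i
  proof -
    have "lc T H x i = (\<Sum>s<T. \<Sum>r<T. x s * (C r s * Q r i))" unfolding lc_def using that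
      by (intro sum.cong refl) (simp add: H lc_def sum_distrib_left)
    also have "... = (\<Sum>r<T. \<Sum>s<T. x s * (C r s * Q r i))" by (rule sum.swap)
    finally show ?thesis unfolding lc_def by (simp add: sum_distrib_right sum_distrib_left mult_ac)
  qed
  have CC: "(\<Sum>l<T. C l j * C l m) = vinner n (H j) (H m) / ?n" if "j < T" "m < T" for j m
  proof -
    have "vinner n (H j) (H m) = vinner n (lc T Q (%r. C r j)) (lc T Q (%r. C r m))"
      using that by (intro vinner_cong) (simp_all add: H)
    also have "... = (\<Sum>r<T. C r j * vinner n (Q r) (lc T Q (%r. C r m)))"
      by (subst (1) lc_def) (rule vinner_sum_left)
    also have "... = (\<Sum>r<T. ?n * (C r j * C r m))" by (intro sum.cong refl) (simp add: vinner_orth_lc[OF o])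
    finally show ?thesis using n by (simp add: sum_distrib_left[symmetric])
  qed
  have CI: "bbd T (%i j. C i j - of_bool (i = j)) d" unfolding d
  proof (rule cholesky_perturbation[OF T up dg])
    have "bf T (%i j. (\<Sum>l<T. C l i * C l j) - of_bool (i = j)) x y = bf T (%j l. vinner n (H j) (H l) / ?n - of_bool (j = l)) x y" for x y
      by (rule bf_cong) (simp_all add: CC)
    then show "bbd T (%i j. (\<Sum>l<T. C l i * C l j) - of_bool (i = j)) e" using HH unfolding bbd_def by simp
  qed
  \<comment> \<open>D x = (I - C) x, so that Q x - H x = Q (D x): every passage between the
    directions and the columns of \<open>H\<close> is paid for by C - I.\<close>
  define D where "D x = (%r. x r - ?C x r)" for x :: vec
  have Dn: "vnorm T (D x) \<le> d * vnorm T x" for x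
  proof -
    have "vnorm T (D x) = vnorm T (%i. \<Sum>j<T. (C i j - of_bool (i = j)) * x j)"
    proof -
      have "(\<Sum>j<T. (C i j - of_bool (i = j)) * x j) = - D x i" if "i < T" for i
      proof -
        have "(\<Sum>j<T. of_bool (i = j) * x j) = (\<Sum>j<T. if j = i then x i else 0)" by (intro sum.cong refl) auto
        also have "... = x i" using that by (simp add: sum.delta)
        finally show ?thesis unfolding D_def by (simp add: left_diff_distrib sum_subtractf)
      qed
      then show ?thesis using vnorm_cong[of T "%i. \<Sum>j<T. (C i j - of_bool (i = j)) * x j" "%i. - D x i"] by simp
    qed
    then show ?thesis using bbd_mv[OF CI d0, of x] by simp
  qed
  have Qn: "vnorm n (lc T Q u) = ?s * vnorm T u" for u by (rule vnorm_orth_lc[OF o])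
  have QHD: "lc T Q x i = lc T H x i + lc T Q (D x) i" if "i < n" for x i
    unfolding lcH[OF that] D_def lc_diff by simp
  let ?adj = "%w s. vinner n (Z s) w"
  define R where "R = (%s. (\<Sum>t<T. A' s t * x t) - ?adj (lc T Q x) s / ?n)"
  have ZAQ: "lc T Z x i = mv n n A (lc T Q x) i + lc T Q R i" if i: "i < n" for i
  proof -
    have "lc T Z x i = (\<Sum>t<T. x t * mv n n A (Q t) i) + (\<Sum>t<T. \<Sum>s<T. x t * ((A' s t - ?adj (Q t) s / ?n) * Q s i))"
      unfolding lc_def sum.distrib[symmetric]
      by (intro sum.cong refl) (simp add: columns_identity[OF n o A A' Z _ i] distrib_left sum_distrib_left)
    also have "(\<Sum>t<T. x t * mv n n A (Q t) i) = mv n n A (lc T Q x) i"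
    proof -
      have "(\<Sum>t<T. x t * mv n n A (Q t) i) = (\<Sum>t<T. \<Sum>j<n. x t * (A i j * Q t j))"
        using i by (simp add: mv_def sum_distrib_left)
      also have "... = (\<Sum>j<n. \<Sum>t<T. x t * (A i j * Q t j))" by (rule sum.swap)
      also have "... = mv n n A (lc T Q x) i" using i by (simp add: mv_def lc_def sum_distrib_left mult_ac)
      finally show ?thesis .
    qed
    also have "(\<Sum>t<T. \<Sum>s<T. x t * ((A' s t - ?adj (Q t) s / ?n) * Q s i)) = (\<Sum>s<T. \<Sum>t<T. x t * ((A' s t - ?adj (Q t) s / ?n) * Q s i))"
      by (rule sum.swap)
    also have "... = lc T Q R i"
      unfolding lc_def[of T Q R]
    proof (rule sum.cong[OF refl])
      fix s
      have "?adj (lc T Q x) s = (\<Sum>t<T. x t * ?adj (Q t) s)" unfolding lc_def by (rule vinner_sum_right)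
      then have "R s = (\<Sum>t<T. x t * (A' s t - ?adj (Q t) s / ?n))"
        unfolding R_def by (simp add: right_diff_distrib sum_subtractf sum_divide_distrib mult_ac)
      then show "(\<Sum>t<T. x t * ((A' s t - ?adj (Q t) s / ?n) * Q s i)) = R s * Q s i"
        by (simp add: sum_distrib_right sum_distrib_left mult_ac)
    qed
    finally show ?thesis .
  qed
  have mvd: "mv n n A (lc T Q x) i - mv n n A (lc T H x) i = mv n n A (lc T Q (D x)) i" if "i < n" for i
  proof -
    have "(\<Sum>j<n. A i j * lc T Q x j) = (\<Sum>j<n. A i j * lc T H x j + A i j * lc T Q (D x) j)"
    proof (rule sum.cong[OF refl])
      fix j assume "j \<in> {..<n}"
      then show "A i j * lc T Q x j = A i j * lc T H x j + A i j * lc T Q (D x) j"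
        unfolding distrib_left[symmetric] by (subst QHD) simp_all
    qed
    then show ?thesis unfolding mv_def using that by (simp only: if_True sum.distrib add_diff_cancel_left')
  qed
  let ?A'x = "%s. \<Sum>t<T. A' s t * x t" and ?Kx = "%s. \<Sum>t<T. K s t * x t"
  have V1: "V x i = mv n n A (lc T Q (D x)) i + lc T Q R i + lc T H ?Kx i" if "i < n" for i
    unfolding V ZAQ[OF that] mvd[OF that, symmetric] by simp
  have AQD: "vnorm n (mv n n A (lc T Q (D x))) \<le> 4 * ?s * d * vnorm T x"
  proof -
    have "vnorm n (mv n n A (lc T Q (D x))) \<le> 4 * (?s * vnorm T (D x))" using vnorm_mv_le[OF An, of "lc T Q (D x)"] Qn by simp
    also have "... \<le> 4 * (?s * (d * vnorm T x))" by (intro mult_left_mono Dn) auto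
    finally show ?thesis by (simp add: mult_ac)
  qed
  have A'x: "vnorm n (lc T Q ?A'x) \<le> ?s * a * vnorm T x"
    unfolding Qn using mult_left_mono[OF bbd_mv[OF A'n a0, of x], of ?s] by (simp add: mult_ac)
  have adjn: "vnorm n (lc T Q (%s. ?adj w s / ?n)) \<le> z / ?s * vnorm n w" for w
  proof -
    have "vnorm n (lc T Q (%s. ?adj w s / ?n)) = ?s * (vnorm T (?adj w) / ?n)"
      unfolding Qn using vnorm_scale[of T "1 / ?n" "?adj w"] by simp
    also have "... = vnorm T (?adj w) / ?s" using n by (simp add: field_simps)
    also have "... \<le> z * vnorm n w / ?s" by (intro divide_right_mono vnorm_adjoint_le ZZ z0) simp
    finally show ?thesis by simp
  qed
  have V2: "V x i = (mv n n A (lc T Q (D x)) i + lc T Q ?A'x i) + (lc T H ?Kx i - lc T Q (%s. ?adj (lc T Q x) s / ?n) i)" if "i < n" for i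
    unfolding V1[OF that] R_def lc_diff by simp
  have s0: "0 < ?s" using n by simp
  show ?crude
  proof -
    have HKx: "vnorm n (lc T H u) \<le> sqrt (?n * (1 + e)) * vnorm T u" for u
    proof -
      have "(vnorm n (lc T H u))\<^sup>2 = ?n * (bf T (%j l. vinner n (H j) (H l) / ?n - of_bool (j = l)) u u + (vnorm T u)\<^sup>2)"
        unfolding bf_diff_mat bf_id vinner_self unfolding vinner_self[symmetric, of n] vinner_lc_lc bf_def
        using n by (simp add: sum_distrib_left)
      also have "... \<le> ?n * (e * vnorm T u * vnorm T u + (vnorm T u)\<^sup>2)"
        using bbdD[OF HH, of u u] by (intro mult_left_mono) auto
      also have "... = (sqrt (?n * (1 + e)) * vnorm T u)\<^sup>2"
        using e0 by (simp add: power_mult_distrib power2_eq_square algebra_simps)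
      finally show ?thesis by (rule power2_le_imp_le) (use e0 in simp)
    qed
    have 1: "vnorm n (lc T H ?Kx) \<le> sqrt (?n * (1 + e)) * \<kappa> * vnorm T x"
      using order_trans[OF HKx mult_left_mono[OF bbd_mv[OF K k0, of x]]] e0 by (simp add: mult_ac)
    have 2: "vnorm n (lc T Q (%s. ?adj (lc T Q x) s / ?n)) \<le> z * vnorm T x"
      using adjn[of "lc T Q x"] n unfolding Qn by simp
    have "vnorm n (V x) = vnorm n (%i. (mv n n A (lc T Q (D x)) i + lc T Q ?A'x i) + (lc T H ?Kx i - lc T Q (%s. ?adj (lc T Q x) s / ?n) i))"
      by (rule vnorm_cong) (rule V2)
    also have "... \<le> (vnorm n (mv n n A (lc T Q (D x))) + vnorm n (lc T Q ?A'x)) + (vnorm n (lc T H ?Kx) + vnorm n (lc T Q (%s. ?adj (lc T Q x) s / ?n)))"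
      by (rule order_trans[OF vnorm_triangle add_mono[OF vnorm_triangle vnorm_diff]])
    also have "... \<le> (4 * ?s * d * vnorm T x + ?s * a * vnorm T x) + (sqrt (?n * (1 + e)) * \<kappa> * vnorm T x + z * vnorm T x)"
      by (intro add_mono AQD A'x 1 2)
    finally show ?thesis by (simp add: algebra_simps)
  qed
  show ?fine
  proof -
    \<comment> \<open>The cancellation behind the fine bound: H K - Q Z^T Q / n = - Q D K + Q (K -
      Z^T H / n) - Q Z^T Q D / n.\<close>
    have 3: "lc T H ?Kx i - lc T Q (%s. ?adj (lc T Q x) s / ?n) i
       = - lc T Q (D ?Kx) i + (lc T Q (%s. ?Kx s - ?adj (lc T H x) s / ?n) i - lc T Q (%s. ?adj (lc T Q (D x)) s / ?n) i)" if "i < n" for i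
    proof -
      have "?adj (lc T Q x) s = ?adj (lc T H x) s + ?adj (lc T Q (D x)) s" for s
        unfolding vinner_add_right[symmetric] by (rule vinner_cong[OF refl QHD])
      then have "lc T Q (%s. ?adj (lc T Q x) s / ?n) i = lc T Q (%s. ?adj (lc T H x) s / ?n) i + lc T Q (%s. ?adj (lc T Q (D x)) s / ?n) i"
        by (simp add: lc_add add_divide_distrib)
      then show ?thesis using QHD[OF that, of ?Kx] unfolding lc_diff by simp
    qed
    have 4: "vnorm n (%i. - lc T Q (D ?Kx) i) \<le> ?s * d * \<kappa> * vnorm T x"
    proof -
      have "vnorm T (D ?Kx) \<le> d * (\<kappa> * vnorm T x)"
        by (rule order_trans[OF Dn mult_left_mono[OF bbd_mv[OF K k0]]]) (rule d0)
      then show ?thesis unfolding vnorm_uminus Qn using mult_left_mono[of _ _ ?s] by (simp add: mult.assoc)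
    qed
    have 5: "vnorm n (lc T Q (%s. ?Kx s - ?adj (lc T H x) s / ?n)) \<le> y * vnorm T x"
    proof -
      have "?Kx s - ?adj (lc T H x) s / ?n = - (\<Sum>t<T. (vinner n (Z s) (H t) / ?n - K s t) * x t)" for s
        unfolding lc_def vinner_sum_right by (simp add: left_diff_distrib right_diff_distrib sum_subtractf sum_divide_distrib mult_ac)
      then have "vnorm T (%s. ?Kx s - ?adj (lc T H x) s / ?n) = vnorm T (%s. \<Sum>t<T. (vinner n (Z s) (H t) / ?n - K s t) * x t)" by simp
      also have "... \<le> y / ?s * vnorm T x" by (rule bbd_mv[OF ZH]) (use y0 in simp)
      finally have "?s * vnorm T (%s. ?Kx s - ?adj (lc T H x) s / ?n) \<le> ?s * (y / ?s * vnorm T x)" using s0 by (intro mult_left_mono) auto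
      then show ?thesis unfolding Qn using s0 by simp
    qed
    have 6: "vnorm n (lc T Q (%s. ?adj (lc T Q (D x)) s / ?n)) \<le> z * d * vnorm T x"
    proof -
      have "vnorm n (lc T Q (%s. ?adj (lc T Q (D x)) s / ?n)) \<le> z * vnorm T (D x)"
        using adjn[of "lc T Q (D x)"] n unfolding Qn by simp
      also have "... \<le> z * (d * vnorm T x)" by (intro mult_left_mono Dn z0)
      finally show ?thesis by (simp add: mult.assoc)
    qed
    have V3: "V x i = (mv n n A (lc T Q (D x)) i + lc T Q ?A'x i) + (- lc T Q (D ?Kx) i + (lc T Q (%s. ?Kx s - ?adj (lc T H x) s / ?n) i - lc T Q (%s. ?adj (lc T Q (D x)) s / ?n) i))" if "i < n" for i
      unfolding V2[OF that] 3[OF that] ..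
    have "vnorm n (V x) = vnorm n (%i. (mv n n A (lc T Q (D x)) i + lc T Q ?A'x i) + (- lc T Q (D ?Kx) i + (lc T Q (%s. ?Kx s - ?adj (lc T H x) s / ?n) i - lc T Q (%s. ?adj (lc T Q (D x)) s / ?n) i)))"
      by (rule vnorm_cong) (rule V3)
    also have "... \<le> (vnorm n (mv n n A (lc T Q (D x))) + vnorm n (lc T Q ?A'x))
       + (vnorm n (%i. - lc T Q (D ?Kx) i) + (vnorm n (lc T Q (%s. ?Kx s - ?adj (lc T H x) s / ?n)) + vnorm n (lc T Q (%s. ?adj (lc T Q (D x)) s / ?n))))"
      by (rule order_trans[OF vnorm_triangle add_mono[OF vnorm_triangle order_trans[OF vnorm_triangle add_mono[OF order_refl vnorm_diff]]]])
    also have "... \<le> (4 * ?s * d * vnorm T x + ?s * a * vnorm T x) + (?s * d * \<kappa> * vnorm T x + (y * vnorm T x + z * d * vnorm T x))"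
      by (intro add_mono AQD A'x 4 5 6)
    finally show ?thesis by (simp add: algebra_simps)
  qed
qed

subsection \<open>Constants\<close>

text \<open>Evaluates the Gram fluctuation at \<tau> = 2 \<Lambda> sqrt 5 \<rho> and b = s sqrt(2 (1
  + \<sigma>)), where s will be sqrt n and \<rho> will be sqrt(T + r). Young's inequality with
  weight s splits the mixed term, so that \<sigma> enters only as s \<sigma>.\<close>

lemma fluctuation_bound:
  fixes s \<sigma> \<rho> \<Lambda> L :: real
  assumes s: "1 \<le> s" and sg: "0 \<le> \<sigma>" and r: "1 \<le> \<rho>" "\<rho>\<^sup>2 \<le> 2 * s\<^sup>2" and L: "1 \<le> \<Lambda>" "\<Lambda> \<le> L"
  shows "8/7 * (2 * (2 * \<Lambda> * (sqrt 5 * \<rho>)) * (s * sqrt (2 * (1 + \<sigma>))) + (2 * \<Lambda> * (sqrt 5 * \<rho>))\<^sup>2 + 4 * \<Lambda>\<^sup>2)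
    \<le> s * (70 * (s * \<sigma> + L\<^sup>2 * \<rho>))"
    and "L * sqrt (1 + \<sigma>) * \<rho> \<le> 2 * (s * \<sigma> + L\<^sup>2 * \<rho>)"
proof -
  \<comment> \<open>\<open>M\<close> is \<Lambda> for the first claim and \<open>L\<close> for the
    second. The bound \<rho>^2 \<le> 2 s^2, which reflects T \<le> n and r \<le> n, gives \<rho>
    \<le> 3/2 s.\<close>
  have aux: "M * \<rho> * sqrt (1 + \<sigma>) \<le> M\<^sup>2 * \<rho> + (s * \<sigma> + 3/2 * (M\<^sup>2 * \<rho>)) / 2" and aux2: "M\<^sup>2 * \<rho>\<^sup>2 \<le> 3/2 * s * (M\<^sup>2 * \<rho>)" if M: "1 \<le> M" for M
  proof -
    have "(3/2 * s)\<^sup>2 = 9/4 * s\<^sup>2" by (simp add: power_mult_distrib power_divide)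
    then have "\<rho>\<^sup>2 \<le> (3/2 * s)\<^sup>2" using r zero_le_power2[of s] by linarith
    then have "\<rho> \<le> 3/2 * s" by (rule power2_le_imp_le) (use s in simp)
    then have "\<rho> * \<rho> \<le> 3/2 * s * \<rho>" using r by (intro mult_right_mono) auto
    then have "M\<^sup>2 * (\<rho> * \<rho>) \<le> M\<^sup>2 * (3/2 * s * \<rho>)" by (rule mult_left_mono) simp
    then show 2: "M\<^sup>2 * \<rho>\<^sup>2 \<le> 3/2 * s * (M\<^sup>2 * \<rho>)" by (simp add: power2_eq_square mult_ac)
    have q: "sqrt (1 + \<sigma>) \<le> 1 + sqrt \<sigma>" by (rule real_le_lsqrt) (use sg in \<open>auto simp: power2_eq_square algebra_simps\<close>)
    have "M * \<rho> * sqrt \<sigma> \<le> (s * \<sigma> + 3/2 * (M\<^sup>2 * \<rho>)) / 2"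
    proof -
      have "0 \<le> (s * sqrt \<sigma> - M * \<rho>)\<^sup>2" by simp
      then have "2 * s * (M * \<rho> * sqrt \<sigma>) \<le> s\<^sup>2 * \<sigma> + M\<^sup>2 * \<rho>\<^sup>2"
        using sg by (simp add: power2_diff power_mult_distrib mult_ac)
      also have "... \<le> s * (s * \<sigma> + 3/2 * (M\<^sup>2 * \<rho>))" using 2 by (simp add: power2_eq_square algebra_simps)
      finally have "s * (2 * (M * \<rho> * sqrt \<sigma>)) \<le> s * (s * \<sigma> + 3/2 * (M\<^sup>2 * \<rho>))" by (simp add: mult_ac)
      then show ?thesis using s by simp
    qed
    moreover have "M * \<rho> \<le> M\<^sup>2 * \<rho>" using M r by (simp add: power2_eq_square)
    moreover have "M * \<rho> * sqrt (1 + \<sigma>) \<le> M * \<rho> * (1 + sqrt \<sigma>)" using q M r by (intro mult_left_mono) auto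
    ultimately show "M * \<rho> * sqrt (1 + \<sigma>) \<le> M\<^sup>2 * \<rho> + (s * \<sigma> + 3/2 * (M\<^sup>2 * \<rho>)) / 2"
      unfolding distrib_left by linarith
  qed
  let ?P = "\<Lambda>\<^sup>2 * \<rho>"
  have P: "?P \<le> L\<^sup>2 * \<rho>" using L r by (intro mult_right_mono power_mono) auto
  have P0: "0 \<le> ?P" "0 \<le> s * \<sigma>" using r s sg by auto
  show "L * sqrt (1 + \<sigma>) * \<rho> \<le> 2 * (s * \<sigma> + L\<^sup>2 * \<rho>)"
  proof -
    have "L * \<rho> * sqrt (1 + \<sigma>) \<le> L\<^sup>2 * \<rho> + (s * \<sigma> + 3/2 * (L\<^sup>2 * \<rho>)) / 2" by (rule aux) (use L in simp)
    moreover have "0 \<le> L\<^sup>2 * \<rho>" using r by simp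
    moreover have "L * sqrt (1 + \<sigma>) * \<rho> = L * \<rho> * sqrt (1 + \<sigma>)" by simp
    ultimately show ?thesis using P0 by argo
  qed
  have r10: "sqrt 5 * sqrt 2 \<le> (16/5 :: real)" unfolding real_sqrt_mult[symmetric] by (rule real_le_lsqrt) (auto simp: power2_eq_square)
  have t1: "2 * (2 * \<Lambda> * (sqrt 5 * \<rho>)) * (s * sqrt (2 * (1 + \<sigma>))) \<le> s * (64/5 * (?P + (s * \<sigma> + 3/2 * ?P) / 2))"
  proof -
    have "2 * (2 * \<Lambda> * (sqrt 5 * \<rho>)) * (s * sqrt (2 * (1 + \<sigma>))) = 4 * s * (sqrt 5 * sqrt 2) * (\<Lambda> * \<rho> * sqrt (1 + \<sigma>))"
      unfolding real_sqrt_mult[of 2 "1 + \<sigma>"] by algebra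
    also have "... \<le> 4 * s * (16/5) * (?P + (s * \<sigma> + 3/2 * ?P) / 2)"
      using r10 aux[OF L(1)] s sg L r P0 by (intro mult_mono) auto
    finally show ?thesis by (simp add: mult_ac)
  qed
  have t2: "(2 * \<Lambda> * (sqrt 5 * \<rho>))\<^sup>2 \<le> s * (30 * ?P)"
  proof -
    have "(2 * \<Lambda> * (sqrt 5 * \<rho>))\<^sup>2 = 20 * (\<Lambda>\<^sup>2 * \<rho>\<^sup>2)" by (simp add: power_mult_distrib)
    then show ?thesis using aux2[OF L(1)] by (simp add: mult_ac)
  qed
  have t3: "4 * \<Lambda>\<^sup>2 \<le> s * (6 * ?P)"
  proof -
    have "\<Lambda>\<^sup>2 * 1 \<le> \<Lambda>\<^sup>2 * \<rho>\<^sup>2" using r by (intro mult_left_mono) auto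
    then show ?thesis using aux2[OF L(1)] by (simp add: mult_ac)
  qed
  have "8/7 * (2 * (2 * \<Lambda> * (sqrt 5 * \<rho>)) * (s * sqrt (2 * (1 + \<sigma>))) + (2 * \<Lambda> * (sqrt 5 * \<rho>))\<^sup>2 + 4 * \<Lambda>\<^sup>2)
     \<le> 8/7 * (s * (64/5 * (?P + (s * \<sigma> + 3/2 * ?P) / 2)) + s * (30 * ?P) + s * (6 * ?P))"
    by (intro mult_left_mono add_mono t1 t2 t3) auto
  also have "... = s * (8/7 * (64/5 * (?P + (s * \<sigma> + 3/2 * ?P) / 2) + 36 * ?P))" by (simp add: algebra_simps)
  also have "... \<le> s * (70 * (s * \<sigma> + L\<^sup>2 * \<rho>))"
  proof (rule mult_left_mono)
    show "8/7 * (64/5 * (?P + (s * \<sigma> + 3/2 * ?P) / 2) + 36 * ?P) \<le> 70 * (s * \<sigma> + L\<^sup>2 * \<rho>)"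
      using P P0 by argo
  qed (use s in simp)
  finally show "8/7 * (2 * (2 * \<Lambda> * (sqrt 5 * \<rho>)) * (s * sqrt (2 * (1 + \<sigma>))) + (2 * \<Lambda> * (sqrt 5 * \<rho>))\<^sup>2 + 4 * \<Lambda>\<^sup>2)
    \<le> s * (70 * (s * \<sigma> + L\<^sup>2 * \<rho>))" .
qed

text \<open>If \<beta> \<le> s, then \<sigma> \<le> 1, so the norm bound for K is at most 2 and z is
  at most 9 s: the fine estimate is of order s d. If \<beta> > s, all terms of order s are below
  \<beta> and the crude estimate is enough.\<close>

lemma error_constants:
  fixes s \<sigma> \<rho> L l \<beta> :: real
  assumes s: "1 \<le> s" and sg: "0 \<le> \<sigma>" and r: "1 \<le> \<rho>" and L: "1 \<le> L" and l: "0 \<le> l" "l \<le> L"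
    and \<beta>: "\<beta> = s * \<sigma> + L\<^sup>2 * \<rho>" and \<eta>: "\<eta> = 70 * \<beta>" and a: "a = 8/7 * (2 * (sqrt 5 * \<rho> / s))"
    and z: "z = sqrt (s\<^sup>2 + s * \<eta>)" and e: "e = \<sigma> + \<eta> / s" and d: "d = 5 * l * e"
  shows "4 * s * d + s * a + s * d * sqrt (1 + \<sigma>) + \<eta> + z * d \<le> 5500 * (L * \<beta>)
    \<or> 4 * s * d + s * a + z + sqrt (s\<^sup>2 * (1 + e)) * sqrt (1 + \<sigma>) \<le> 5500 * (L * \<beta>)"
proof -
  have rL: "\<rho> \<le> L\<^sup>2 * \<rho>" using mult_right_mono[OF one_le_power[OF L, of 2], of \<rho>] r by simp
  have ps0: "0 \<le> s * \<sigma>" using s sg by simp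
  have b: "0 \<le> \<beta>" "\<rho> \<le> \<beta>" "s * \<sigma> \<le> \<beta>" using rL r ps0 unfolding \<beta> by linarith+
  have bL: "\<beta> \<le> L * \<beta>" using L b by (simp add: mult_le_cancel_right1)
  have e0: "0 \<le> e" "0 \<le> \<eta>" using b sg s by (auto simp: e \<eta>)
  have d0: "0 \<le> d" using e0 l by (simp add: d)
  have se: "s * e \<le> 71 * \<beta>"
  proof -
    have "s * e = s * \<sigma> + \<eta>" using s by (simp add: e field_simps)
    then show ?thesis using b by (simp add: \<eta>)
  qed
  have sd: "s * d \<le> 355 * (L * \<beta>)"
  proof -
    have "s * d = 5 * (l * (s * e))" by (simp add: d)
    also have "l * (s * e) \<le> L * (71 * \<beta>)" by (rule mult_mono[OF l(2) se]) (use l e0 s in auto)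
    finally show ?thesis by simp
  qed
  have sa: "s * a \<le> 6 * (L * \<beta>)"
  proof -
    have "sqrt 5 \<le> (9/4 :: real)" by (rule real_le_lsqrt) (auto simp: power2_eq_square)
    then have "sqrt 5 * \<rho> \<le> 9/4 * \<rho>" using r by (intro mult_right_mono) auto
    moreover have "s * a = 16/7 * (sqrt 5 * \<rho>)" using s by (simp add: a)
    ultimately show ?thesis using b bL by argo
  qed
  show ?thesis
  proof (cases "\<beta> \<le> s")
    case True
    have "s * \<sigma> \<le> s * 1" using b True by simp
    then have s1: "\<sigma> \<le> 1" using s by simp
    have k: "sqrt (1 + \<sigma>) \<le> 2" by (rule real_le_lsqrt) (use s1 sg in auto)
    have z9: "z \<le> 9 * s" unfolding z
    proof (rule real_le_lsqrt)
      have "s * \<eta> \<le> s * (70 * s)" using True s by (intro mult_left_mono) (auto simp: \<eta>)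
      then have "s * \<eta> \<le> 70 * (s * s)" by (simp only: mult_ac)
      moreover have "0 \<le> s * s" by simp
      ultimately have "s * s + s * \<eta> \<le> 81 * (s * s)" by linarith
      then show "s\<^sup>2 + s * \<eta> \<le> (9 * s)\<^sup>2" by (simp add: power2_eq_square)
    qed (use s in simp)
    have "s * d * sqrt (1 + \<sigma>) \<le> s * d * 2" using k d0 s by (intro mult_left_mono) auto
    moreover have "z * d \<le> 9 * s * d" using z9 d0 by (rule mult_right_mono)
    moreover have "4 * s * d = 4 * (s * d)" "9 * s * d = 9 * (s * d)" "s * d * 2 = 2 * (s * d)" by simp_all
    ultimately have "4 * s * d + s * a + s * d * sqrt (1 + \<sigma>) + \<eta> + z * d \<le> 15 * (s * d) + s * a + \<eta>" by linarith
    also have "... \<le> 5500 * (L * \<beta>)" using sd sa bL b unfolding \<eta> by argo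
    finally show ?thesis by blast
  next
    case False
    have z9: "z \<le> 9 * \<beta>" unfolding z
    proof (rule real_le_lsqrt)
      have "s * \<eta> \<le> \<beta> * (70 * \<beta>)" using False s b by (intro mult_mono) (auto simp: \<eta>)
      then have "s * \<eta> \<le> 70 * (\<beta> * \<beta>)" by (simp only: mult_ac)
      moreover have "s * s \<le> \<beta> * \<beta>" using False s by (intro mult_mono) auto
      moreover have "0 \<le> \<beta> * \<beta>" by simp
      ultimately have "s * s + s * \<eta> \<le> 81 * (\<beta> * \<beta>)" by linarith
      then show "s\<^sup>2 + s * \<eta> \<le> (9 * \<beta>)\<^sup>2" by (simp add: power2_eq_square)
    qed (use b in simp)
    have "sqrt (s\<^sup>2 * (1 + e)) * sqrt (1 + \<sigma>) = sqrt ((s * (1 + e)) * (s * (1 + \<sigma>)))"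
      by (simp add: real_sqrt_mult[symmetric] power2_eq_square mult_ac)
    also have "... \<le> (s * (1 + e) + s * (1 + \<sigma>)) / 2" by (rule arith_geo_mean_sqrt) (use s e0 sg in auto)
    also have "... = (2 * s + s * e + s * \<sigma>) / 2" by (simp add: algebra_simps)
    also have "... \<le> 37 * \<beta>" using False se b by simp
    finally have "4 * s * d + s * a + z + sqrt (s\<^sup>2 * (1 + e)) * sqrt (1 + \<sigma>) \<le> 4 * (s * d) + s * a + 9 * \<beta> + 37 * \<beta>"
      using z9 by simp
    also have "... \<le> 5500 * (L * \<beta>)" using sd sa bL b by argo
    finally show ?thesis by blast
  qed
qed

text \<open>The exponent 5 (T + r) is chosen to beat the cost of uniformity: 2 times 25^T is at most
  50^T \<le> exp(5 T). The power 5^(T + T) belongs to the 2 T columns of [Z, H], the power 5^T to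
  the block of \<open>A'\<close>.\<close>

lemma union_constants:
  assumes "0 \<le> r" and T: "1 \<le> T"
  shows "5 ^ (T + T) * (2 * exp (- (5 * (real T + r)))) \<le> exp (- r)"
    and "5 ^ T * (2 * exp (- (5 * (real T + r)))) \<le> exp (- r)"
proof -
  have e: "(50::real) \<le> exp 1 ^ 5"
  proof -
    have "(5/2::real) \<le> exp 1" using exp_lower_Taylor_quadratic[of 1] by simp
    then have "(5/2::real)^5 \<le> exp 1 ^ 5" by (intro power_mono) auto
    then show ?thesis by (simp add: power_divide)
  qed
  have k: "c ^ T * (2 * exp (- (5 * (real T + r)))) \<le> exp (- r)" if c: "0 \<le> c" "c \<le> 25" for c :: real
  proof -
    have "c ^ T * 2 \<le> 25 ^ T * 2 ^ T" using c T by (intro mult_mono power_mono self_le_power) auto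
    also have "... = 50 ^ T" by (simp add: power_mult_distrib[symmetric])
    also have "... \<le> (exp 1 ^ 5) ^ T" using e by (intro power_mono) auto
    also have "... = exp (5 * real T)" by (simp add: exp_of_nat_mult[symmetric] power_mult[symmetric])
    finally have "c ^ T * 2 * exp (- (5 * (real T + r))) \<le> exp (5 * real T) * exp (- (5 * (real T + r)))" by (intro mult_right_mono) auto
    also have "... = exp (- (5 * r))" by (simp add: exp_add[symmetric] algebra_simps)
    also have "... \<le> exp (- r)" using assms by simp
    finally show ?thesis by (simp add: mult.assoc)
  qed
  show "5 ^ (T + T) * (2 * exp (- (5 * (real T + r)))) \<le> exp (- r)"
    using k[of 25] by (simp add: power_add power_mult_distrib[symmetric])
  show "5 ^ T * (2 * exp (- (5 * (real T + r)))) \<le> exp (- r)"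
    using k[of 5] by simp
qed

subsection \<open>Stability of the iteration\<close>

lemma sqrt_add_square_le: "0 \<le> a ==> 0 \<le> b ==> sqrt (a\<^sup>2 + b\<^sup>2) \<le> a + (b::real)"
  by (rule real_le_lsqrt) (auto simp: power2_eq_square algebra_simps)

lemma iteration_stability:
  assumes T: "1 \<le> T" and lf: "\<And>t. t < T ==> lipschitz_on_prefix n t Lf (f t)"
    and lg: "\<And>t. t < T ==> lipschitz_on_prefix n t Lg (g t)" and L0: "0 \<le> Lf" "0 \<le> Lg"
    and A: "bbd n A 4" and X: "\<And>t i. t < T ==> i < n ==> X t i = mv n n A (f t X) i + g t X i"
  shows "sqrt (\<Sum>t<T. \<Sum>i<n. (X t i - Y t i)\<^sup>2)
    \<le> (1 + 4 * Lf + Lg) ^ (T - 1) * (\<Sum>t<T. vnorm n (%i. Y t i - mv n n A (f t Y) i - g t Y i))"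
proof -
  let ?D = "%t. sqrt (\<Sum>s<t. \<Sum>i<n. (X s i - Y s i)\<^sup>2)" and ?E = "%t. vnorm n (%i. Y t i - mv n n A (f t Y) i - g t Y i)"
  let ?a = "1 + 4 * Lf + Lg"
  have step: "?D (Suc t) \<le> ?a * ?D t + ?E t" if t: "t < T" for t
  proof -
    have D0: "0 \<le> ?D t" by (intro real_sqrt_ge_zero sum_nonneg) auto
    have "vnorm n (%i. X t i - Y t i) = vnorm n (%i. (mv n n A (%i. f t X i - f t Y i) i + (g t X i - g t Y i)) - (Y t i - mv n n A (f t Y) i - g t Y i))"
    proof (rule vnorm_cong)
      fix i assume i: "i < n"
      have "mv n n A (%i. f t X i - f t Y i) i = mv n n A (f t X) i - mv n n A (f t Y) i"
        by (simp add: mv_def right_diff_distrib sum_subtractf)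
      then show "X t i - Y t i = (mv n n A (%i. f t X i - f t Y i) i + (g t X i - g t Y i)) - (Y t i - mv n n A (f t Y) i - g t Y i)"
        using X[OF t i] by simp
    qed
    also have "... \<le> (vnorm n (mv n n A (%i. f t X i - f t Y i)) + vnorm n (%i. g t X i - g t Y i)) + ?E t"
      by (rule order_trans[OF vnorm_diff add_mono[OF vnorm_triangle order_refl]])
    also have "... \<le> (4 * (Lf * ?D t) + Lg * ?D t) + ?E t"
    proof (intro add_mono order_refl)
      have "vnorm n (mv n n A (%i. f t X i - f t Y i)) \<le> 4 * vnorm n (%i. f t X i - f t Y i)" by (rule vnorm_mv_le[OF A]) simp
      also have "... \<le> 4 * (Lf * ?D t)" using lf[OF t] unfolding lipschitz_on_prefix_def by simp
      finally show "vnorm n (mv n n A (%i. f t X i - f t Y i)) \<le> 4 * (Lf * ?D t)" .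
      show "vnorm n (%i. g t X i - g t Y i) \<le> Lg * ?D t" using lg[OF t] unfolding lipschitz_on_prefix_def by blast
    qed
    finally have x: "vnorm n (%i. X t i - Y t i) \<le> (4 * (Lf * ?D t) + Lg * ?D t) + ?E t" .
    have "?D (Suc t) = sqrt ((?D t)\<^sup>2 + (vnorm n (%i. X t i - Y t i))\<^sup>2)"
      by (simp add: vnorm_sq sum_nonneg)
    also have "... \<le> ?D t + vnorm n (%i. X t i - Y t i)" by (rule sqrt_add_square_le[OF D0]) simp
    finally show ?thesis using x by (simp add: algebra_simps)
  qed
  have a1: "1 \<le> ?a" using L0 by simp
  have "?D t \<le> ?a ^ (t - 1) * (\<Sum>s<t. ?E s)" if "t \<le> T" for t
    using that
  proof (induction t)
    case (Suc t)
    have S0: "0 \<le> (\<Sum>s<t. ?E s)" by (intro sum_nonneg) simp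
    have "?D (Suc t) \<le> ?a * ?D t + ?E t" using Suc.prems by (intro step) simp
    \<comment> \<open>At t = 0 there is no earlier error, so the growth factor is not applied once;
      this accounts for the exponent T - 1.\<close>
    also have "?a * ?D t \<le> ?a ^ t * (\<Sum>s<t. ?E s)"
    proof (cases t)
      case (Suc t')
      have "?a * ?D t \<le> ?a * (?a ^ (t - 1) * (\<Sum>s<t. ?E s))" using Suc.IH Suc.prems a1 by (intro mult_left_mono) auto
      then show ?thesis using Suc by (simp add: mult.assoc)
    qed simp
    also have "?a ^ t * (\<Sum>s<t. ?E s) + ?E t \<le> ?a ^ t * (\<Sum>s<t. ?E s) + ?a ^ t * ?E t"
      using one_le_power[OF a1, of t] mult_right_mono[of 1 "?a ^ t" "?E t"] by simp
    finally show ?case by (simp add: distrib_left)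
  qed simp
  from this[OF order_refl] show ?thesis .
qed

lemma iterX_fixed:
  assumes lf: "\<And>t. t < T ==> lipschitz_on_prefix n t Lf (f t)" and lg: "\<And>t. t < T ==> lipschitz_on_prefix n t Lg (g t)"
    and t: "t < T" and i: "i < n"
  shows "iterX n f g A T t i = mv n n A (f t (iterX n f g A T)) i + g t (iterX n f g A T) i"
proof -
  have pre: "iterX n f g A k s = iterX n f g A j s" if "s < j" "j \<le> k" for k j s
    using that
  proof (induction k)
    case (Suc k) then show ?case by (cases "j = Suc k") (auto simp: Let_def)
  qed simp
  have e: "iterX n f g A T s i = iterX n f g A t s i" if "s < t" for s i using pre[of s t T] that t by simp
  have "iterX n f g A T t i = iterX n f g A (Suc t) t i" using t by (simp add: pre[of t "Suc t" T])
  also have "... = mv n n A (f t (iterX n f g A t)) i + g t (iterX n f g A t) i" by (simp add: Let_def)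
  also have "mv n n A (f t (iterX n f g A t)) i = mv n n A (f t (iterX n f g A T)) i"
    unfolding mv_def using lip_prefix_cong[OF lf[OF t], of "iterX n f g A t" "iterX n f g A T"] e by auto
  also have "g t (iterX n f g A t) i = g t (iterX n f g A T) i"
    by (rule lip_prefix_cong[OF lg[OF t] _ i]) (simp add: e)
  finally show ?thesis .
qed

lemma measurable_iterX:
  assumes lf: "\<And>t. t < T ==> lipschitz_on_prefix n t Lf (f t)" and lg: "\<And>t. t < T ==> lipschitz_on_prefix n t Lg (g t)"
    and A: "\<And>i j. (%\<omega>. A \<omega> i j) \<in> borel_measurable M" and i: "i < n"
  shows "t \<le> T ==> (%\<omega>. iterX n f g (A \<omega>) t s i) \<in> borel_measurable M"
  using i
proof (induction t arbitrary: s i)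
  case (Suc t)
  have tT: "t < T" using Suc.prems by simp
  have IH: "(%\<omega>. iterX n f g (A \<omega>) t s i) \<in> borel_measurable M" if "i < n" for s i
    by (rule Suc.IH) (use that tT in auto)
  have 1: "(%\<omega>. f t (iterX n f g (A \<omega>) t) i) \<in> borel_measurable M" if "i < n" for i
    by (rule lip_prefix_measurable[OF lf[OF tT] _ that]) (rule IH)
  have 2: "(%\<omega>. mv n n (A \<omega>) (f t (iterX n f g (A \<omega>) t)) i) \<in> borel_measurable M"
    by (rule measurable_mv[OF A 1])
  have 3: "(%\<omega>. g t (iterX n f g (A \<omega>) t) i) \<in> borel_measurable M"
    by (rule lip_prefix_measurable[OF lg[OF tT] _ Suc.prems(2)]) (rule IH)
  show ?case
  proof (cases "s = t")
    case True
    have "(%\<omega>. iterX n f g (A \<omega>) (Suc t) s i) = (%\<omega>. mv n n (A \<omega>) (f t (iterX n f g (A \<omega>) t)) i + g t (iterX n f g (A \<omega>) t) i)"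
      using True by (simp only: iterX.simps Let_def fun_upd_same)
    then show ?thesis using borel_measurable_add[OF 2 3] by (simp only:)
  next
    case False
    have "(%\<omega>. iterX n f g (A \<omega>) (Suc t) s i) = (%\<omega>. iterX n f g (A \<omega>) t s i)"
      using False by (simp only: iterX.simps Let_def fun_upd_apply if_False)
    then show ?thesis using IH[OF Suc.prems(2)] by (simp only:)
  qed
qed simp

subsection \<open>Lipschitz estimates along the Gaussian columns\<close>

lemma sum_lessThan_add: "(\<Sum>j<a + k. h j) = (\<Sum>j<a. h j) + (\<Sum>j<k. h (a + j))" for h :: "nat => 'b::comm_monoid_add"
  by (induction k) (simp_all add: add.assoc)

lemma lc_blocks: "lc (a + k) W u i = lc a W u i + lc k (%s. W (a + s)) (%s. u (a + s)) i"
  unfolding lc_def sum_lessThan_add ..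

lemma vnorm_blocks: "(vnorm (a + k) u)\<^sup>2 = (vnorm a u)\<^sup>2 + (vnorm k (%s. u (a + s)))\<^sup>2"
  unfolding vnorm_sq sum_lessThan_add ..

lemma bf_blocks: "bf (a + k) M x y = bf a M x y + (\<Sum>i<a. \<Sum>j<k. x i * M i (a + j) * y (a + j))
    + (\<Sum>i<k. \<Sum>j<a. x (a + i) * M (a + i) j * y j) + bf k (%i j. M (a + i) (a + j)) (%i. x (a + i)) (%j. y (a + j))"
  unfolding bf_def sum_lessThan_add sum.distrib by simp

lemma bbd_block:
  assumes B: "bbd (T + T) M c" and ab: "a = 0 \<or> a = T" "b = 0 \<or> b = T"
  shows "bbd T (%s t. M (a + s) (b + t)) c"
  unfolding bbd_def
proof (intro allI)
  fix x y :: vec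
  define x' where "x' j = (if a \<le> j \<and> j < a + T then x (j - a) else 0)" for j
  define y' where "y' j = (if b \<le> j \<and> j < b + T then y (j - b) else 0)" for j
  have nx: "vnorm (T + T) x' = vnorm T x"
  proof -
    have "(vnorm (T + T) x')\<^sup>2 = (vnorm T x)\<^sup>2" unfolding vnorm_blocks using ab(1) by (auto simp: x'_def vnorm_sq)
    then show ?thesis by (simp add: power2_eq_iff_nonneg)
  qed
  have ny: "vnorm (T + T) y' = vnorm T y"
  proof -
    have "(vnorm (T + T) y')\<^sup>2 = (vnorm T y)\<^sup>2" unfolding vnorm_blocks using ab(2) by (auto simp: y'_def vnorm_sq)
    then show ?thesis by (simp add: power2_eq_iff_nonneg)
  qed
  have "bf (T + T) M x' y' = bf T (%s t. M (a + s) (b + t)) x y"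
    unfolding bf_blocks using ab by (auto simp: x'_def y'_def bf_def)
  then show "\<bar>bf T (%s t. M (a + s) (b + t)) x y\<bar> \<le> c * vnorm T x * vnorm T y"
    using bbdD[OF B, of x' y'] unfolding nx ny by simp
qed

lemma bbdI_sum_squares:
  assumes s: "\<And>x y. 2 * \<bar>bf k M x y\<bar> \<le> c * ((vnorm k x)\<^sup>2 + (vnorm k y)\<^sup>2)"
  shows "bbd k M c"
  unfolding bbd_def
proof (intro allI)
  fix x y
  show "\<bar>bf k M x y\<bar> \<le> c * vnorm k x * vnorm k y"
  proof (cases "vnorm k x = 0 \<or> vnorm k y = 0")
    case True
    then have "bf k M x y = 0" unfolding bf_def vnorm_zero_iff by (intro sum.neutral) auto
    then show ?thesis using True by auto
  next
    case False
    then have p: "0 < vnorm k x" "0 < vnorm k y" by (auto simp: less_le)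
    let ?x = "%i. 1 / vnorm k x * x i" and ?y = "%i. 1 / vnorm k y * y i"
    have "vnorm k ?x = 1" "vnorm k ?y = 1" using p unfolding vnorm_scale by simp_all
    then have "2 * \<bar>bf k M ?x ?y\<bar> \<le> c * 2" using s[of ?x ?y] by simp
    then have "\<bar>bf k M x y\<bar> / (vnorm k x * vnorm k y) \<le> c"
      unfolding bf_scale_left bf_scale_right by (simp add: abs_mult)
    then show ?thesis using p by (simp add: field_simps)
  qed
qed

lemma le_divide_sqrtI:
  assumes "a * x\<^sup>2 \<le> y\<^sup>2" "0 < a" "0 \<le> y" shows "x \<le> y / sqrt (a::real)"
proof -
  have "(sqrt a * x)\<^sup>2 \<le> y\<^sup>2" using assms by (simp add: power_mult_distrib)
  then have "sqrt a * x \<le> y" using assms(3) by (rule power2_le_imp_le)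
  then show ?thesis using assms(2) by (simp add: field_simps)
qed

text \<open>\<open>D\<close> is the inverse of the Cholesky factor; lmin and lmax bound the squared
  singular values of \<open>Om\<close>, which are the eigenvalues of \<Sigma>.\<close>

locale se = amp n T f m Om v Lf Lm for n T f m Om v Lf Lm +
  fixes g :: "nat => vecs => vec" and D :: vecs and Lg lmin lmax :: real
  assumes lipg: "\<And>t. t < T ==> lipschitz_on_prefix n t Lg (g t)"
    and L0: "0 \<le> Lf" "0 \<le> Lg" "0 \<le> Lm"
    and Omup: "\<And>i j. i < T ==> j < i ==> Om i j = 0"
    and Dup: "\<And>i j. i < T ==> j < i ==> D i j = 0" and Ddg: "\<And>i. i < T ==> 0 < D i i"
    and OD: "\<And>i j. i < T ==> j < T ==> (\<Sum>l<T. Om i l * D l j) = of_bool (i = j)"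
    and DO: "\<And>i j. i < T ==> j < T ==> (\<Sum>l<T. D i l * Om l j) = of_bool (i = j)"
    and l0: "0 < lmin" "lmin \<le> lmax"
    and lo: "\<And>x. lmin * (vnorm T x)\<^sup>2 \<le> (vnorm T (%i. \<Sum>j<T. Om i j * x j))\<^sup>2"
    and hi: "\<And>x. (vnorm T (%i. \<Sum>j<T. Om i j * x j))\<^sup>2 \<le> lmax * (vnorm T x)\<^sup>2"
begin

abbreviation I where "I \<equiv> {..<T} \<times> {..<n}"

text \<open>\<open>sk\<close> will be the square root of the condition number. \<open>L1\<close> is
  the Lipschitz constant of \<open>H\<close> in the Gaussian columns; \<open>L2\<close> adds the
  shares of g and m and is L without its logarithm.\<close>

definition sk :: real where "sk = sqrt (lmax / lmin)"
definition L1 :: real where "L1 = sqrt (real T) * Lf * (1 + Lm) ^ (T - 1) * sk"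
definition L2 :: real where "L2 = sqrt (real T) * (Lf + Lg + Lm) * (1 + Lm) ^ (T - 1) * sk"
definition dZ :: "vecs => vecs => real" where "dZ Z Z' = sqrt (\<Sum>s<T. \<Sum>i<n. (Z s i - Z' s i)\<^sup>2)"
definition Hz :: "vecs => vecs" where "Hz Z = (%s i. \<Sum>q<T. D q s * f q (Yz Z T) i)"
definition Wz :: "(nat \<times> nat => real) => vecs" where
  "Wz x = (%j. if j < T then cu x j else Hz (cu x) (j - T))"

lemma sk: "0 < sk" "sqrt lmax = sk * sqrt lmin"
  using l0 unfolding sk_def by (auto simp: real_sqrt_divide)

lemma L1_nonneg: "0 \<le> L1" unfolding L1_def using L0 sk by simp

lemma Om_adjoint: "vnorm T (%s. \<Sum>r<T. Om r s * y r) \<le> sqrt lmax * vnorm T y"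
proof -
  have "vnorm T (lc T (%s i. Om i s) u) \<le> sqrt lmax * vnorm T u" for u
  proof -
    have e: "lc T (%s i. Om i s) u = (%i. \<Sum>j<T. Om i j * u j)" by (simp add: lc_def mult.commute)
    show ?thesis unfolding e
      by (rule power2_le_imp_le) (use hi[of u] l0 in \<open>simp_all add: power_mult_distrib\<close>)
  qed
  from vnorm_adjoint_le[OF this, of y] l0 show ?thesis by (simp add: vinner_def)
qed

lemma D_bound: "vnorm T (%i. \<Sum>j<T. D i j * u j) \<le> vnorm T u / sqrt lmin"
proof -
  let ?w = "%i. \<Sum>j<T. D i j * u j"
  have Ow: "(\<Sum>j<T. Om i j * ?w j) = u i" if i: "i < T" for i
  proof -
    have "(\<Sum>j<T. Om i j * ?w j) = (\<Sum>j<T. \<Sum>l<T. Om i j * D j l * u l)" by (simp add: sum_distrib_left mult.assoc)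
    also have "... = (\<Sum>l<T. \<Sum>j<T. Om i j * D j l * u l)" by (rule sum.swap)
    also have "... = (\<Sum>l<T. of_bool (i = l) * u l)"
      by (intro sum.cong refl) (simp add: sum_distrib_right[symmetric] OD i)
    also have "... = (\<Sum>l<T. if l = i then u i else 0)" by (intro sum.cong refl) auto
    finally show ?thesis using i by (simp add: sum.delta)
  qed
  have "vnorm T (%i. \<Sum>j<T. Om i j * ?w j) = vnorm T u" by (rule vnorm_cong) (rule Ow)
  then have "lmin * (vnorm T ?w)\<^sup>2 \<le> (vnorm T u)\<^sup>2" using lo[of ?w] by (simp only:)
  then show ?thesis by (rule le_divide_sqrtI[OF _ l0(1) vnorm_nonneg])
qed

lemma norm21_Om: "norm21 T T Om = (\<Sum>t<T. vnorm T (%i. Om i t))"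
  by (simp add: norm21_def vnorm_def)

text \<open>Each column of \<open>Om\<close> is the image of a unit vector, hence of norm at least
  sqrt lmin. The bound converts T sqrt lmin, as it arises from T Lipschitz columns, into the norm of
  the theorem.\<close>

lemma norm21_ge: "real T * sqrt lmin \<le> norm21 T T Om"
proof -
  have "sqrt lmin \<le> vnorm T (%i. Om i t)" if t: "t < T" for t
  proof -
    have "(\<Sum>j<T. Om i j * of_bool (j = t)) = (\<Sum>j<T. if j = t then Om i t else 0)" for i by (intro sum.cong refl) auto
    then have "(\<Sum>j<T. Om i j * of_bool (j = t)) = Om i t" for i using t by (simp add: sum.delta)
    then have "lmin \<le> (vnorm T (%i. Om i t))\<^sup>2" using lo[of "%j. of_bool (j = t)"] vnorm_unit[OF t] by simp
    then show ?thesis by (rule real_le_lsqrt[rotated]) (use l0 in auto)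
  qed
  then have "(\<Sum>t<T. sqrt lmin) \<le> (\<Sum>t<T. vnorm T (%i. Om i t))" by (intro sum_mono) auto
  then show ?thesis unfolding norm21_Om by simp
qed

lemma norm21_pos: "0 < norm21 T T Om"
  by (rule less_le_trans[OF _ norm21_ge]) (use T1 l0 in simp)

lemma Yz_eq:
  assumes t: "t < T" and i: "i < n"
  shows "Yz Z T t i = m t (Yz Z T) i + lc T Z (%s. Om s t) i"
proof -
  have "Yz Z T t i = Yz Z (Suc t) t i" using t by (simp add: Yz_prefix[of t "Suc t" T])
  also have "... = m t (Yz Z t) i + (\<Sum>s\<le>t. Om s t * Z s i)" using i by (simp add: Yz.simps(2))
  also have "m t (Yz Z t) i = m t (Yz Z T) i"
    by (rule lip_prefix_cong[OF lipm[OF t] _ i]) (use t in \<open>simp add: Yz_prefix[of _ t T]\<close>)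
  also have "(\<Sum>s\<le>t. Om s t * Z s i) = (\<Sum>s<T. Om s t * Z s i)"
    using t Omup by (intro sum.mono_neutral_left) auto
  finally show ?thesis by (simp add: lc_def)
qed

text \<open>The Gaussian increments w_t enter in quadrature: Minkowski's inequality splits off Lm
  d_t and leaves sqrt(d_t^2 + w_t^2), so only their joint Euclidean norm appears and no further
  factor in T is lost. The exponent is t - 1 since the first step has no past.\<close>

lemma Y_lipschitz_aux:
  "t \<le> T ==> sqrt (\<Sum>s<t. \<Sum>i<n. (Yz Z T s i - Yz Z' T s i)\<^sup>2)
    \<le> (1 + Lm) ^ (t - 1) * sqrt (\<Sum>s<t. (vnorm n (lc T (%r i. Z r i - Z' r i) (%r. Om r s)))\<^sup>2)"
proof (induction t)
  case (Suc t)
  let ?w = "%s. vnorm n (lc T (%r i. Z r i - Z' r i) (%r. Om r s))"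
  let ?d = "%t. sqrt (\<Sum>s<t. \<Sum>i<n. (Yz Z T s i - Yz Z' T s i)\<^sup>2)" and ?N = "%t. sqrt (\<Sum>s<t. (?w s)\<^sup>2)"
  have t: "t < T" using Suc.prems by simp
  have d0: "0 \<le> ?d t" by (intro real_sqrt_ge_zero sum_nonneg) auto
  have "vnorm n (%i. Yz Z T t i - Yz Z' T t i) = vnorm n (%i. (m t (Yz Z T) i - m t (Yz Z' T) i) + lc T (%r i. Z r i - Z' r i) (%r. Om r t) i)"
    by (rule vnorm_cong) (simp add: Yz_eq[OF t] lc_def right_diff_distrib sum_subtractf)
  also have "... \<le> Lm * ?d t + ?w t"
    by (rule order_trans[OF vnorm_triangle add_right_mono]) (use lipm[OF t] in \<open>simp add: lipschitz_on_prefix_def\<close>)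
  finally have y: "vnorm n (%i. Yz Z T t i - Yz Z' T t i) \<le> Lm * ?d t + ?w t" .
  have S0: "0 \<le> (\<Sum>s<t. \<Sum>i<n. (Yz Z T s i - Yz Z' T s i)\<^sup>2)" by (intro sum_nonneg) auto
  have "?d (Suc t) = sqrt ((?d t)\<^sup>2 + (vnorm n (%i. Yz Z T t i - Yz Z' T t i))\<^sup>2)"
    unfolding vnorm_sq real_sqrt_pow2[OF S0] by simp
  also have "... \<le> sqrt ((?d t + 0)\<^sup>2 + (?w t + Lm * ?d t)\<^sup>2)"
    using y S0 by (intro real_sqrt_le_mono add_mono power_mono) auto
  also have "... \<le> sqrt ((?d t)\<^sup>2 + (?w t)\<^sup>2) + sqrt (0\<^sup>2 + (Lm * ?d t)\<^sup>2)" by (rule real_sqrt_sum_squares_triangle_ineq)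
  also have "sqrt (0\<^sup>2 + (Lm * ?d t)\<^sup>2) = Lm * ?d t" using d0 L0 by simp
  finally have 1: "?d (Suc t) \<le> sqrt ((?d t)\<^sup>2 + (?w t)\<^sup>2) + Lm * ?d t" .
  show ?case
  proof (cases t)
    case 0
    have "?d t = 0" using 0 by simp
    then have "?d (Suc t) \<le> ?w t" using 1 by simp
    then show ?thesis using 0 by simp
  next
    case (Suc t')
    let ?p = "(1 + Lm) ^ t'"
    have p1: "1 \<le> ?p" using L0 by (simp add: one_le_power)
    have IH: "?d t \<le> ?p * ?N t" using Suc.IH t Suc by simp
    have N: "?N t \<le> ?N (Suc t)" by (intro real_sqrt_le_mono) simp
    have N0: "0 \<le> ?N t" by (intro real_sqrt_ge_zero sum_nonneg) auto
    have "sqrt ((?d t)\<^sup>2 + (?w t)\<^sup>2) \<le> sqrt ((?p * ?N t)\<^sup>2 + (?p * ?w t)\<^sup>2)"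
    proof (intro real_sqrt_le_mono add_mono power_mono IH d0)
      show "?w t \<le> ?p * ?w t" using mult_right_mono[OF p1 vnorm_nonneg[of n "lc T (%r i. Z r i - Z' r i) (%r. Om r t)"]] by simp
    qed simp
    also have "... = ?p * ?N (Suc t)"
    proof -
      have "(?p * ?N t)\<^sup>2 + (?p * ?w t)\<^sup>2 = ?p\<^sup>2 * (?N (Suc t))\<^sup>2"
        by (simp add: power_mult_distrib distrib_left sum_nonneg)
      then show ?thesis using p1 by (simp add: real_sqrt_mult sum_nonneg)
    qed
    finally have 2: "sqrt ((?d t)\<^sup>2 + (?w t)\<^sup>2) \<le> ?p * ?N (Suc t)" .
    have "Lm * ?d t \<le> Lm * (?p * ?N (Suc t))"
      using IH N p1 L0 by (intro mult_left_mono order_trans[OF IH mult_left_mono[OF N]]) auto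
    then have "?d (Suc t) \<le> ?p * ?N (Suc t) + Lm * (?p * ?N (Suc t))" using 1 2 by linarith
    then show ?thesis using Suc by (simp add: algebra_simps)
  qed
qed simp

lemma Y_lipschitz:
  "sqrt (\<Sum>s<T. \<Sum>i<n. (Yz Z T s i - Yz Z' T s i)\<^sup>2) \<le> (1 + Lm) ^ (T - 1) * sqrt lmax * dZ Z Z'"
proof -
  let ?d = "%r i. Z r i - Z' r i"
  have "(\<Sum>s<T. (vnorm n (lc T ?d (%r. Om r s)))\<^sup>2) = (\<Sum>i<n. (vnorm T (%s. \<Sum>r<T. Om r s * ?d r i))\<^sup>2)"
    unfolding vnorm_sq lc_def by (rule sum.swap)
  also have "... \<le> (\<Sum>i<n. (sqrt lmax * vnorm T (%r. ?d r i))\<^sup>2)"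
    by (intro sum_mono power_mono Om_adjoint) simp
  also have "... = (\<Sum>i<n. \<Sum>r<T. lmax * (?d r i)\<^sup>2)"
    using l0 by (simp add: power_mult_distrib vnorm_sq sum_distrib_left)
  also have "... = lmax * (\<Sum>s<T. \<Sum>i<n. (?d s i)\<^sup>2)"
    by (subst sum.swap) (simp add: sum_distrib_left)
  finally have "sqrt (\<Sum>s<T. (vnorm n (lc T ?d (%r. Om r s)))\<^sup>2) \<le> sqrt lmax * dZ Z Z'"
    unfolding dZ_def real_sqrt_mult[symmetric] by (rule real_sqrt_le_mono)
  then have "(1 + Lm) ^ (T - 1) * sqrt (\<Sum>s<T. (vnorm n (lc T ?d (%r. Om r s)))\<^sup>2) \<le> (1 + Lm) ^ (T - 1) * (sqrt lmax * dZ Z Z')"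
    using L0 by (intro mult_left_mono) auto
  then show ?thesis using Y_lipschitz_aux[OF order_refl, of Z Z'] by (simp add: mult.assoc)
qed

lemma column_lipschitz:
  assumes h: "lipschitz_on_prefix n t Lh h" and t: "t \<le> T" and Lh: "0 \<le> Lh"
  shows "vnorm n (%i. h (Yz Z T) i - h (Yz Z' T) i) \<le> Lh * ((1 + Lm) ^ (T - 1) * sqrt lmax * dZ Z Z')"
proof -
  have "vnorm n (%i. h (Yz Z T) i - h (Yz Z' T) i) \<le> Lh * sqrt (\<Sum>s<t. \<Sum>i<n. (Yz Z T s i - Yz Z' T s i)\<^sup>2)"
    using h unfolding lipschitz_on_prefix_def by blast
  also have "... \<le> Lh * sqrt (\<Sum>s<T. \<Sum>i<n. (Yz Z T s i - Yz Z' T s i)\<^sup>2)"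
    using t by (intro mult_left_mono real_sqrt_le_mono sum_mono2 Lh sum_nonneg) auto
  also have "... \<le> Lh * ((1 + Lm) ^ (T - 1) * sqrt lmax * dZ Z Z')" by (rule mult_left_mono[OF Y_lipschitz Lh])
  finally show ?thesis .
qed

text \<open>\<open>Yz\<close> contributes sqrt lmax, the inverse \<open>D\<close> contributes 1 /
  sqrt lmin, and passing from T Lipschitz columns to their Frobenius norm contributes sqrt
  T.\<close>

lemma H_lipschitz: "vnorm n (lc T (%s i. Hz Z s i - Hz Z' s i) u) \<le> L1 * vnorm T u * dZ Z Z'"
proof -
  let ?F = "%q i. f q (Yz Z T) i - f q (Yz Z' T) i" and ?Du = "%q. \<Sum>s<T. D q s * u s"
  let ?c = "(1 + Lm) ^ (T - 1) * sqrt lmax * dZ Z Z'"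
  have dz: "0 \<le> dZ Z Z'" unfolding dZ_def by (intro real_sqrt_ge_zero sum_nonneg) auto
  have c0: "0 \<le> ?c" using L0 l0 dz by simp
  have "lc T (%s i. Hz Z s i - Hz Z' s i) u = lc T ?F ?Du"
  proof
    fix i
    have "lc T (%s i. Hz Z s i - Hz Z' s i) u i = (\<Sum>s<T. \<Sum>q<T. D q s * u s * ?F q i)"
      unfolding lc_def Hz_def sum_subtractf[symmetric] right_diff_distrib[symmetric] by (simp add: sum_distrib_left mult_ac)
    also have "... = (\<Sum>q<T. \<Sum>s<T. D q s * u s * ?F q i)" by (rule sum.swap)
    finally show "lc T (%s i. Hz Z s i - Hz Z' s i) u i = lc T ?F ?Du i" unfolding lc_def by (simp add: sum_distrib_right)
  qed
  then have "vnorm n (lc T (%s i. Hz Z s i - Hz Z' s i) u) \<le> vnorm T ?Du * sqrt (\<Sum>q<T. \<Sum>i<n. (?F q i)\<^sup>2)"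
    by (simp only: vnorm_lc_le)
  also have "... \<le> (vnorm T u / sqrt lmin) * (sqrt (real T) * (Lf * ?c))"
  proof (intro mult_mono D_bound)
    have "(\<Sum>q<T. \<Sum>i<n. (?F q i)\<^sup>2) = (\<Sum>q<T. (vnorm n (?F q))\<^sup>2)" by (simp only: vnorm_sq)
    also have "... \<le> (\<Sum>q<T. (Lf * ?c)\<^sup>2)"
      by (intro sum_mono power_mono column_lipschitz[OF lipf less_imp_le L0(1)]) auto
    also have "... = real T * (Lf * ?c)\<^sup>2" by simp
    finally have "sqrt (\<Sum>q<T. \<Sum>i<n. (?F q i)\<^sup>2) \<le> sqrt (real T * (Lf * ?c)\<^sup>2)" by (rule real_sqrt_le_mono)
    then show "sqrt (\<Sum>q<T. \<Sum>i<n. (?F q i)\<^sup>2) \<le> sqrt (real T) * (Lf * ?c)"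
      using L0 c0 by (simp add: real_sqrt_mult)
  qed (use l0 in \<open>auto intro!: sum_nonneg\<close>)
  also have "... = L1 * vnorm T u * dZ Z Z'"
    unfolding L1_def sk(2) using l0 by (simp add: field_simps)
  finally show ?thesis .
qed

lemma dZ_cu: "dZ (cu x) (cu y) = L2_set (%p. x p - y p) I"
  unfolding dZ_def cu_def L2_set_def by (simp add: sum.cartesian_product split_def)

lemma lc_Wz: "lc (T + T) (Wz x) u i = lc T (cu x) u i + lc T (Hz (cu x)) (%s. u (T + s)) i"
  unfolding lc_blocks by (simp add: lc_def Wz_def)

text \<open>The summand 1 is the share of \<open>Z\<close>, which is the identity in the Gaussian
  coordinates.\<close>

sublocale W: lipschitz_family I n "T + T" Wz "1 + L1"
proof
  fix x y :: "nat \<times> nat => real" and u :: vec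
  let ?d = "L2_set (%p. x p - y p) I" and ?u2 = "%s. u (T + s)"
  have le: "vnorm T u \<le> vnorm (T + T) u" "vnorm T ?u2 \<le> vnorm (T + T) u"
    by (rule power2_le_imp_le; simp add: vnorm_blocks)+
  have "lc (T + T) (%j i. Wz x j i - Wz y j i) u i = lc T (%s i. cu x s i - cu y s i) u i + lc T (%s i. Hz (cu x) s i - Hz (cu y) s i) ?u2 i" for i
    unfolding lc_blocks by (simp add: lc_def Wz_def)
  then have "vnorm n (lc (T + T) (%j i. Wz x j i - Wz y j i) u)
     \<le> vnorm n (lc T (%s i. cu x s i - cu y s i) u) + vnorm n (lc T (%s i. Hz (cu x) s i - Hz (cu y) s i) ?u2)"
    using vnorm_triangle[of n "lc T (%s i. cu x s i - cu y s i) u" "lc T (%s i. Hz (cu x) s i - Hz (cu y) s i) ?u2"]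
    by (simp only: vnorm_cong[of n "lc (T + T) (%j i. Wz x j i - Wz y j i) u" "%i. lc T (%s i. cu x s i - cu y s i) u i + lc T (%s i. Hz (cu x) s i - Hz (cu y) s i) ?u2 i"])
  also have "... \<le> vnorm T u * ?d + L1 * vnorm T ?u2 * ?d"
    by (intro add_mono order_trans[OF vnorm_lc_le] order_trans[OF H_lipschitz])
       (simp_all add: dZ_cu[unfolded dZ_def] dZ_cu)
  also have "... \<le> vnorm (T + T) u * ?d + L1 * vnorm (T + T) u * ?d"
    using le L1_nonneg by (intro add_mono mult_right_mono mult_left_mono) auto
  finally show "vnorm n (lc (T + T) (%j i. Wz x j i - Wz y j i) u) \<le> (1 + L1) * vnorm (T + T) u * ?d"
    by (simp add: algebra_simps)
qed (use L1_nonneg in auto)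

end

lemma (in gauss_lipschitz) upper_event:
  assumes r: "0 \<le> r"
  shows "\<exists>B\<in>sets (gauss I). prob B \<le> exp (- r) \<and> (\<forall>x\<in>space (gauss I) - B. h x \<le> expectation h + 2 * L * sqrt r)"
proof -
  define B where "B = {x \<in> space (gauss I). 2 * L * sqrt r \<le> h x - expectation h}"
  have B: "B \<in> sets (gauss I)" unfolding B_def by measurable
  have e: "- (2 * L * sqrt r)\<^sup>2 / (4 * L\<^sup>2) = - r" using L r by (simp add: power_mult_distrib)
  have "prob B \<le> exp (- (2 * L * sqrt r)\<^sup>2 / (4 * L\<^sup>2))" unfolding B_def by (rule concentration_upper) (use L r in simp)
  then have p: "prob B \<le> exp (- r)" unfolding e .
  have "h x \<le> expectation h + 2 * L * sqrt r" if "x \<in> space (gauss I) - B" for x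
    using that unfolding B_def by auto
  then show ?thesis using B p by blast
qed

context se begin

subsection \<open>Covariances and the exceptional events\<close>

text \<open>\<open>Sz\<close> and \<open>Kz\<close> are the lower right and upper right blocks of
  the mean Gram matrix of [Z, H] divided by n; the upper left block is the identity.\<close>

definition Sz :: vecs where "Sz s t = W.gram (T + s) (T + t) / real n"
definition Kz :: vecs where "Kz s t = W.gram s (T + t) / real n"

text \<open>Column t of K \<Omega>. Since B is the inverse of \<Omega> times K \<Omega>, column t of
  F B is \<open>H\<close> applied to \<open>KO t\<close>, and \<open>drift\<close> is the integrand
  of \<psi>_1 before division by the norm of \<Omega>.\<close>

definition KO :: "nat => vec" where "KO t = (%s. \<Sum>q<T. Kz s q * Om q t)"
definition drift :: "vecs => real" where
  "drift Z = (\<Sum>t<T. vnorm n (%i. m t (Yz Z T) i - g t (Yz Z T) i - lc T (Hz Z) (KO t) i))"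

lemma gram_sym: "W.gram j l = W.gram l j"
  unfolding W.gram_def by (simp only: vinner_commute[of n "Wz _ j" "Wz _ l"])

lemma gram_columns: "s < T ==> t < T ==> W.gram s t = real n * of_bool (s = t)"
proof -
  assume st: "s < T" "t < T"
  have "W.gram s t = (\<integral>x. (\<Sum>i<n. x (s, i) * x (t, i)) \<partial>gauss I)"
    unfolding W.gram_def using st by (simp add: Wz_def vinner_def cu_def)
  also have "... = (\<Sum>i<n. \<integral>x. x (s, i) * x (t, i) \<partial>gauss I)"
  proof (rule Bochner_Integration.integral_sum)
    fix i assume "i \<in> {..<n}"
    then show "integrable (gauss I) (%x. x (s, i) * x (t, i))"
      using W.integrable_mult[of s i t i] st by (simp add: Wz_def cu_def)
  qed
  also have "... = (\<Sum>i<n. of_bool (s = t))"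
    by (intro sum.cong refl) (use st in \<open>simp add: gauss_second_moment\<close>)
  finally show ?thesis by simp
qed

lemma gram_split:
  "bf (T + T) W.gram u u = real n * ((vnorm T u)\<^sup>2 + 2 * bf T Kz u (%s. u (T + s)) + bf T Sz (%s. u (T + s)) (%s. u (T + s)))"
proof -
  let ?u = "%s. u (T + s)"
  have 1: "bf T W.gram u u = real n * (vnorm T u)\<^sup>2"
  proof -
    have "bf T W.gram u u = bf T (%i j. real n * of_bool (i = j)) u u" by (rule bf_cong) (simp_all add: gram_columns)
    also have "... = real n * bf T (%i j. of_bool (i = j)) u u" by (simp add: bf_def sum_distrib_left mult_ac)
    finally show ?thesis by (simp add: bf_id vinner_self)
  qed
  have 2: "(\<Sum>i<T. \<Sum>j<T. u i * W.gram i (T + j) * u (T + j)) = real n * bf T Kz u ?u"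
    unfolding bf_def Kz_def using n0 by (simp add: sum_distrib_left)
  have 3: "(\<Sum>i<T. \<Sum>j<T. u (T + i) * W.gram (T + i) j * u j) = real n * bf T Kz u ?u"
    unfolding 2[symmetric] by (subst sum.swap) (intro sum.cong refl, simp add: gram_sym[of "T + _"] mult_ac)
  have 4: "bf T (%i j. W.gram (T + i) (T + j)) ?u ?u = real n * bf T Sz ?u ?u"
    unfolding bf_def Sz_def using n0 by (simp add: sum_distrib_left)
  show ?thesis unfolding bf_blocks 1 2 3 4 by (simp add: algebra_simps)
qed

lemma gram_psd: "0 \<le> bf (T + T) W.gram u u"
  unfolding W.vinner_lc_integral(2)[symmetric] vinner_self by (rule Bochner_Integration.integral_nonneg) simp

context
  fixes \<sigma> :: real
  assumes sg: "bbd T (%s t. Sz s t - of_bool (s = t)) \<sigma>" and sg0: "0 \<le> \<sigma>"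
begin

lemma Sz_le: "bf T Sz x x \<le> (1 + \<sigma>) * (vnorm T x)\<^sup>2"
  using bbdD[OF sg, of x x] unfolding bf_diff_mat bf_id vinner_self by (simp add: power2_eq_square algebra_simps)

lemma covariance_psd: "0 \<le> (vnorm T x)\<^sup>2 + 2 * bf T Kz x y + bf T Sz y y"
proof -
  let ?u = "%j. if j < T then x j else y (j - T)"
  have "vnorm T ?u = vnorm T x" by (rule vnorm_cong) simp
  moreover have "bf T Kz ?u (%s. ?u (T + s)) = bf T Kz x y" by (rule bf_cong) simp_all
  moreover have "bf T Sz (%s. ?u (T + s)) (%s. ?u (T + s)) = bf T Sz y y" by (rule bf_cong) simp_all
  ultimately show ?thesis using gram_psd[of ?u] n0 unfolding gram_split by (simp add: zero_le_mult_iff)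
qed

text \<open>The block matrix formed by I, K and S is positive semidefinite, which bounds K by the
  square root of the norm of S. The arguments are scaled by q and 1/q with q^4 = 1 + \<sigma> to
  balance the diagonal terms; the sign c covers both signs of the form.\<close>

lemma Kz_bound: "bbd T Kz (sqrt (1 + \<sigma>))"
proof (rule bbdI_sum_squares)
  fix x y
  let ?q = "sqrt (sqrt (1 + \<sigma>))"
  have q: "0 < ?q" "?q\<^sup>2 = sqrt (1 + \<sigma>)" using sg0 by simp_all
  have k: "- (2 * bf T Kz x y) * c \<le> sqrt (1 + \<sigma>) * ((vnorm T x)\<^sup>2 + (vnorm T y)\<^sup>2)" if c: "c = 1 \<or> c = -1" for c
  proof -
    have "0 \<le> (vnorm T (%i. ?q * x i))\<^sup>2 + 2 * bf T Kz (%i. ?q * x i) (%i. (c / ?q) * y i) + bf T Sz (%i. (c / ?q) * y i) (%i. (c / ?q) * y i)"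
      by (rule covariance_psd)
    also have "... \<le> (vnorm T (%i. ?q * x i))\<^sup>2 + 2 * bf T Kz (%i. ?q * x i) (%i. (c / ?q) * y i) + (1 + \<sigma>) * (vnorm T (%i. (c / ?q) * y i))\<^sup>2"
      using Sz_le by simp
    also have "2 * bf T Kz (%i. ?q * x i) (%i. (c / ?q) * y i) = 2 * bf T Kz x y * c"
      unfolding bf_scale_left bf_scale_right using q by simp
    also have "(vnorm T (%i. ?q * x i))\<^sup>2 = sqrt (1 + \<sigma>) * (vnorm T x)\<^sup>2"
      unfolding vnorm_scale power_mult_distrib power2_abs q(2) ..
    also have "(1 + \<sigma>) * (vnorm T (%i. (c / ?q) * y i))\<^sup>2 = sqrt (1 + \<sigma>) * (vnorm T y)\<^sup>2"
    proof -
      have "(1 + \<sigma>) * (c / ?q)\<^sup>2 = (1 + \<sigma>) / sqrt (1 + \<sigma>)" unfolding power_divide q(2) using c by auto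
      also have "... = sqrt (1 + \<sigma>)" using sg0 by (simp add: real_div_sqrt)
      finally show ?thesis unfolding vnorm_scale power_mult_distrib power2_abs mult.assoc[symmetric] by (simp only:)
    qed
    finally show ?thesis by (simp add: algebra_simps)
  qed
  show "2 * \<bar>bf T Kz x y\<bar> \<le> sqrt (1 + \<sigma>) * ((vnorm T x)\<^sup>2 + (vnorm T y)\<^sup>2)"
    using k[of 1] k[of "-1"] by (simp add: abs_if)
qed

text \<open>Positive semidefiniteness with the second half of u negated bounds the cross term by the
  diagonal ones, hence the factor 2.\<close>

lemma gram_le: "bf (T + T) W.gram u u \<le> (sqrt (real n) * sqrt (2 * (1 + \<sigma>)) * vnorm (T + T) u)\<^sup>2"
proof -
  let ?u = "%s. u (T + s)"
  have "0 \<le> (vnorm T u)\<^sup>2 + 2 * bf T Kz u (%i. - 1 * ?u i) + bf T Sz (%i. - 1 * ?u i) (%i. - 1 * ?u i)"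
    by (rule covariance_psd)
  then have "2 * bf T Kz u ?u \<le> (vnorm T u)\<^sup>2 + bf T Sz ?u ?u"
    unfolding bf_scale_left bf_scale_right by simp
  moreover have "bf T Sz ?u ?u \<le> (1 + \<sigma>) * (vnorm T ?u)\<^sup>2" by (rule Sz_le)
  moreover have "(vnorm T u)\<^sup>2 \<le> (1 + \<sigma>) * (vnorm T u)\<^sup>2" using sg0 by (simp add: algebra_simps)
  moreover have "2 * (1 + \<sigma>) * (vnorm (T + T) u)\<^sup>2 = 2 * ((1 + \<sigma>) * (vnorm T u)\<^sup>2) + 2 * ((1 + \<sigma>) * (vnorm T ?u)\<^sup>2)"
    unfolding vnorm_blocks by (simp add: algebra_simps)
  ultimately have "(vnorm T u)\<^sup>2 + 2 * bf T Kz u ?u + bf T Sz ?u ?u \<le> 2 * (1 + \<sigma>) * (vnorm (T + T) u)\<^sup>2"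
    by linarith
  then have "real n * ((vnorm T u)\<^sup>2 + 2 * bf T Kz u ?u + bf T Sz ?u ?u) \<le> real n * (2 * (1 + \<sigma>) * (vnorm (T + T) u)\<^sup>2)"
    by (rule mult_left_mono) simp
  also have "... = (sqrt (real n) * sqrt (2 * (1 + \<sigma>)) * vnorm (T + T) u)\<^sup>2"
    using sg0 by (simp add: power_mult_distrib)
  finally show ?thesis unfolding gram_split .
qed

context
  fixes r \<rho> L \<beta> :: real
  assumes r: "0 \<le> r" "r \<le> real n" and rho: "\<rho> = sqrt (real T + r)" and LL: "1 + L2 \<le> L"
    and beta: "\<beta> = sqrt (real n) * \<sigma> + L\<^sup>2 * \<rho>"
begin

lemma rho_bounds: "1 \<le> \<rho>" "\<rho>\<^sup>2 = real T + r" "\<rho>\<^sup>2 \<le> 2 * (sqrt (real n))\<^sup>2" "sqrt r \<le> \<rho>" "\<rho> \<le> sqrt (real T) + sqrt r"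
  using T1 Tn r unfolding rho by (auto intro: real_sqrt_le_mono sqrt_add_le_add_sqrt)

lemma L1_le_L2: "L1 \<le> L2"
  unfolding L1_def L2_def using L0 sk by (intro mult_mono) auto

lemma L_bounds: "1 + L1 \<le> L" "1 \<le> 1 + L1" "1 \<le> L"
  using LL L1_le_L2 L1_nonneg by auto

lemma gram_event:
  "\<exists>B\<in>sets (gauss I). measure (gauss I) B \<le> exp (- r) \<and>
    (\<forall>x\<in>space (gauss I) - B. bbd (T + T) (%j l. vinner n (Wz x j) (Wz x l) - W.gram j l) (sqrt (real n) * (70 * \<beta>)))"
proof -
  \<comment> \<open>Chosen so that its square over 4 (1 + L1)^2 is 5 (T + r), the exponent that
    absorbs 5^(T + T).\<close>
  let ?t = "2 * (1 + L1) * (sqrt 5 * \<rho>)" and ?b = "sqrt (real n) * sqrt (2 * (1 + \<sigma>))"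
  have t: "0 < ?t" using L_bounds rho_bounds(1) by simp
  obtain B where B: "B \<in> sets (gauss I)" "measure (gauss I) B \<le> 5 ^ (T + T) * (2 * exp (- ?t\<^sup>2 / (4 * (1 + L1)\<^sup>2)))"
    and q: "\<And>x u. x \<in> space (gauss I) - B ==> \<bar>bf (T + T) (%j l. vinner n (Wz x j) (Wz x l) - W.gram j l) u u\<bar>
        \<le> 8/7 * (2 * ?t * ?b + ?t\<^sup>2 + 4 * (1 + L1)\<^sup>2) * (vnorm (T + T) u)\<^sup>2"
    using W.gram_concentration[OF t _ gram_le] sg0 by auto
  have e: "- ?t\<^sup>2 / (4 * (1 + L1)\<^sup>2) = - (5 * (real T + r))"
  proof -
    have g: "- (a * b) / a = - b" if "a \<noteq> 0" for a b :: real using that by simp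
    have eq: "?t\<^sup>2 = (4 * (1 + L1)\<^sup>2) * (5 * (real T + r))"
      unfolding power_mult_distrib rho_bounds(2) by simp
    show ?thesis unfolding eq by (rule g) (use L_bounds in simp)
  qed
  have "measure (gauss I) B \<le> exp (- r)"
    using order_trans[OF B(2)[unfolded e] union_constants(1)[OF r(1) T1]] .
  moreover have "bbd (T + T) (%j l. vinner n (Wz x j) (Wz x l) - W.gram j l) (sqrt (real n) * (70 * \<beta>))"
    if x: "x \<in> space (gauss I) - B" for x
  proof (rule bbd_sym_qf)
    show "vinner n (Wz x i) (Wz x j) - W.gram i j = vinner n (Wz x j) (Wz x i) - W.gram j i" for i j
      by (simp only: vinner_commute[of n "Wz x i"] gram_sym[of i])
    fix u
    have "8/7 * (2 * ?t * ?b + ?t\<^sup>2 + 4 * (1 + L1)\<^sup>2) \<le> sqrt (real n) * (70 * \<beta>)"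
      unfolding beta by (rule fluctuation_bound(1)) (use n0 sg0 rho_bounds L_bounds in auto)
    then have "8/7 * (2 * ?t * ?b + ?t\<^sup>2 + 4 * (1 + L1)\<^sup>2) * (vnorm (T + T) u)\<^sup>2 \<le> sqrt (real n) * (70 * \<beta>) * (vnorm (T + T) u)\<^sup>2"
      by (rule mult_right_mono) simp
    then show "\<bar>bf (T + T) (%j l. vinner n (Wz x j) (Wz x l) - W.gram j l) u u\<bar> \<le> sqrt (real n) * (70 * \<beta>) * (vnorm (T + T) u)\<^sup>2"
      using q[OF x, of u] by linarith
  qed
  ultimately show ?thesis using B(1) by blast
qed

text \<open>The shares of m and g are proportional to T sqrt lmax = sk T sqrt lmin, and T sqrt lmin
  is absorbed by \<open>norm21_ge\<close>. The columns of K \<Omega> contribute L1 times the norm of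
  \<Omega> through the bound on K. Together they stay within L2, up to the common factor sqrt(1 +
  \<sigma>).\<close>

lemma drift_lipschitz: "\<bar>drift Z - drift Z'\<bar> \<le> L * sqrt (1 + \<sigma>) * norm21 T T Om * dZ Z Z'"
proof -
  let ?c = "(1 + Lm) ^ (T - 1) * sqrt lmax * dZ Z Z'" and ?k = "sqrt (1 + \<sigma>)"
  let ?e = "%Z t i. m t (Yz Z T) i - g t (Yz Z T) i - lc T (Hz Z) (KO t) i"
  have dz: "0 \<le> dZ Z Z'" unfolding dZ_def by (intro real_sqrt_ge_zero sum_nonneg) auto
  have k1: "1 \<le> ?k" using sg0 by simp
  have col: "vnorm n (%i. ?e Z t i - ?e Z' t i) \<le> (Lm + Lg) * ?c + L1 * (?k * vnorm T (%i. Om i t)) * dZ Z Z'" if t: "t < T" for t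
  proof -
    have "vnorm n (%i. ?e Z t i - ?e Z' t i) = vnorm n (%i. ((m t (Yz Z T) i - m t (Yz Z' T) i) - (g t (Yz Z T) i - g t (Yz Z' T) i)) - lc T (%s i. Hz Z s i - Hz Z' s i) (KO t) i)"
      by (rule vnorm_cong) (simp add: lc_def right_diff_distrib sum_subtractf)
    also have "... \<le> (vnorm n (%i. m t (Yz Z T) i - m t (Yz Z' T) i) + vnorm n (%i. g t (Yz Z T) i - g t (Yz Z' T) i)) + vnorm n (lc T (%s i. Hz Z s i - Hz Z' s i) (KO t))"
      by (rule order_trans[OF vnorm_diff add_mono[OF vnorm_diff order_refl]])
    also have "... \<le> (Lm * ?c + Lg * ?c) + L1 * (?k * vnorm T (%i. Om i t)) * dZ Z Z'"
    proof (intro add_mono column_lipschitz[OF lipm less_imp_le L0(3)] column_lipschitz[OF lipg less_imp_le L0(2)] t)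
      have "vnorm T (KO t) \<le> ?k * vnorm T (%i. Om i t)" unfolding KO_def by (rule bbd_mv[OF Kz_bound]) (use sg0 in simp)
      then have "L1 * vnorm T (KO t) * dZ Z Z' \<le> L1 * (?k * vnorm T (%i. Om i t)) * dZ Z Z'"
        by (intro mult_right_mono mult_left_mono L1_nonneg dz)
      then show "vnorm n (lc T (%s i. Hz Z s i - Hz Z' s i) (KO t)) \<le> L1 * (?k * vnorm T (%i. Om i t)) * dZ Z Z'"
        using H_lipschitz[of Z Z' "KO t"] by (rule order_trans[rotated])
    qed
    finally show ?thesis by (simp only: distrib_right)
  qed
  have "\<bar>drift Z - drift Z'\<bar> \<le> (\<Sum>t<T. \<bar>vnorm n (?e Z t) - vnorm n (?e Z' t)\<bar>)"
    unfolding drift_def sum_subtractf[symmetric] by (rule sum_abs)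
  also have "... \<le> (\<Sum>t<T. (Lm + Lg) * ?c + L1 * (?k * vnorm T (%i. Om i t)) * dZ Z Z')"
    by (intro sum_mono order_trans[OF vnorm_diff_abs col]) simp
  also have "... = real T * ((Lm + Lg) * ?c) + L1 * (?k * norm21 T T Om) * dZ Z Z'"
    unfolding norm21_Om by (simp add: sum.distrib sum_distrib_left sum_distrib_right)
  also have "... = ((Lm + Lg) * (1 + Lm) ^ (T - 1) * sk * (real T * sqrt lmin) + L1 * ?k * norm21 T T Om) * dZ Z Z'"
    unfolding sk(2) by (simp add: algebra_simps)
  also have "... \<le> (sqrt (real T) * (Lm + Lg) * (1 + Lm) ^ (T - 1) * sk * ?k * norm21 T T Om + L1 * ?k * norm21 T T Om) * dZ Z Z'"
  proof (intro mult_right_mono add_mono order_refl dz)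
    let ?x = "(Lm + Lg) * (1 + Lm) ^ (T - 1) * sk"
    have x: "0 \<le> ?x" using L0 sk by simp
    have "1 * 1 \<le> sqrt (real T) * ?k" using T1 k1 by (intro mult_mono) auto
    then have "?x * (1 * 1) \<le> ?x * (sqrt (real T) * ?k)" using x by (rule mult_left_mono)
    then have h: "?x \<le> ?x * (sqrt (real T) * ?k)" by (simp only: mult_1_right)
    have "?x * (real T * sqrt lmin) \<le> ?x * (sqrt (real T) * ?k) * norm21 T T Om"
      by (rule mult_mono[OF h norm21_ge]) (use order_trans[OF x h] l0 in simp_all)
    then show "?x * (real T * sqrt lmin) \<le> sqrt (real T) * (Lm + Lg) * (1 + Lm) ^ (T - 1) * sk * ?k * norm21 T T Om"
      by (simp only: mult_ac)
  qed (use sg0 norm21_pos in simp_all)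
  also have "... = L2 * (?k * norm21 T T Om * dZ Z Z')"
    unfolding L1_def L2_def by (simp add: algebra_simps)
  also have "... \<le> L * (?k * norm21 T T Om * dZ Z Z')"
    using LL k1 norm21_pos dz by (intro mult_right_mono) auto
  finally show ?thesis by (simp only: mult.assoc)
qed

lemma drift_gauss: "gauss_lipschitz I (%x. drift (cu x)) (L * sqrt (1 + \<sigma>) * norm21 T T Om)"
proof (rule gauss_lipschitz.intro)
  show "0 < L * sqrt (1 + \<sigma>) * norm21 T T Om" using L_bounds sg0 norm21_pos by simp
  fix x y :: "nat \<times> nat => real"
  show "\<bar>drift (cu x) - drift (cu y)\<bar> \<le> L * sqrt (1 + \<sigma>) * norm21 T T Om * L2_set (%i. x i - y i) I"
    using drift_lipschitz[of "cu x" "cu y"] unfolding dZ_cu .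
qed simp

lemma drift_event:
  "\<exists>B\<in>sets (gauss I). measure (gauss I) B \<le> exp (- r) \<and>
    (\<forall>x\<in>space (gauss I) - B. drift (cu x) \<le> (\<integral>x. drift (cu x) \<partial>gauss I) + 4 * \<beta> * norm21 T T Om)"
proof -
  let ?L = "L * sqrt (1 + \<sigma>) * norm21 T T Om"
  have "L * sqrt (1 + \<sigma>) * sqrt r \<le> L * sqrt (1 + \<sigma>) * \<rho>" using rho_bounds L_bounds sg0 by (intro mult_left_mono) auto
  also have "... \<le> 2 * \<beta>" unfolding beta by (rule fluctuation_bound(2)[where \<Lambda> = 1]) (use n0 sg0 rho_bounds L_bounds in auto)
  finally have "2 * norm21 T T Om * (L * sqrt (1 + \<sigma>) * sqrt r) \<le> 2 * norm21 T T Om * (2 * \<beta>)"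
    using norm21_pos by (intro mult_left_mono) auto
  then have s: "2 * ?L * sqrt r \<le> 4 * \<beta> * norm21 T T Om" by (simp add: mult_ac)
  obtain B where B: "B \<in> sets (gauss I)" "measure (gauss I) B \<le> exp (- r)"
    and le: "\<forall>x\<in>space (gauss I) - B. drift (cu x) \<le> (\<integral>x. drift (cu x) \<partial>gauss I) + 2 * ?L * sqrt r"
    using gauss_lipschitz.upper_event[OF drift_gauss r(1)] by blast
  have "\<forall>x\<in>space (gauss I) - B. drift (cu x) \<le> (\<integral>x. drift (cu x) \<partial>gauss I) + 4 * \<beta> * norm21 T T Om"
  proof
    fix x assume "x \<in> space (gauss I) - B"
    from bspec[OF le this] s show "drift (cu x) \<le> (\<integral>x. drift (cu x) \<partial>gauss I) + 4 * \<beta> * norm21 T T Om" by linarith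
  qed
  with B show ?thesis by blast
qed

end
end
end

lemma bbd_divide: "bbd k M c ==> 0 < d ==> bbd k (%i j. M i j / d) (c / d)"
  unfolding bbd_def bf_def by (simp add: sum_divide_distrib[symmetric] divide_right_mono)

lemma bbd_cong: "bbd k M c ==> (\<And>i j. i < k ==> j < k ==> M i j = M' i j) ==> bbd k M' c"
  unfolding bbd_def bf_def by simp

context se begin

subsection \<open>Bounding the error on the good event\<close>

lemma f_prefix: "t < T ==> i < n ==> f t (Yz Z T) i = f t (Yz Z t) i"
  by (rule lip_prefix_cong[OF lipf]) (simp_all add: Yz_prefix[of _ t T])

text \<open>F = Q U with U upper triangular of nonnegative diagonal; multiplication by the inverse
  of \<Omega>, upper triangular of positive diagonal, keeps both properties. This makes C a Cholesky
  factor of H^T H / n.\<close>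

lemma H_triangular:
  "\<exists>C. (\<forall>s<T. \<forall>i<n. Hz Z s i = lc T (Qz Z T) (%r. C r s) i) \<and> (\<forall>i<T. \<forall>j<i. C i j = 0) \<and> (\<forall>i<T. 0 \<le> C i i)"
proof -
  have "\<forall>t. \<exists>U. t < T \<longrightarrow> (\<forall>i<n. f t (Yz Z t) i = (\<Sum>s\<le>t. U s * Qz Z (Suc t) s i)) \<and> 0 \<le> U t"
    using f_decomposition by blast
  then obtain U where U: "\<And>t i. t < T ==> i < n ==> f t (Yz Z t) i = (\<Sum>s\<le>t. U t s * Qz Z (Suc t) s i)" and U0: "\<And>t. t < T ==> 0 \<le> U t t"
    by metis
  define C where "C r s = (\<Sum>q<T. (if r \<le> q then U q r else 0) * D q s)" for r s
  have f: "f q (Yz Z T) i = (\<Sum>r<T. (if r \<le> q then U q r else 0) * Qz Z T r i)" if q: "q < T" and i: "i < n" for q i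
  proof -
    have "f q (Yz Z T) i = (\<Sum>r\<le>q. U q r * Qz Z (Suc q) r i)" by (simp add: f_prefix[OF q i] U[OF q i])
    also have "... = (\<Sum>r\<le>q. (if r \<le> q then U q r else 0) * Qz Z T r i)"
      using q by (intro sum.cong refl) (simp add: Qz_prefix[of _ "Suc q" T])
    also have "... = (\<Sum>r<T. (if r \<le> q then U q r else 0) * Qz Z T r i)"
      using q by (intro sum.mono_neutral_left) auto
    finally show ?thesis .
  qed
  have "Hz Z s i = lc T (Qz Z T) (%r. C r s) i" if i: "i < n" for s i
  proof -
    have "Hz Z s i = (\<Sum>q<T. \<Sum>r<T. (if r \<le> q then U q r else 0) * D q s * Qz Z T r i)"
      unfolding Hz_def by (intro sum.cong refl) (use i in \<open>simp only: f lessThan_iff sum_distrib_left mult_ac\<close>)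
    also have "... = (\<Sum>r<T. \<Sum>q<T. (if r \<le> q then U q r else 0) * D q s * Qz Z T r i)" by (rule sum.swap)
    also have "... = lc T (Qz Z T) (%r. C r s) i" unfolding lc_def C_def by (simp only: sum_distrib_right)
    finally show ?thesis .
  qed
  moreover have "C i j = 0" if "i < T" "j < i" for i j
    unfolding C_def using that Dup by (intro sum.neutral) auto
  moreover have "0 \<le> C i i" if "i < T" for i
  proof -
    have "C i i = (\<Sum>q<T. if q = i then U i i * D i i else 0)"
      unfolding C_def using Dup by (intro sum.cong refl) auto
    then show ?thesis using that U0[OF that] Ddg[OF that] by (simp add: sum.delta)
  qed
  ultimately show ?thesis by blast
qed

lemma H_Om: "t < T ==> lc T (Hz Z) (%s. Om s t) i = f t (Yz Z T) i"
proof -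
  assume t: "t < T"
  have "lc T (Hz Z) (%s. Om s t) i = (\<Sum>s<T. \<Sum>q<T. D q s * Om s t * f q (Yz Z T) i)"
    unfolding lc_def Hz_def by (simp add: sum_distrib_left mult_ac)
  also have "... = (\<Sum>q<T. \<Sum>s<T. D q s * Om s t * f q (Yz Z T) i)" by (rule sum.swap)
  also have "... = (\<Sum>q<T. of_bool (q = t) * f q (Yz Z T) i)"
    by (intro sum.cong refl) (simp add: sum_distrib_right[symmetric] DO t)
  also have "... = (\<Sum>q<T. if q = t then f t (Yz Z T) i else 0)" by (intro sum.cong refl) auto
  finally show ?thesis using t by (simp add: sum.delta)
qed

context
  fixes \<sigma> r \<rho> L \<beta> :: real
  assumes sg: "bbd T (%s t. Sz s t - of_bool (s = t)) \<sigma>" and sg0: "0 \<le> \<sigma>"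
    and r: "0 \<le> r" "r \<le> real n" and rho: "\<rho> = sqrt (real T + r)" and LL: "1 + L2 \<le> L"
    and beta: "\<beta> = sqrt (real n) * \<sigma> + L\<^sup>2 * \<rho>" and lL: "log 2 (2 * real T) \<le> L"
begin

lemmas rho_b = rho_bounds[OF sg sg0 r rho LL beta] and L_b = L_bounds[OF sg sg0 r rho LL beta]

lemma beta_nonneg: "0 \<le> \<beta>" "\<rho> \<le> \<beta>"
proof -
  have "1 * \<rho> \<le> L\<^sup>2 * \<rho>" using rho_b(1) one_le_power[OF L_b(3), of 2] by (intro mult_right_mono) auto
  moreover have "0 \<le> sqrt (real n) * \<sigma>" using sg0 by simp
  ultimately show "\<rho> \<le> \<beta>" unfolding beta by linarith
  then show "0 \<le> \<beta>" using rho_b(1) by linarith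
qed

definition Vop :: "vecs => vecs => vec => vec" where
  "Vop A Z x i = lc T Z x i - mv n n A (lc T (Hz Z) x) i + lc T (Hz Z) (%s. \<Sum>t<T. Kz s t * x t) i"

text \<open>The single bound on the Gram fluctuation of [Z, H] yields, by its blocks, the norm of
  \<open>Z\<close>, the deviation of Z^T H / n from K, and that of H^T H / n from I, the last with
  \<sigma> added for the mean. The operator bound adequate for the size of \<beta> is then
  selected.\<close>

lemma Vop_bound:
  assumes A: "\<And>i j. A i j = A j i" and A': "\<And>i j. A' i j = A' j i"
    and An: "bbd n A 4" and A'n: "bbd T A' (8/7 * (2 * (sqrt 5 * \<rho> / sqrt (real n))))"
    and Z: "\<And>s i. s < T ==> i < n ==> cu x s i = znext n (Qz (cu x) T) s A A' i"
    and G: "bbd (T + T) (%j l. vinner n (Wz x j) (Wz x l) - W.gram j l) (sqrt (real n) * (70 * \<beta>))"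
  shows "vnorm n (Vop A (cu x) u) \<le> 5500 * (L * \<beta>) * vnorm T u"
proof -
  let ?s = "sqrt (real n)" and ?\<eta> = "70 * \<beta>" and ?Z = "cu x" and ?H = "Hz (cu x)"
  let ?e = "\<sigma> + ?\<eta> / ?s" and ?z = "sqrt (?s\<^sup>2 + ?s * ?\<eta>)" and ?l = "log 2 (2 * real T)"
  let ?d = "5 * ?l * ?e" and ?a = "8/7 * (2 * (sqrt 5 * \<rho> / ?s))" and ?k = "sqrt (1 + \<sigma>)"
  have s: "1 \<le> ?s" "?s * ?s = real n" "0 < ?s" using n0 by auto
  have eta0: "0 \<le> ?\<eta>" using beta_nonneg by simp
  have n: "0 < real n" using n0 by simp
  have cn: "?s * ?\<eta> / real n = ?\<eta> / ?s" using s by (simp add: field_simps)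
  have ZZ: "vnorm n (lc T ?Z u) \<le> ?z * vnorm T u" for u
  proof (rule power2_le_imp_le)
    have b: "bbd T (%s t. vinner n (?Z s) (?Z t) - real n * of_bool (s = t)) (?s * ?\<eta>)"
      by (rule bbd_cong[OF bbd_block[OF G, of 0 0]]) (simp_all add: Wz_def gram_columns)
    have "(vnorm n (lc T ?Z u))\<^sup>2 = bf T (%s t. vinner n (?Z s) (?Z t)) u u"
      unfolding vinner_self[symmetric] vinner_lc_lc bf_def ..
    also have "... = bf T (%s t. vinner n (?Z s) (?Z t) - real n * of_bool (s = t)) u u + real n * bf T (%s t. of_bool (s = t)) u u"
      unfolding bf_diff_mat by (simp add: bf_def sum_distrib_left mult_ac)
    also have "... \<le> ?s * ?\<eta> * vnorm T u * vnorm T u + real n * (vnorm T u)\<^sup>2"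
      unfolding bf_id vinner_self using bbdD[OF b, of u u] by linarith
    also have "... = (?z * vnorm T u)\<^sup>2"
      using eta0 by (simp add: power_mult_distrib power2_eq_square[of "vnorm T u"] algebra_simps)
    finally show "(vnorm n (lc T ?Z u))\<^sup>2 \<le> (?z * vnorm T u)\<^sup>2" .
  qed (use eta0 in simp)
  have HH: "bbd T (%j l. vinner n (?H j) (?H l) / real n - of_bool (j = l)) ?e"
  proof -
    have b: "bbd T (%s t. (vinner n (Wz x (T + s)) (Wz x (T + t)) - W.gram (T + s) (T + t)) / real n) (?\<eta> / ?s)"
      using bbd_divide[OF bbd_block[OF G, of T T] n] unfolding cn by simp
    show ?thesis
      by (rule bbd_cong[OF bbd_add[OF sg b]]) (simp add: Wz_def Sz_def diff_divide_distrib)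
  qed
  have ZH: "bbd T (%s t. vinner n (?Z s) (?H t) / real n - Kz s t) (?\<eta> / ?s)"
  proof -
    have b: "bbd T (%s t. (vinner n (Wz x s) (Wz x (T + t)) - W.gram s (T + t)) / real n) (?\<eta> / ?s)"
      using bbd_divide[OF bbd_block[OF G, of 0 T] n] unfolding cn by simp
    show ?thesis by (rule bbd_cong[OF b]) (simp add: Wz_def Kz_def diff_divide_distrib)
  qed
  obtain C where CC: "(\<forall>s<T. \<forall>i<n. ?H s i = lc T (Qz ?Z T) (%r. C r s) i) \<and> (\<forall>i<T. \<forall>j<i. C i j = 0) \<and> (\<forall>i<T. 0 \<le> C i i)"
    using H_triangular[of ?Z] by (elim exE)
  note C = CC[THEN conjunct1, rule_format] and up = CC[THEN conjunct2, THEN conjunct1, rule_format]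
    and dg = CC[THEN conjunct2, THEN conjunct2, rule_format]
  have e0: "0 \<le> ?e" using sg0 eta0 s by simp
  have a0: "0 \<le> ?a" using rho_b(1) s by simp
  have z0: "0 \<le> ?z" using eta0 by simp
  have kk: "0 \<le> sqrt (1 + \<sigma>)" by (rule real_sqrt_ge_zero) (use sg0 in linarith)
  note V = error_operator_bound[OF n0 T1 orth_Qz[OF Tn] A A' An A'n a0 Z C up dg ZZ z0 HH e0 ZH eta0 Kz_bound[OF sg sg0] kk Vop_def[of A "cu x"] refl, of u]
  have fine: "vnorm n (Vop A ?Z u) \<le> (4 * ?s * ?d + ?s * ?a + ?s * ?d * ?k + ?\<eta> + ?z * ?d) * vnorm T u"
    by (rule V(1))
  have crude: "vnorm n (Vop A ?Z u) \<le> (4 * ?s * ?d + ?s * ?a + ?z + sqrt (?s\<^sup>2 * (1 + ?e)) * ?k) * vnorm T u"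
    unfolding real_sqrt_pow2[OF less_imp_le[OF n]] by (rule V(2)[unfolded real_sqrt_pow2[OF less_imp_le[OF n]]])
  have l0: "0 \<le> ?l" using T1 by simp
  have "4 * ?s * ?d + ?s * ?a + ?s * ?d * ?k + ?\<eta> + ?z * ?d \<le> 5500 * (L * \<beta>)
    \<or> 4 * ?s * ?d + ?s * ?a + ?z + sqrt (?s\<^sup>2 * (1 + ?e)) * ?k \<le> 5500 * (L * \<beta>)"
    by (rule error_constants[OF s(1) sg0 rho_b(1) L_b(3) l0 lL beta refl refl refl refl refl])
  then show ?thesis
    using order_trans[OF fine mult_right_mono[OF _ vnorm_nonneg]] order_trans[OF crude mult_right_mono[OF _ vnorm_nonneg]] by blast
qed

lemma good_event_bound:
  assumes A: "\<And>i j. A i j = A j i" and A': "\<And>i j. A' i j = A' j i"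
    and An: "bbd n A 4" and A'n: "bbd T A' (8/7 * (2 * (sqrt 5 * \<rho> / sqrt (real n))))"
    and Z: "\<And>s i. s < T ==> i < n ==> cu x s i = znext n (Qz (cu x) T) s A A' i"
    and G: "bbd (T + T) (%j l. vinner n (Wz x j) (Wz x l) - W.gram j l) (sqrt (real n) * (70 * \<beta>))"
    and dr: "drift (cu x) \<le> P + 4 * \<beta> * norm21 T T Om" and P: "0 \<le> P"
  shows "sqrt (\<Sum>t<T. \<Sum>i<n. (iterX n f g A T t i - Yz (cu x) T t i)\<^sup>2)
    \<le> 6000 * (1 + 4 * Lf + Lg) ^ (T - 1) * (P / norm21 T T Om + L * (sqrt (real n) * \<sigma>) + L ^ 3 * (sqrt (real T) + sqrt r)) * norm21 T T Om"
proof -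
  let ?Z = "cu x" and ?X = "iterX n f g A T" and ?N = "norm21 T T Om"
  let ?Y = "Yz ?Z T"
  have col: "vnorm n (%i. ?Y t i - mv n n A (f t ?Y) i - g t ?Y i)
     \<le> vnorm n (%i. m t ?Y i - g t ?Y i - lc T (Hz ?Z) (KO t) i) + 5500 * (L * \<beta>) * vnorm T (%i. Om i t)" if t: "t < T" for t
  proof -
    have "vnorm n (%i. ?Y t i - mv n n A (f t ?Y) i - g t ?Y i)
      = vnorm n (%i. (m t ?Y i - g t ?Y i - lc T (Hz ?Z) (KO t) i) + Vop A ?Z (%s. Om s t) i)"
    proof (rule vnorm_cong)
      fix i assume i: "i < n"
      have "lc T (Hz ?Z) (%s. Om s t) = f t ?Y" by (rule ext) (rule H_Om[OF t])
      then show "?Y t i - mv n n A (f t ?Y) i - g t ?Y i = (m t ?Y i - g t ?Y i - lc T (Hz ?Z) (KO t) i) + Vop A ?Z (%s. Om s t) i"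
        unfolding Vop_def KO_def[symmetric] Yz_eq[OF t i] by simp
    qed
    also have "... \<le> vnorm n (%i. m t ?Y i - g t ?Y i - lc T (Hz ?Z) (KO t) i) + vnorm n (Vop A ?Z (%s. Om s t))"
      by (rule vnorm_triangle)
    also have "... \<le> vnorm n (%i. m t ?Y i - g t ?Y i - lc T (Hz ?Z) (KO t) i) + 5500 * (L * \<beta>) * vnorm T (%i. Om i t)"
      by (intro add_left_mono Vop_bound[OF A A' An A'n Z G])
    finally show ?thesis .
  qed
  have "(\<Sum>t<T. vnorm n (%i. ?Y t i - mv n n A (f t ?Y) i - g t ?Y i))
    \<le> (\<Sum>t<T. vnorm n (%i. m t ?Y i - g t ?Y i - lc T (Hz ?Z) (KO t) i) + 5500 * (L * \<beta>) * vnorm T (%i. Om i t))"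
    by (intro sum_mono col) simp
  also have "... = drift ?Z + 5500 * (L * \<beta>) * ?N"
    unfolding drift_def norm21_Om sum.distrib sum_distrib_left ..
  also have "... \<le> 6000 * (P / ?N + L * (sqrt (real n) * \<sigma>) + L ^ 3 * (sqrt (real T) + sqrt r)) * ?N"
  proof -
    have N: "0 < ?N" by (rule norm21_pos)
    have "1 * \<beta> \<le> L * \<beta>" using L_b(3) beta_nonneg(1) by (intro mult_right_mono)
    moreover have "L ^ 3 * \<rho> \<le> L ^ 3 * (sqrt (real T) + sqrt r)" using rho_b(5) L_b(3) by (intro mult_left_mono) auto
    \<comment> \<open>One factor L stems from the triangular truncation and L^2 is contained in
      \<beta>, which accounts for L^3. The final constant 6000 absorbs 5500 L \<beta> together with
      4 \<beta> \<le> 4 L \<beta>.\<close>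
    moreover have "L * \<beta> = L * (sqrt (real n) * \<sigma>) + L ^ 3 * \<rho>" unfolding beta by (simp add: power2_eq_square power3_eq_cube algebra_simps)
    moreover have "0 \<le> L * \<beta>" using L_b(3) beta_nonneg(1) by simp
    moreover have "0 \<le> P / ?N" using P N by simp
    ultimately have "P / ?N + 4 * \<beta> + 5500 * (L * \<beta>) \<le> 6000 * (P / ?N + L * (sqrt (real n) * \<sigma>) + L ^ 3 * (sqrt (real T) + sqrt r))"
      by argo
    then have "(P / ?N + 4 * \<beta> + 5500 * (L * \<beta>)) * ?N \<le> 6000 * (P / ?N + L * (sqrt (real n) * \<sigma>) + L ^ 3 * (sqrt (real T) + sqrt r)) * ?N"
      using N by (intro mult_right_mono) auto
    moreover have "(P / ?N + 4 * \<beta> + 5500 * (L * \<beta>)) * ?N = P + 4 * \<beta> * ?N + 5500 * (L * \<beta>) * ?N"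
      using N by (simp add: algebra_simps)
    ultimately show ?thesis using dr by linarith
  qed
  finally have S: "(\<Sum>t<T. vnorm n (%i. ?Y t i - mv n n A (f t ?Y) i - g t ?Y i))
     \<le> 6000 * (P / ?N + L * (sqrt (real n) * \<sigma>) + L ^ 3 * (sqrt (real T) + sqrt r)) * ?N" .
  have "sqrt (\<Sum>t<T. \<Sum>i<n. (?X t i - ?Y t i)\<^sup>2) \<le> (1 + 4 * Lf + Lg) ^ (T - 1) * (\<Sum>t<T. vnorm n (%i. ?Y t i - mv n n A (f t ?Y) i - g t ?Y i))"
    by (rule iteration_stability[OF T1 lipf lipg L0(1,2) An iterX_fixed[OF lipf lipg]])
  also have "... \<le> (1 + 4 * Lf + Lg) ^ (T - 1) * (6000 * (P / ?N + L * (sqrt (real n) * \<sigma>) + L ^ 3 * (sqrt (real T) + sqrt r)) * ?N)"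
    using S L0 by (intro mult_left_mono) auto
  finally show ?thesis by (simp only: mult_ac)
qed

end
end

lemma sum_mat_assoc: "(\<Sum>l<k. (\<Sum>a<k. x a * A a l) * y l) = (\<Sum>a<k. x a * (\<Sum>l<k. A a l * (y l :: real)))"
  by (simp add: sum_distrib_left sum_distrib_right mult.assoc) (rule sum.swap)

lemma sum_of_bool: "a < (k::nat) ==> (\<Sum>i<k. of_bool (a = i) * y i) = (y a :: real)"
proof -
  assume a: "a < (k::nat)"
  have "(\<Sum>i<k. of_bool (a = i) * y i) = (\<Sum>i<k. if i = a then y a else 0)" by (intro sum.cong refl) auto
  then show ?thesis using a by (simp add: sum.delta)
qed

context se begin

subsection \<open>Transfer to the coupling\<close>

lemma cu_rs_T: "Yz (cu (rs T Z)) T = Yz Z T" "Qz (cu (rs T Z)) T = Qz Z T"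
proof -
  show "Yz (cu (rs T Z)) T = Yz Z T" by (rule Yz_cong) (rule cu_rs)
  obtain T' where T': "T = Suc T'" using T1 by (cases T) auto
  have "Qz (cu (rs T Z)) (Suc T') = Qz Z (Suc T')" by (rule Qz_cong_Suc) (rule cu_rs, use T' in auto)
  then show "Qz (cu (rs T Z)) T = Qz Z T" unfolding T' .
qed

lemma coupledY_eq:
  assumes "t < T" "i < n" shows "coupledY n T v f m Om \<omega> t i = Yz (cu (rs T (zc \<omega> T))) T t i"
proof -
  obtain Q Z Y where c: "coupling n v f m Om (fst \<omega>) (snd \<omega>) T = (Q, Z, Y)" by (metis prod_cases3)
  show ?thesis unfolding cu_rs_T coupledY_def c using coupling_columns(3)[OF order_refl c assms] by simp
qed

lemma expectation_transfer:
  fixes h :: "(nat \<times> nat => real) => real"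
  assumes "h \<in> borel_measurable (PiM I (%_. borel))"
  shows "(\<integral>\<omega>. h (rs T (zc \<omega> T)) \<partial>(GOE2 n)) = (\<integral>x. h x \<partial>gauss I)"
  unfolding columns_gauss[symmetric] by (rule integral_distr[OF rs_zc_measurable assms, symmetric])

lemma bf_gram_blocks:
  "(\<integral>x. vinner n (lc T (cu x) u) (lc T (Hz (cu x)) w) \<partial>gauss I) = real n * bf T Kz u w" (is ?K)
  "(\<integral>x. vinner n (lc T (Hz (cu x)) u) (lc T (Hz (cu x)) w) \<partial>gauss I) = real n * bf T Sz u w" (is ?S)
proof -
  let ?l = "%u j. if j < T then u j else 0 :: real" and ?r = "%u j. if j < T then 0 else u (j - T) :: real"
  have l: "lc (T + T) (Wz x) (?l u) = lc T (cu x) u" and r: "lc (T + T) (Wz x) (?r u) = lc T (Hz (cu x)) u" for x u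
    by (rule ext, subst lc_Wz, simp add: lc_def)+
  have "bf (T + T) W.gram (?l u) (?r w) = real n * bf T Kz u w"
    unfolding bf_blocks using n0 by (simp add: bf_def Kz_def sum_distrib_left)
  then show ?K using W.vinner_lc_integral(2)[of "?l u" "?r w"] unfolding l r by simp
  have "bf (T + T) W.gram (?r u) (?r w) = real n * bf T Sz u w"
    unfolding bf_blocks using n0 by (simp add: bf_def Sz_def sum_distrib_left)
  then show ?S using W.vinner_lc_integral(2)[of "?r u" "?r w"] unfolding r by simp
qed

lemma measurable_vinner_lc:
  "(%x. vinner n (lc T (cu x) u) (lc T (Hz (cu x)) w)) \<in> borel_measurable (PiM I (%_. borel))"
  "(%x. vinner n (lc T (Hz (cu x)) u) (lc T (Hz (cu x)) w)) \<in> borel_measurable (PiM I (%_. borel))"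
proof -
  have c: "(%x. Wz x j i) \<in> borel_measurable (PiM I (%_. borel))" if "j < T + T" "i < n" for j i
    using W.coord_measurable[OF that] unfolding measurable_cong_sets[OF sets_gauss refl] .
  have z: "(%x. cu x j i) \<in> borel_measurable (PiM I (%_. borel))" if "j < T" "i < n" for j i
  proof -
    have "(%x. cu x j i) = (%x. Wz x j i)" using that by (simp only: Wz_def if_True)
    moreover have "j < T + T" using that by simp
    ultimately show ?thesis using c[of j i] that(2) by (simp only:)
  qed
  have h: "(%x. Hz (cu x) j i) \<in> borel_measurable (PiM I (%_. borel))" if "j < T" "i < n" for j i
  proof -
    have "(%x. Hz (cu x) j i) = (%x. Wz x (T + j) i)" by (simp add: Wz_def)
    moreover have "T + j < T + T" using that by simp
    ultimately show ?thesis using c[of "T + j" i] that(2) by (simp only:)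
  qed
  have lz: "(%x. lc T (cu x) u i) \<in> borel_measurable (PiM I (%_. borel))" if "i < n" for i u
    unfolding lc_def by (rule borel_measurable_sum, rule borel_measurable_times[OF borel_measurable_const z]) (use that in auto)
  have lh: "(%x. lc T (Hz (cu x)) u i) \<in> borel_measurable (PiM I (%_. borel))" if "i < n" for i u
    unfolding lc_def by (rule borel_measurable_sum, rule borel_measurable_times[OF borel_measurable_const h]) (use that in auto)
  show "(%x. vinner n (lc T (cu x) u) (lc T (Hz (cu x)) w)) \<in> borel_measurable (PiM I (%_. borel))"
    "(%x. vinner n (lc T (Hz (cu x)) u) (lc T (Hz (cu x)) w)) \<in> borel_measurable (PiM I (%_. borel))"
    by (rule measurable_vinner[OF lz lh], assumption+) (rule measurable_vinner[OF lh lh])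
qed

lemma coupled_prefix:
  assumes h: "lipschitz_on_prefix n t Lh h" and t: "t < T" and i: "i < n"
  shows "h (coupledY n T v f m Om \<omega>) i = h (Yz (cu (rs T (zc \<omega> T))) T) i"
  by (rule lip_prefix_cong[OF h coupledY_eq i]) (use t in auto)

text \<open>Y - M = Z \<Omega> and F = H \<Omega>, so the expectation is n times the entry of
  \<Omega>^T K \<Omega>.\<close>

lemma EYF_eq:
  assumes s: "s < T" and t: "t < T"
  shows "(\<integral>\<omega>. mmul T n T (mtrans (%i j. seqmat n T (coupledY n T v f m Om \<omega>) i j - colmat n T m (coupledY n T v f m Om \<omega>) i j))
      (colmat n T f (coupledY n T v f m Om \<omega>)) s t \<partial>(GOE2 n)) = real n * (\<Sum>i<T. Om i s * KO t i)"
proof -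
  let ?h = "%x. vinner n (lc T (cu x) (%i. Om i s)) (lc T (Hz (cu x)) (%i. Om i t))"
  have e: "mmul T n T (mtrans (%i j. seqmat n T (coupledY n T v f m Om \<omega>) i j - colmat n T m (coupledY n T v f m Om \<omega>) i j))
      (colmat n T f (coupledY n T v f m Om \<omega>)) s t = ?h (rs T (zc \<omega> T))" for \<omega>
  proof -
    have "(coupledY n T v f m Om \<omega> s l - m s (coupledY n T v f m Om \<omega>) l) * f t (coupledY n T v f m Om \<omega>) l
      = lc T (cu (rs T (zc \<omega> T))) (%i. Om i s) l * lc T (Hz (cu (rs T (zc \<omega> T)))) (%i. Om i t) l" if l: "l < n" for l
      unfolding coupledY_eq[OF s l] coupled_prefix[OF lipm[OF s] s l] coupled_prefix[OF lipf[OF t] t l] Yz_eq[OF s l] H_Om[OF t] by simp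
    then show ?thesis unfolding mmul_def mtrans_def seqmat_def colmat_def vinner_def using s t by simp
  qed
  show ?thesis unfolding e expectation_transfer[OF measurable_vinner_lc(1)] bf_gram_blocks
    unfolding bf_vinner_right vinner_def KO_def ..
qed

lemma EFF_eq:
  assumes s: "s < T" and t: "t < T"
  shows "(\<integral>\<omega>. mmul T n T (mtrans (colmat n T f (coupledY n T v f m Om \<omega>))) (colmat n T f (coupledY n T v f m Om \<omega>)) s t \<partial>(GOE2 n))
    = real n * (\<Sum>i<T. Om i s * (\<Sum>j<T. Sz i j * Om j t))"
proof -
  let ?h = "%x. vinner n (lc T (Hz (cu x)) (%i. Om i s)) (lc T (Hz (cu x)) (%i. Om i t))"
  have e: "mmul T n T (mtrans (colmat n T f (coupledY n T v f m Om \<omega>))) (colmat n T f (coupledY n T v f m Om \<omega>)) s t = ?h (rs T (zc \<omega> T))" for \<omega>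
  proof -
    have "f s (coupledY n T v f m Om \<omega>) l * f t (coupledY n T v f m Om \<omega>) l
      = lc T (Hz (cu (rs T (zc \<omega> T)))) (%i. Om i s) l * lc T (Hz (cu (rs T (zc \<omega> T)))) (%i. Om i t) l" if l: "l < n" for l
      unfolding coupled_prefix[OF lipf[OF s] s l] coupled_prefix[OF lipf[OF t] t l] H_Om[OF t] H_Om[OF s] ..
    then show ?thesis unfolding mmul_def mtrans_def colmat_def vinner_def using s t by simp
  qed
  show ?thesis unfolding e expectation_transfer[OF measurable_vinner_lc(2)] bf_gram_blocks
    unfolding bf_vinner_right vinner_def ..
qed

lemma DT_Om: "k < T ==> (\<Sum>l<T. D l k * (\<Sum>i<T. Om i l * y i)) = y k"
proof -
  assume k: "k < T"
  have "(\<Sum>l<T. D l k * (\<Sum>i<T. Om i l * y i)) = (\<Sum>i<T. (\<Sum>l<T. D l k * Om i l) * y i)"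
    by (rule sum_mat_assoc[symmetric])
  also have "... = (\<Sum>i<T. of_bool (k = i) * y i)"
    by (intro sum.cong refl) (use OD k in \<open>simp add: mult.commute eq_commute\<close>)
  finally show ?thesis by (simp only: sum_of_bool[OF k])
qed

lemma S_identity:
  assumes E: "\<And>k l. k < T ==> l < T ==> E k l = real n * (\<Sum>i<T. Om i k * (\<Sum>j<T. Sz i j * Om j l))" and st: "s < T" "t < T"
  shows "1 / real n * mmul T T T (mmul T T T (mtrans D) E) D s t = Sz s t"
proof -
  have "mmul T T T (mmul T T T (mtrans D) E) D s t = (\<Sum>l<T. (\<Sum>k<T. D k s * E k l) * D l t)"
    using st by (simp add: mmul_def mtrans_def)
  also have "... = (\<Sum>l<T. real n * ((\<Sum>j<T. Sz s j * Om j l) * D l t))"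
  proof (rule sum.cong[OF refl])
    fix l assume "l \<in> {..<T}"
    then have "(\<Sum>k<T. D k s * E k l) = (\<Sum>k<T. real n * (D k s * (\<Sum>i<T. Om i k * (\<Sum>j<T. Sz i j * Om j l))))"
      by (intro sum.cong refl) (simp add: E)
    also have "... = real n * (\<Sum>j<T. Sz s j * Om j l)"
      unfolding sum_distrib_left[symmetric] by (simp only: DT_Om[OF st(1)])
    finally show "(\<Sum>k<T. D k s * E k l) * D l t = real n * ((\<Sum>j<T. Sz s j * Om j l) * D l t)" by simp
  qed
  also have "... = real n * (\<Sum>j<T. Sz s j * (\<Sum>l<T. Om j l * D l t))"
    unfolding sum_distrib_left[symmetric] by (simp only: sum_mat_assoc)
  also have "(\<Sum>j<T. Sz s j * (\<Sum>l<T. Om j l * D l t)) = (\<Sum>j<T. of_bool (t = j) * Sz s j)"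
    by (intro sum.cong refl) (use OD st in auto)
  also have "... = Sz s t" by (rule sum_of_bool[OF st(2)])
  finally show ?thesis using n0 by simp
qed

lemma B_identity:
  assumes E: "\<And>l t. l < T ==> t < T ==> E l t = real n * (\<Sum>i<T. Om i l * KO t i)" and st: "s < T" "t < T"
    and N: "\<And>i j. i < T ==> j < T ==> N i j = (\<Sum>k<T. D i k * D j k)"
  shows "1 / real n * mmul T T T N E s t = (\<Sum>k<T. D s k * KO t k)"
proof -
  have "mmul T T T N E s t = (\<Sum>l<T. real n * ((\<Sum>k<T. D s k * D l k) * (\<Sum>i<T. Om i l * KO t i)))"
    using st by (simp add: mmul_def E N mult_ac)
  also have "... = real n * (\<Sum>k<T. D s k * (\<Sum>l<T. D l k * (\<Sum>i<T. Om i l * KO t i)))"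
    unfolding sum_distrib_left[symmetric] by (simp only: sum_mat_assoc[of "D s" "%k l. D l k"])
  also have "(\<Sum>k<T. D s k * (\<Sum>l<T. D l k * (\<Sum>i<T. Om i l * KO t i))) = (\<Sum>k<T. D s k * KO t k)"
    by (intro sum.cong refl) (simp add: DT_Om)
  finally show ?thesis using n0 by simp
qed

lemma psi1_integrand:
  assumes B: "\<And>s t. s < T ==> t < T ==> B s t = (\<Sum>k<T. D s k * KO t k)"
  shows "norm21 n T (%i t. colmat n T m (coupledY n T v f m Om \<omega>) i t - colmat n T g (coupledY n T v f m Om \<omega>) i t
      - mmul n T T (colmat n T f (coupledY n T v f m Om \<omega>)) B i t) = drift (cu (rs T (zc \<omega> T)))"
proof -
  let ?Y = "coupledY n T v f m Om \<omega>" and ?Z = "cu (rs T (zc \<omega> T))"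
  have "colmat n T m ?Y i t - colmat n T g ?Y i t - mmul n T T (colmat n T f ?Y) B i t
     = m t (Yz ?Z T) i - g t (Yz ?Z T) i - lc T (Hz ?Z) (KO t) i" if t: "t < T" and i: "i < n" for t i
  proof -
    have "mmul n T T (colmat n T f ?Y) B i t = (\<Sum>s<T. f s (Yz ?Z T) i * (\<Sum>k<T. D s k * KO t k))"
      unfolding mmul_def colmat_def using t i by (simp add: B coupled_prefix[OF lipf])
    also have "... = (\<Sum>k<T. (\<Sum>s<T. f s (Yz ?Z T) i * D s k) * KO t k)" by (rule sum_mat_assoc[symmetric])
    also have "... = lc T (Hz ?Z) (KO t) i" unfolding lc_def Hz_def by (simp add: mult.commute)
    finally show ?thesis using t i by (simp add: colmat_def coupled_prefix[OF lipm[OF t] t i] coupled_prefix[OF lipg[OF t] t i])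
  qed
  then show ?thesis unfolding norm21_def drift_def vnorm_def by simp
qed

end

context se begin

lemma measure_GOE_fst:
  assumes "B \<in> sets (GOE n)"
  shows "fst -` B \<inter> space (GOE2 n) \<in> sets (GOE2 n)"
    "measure (GOE2 n) (fst -` B \<inter> space (GOE2 n)) = measure (GOE n) B"
    "snd -` B \<inter> space (GOE2 n) \<in> sets (GOE2 n)"
    "measure (GOE2 n) (snd -` B \<inter> space (GOE2 n)) = measure (GOE n) B"
proof -
  interpret G: prob_space "GOE n" by (rule prob_space_GOE[OF n0])
  have e: "fst -` B \<inter> space (GOE2 n) = B \<times> space (GOE n)"
    "snd -` B \<inter> space (GOE2 n) = space (GOE n) \<times> B"
    by (auto simp: space_pair_measure)
  have s: "space (GOE n) \<in> sets (GOE n)" by (rule sets.top)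
  show "fst -` B \<inter> space (GOE2 n) \<in> sets (GOE2 n)"
    "snd -` B \<inter> space (GOE2 n) \<in> sets (GOE2 n)"
    unfolding e by (rule pair_measureI[OF assms s], rule pair_measureI[OF s assms])
  show "measure (GOE2 n) (fst -` B \<inter> space (GOE2 n)) = measure (GOE n) B"
    unfolding e measure_def G.emeasure_pair_measure_Times[OF assms s] G.emeasure_space_1 by simp
  show "measure (GOE2 n) (snd -` B \<inter> space (GOE2 n)) = measure (GOE n) B"
    unfolding e measure_def G.emeasure_pair_measure_Times[OF s assms] G.emeasure_space_1 by simp
qed

lemma measure_columns:
  assumes "B \<in> sets (gauss I)"
  shows "(%\<omega>. rs T (zc \<omega> T)) -` B \<inter> space (GOE2 n) \<in> sets (GOE2 n)"
    "measure (GOE2 n) ((%\<omega>. rs T (zc \<omega> T)) -` B \<inter> space (GOE2 n)) = measure (gauss I) B"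
proof -
  have B: "B \<in> sets (PiM I (%_. borel))" using assms unfolding sets_gauss .
  show "(%\<omega>. rs T (zc \<omega> T)) -` B \<inter> space (GOE2 n) \<in> sets (GOE2 n)"
    by (rule measurable_sets[OF rs_zc_measurable B])
  show "measure (GOE2 n) ((%\<omega>. rs T (zc \<omega> T)) -` B \<inter> space (GOE2 n)) = measure (gauss I) B"
    using measure_distr[OF rs_zc_measurable B] unfolding columns_gauss by (rule sym)
qed

lemma AE_symmetric:
  "AE \<omega> in GOE2 n. (\<forall>i j. fst \<omega> i j = fst \<omega> j i) \<and> (\<forall>i j. snd \<omega> i j = snd \<omega> j i)"
proof -
  interpret G: prob_space "GOE n" by (rule prob_space_GOE[OF n0])
  interpret GG: pair_prob_space "GOE n" "GOE n" ..
  have c[measurable]: "(%\<omega>. fst \<omega> i j) \<in> borel_measurable (GOE2 n)" "(%\<omega>. snd \<omega> i j) \<in> borel_measurable (GOE2 n)" for i j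
    unfolding measurable_pair_GOE_iff by (rule measurable_pair_VV_coord)+
  have p1: "Measurable.pred (GOE2 n) (%\<omega>. \<forall>i j. fst \<omega> i j = fst \<omega> j i)"
    by measurable
  have p2: "Measurable.pred (GOE2 n) (%\<omega>. \<forall>i j. snd \<omega> i j = snd \<omega> j i)"
    by measurable
  have "AE \<omega> in GOE2 n. \<forall>i j. fst \<omega> i j = fst \<omega> j i"
  proof (rule GG.AE_pair_measure)
    show "{\<omega> \<in> space (GOE2 n). \<forall>i j. fst \<omega> i j = fst \<omega> j i} \<in> sets (GOE2 n)" by (rule predE[OF p1])
    show "AE x in GOE n. AE y in GOE n. \<forall>i j. fst (x, y) i j = fst (x, y) j i" using AE_GOE_symmetric[of n] by simp
  qed
  moreover have "AE \<omega> in GOE2 n. \<forall>i j. snd \<omega> i j = snd \<omega> j i"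
  proof (rule GG.AE_pair_measure)
    show "{\<omega> \<in> space (GOE2 n). \<forall>i j. snd \<omega> i j = snd \<omega> j i} \<in> sets (GOE2 n)" by (rule predE[OF p2])
    show "AE x in GOE n. AE y in GOE n. \<forall>i j. snd (x, y) i j = snd (x, y) j i" using AE_GOE_symmetric[of n] by simp
  qed
  ultimately show ?thesis by (rule AE_conjI)
qed

lemma distance_measurable:
  "(%\<omega>. sqrt (\<Sum>t<T. \<Sum>i<n. (iterX n f g (fst \<omega>) T t i - Yz (cu (rs T (zc \<omega> T))) T t i)\<^sup>2)) \<in> borel_measurable (GOE2 n)"
proof -
  have x: "(%\<omega>. iterX n f g (fst \<omega>) T t i) \<in> borel_measurable (GOE2 n)" if "i < n" for t i
    unfolding measurable_pair_GOE_iff by (rule measurable_iterX[OF lipf lipg measurable_pair_VV_coord(1) that order_refl])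
  have y: "(%\<omega>. Yz (cu (rs T (zc \<omega> T))) T t i) \<in> borel_measurable (GOE2 n)" for t i
    unfolding cu_rs_T measurable_pair_GOE_iff by (rule measurable_Yz[OF order_refl]) (rule measurable_zc[OF order_refl])
  have "(%\<omega>. \<Sum>t<T. \<Sum>i<n. (iterX n f g (fst \<omega>) T t i - Yz (cu (rs T (zc \<omega> T))) T t i)\<^sup>2) \<in> borel_measurable (GOE2 n)"
    by (rule borel_measurable_sum, rule borel_measurable_sum, rule borel_measurable_power, rule borel_measurable_diff[OF x y]) simp
  then show ?thesis by (rule measurable_compose[OF _ borel_measurable_sqrt])
qed

lemma drift_measurable:
  assumes sg: "bbd T (%s t. Sz s t - of_bool (s = t)) \<sigma>" and sg0: "0 \<le> \<sigma>"
  shows "(%x. drift (cu x)) \<in> borel_measurable (PiM I (%_. borel))"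
proof -
  have "gauss_lipschitz I (%x. drift (cu x)) ((1 + L2) * sqrt (1 + \<sigma>) * norm21 T T Om)"
    by (rule drift_gauss[OF sg sg0 order_refl _ refl order_refl refl]) simp
  from gauss_lipschitz.meas[OF this] show ?thesis unfolding measurable_cong_sets[OF sets_gauss refl] .
qed

lemma coupling_bound:
  assumes sg: "bbd T (%s t. Sz s t - of_bool (s = t)) \<sigma>" and sg0: "0 \<le> \<sigma>"
    and r: "0 \<le> r" "r \<le> real n" and L: "L = log 2 (2 * real T) + L2"
  shows "1 - 5 * exp (- r) \<le> measure (GOE2 n) {\<omega> \<in> space (GOE2 n).
    sqrt (\<Sum>t<T. \<Sum>i<n. (iterX n f g (fst \<omega>) T t i - Yz (cu (rs T (zc \<omega> T))) T t i)\<^sup>2)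
    \<le> 6000 * (1 + 4 * Lf + Lg) ^ (T - 1) * ((\<integral>x. drift (cu x) \<partial>gauss I) / norm21 T T Om + L * (sqrt (real n) * \<sigma>)
        + L ^ 3 * (sqrt (real T) + sqrt r)) * norm21 T T Om}" (is "_ \<le> measure ?M {\<omega> \<in> space ?M. ?d \<omega> \<le> ?R}")
proof -
  interpret G: prob_space "GOE n" by (rule prob_space_GOE[OF n0])
  interpret GG: pair_prob_space "GOE n" "GOE n" ..
  define \<rho> where "\<rho> = sqrt (real T + r)"
  define \<beta> where "\<beta> = sqrt (real n) * \<sigma> + L\<^sup>2 * \<rho>"
  have L20: "0 \<le> L2" unfolding L2_def using L0 sk by simp
  have "log 2 (2 * 1) \<le> log 2 (2 * real T)" using T1 by (subst log_le_cancel_iff) auto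
  then have LL: "1 + L2 \<le> L" and lL: "log 2 (2 * real T) \<le> L" using L20 unfolding L by auto
  note ctx = sg sg0 r \<rho>_def LL \<beta>_def
  have rho: "0 < \<rho>" "\<rho>\<^sup>2 = real T + r" using rho_bounds[OF ctx] by auto
  \<comment> \<open>Here t^2 n / 4 = 5 (T + r), the same exponent as for the Gram matrix, absorbing
    5^T this time.\<close>
  let ?t = "2 * (sqrt 5 * \<rho> / sqrt (real n))"
  have t0: "0 < ?t" using rho n0 by simp
  obtain B0 where B0: "B0 \<in> sets (GOE n)" "measure (GOE n) B0 \<le> 2 * exp (- real n)"
    and b0: "\<And>A x. A \<notin> B0 ==> \<bar>bf n A x x\<bar> \<le> 4 * (vnorm n x)\<^sup>2"
    using GOE_opnorm_bound[OF n0] by blast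
  obtain B3 where B3: "B3 \<in> sets (GOE n)" "measure (GOE n) B3 \<le> 5 ^ T * (2 * exp (- (?t\<^sup>2 * real n / 4)))"
    and b3: "\<And>A x. A \<notin> B3 ==> \<bar>bf T A x x\<bar> \<le> 8/7 * ?t * (vnorm T x)\<^sup>2"
    using GOE_block_bound[OF n0 Tn t0] by blast
  have te: "?t\<^sup>2 * real n / 4 = 5 * (real T + r)"
    unfolding rho(2)[symmetric] using n0 by (simp add: power_mult_distrib power_divide)
  have B3r: "measure (GOE n) B3 \<le> exp (- r)" by (rule order_trans[OF B3(2)[unfolded te] union_constants(2)[OF r(1) T1]])
  obtain BG where BG: "BG \<in> sets (gauss I)" "measure (gauss I) BG \<le> exp (- r)"
    and bG: "\<forall>x\<in>space (gauss I) - BG. bbd (T + T) (%j l. vinner n (Wz x j) (Wz x l) - W.gram j l) (sqrt (real n) * (70 * \<beta>))"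
    using gram_event[OF ctx] by (elim bexE conjE)
  obtain BD where BD: "BD \<in> sets (gauss I)" "measure (gauss I) BD \<le> exp (- r)"
    and bD: "\<forall>x\<in>space (gauss I) - BD. drift (cu x) \<le> (\<integral>x. drift (cu x) \<partial>gauss I) + 4 * \<beta> * norm21 T T Om"
    using drift_event[OF ctx] by (elim bexE conjE)
  let ?\<psi> = "%\<omega>. rs T (zc \<omega> T)"
  define E0 where "E0 = fst -` B0 \<inter> space ?M"
  define E3 where "E3 = snd -` B3 \<inter> space ?M"
  define EG where "EG = ?\<psi> -` BG \<inter> space ?M"
  define ED where "ED = ?\<psi> -` BD \<inter> space ?M"
  have sets: "E0 \<in> sets ?M" "E3 \<in> sets ?M" "EG \<in> sets ?M" "ED \<in> sets ?M"
    unfolding E0_def E3_def EG_def ED_def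
    by (rule measure_GOE_fst(1)[OF B0(1)], rule measure_GOE_fst(3)[OF B3(1)], rule measure_columns(1)[OF BG(1)], rule measure_columns(1)[OF BD(1)])
  \<comment> \<open>The only event whose probability is tied to n instead of r; r \<le> n turns 2
    exp(- n) into 2 exp(- r).\<close>
  have m0: "measure ?M E0 \<le> 2 * exp (- r)"
  proof -
    have "exp (- real n) \<le> exp (- r)" using r by simp
    then show ?thesis unfolding E0_def measure_GOE_fst(2)[OF B0(1)] using B0(2) by linarith
  qed
  have m3: "measure ?M E3 \<le> exp (- r)" unfolding E3_def measure_GOE_fst(4)[OF B3(1)] by (rule B3r)
  have mG: "measure ?M EG \<le> exp (- r)" unfolding EG_def measure_columns(2)[OF BG(1)] by (rule BG(2))
  have mD: "measure ?M ED \<le> exp (- r)" unfolding ED_def measure_columns(2)[OF BD(1)] by (rule BD(2))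
  define E where "E = (E0 \<union> E3) \<union> (EG \<union> ED)"
  have Es: "E \<in> sets ?M" unfolding E_def by (intro sets.Un sets)
  have mE: "measure ?M E \<le> 5 * exp (- r)"
  proof -
    have "measure ?M E \<le> measure ?M (E0 \<union> E3) + measure ?M (EG \<union> ED)"
      unfolding E_def by (rule measure_Un_le[OF sets.Un[OF sets(1,2)] sets.Un[OF sets(3,4)]])
    moreover have "measure ?M (E0 \<union> E3) \<le> measure ?M E0 + measure ?M E3" by (rule measure_Un_le[OF sets(1,2)])
    moreover have "measure ?M (EG \<union> ED) \<le> measure ?M EG + measure ?M ED" by (rule measure_Un_le[OF sets(3,4)])
    ultimately show ?thesis using m0 m3 mG mD by linarith
  qed
  have P0: "0 \<le> (\<integral>x. drift (cu x) \<partial>gauss I)"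
    by (rule Bochner_Integration.integral_nonneg) (simp add: drift_def sum_nonneg)
  have good: "?d \<omega> \<le> ?R" if w: "\<omega> \<in> space ?M" "\<omega> \<notin> E" and s: "(\<forall>i j. fst \<omega> i j = fst \<omega> j i) \<and> (\<forall>i j. snd \<omega> i j = snd \<omega> j i)" for \<omega>
  proof -
    have ns: "fst \<omega> \<notin> B0" "snd \<omega> \<notin> B3" "?\<psi> \<omega> \<notin> BG" "?\<psi> \<omega> \<notin> BD"
      using w unfolding E_def E0_def E3_def EG_def ED_def by blast+
    have x: "?\<psi> \<omega> \<in> space (gauss I)"
      using measurable_space[OF rs_zc_measurable w(1)] by (simp add: space_PiM)
    have sA: "fst \<omega> i j = fst \<omega> j i" and sA': "snd \<omega> i j = snd \<omega> j i" for i j using s by blast+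
    have An: "bbd n (fst \<omega>) 4" by (rule bbd_sym_qf[OF sA b0[OF ns(1)]])
    have A'n: "bbd T (snd \<omega>) (8/7 * ?t)" by (rule bbd_sym_qf[OF sA' b3[OF ns(2)]])
    have Z: "cu (?\<psi> \<omega>) s i = znext n (Qz (cu (?\<psi> \<omega>)) T) s (fst \<omega>) (snd \<omega>) i" if "s < T" "i < n" for s i
      unfolding cu_rs_T cu_rs[OF that] by (rule zc_step[OF that])
    show ?thesis
      by (rule good_event_bound[OF ctx lL sA sA' An A'n Z bspec[OF bG] bspec[OF bD] P0]) (use x ns in auto)
  qed
  have gs: "{\<omega> \<in> space ?M. ?d \<omega> \<le> ?R} \<in> sets ?M"
    by (rule borel_measurable_le[OF distance_measurable borel_measurable_const])
  have "measure ?M (space ?M - E) \<le> measure ?M {\<omega> \<in> space ?M. ?d \<omega> \<le> ?R}"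
  proof (rule GG.P.finite_measure_mono_AE[OF _ gs])
    \<comment> \<open>The deterministic bound needs symmetric matrices, so the inclusion of events
      holds up to a null set.\<close>
    show "AE \<omega> in ?M. \<omega> \<in> space ?M - E \<longrightarrow> \<omega> \<in> {\<omega> \<in> space ?M. ?d \<omega> \<le> ?R}"
      using AE_symmetric by eventually_elim (use good in blast)
  qed
  moreover have "measure ?M (space ?M - E) = 1 - measure ?M E" by (rule GG.P.prob_compl[OF Es])
  ultimately show ?thesis using mE by linarith
qed

end

section \<open>Assembling the statement in matrix form\<close>

lemma frob_seqmat:
  "frob n T (%i t. seqmat n T X i t - seqmat n T Y i t) = sqrt (\<Sum>t<T. \<Sum>i<n. (X t i - Y t i)\<^sup>2)"
proof -
  have "(\<Sum>i<n. \<Sum>t<T. (seqmat n T X i t - seqmat n T Y i t)\<^sup>2) = (\<Sum>i<n. \<Sum>t<T. (X t i - Y t i)\<^sup>2)"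
    by (intro sum.cong refl) (simp add: seqmat_def)
  also have "... = (\<Sum>t<T. \<Sum>i<n. (X t i - Y t i)\<^sup>2)" by (rule sum.swap)
  finally show ?thesis by (simp add: frob_def)
qed

lemma minv_gram:
  assumes S: "\<And>i j. i < k ==> j < k ==> Sig i j = (\<Sum>l<k. Om l i * Om l j)"
    and OD: "\<And>i j. i < k ==> j < k ==> (\<Sum>l<k. Om i l * D l j) = of_bool (i = j)"
    and DO: "\<And>i j. i < k ==> j < k ==> (\<Sum>l<k. D i l * Om l j) = of_bool (i = j)"
  shows "minv k Sig = (%i j. if i < k \<and> j < k then \<Sum>l<k. D i l * D j l else 0)"
proof -
  let ?N = "%i j. if i < k \<and> j < k then \<Sum>l<k. D i l * D j l else 0"
  have 1: "(\<Sum>l<k. Sig i l * ?N l j) = of_bool (i = j)" if ij: "i < k" "j < k" for i j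
  proof -
    have "(\<Sum>l<k. Sig i l * ?N l j) = (\<Sum>l<k. (\<Sum>a<k. Om a i * Om a l) * (\<Sum>b<k. D l b * D j b))"
      by (intro sum.cong refl) (simp add: S ij)
    also have "... = (\<Sum>a<k. Om a i * (\<Sum>l<k. Om a l * (\<Sum>b<k. D l b * D j b)))" by (rule sum_mat_assoc)
    also have "... = (\<Sum>a<k. Om a i * D j a)"
    proof (rule sum.cong[OF refl])
      fix a assume a: "a \<in> {..<k}"
      have "(\<Sum>l<k. Om a l * (\<Sum>b<k. D l b * D j b)) = (\<Sum>b<k. (\<Sum>l<k. Om a l * D l b) * D j b)" by (rule sum_mat_assoc[symmetric])
      also have "... = (\<Sum>b<k. of_bool (a = b) * D j b)" by (intro sum.cong refl) (use OD a in simp)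
      also have "... = D j a" by (rule sum_of_bool) (use a in simp)
      finally show "Om a i * (\<Sum>l<k. Om a l * (\<Sum>b<k. D l b * D j b)) = Om a i * D j a" by simp
    qed
    also have "... = of_bool (i = j)" using DO[OF ij(2,1)] by (simp add: mult.commute eq_commute)
    finally show ?thesis .
  qed
  have sN: "?N i j = ?N j i" for i j by (auto intro: sum.cong)
  have sS: "Sig i j = Sig j i" if "i < k" "j < k" for i j unfolding S[OF that] S[OF that(2,1)] by (intro sum.cong refl mult.commute)
  show ?thesis
  proof (rule minv_eqI[OF _ 1])
    fix i j assume ij: "i < k" "j < k"
    have "(\<Sum>l<k. ?N i l * Sig l j) = (\<Sum>l<k. Sig j l * ?N l i)"
      by (intro sum.cong refl) (subst sN, use sS ij in \<open>simp add: mult.commute\<close>)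
    then show "(\<Sum>l<k. ?N i l * Sig l j) = of_bool (i = j)" using 1[OF ij(2,1)] by (simp add: eq_commute)
  qed auto
qed

text \<open>As a quadratic form \<Sigma> is |\<Omega> x|^2, so its extreme eigenvalues bound
  \<open>Om\<close> from both sides. The one triangular inverse D identifies
  \<open>minv T Om\<close> and, as D D^T, also \<open>minv T Sig\<close>.\<close>

lemma cholesky_se:
  assumes "1 \<le> T" "T \<le> n" "0 \<le> Lf" "0 \<le> Lg" "0 \<le> Lm"
    and lip: "\<forall>t<T. lipschitz_on_prefix n t Lf (f t) \<and> lipschitz_on_prefix n t Lg (g t) \<and> lipschitz_on_prefix n t Lm (m t)"
    and pd: "pos_def T Sig" and ch: "cholesky T Sig Om" and b: "is_basis n v"
  obtains D lmin lmax where "se n T f m Om v Lf Lm g D Lg lmin lmax" "cond_num T Sig = lmax / lmin" "minv T Om = D"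
    "\<And>i j. i < T ==> j < T ==> minv T Sig i j = (\<Sum>k<T. D i k * D j k)"
proof -
  obtain lmin lmax where l: "0 < lmin" "lmin \<le> lmax" and c: "cond_num T Sig = lmax / lmin"
    and q: "\<And>x. lmin * (vnorm T x)\<^sup>2 \<le> bf T Sig x x" "\<And>x. bf T Sig x x \<le> lmax * (vnorm T x)\<^sup>2"
    using cond_num_bounds[OF pd assms(1)] by metis
  have up: "\<And>i j. i < T ==> j < i ==> Om i j = 0" and dg: "\<And>i. i < T ==> 0 < Om i i"
    and S: "\<And>i j. i < T ==> j < T ==> Sig i j = (\<Sum>l<T. Om l i * Om l j)"
    using ch unfolding cholesky_def by blast+
  have dg': "\<And>i. i < T ==> Om i i \<noteq> 0" using dg by (simp add: less_imp_neq[symmetric])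
  have "\<exists>D. (\<forall>i j. \<not> (i < T \<and> j < T) \<longrightarrow> D i j = 0) \<and> (\<forall>i<T. \<forall>j<i. D i j = 0) \<and> (\<forall>i<T. D i i = 1 / Om i i) \<and>
    (\<forall>i<T. \<forall>j<T. (\<Sum>l<T. Om i l * D l j) = of_bool (i = j)) \<and> (\<forall>i<T. \<forall>j<T. (\<Sum>l<T. D i l * Om l j) = of_bool (i = j))"
    by (rule upper_triangular_inverse[of T Om, OF up dg'])
  then obtain D where D: "(\<forall>i j. \<not> (i < T \<and> j < T) \<longrightarrow> D i j = 0) \<and> (\<forall>i<T. \<forall>j<i. D i j = 0) \<and> (\<forall>i<T. D i i = 1 / Om i i) \<and>
    (\<forall>i<T. \<forall>j<T. (\<Sum>l<T. Om i l * D l j) = of_bool (i = j)) \<and> (\<forall>i<T. \<forall>j<T. (\<Sum>l<T. D i l * Om l j) = of_bool (i = j))" ..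
  have pad: "\<And>i j. \<not> (i < T \<and> j < T) ==> D i j = 0" and Dup: "\<And>i j. i < T ==> j < i ==> D i j = 0"
    and Ddg: "\<And>i. i < T ==> D i i = 1 / Om i i"
    and OD: "\<And>i j. i < T ==> j < T ==> (\<Sum>l<T. Om i l * D l j) = of_bool (i = j)"
    and DO: "\<And>i j. i < T ==> j < T ==> (\<Sum>l<T. D i l * Om l j) = of_bool (i = j)"
    using D by blast+
  have qf: "bf T Sig x x = (vnorm T (%i. \<Sum>j<T. Om i j * x j))\<^sup>2" for x
  proof -
    have "bf T Sig x x = bf T (%i j. \<Sum>l<T. Om l i * Om l j) x x" by (rule bf_cong) (simp_all add: S)
    then show ?thesis unfolding bf_gram vinner_self .
  qed
  have se: "se n T f m Om v Lf Lm g D Lg lmin lmax"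
    by (intro se.intro amp.intro se_axioms.intro assms b up Dup OD DO l)
       (use lip Ddg dg q qf in auto)
  have mO: "minv T Om = D" by (rule minv_eqI[OF pad OD DO])
  have mg: "minv T Sig = (%i j. if i < T \<and> j < T then \<Sum>l<T. D i l * D j l else 0)"
    by (rule minv_gram[OF S OD DO])
  have mS: "minv T Sig i j = (\<Sum>k<T. D i k * D j k)" if "i < T" "j < T" for i j
    unfolding mg using that by simp
  show ?thesis by (rule that[OF se c mO mS])
qed

theorem theorem5:
  shows "\<exists>c>0. \<forall>(n::nat) (T::nat) (f::nat \<Rightarrow> vecs \<Rightarrow> vec) (g::nat \<Rightarrow> vecs \<Rightarrow> vec)
      (m::nat \<Rightarrow> vecs \<Rightarrow> vec) (Lf::real) (Lg::real) (Lm::real) (Sig::vecs) (Om::vecs)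
      (v::vecs) (r::real).
    1 \<le> T \<and> T \<le> n \<and>
    0 \<le> Lf \<and> 0 \<le> Lg \<and> 0 \<le> Lm \<and>
    (\<forall>t<T. lipschitz_on_prefix n t Lf (f t) \<and> lipschitz_on_prefix n t Lg (g t)
           \<and> lipschitz_on_prefix n t Lm (m t)) \<and>
    pos_def T Sig \<and> cholesky T Sig Om \<and> is_basis n v \<and> 0 \<le> r \<and> r \<le> real n
    \<longrightarrow>
    (let M = GOE n \<Otimes>\<^sub>M GOE n;
         Y = (\<lambda>\<omega>. coupledY n T v f m Om \<omega>);
         X = (\<lambda>\<omega>. iterX n f g (fst \<omega>) T);
         FY = (\<lambda>\<omega>. colmat n T f (Y \<omega>));
         GY = (\<lambda>\<omega>. colmat n T g (Y \<omega>));
         MY = (\<lambda>\<omega>. colmat n T m (Y \<omega>));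
         EYF = (\<lambda>s t. integral\<^sup>L M (\<lambda>\<omega>.
                  mmul T n T (mtrans (\<lambda>i j. seqmat n T (Y \<omega>) i j - MY \<omega> i j)) (FY \<omega>) s t));
         EFF = (\<lambda>s t. integral\<^sup>L M (\<lambda>\<omega>. mmul T n T (mtrans (FY \<omega>)) (FY \<omega>) s t));
         B = (\<lambda>s t. (1 / real n) * mmul T T T (minv T Sig) EYF s t);
         S = (\<lambda>s t. (1 / real n) *
                 mmul T T T (mmul T T T (mtrans (minv T Om)) EFF) (minv T Om) s t);
         L = log 2 (2 * real T) + sqrt (real T) * (Lf + Lg + Lm) * (1 + Lm) ^ (T - 1)
               * sqrt (cond_num T Sig);
         psi1 = integral\<^sup>L M (\<lambda>\<omega>. norm21 n T
                   (\<lambda>i t. MY \<omega> i t - GY \<omega> i t - mmul n T T (FY \<omega>) B i t)) / norm21 T T Om;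
         psi2 = sqrt (real n) * opnorm T T (\<lambda>s t. S s t - idm T s t)
     in measure M {\<omega> \<in> space M.
          frob n T (\<lambda>i t. seqmat n T (X \<omega>) i t - seqmat n T (Y \<omega>) i t)
            \<le> c * (1 + 4 * Lf + Lg) ^ (T - 1)
                * (psi1 + L * psi2 + L ^ 3 * (sqrt (real T) + sqrt r)) * norm21 T T Om}
        \<ge> 1 - 5 * exp (- r))"
proof (intro exI[of _ "6000::real"] conjI allI impI)
  show "(0::real) < 6000" by simp
  fix n T :: nat and f g m :: "nat => vecs => vec" and Lf Lg Lm :: real and Sig Om v :: vecs and r :: real
  assume H: "1 \<le> T \<and> T \<le> n \<and> 0 \<le> Lf \<and> 0 \<le> Lg \<and> 0 \<le> Lm \<and>
    (\<forall>t<T. lipschitz_on_prefix n t Lf (f t) \<and> lipschitz_on_prefix n t Lg (g t)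
           \<and> lipschitz_on_prefix n t Lm (m t)) \<and>
    pos_def T Sig \<and> cholesky T Sig Om \<and> is_basis n v \<and> 0 \<le> r \<and> r \<le> real n"
  then have r: "0 \<le> r" "r \<le> real n" by blast+
  obtain D lmin lmax where se: "se n T f m Om v Lf Lm g D Lg lmin lmax" and cn: "cond_num T Sig = lmax / lmin"
    and mO: "minv T Om = D" and mS: "\<And>i j. i < T ==> j < T ==> minv T Sig i j = (\<Sum>k<T. D i k * D j k)"
    using cholesky_se[of T n Lf Lg Lm f g m Sig Om v] H by blast
  interpret se n T f m Om v Lf Lm g D Lg lmin lmax by (rule se)
  let ?M = "GOE n \<Otimes>\<^sub>M GOE n" and ?Y = "coupledY n T v f m Om"
  define EYF where "EYF = (%s t. integral\<^sup>L ?M (%\<omega>.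
      mmul T n T (mtrans (%i j. seqmat n T (?Y \<omega>) i j - colmat n T m (?Y \<omega>) i j)) (colmat n T f (?Y \<omega>)) s t))"
  define EFF where "EFF = (%s t. integral\<^sup>L ?M (%\<omega>. mmul T n T (mtrans (colmat n T f (?Y \<omega>))) (colmat n T f (?Y \<omega>)) s t))"
  define B where "B = (%s t. (1 / real n) * mmul T T T (minv T Sig) EYF s t)"
  define S where "S = (%s t. (1 / real n) * mmul T T T (mmul T T T (mtrans (minv T Om)) EFF) (minv T Om) s t)"
  define L where "L = log 2 (2 * real T) + sqrt (real T) * (Lf + Lg + Lm) * (1 + Lm) ^ (T - 1) * sqrt (cond_num T Sig)"
  define psi1 where "psi1 = integral\<^sup>L ?M (%\<omega>. norm21 n T
      (%i t. colmat n T m (?Y \<omega>) i t - colmat n T g (?Y \<omega>) i t - mmul n T T (colmat n T f (?Y \<omega>)) B i t)) / norm21 T T Om"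
  define \<sigma> where "\<sigma> = opnorm T T (%s t. S s t - idm T s t)"
  have Se: "S s t = Sz s t" if "s < T" "t < T" for s t
    unfolding S_def mO by (rule S_identity[OF _ that]) (simp only: EFF_def EFF_eq)
  have Be: "B s t = (\<Sum>k<T. D s k * KO t k)" if "s < T" "t < T" for s t
    unfolding B_def by (rule B_identity[OF _ that mS]) (simp_all only: EYF_def EYF_eq)
  have sg: "bbd T (%s t. Sz s t - of_bool (s = t)) \<sigma>"
    unfolding \<sigma>_def by (rule bbd_cong[OF opnorm_bbd(1)]) (simp add: Se idm_def)
  have sg0: "0 \<le> \<sigma>" unfolding \<sigma>_def by (rule opnorm_bbd(2))
  have dm: "(%x. drift (cu x)) \<in> borel_measurable (PiM I (%_. borel))"
    by (rule drift_measurable[OF sg sg0])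
  have pi: "norm21 n T (%i t. colmat n T m (?Y \<omega>) i t - colmat n T g (?Y \<omega>) i t - mmul n T T (colmat n T f (?Y \<omega>)) B i t)
     = drift (cu (rs T (zc \<omega> T)))" for \<omega>
    by (rule psi1_integrand[OF Be])
  have p: "psi1 = (\<integral>x. drift (cu x) \<partial>gauss I) / norm21 T T Om"
    unfolding psi1_def pi expectation_transfer[OF dm] ..
  have LL: "L = log 2 (2 * real T) + L2" unfolding L_def L2_def sk_def cn ..
  have fr: "frob n T (%i t. seqmat n T (iterX n f g (fst \<omega>) T) i t - seqmat n T (?Y \<omega>) i t)
     = sqrt (\<Sum>t<T. \<Sum>i<n. (iterX n f g (fst \<omega>) T t i - Yz (cu (rs T (zc \<omega> T))) T t i)\<^sup>2)" for \<omega>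
    unfolding frob_seqmat by (intro arg_cong[where f = sqrt] sum.cong refl) (simp add: coupledY_eq)
  have "1 - 5 * exp (- r) \<le> measure ?M {\<omega> \<in> space ?M.
      frob n T (%i t. seqmat n T (iterX n f g (fst \<omega>) T) i t - seqmat n T (?Y \<omega>) i t)
        \<le> 6000 * (1 + 4 * Lf + Lg) ^ (T - 1) * (psi1 + L * (sqrt (real n) * \<sigma>) + L ^ 3 * (sqrt (real T) + sqrt r)) * norm21 T T Om}"
    unfolding fr p by (rule coupling_bound[OF sg sg0 r LL])
  then show "let M = GOE n \<Otimes>\<^sub>M GOE n;
         Y = (%\<omega>. coupledY n T v f m Om \<omega>);
         X = (%\<omega>. iterX n f g (fst \<omega>) T);
         FY = (%\<omega>. colmat n T f (Y \<omega>));
         GY = (%\<omega>. colmat n T g (Y \<omega>));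
         MY = (%\<omega>. colmat n T m (Y \<omega>));
         EYF = (%s t. integral\<^sup>L M (%\<omega>.
                  mmul T n T (mtrans (%i j. seqmat n T (Y \<omega>) i j - MY \<omega> i j)) (FY \<omega>) s t));
         EFF = (%s t. integral\<^sup>L M (%\<omega>. mmul T n T (mtrans (FY \<omega>)) (FY \<omega>) s t));
         B = (%s t. (1 / real n) * mmul T T T (minv T Sig) EYF s t);
         S = (%s t. (1 / real n) *
                 mmul T T T (mmul T T T (mtrans (minv T Om)) EFF) (minv T Om) s t);
         L = log 2 (2 * real T) + sqrt (real T) * (Lf + Lg + Lm) * (1 + Lm) ^ (T - 1)
               * sqrt (cond_num T Sig);
         psi1 = integral\<^sup>L M (%\<omega>. norm21 n T
                   (%i t. MY \<omega> i t - GY \<omega> i t - mmul n T T (FY \<omega>) B i t)) / norm21 T T Om;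
         psi2 = sqrt (real n) * opnorm T T (%s t. S s t - idm T s t)
     in measure M {\<omega> \<in> space M.
          frob n T (%i t. seqmat n T (X \<omega>) i t - seqmat n T (Y \<omega>) i t)
            \<le> 6000 * (1 + 4 * Lf + Lg) ^ (T - 1)
                * (psi1 + L * psi2 + L ^ 3 * (sqrt (real T) + sqrt r)) * norm21 T T Om}
        \<ge> 1 - 5 * exp (- r)"
    unfolding Let_def \<sigma>_def S_def psi1_def B_def L_def EYF_def EFF_def .
qed

end
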